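(* For each choice of sign, there is an isomorphism of abelian groups $\widetilde{\mathcal L}(\mathbb{Z}[t^\pm],2)\cong\widetilde{\mathcal L}(\mathbb{Z}[t^\pm],\langle 2\rangle)$.
   Context: $\mathbb{Z}[t^{\pm}]$ is the ring $\mathbb{Z}[t]$ with the involution $\sum a_it^i\mapsto\sum(\pm1)^ia_it^i$; $\mathbb{Z}[t]$ means $\mathbb{Z}[t^+]$ (trivial involution); $\mathbb{Z}$ has the trivial involution. Let $R$ be a ring with involution $r\mapsto\overline r$, torsion free as an abelian group, and $\mathbb{Q}R=\mathbb{Q}\otimes R$. An $R$-module $M$ has length one if there is a short exact sequence $0\to F_1\to F_0\to M\to0$ with $F_0,F_1$ finitely generated free. Write $(1+* )R=\{r+\overline r:r\in R\}$ and $\{1+*\}:\mathbb{Q}R/R\to\mathbb{Q}R/(1+* )R$, $[a]\mapsto[a+\overline a]$. A quadratic linking form over $R$ is a triple $(M,b,q)$ where $M$ is a length one $R$-module with $2^nM=0$ for some $n$; $b:M\times M\to\mathbb{Q}R/R$ is biadditive with $b(x,y)=\overline{b(y,x)}$, $b(x,ry)=rb(x,y)$, and nonsingular ($x\mapsto b(x,\cdot)$ is an isomorphism $M\to\mathrm{Hom}_R(M,\mathbb{Q}R/R)$); and $q:M\to\mathbb{Q}R/(1+* )R$ satisfies $[q(x)]=b(x,x)\in\mathbb{Q}R/R$, $q(x+y)-q(x)-q(y)=\{1+*\}b(x,y)$, $q(rx)=rq(x)\overline r$. A Lagrangian is a submodule $L$ with $M/L$ of length one, $q(L)=0$ and $L=L^\perp:=\{x:b(x,L)=0\}$.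 $\mathcal L(R,2^n)$ is the Witt group of quadratic linking forms with $2^nM=0$: $m\sim m'$ if $m\oplus m_0\cong m'\oplus m_0'$ with $m_0,m_0'$ such forms (also of exponent $2^n$) admitting Lagrangians; addition is orthogonal sum. $\mathcal L(R,\langle2\rangle)$ is defined in the same way using all quadratic linking forms (any $n$). With $\varepsilon_0:\mathbb{Z}[t^\pm]\to\mathbb{Z}$, $f\mapsto f(0)$, set $\widetilde{\mathcal L}(\mathbb{Z}[t^\pm],2)=\ker(\varepsilon_{0*}:\mathcal L(\mathbb{Z}[t^\pm],2)\to\mathcal L(\mathbb{Z},2))$ and $\widetilde{\mathcal L}(\mathbb{Z}[t^\pm],\langle2\rangle)=\ker(\varepsilon_{0*}:\mathcal L(\mathbb{Z}[t^\pm],\langle2\rangle)\to\mathcal L(\mathbb{Z},\langle2\rangle))$. *)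

theory Defs
  imports
    "HOL-Algebra.Module"
    "HOL-Algebra.Algebraic_Closure_Type"
    "HOL-Computational_Algebra.Polynomial"
begin

section \<open>Rings with involution and their rationalisation\<close>

text \<open>
  A commutative torsion free ring \<open>R\<close> with involution is given together with the inclusion of
  \<open>R\<close> into \<open>\<rat>R = \<rat> \<otimes> R\<close> and the extension of the involution to \<open>\<rat>R\<close>.
  The predicate \<open>torsion_free_inv_ring\<close> pins \<open>\<rat>R\<close> down up to unique isomorphism: positive
  integers are invertible in it, and each element becomes integral after multiplication by a
  positive integer.
\<close>

record ('r, 'q) inv_ring =
  incl :: "'r \<Rightarrow> 'q"
  invol :: "'r \<Rightarrow> 'r"
  qinvol :: "'q \<Rightarrow> 'q"

definition torsion_free_inv_ring :: "('r::comm_ring_1, 'q::comm_ring_1) inv_ring \<Rightarrow> bool" where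
  "torsion_free_inv_ring A \<longleftrightarrow>
     (\<forall>n r. of_nat n * (r::'r) = 0 \<longrightarrow> n = 0 \<or> r = 0) \<and>
     (\<forall>r r'. invol A (r + r') = invol A r + invol A r') \<and>
     (\<forall>r r'. invol A (r * r') = invol A r' * invol A r) \<and>
     invol A 1 = 1 \<and> (\<forall>r. invol A (invol A r) = r) \<and>
     (\<forall>r r'. incl A (r + r') = incl A r + incl A r') \<and>
     (\<forall>r r'. incl A (r * r') = incl A r * incl A r') \<and>
     incl A 1 = 1 \<and> inj (incl A) \<and>
     (\<forall>n>0. \<exists>a. of_nat n * (a::'q) = 1) \<and>
     (\<forall>a. \<exists>n>0. of_nat n * a \<in> range (incl A)) \<and>
     (\<forall>a a'. qinvol A (a + a') = qinvol A a + qinvol A a') \<and>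
     (\<forall>a a'. qinvol A (a * a') = qinvol A a' * qinvol A a) \<and>
     (\<forall>r. qinvol A (incl A r) = incl A (invol A r))"

definition Z_inv :: "(int, rat) inv_ring" where
  "Z_inv = \<lparr> incl = of_int, invol = (\<lambda>n. n), qinvol = (\<lambda>a. a) \<rparr>"

text \<open>The involution sends \<open>p(t)\<close> to \<open>p(s t)\<close>; only \<open>s = 1\<close> and \<open>s = -1\<close> are of interest.\<close>

definition Zt_inv :: "int \<Rightarrow> (int poly, rat poly) inv_ring" where
  "Zt_inv s = \<lparr> incl = map_poly of_int,
                invol = (\<lambda>p. p \<circ>\<^sub>p [:0, s:]),
                qinvol = (\<lambda>p. p \<circ>\<^sub>p [:0, of_int s:]) \<rparr>"


section \<open>Modules\<close>

text \<open>
  A type \<open>'r\<close> of class \<open>comm_ring_1\<close> is regarded as a ring record via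
  \<open>ring_of_type_algebra\<close>.  Module records inherit the fields \<open>mult\<close> and \<open>one\<close> from rings;
  these are never used.
\<close>

definition mod_hom ::
    "('r, 'k) ring_scheme \<Rightarrow> ('r, 'a, 'm) module_scheme \<Rightarrow> ('r, 'b, 'n) module_scheme \<Rightarrow> ('a \<Rightarrow> 'b) set"
  where
  "mod_hom R M N = {f \<in> carrier M \<rightarrow>\<^sub>E carrier N.
     (\<forall>x\<in>carrier M. \<forall>y\<in>carrier M. f (x \<oplus>\<^bsub>M\<^esub> y) = f x \<oplus>\<^bsub>N\<^esub> f y) \<and>
     (\<forall>r\<in>carrier R. \<forall>x\<in>carrier M. f (r \<odot>\<^bsub>M\<^esub> x) = r \<odot>\<^bsub>N\<^esub> f x)}"

definition free_module :: "('r, 'k) ring_scheme \<Rightarrow> nat \<Rightarrow> ('r, nat \<Rightarrow> 'r) module" where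
  "free_module R n =
     \<lparr> carrier = {..<n} \<rightarrow>\<^sub>E carrier R,
       monoid.mult = (\<lambda>_ _. undefined), one = undefined,
       zero = (\<lambda>i\<in>{..<n}. \<zero>\<^bsub>R\<^esub>),
       add = (\<lambda>f g. \<lambda>i\<in>{..<n}. f i \<oplus>\<^bsub>R\<^esub> g i),
       module.smult = (\<lambda>r f. \<lambda>i\<in>{..<n}. r \<otimes>\<^bsub>R\<^esub> f i) \<rparr>"

definition length_one :: "('r, 'k) ring_scheme \<Rightarrow> ('r, 'a, 'm) module_scheme \<Rightarrow> bool" where
  "length_one R M \<longleftrightarrow>
     (\<exists>k n. \<exists>i \<in> mod_hom R (free_module R k) (free_module R n).
            \<exists>p \<in> mod_hom R (free_module R n) M.
        inj_on i (carrier (free_module R k)) \<and>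
        i ` carrier (free_module R k) = a_kernel (free_module R n) M p \<and>
        p ` carrier (free_module R n) = carrier M)"

text \<open>
  The map into cosets of \<open>H\<close> that a function \<open>f\<close> on representatives induces on cosets.
  Wherever it is used below, \<open>f\<close> maps a coset into a single coset of \<open>H\<close>.
\<close>

definition induced :: "('b, 'm) ring_scheme \<Rightarrow> 'b set \<Rightarrow> ('a \<Rightarrow> 'b) \<Rightarrow> 'a set \<Rightarrow> 'b set" where
  "induced G H f C = (\<Union>a\<in>C. H +>\<^bsub>G\<^esub> f a)"

definition quot_add :: "('a, 'm) ring_scheme \<Rightarrow> 'a set \<Rightarrow> 'a set ring" where
  "quot_add G H =
     \<lparr> carrier = a_rcosets\<^bsub>G\<^esub> H,
       monoid.mult = (\<lambda>_ _. undefined), one = undefined,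
       zero = H, add = set_add G \<rparr>"

definition quot_module :: "('r, 'a, 'm) module_scheme \<Rightarrow> 'a set \<Rightarrow> ('r, 'a set) module" where
  "quot_module M N =
     ring.extend (quot_add M N) (module.fields (\<lambda>r. induced M N (\<lambda>x. r \<odot>\<^bsub>M\<^esub> x)))"


section \<open>Quadratic linking forms\<close>

definition rat_module :: "('r::comm_ring_1, 'q::comm_ring_1) inv_ring \<Rightarrow> ('r, 'q) module" where
  "rat_module A =
     ring.extend ring_of_type_algebra (module.fields (\<lambda>r a. incl A r * a))"

definition rat_mod_int :: "('r::comm_ring_1, 'q::comm_ring_1) inv_ring \<Rightarrow> ('r, 'q set) module" where
  "rat_mod_int A = quot_module (rat_module A) (range (incl A))"

definition one_plus_star :: "('r::comm_ring_1, 'q::comm_ring_1) inv_ring \<Rightarrow> 'q set" where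
  "one_plus_star A = {incl A (r + invol A r) | r. True}"

definition rat_mod_ops :: "('r::comm_ring_1, 'q::comm_ring_1) inv_ring \<Rightarrow> 'q set ring" where
  "rat_mod_ops A = quot_add (rat_module A) (one_plus_star A)"

abbreviation to_int_cosets ::
    "('r::comm_ring_1, 'q::comm_ring_1) inv_ring \<Rightarrow> ('p \<Rightarrow> 'q) \<Rightarrow> 'p set \<Rightarrow> 'q set" where
  "to_int_cosets A \<equiv> induced (rat_module A) (range (incl A))"

abbreviation to_ops_cosets ::
    "('r::comm_ring_1, 'q::comm_ring_1) inv_ring \<Rightarrow> ('p \<Rightarrow> 'q) \<Rightarrow> 'p set \<Rightarrow> 'q set" where
  "to_ops_cosets A \<equiv> induced (rat_module A) (one_plus_star A)"

record ('r, 'a, 'q) linking_form = "('r, 'a) module" +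
  bil :: "'a \<Rightarrow> 'a \<Rightarrow> 'q set"
  quad :: "'a \<Rightarrow> 'q set"

definition two_power_torsion :: "nat \<Rightarrow> ('a, 'm) ring_scheme \<Rightarrow> bool" where
  "two_power_torsion n M \<longleftrightarrow> (\<forall>x\<in>carrier M. add_pow M ((2::nat) ^ n) x = \<zero>\<^bsub>M\<^esub>)"

text \<open>
  The adjoint \<open>x \<mapsto> b(x, -)\<close> is automatically additive and compatible with the module
  structures, so it is an isomorphism as soon as it is bijective.
\<close>

definition quadratic_linking_form ::
    "('r::comm_ring_1, 'q::comm_ring_1) inv_ring \<Rightarrow> ('r, 'a, 'q) linking_form \<Rightarrow> bool" where
  "quadratic_linking_form A m \<longleftrightarrow>
     module ring_of_type_algebra m \<and>
     length_one ring_of_type_algebra m \<and>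
     (\<exists>n. two_power_torsion n m) \<and>
     (\<forall>x\<in>carrier m. \<forall>y\<in>carrier m. bil m x y \<in> carrier (rat_mod_int A)) \<and>
     (\<forall>x\<in>carrier m. \<forall>x'\<in>carrier m. \<forall>y\<in>carrier m.
        bil m (x \<oplus>\<^bsub>m\<^esub> x') y = bil m x y \<oplus>\<^bsub>rat_mod_int A\<^esub> bil m x' y) \<and>
     (\<forall>x\<in>carrier m. \<forall>y\<in>carrier m. \<forall>y'\<in>carrier m.
        bil m x (y \<oplus>\<^bsub>m\<^esub> y') = bil m x y \<oplus>\<^bsub>rat_mod_int A\<^esub> bil m x y') \<and>
     (\<forall>x\<in>carrier m. \<forall>y\<in>carrier m. bil m x y = to_int_cosets A (qinvol A) (bil m y x)) \<and>
     (\<forall>r. \<forall>x\<in>carrier m. \<forall>y\<in>carrier m.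
        bil m x (r \<odot>\<^bsub>m\<^esub> y) = r \<odot>\<^bsub>rat_mod_int A\<^esub> bil m x y) \<and>
     bij_betw (\<lambda>x. \<lambda>y\<in>carrier m. bil m x y) (carrier m)
       (mod_hom (ring_of_type_algebra :: 'r ring) m (rat_mod_int A)) \<and>
     (\<forall>x\<in>carrier m. quad m x \<in> carrier (rat_mod_ops A)) \<and>
     (\<forall>x\<in>carrier m. to_int_cosets A (\<lambda>a. a) (quad m x) = bil m x x) \<and>
     (\<forall>x\<in>carrier m. \<forall>y\<in>carrier m.
        quad m (x \<oplus>\<^bsub>m\<^esub> y) \<ominus>\<^bsub>rat_mod_ops A\<^esub> quad m x \<ominus>\<^bsub>rat_mod_ops A\<^esub> quad m y
          = to_ops_cosets A (\<lambda>a. a + qinvol A a) (bil m x y)) \<and>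
     (\<forall>r. \<forall>x\<in>carrier m.
        quad m (r \<odot>\<^bsub>m\<^esub> x)
          = to_ops_cosets A (\<lambda>a. incl A r * a * incl A (invol A r)) (quad m x))"

definition lagrangian ::
    "('r::comm_ring_1, 'q::comm_ring_1) inv_ring \<Rightarrow> ('r, 'a, 'q) linking_form \<Rightarrow> 'a set \<Rightarrow> bool" where
  "lagrangian A m L \<longleftrightarrow>
     submodule L (ring_of_type_algebra :: 'r ring) m \<and>
     length_one (ring_of_type_algebra :: 'r ring) (quot_module m L) \<and>
     (\<forall>x\<in>L. quad m x = \<zero>\<^bsub>rat_mod_ops A\<^esub>) \<and>
     L = {x \<in> carrier m. \<forall>y\<in>L. bil m x y = \<zero>\<^bsub>rat_mod_int A\<^esub>}"

definition orth_sum ::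
    "('r::comm_ring_1, 'q::comm_ring_1) inv_ring \<Rightarrow> ('r, 'a, 'q) linking_form \<Rightarrow>
     ('r, 'b, 'q) linking_form \<Rightarrow> ('r, 'a \<times> 'b, 'q) linking_form" where
  "orth_sum A m m' =
     \<lparr> carrier = carrier m \<times> carrier m',
       monoid.mult = (\<lambda>_ _. undefined), one = undefined,
       zero = (\<zero>\<^bsub>m\<^esub>, \<zero>\<^bsub>m'\<^esub>),
       add = (\<lambda>(x, x') (y, y'). (x \<oplus>\<^bsub>m\<^esub> y, x' \<oplus>\<^bsub>m'\<^esub> y')),
       module.smult = (\<lambda>r (x, x'). (r \<odot>\<^bsub>m\<^esub> x, r \<odot>\<^bsub>m'\<^esub> x')),
       bil = (\<lambda>(x, x') (y, y'). bil m x y \<oplus>\<^bsub>rat_mod_int A\<^esub> bil m' x' y'),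
       quad = (\<lambda>(x, x'). quad m x \<oplus>\<^bsub>rat_mod_ops A\<^esub> quad m' x') \<rparr>"

definition isometric ::
    "('r::comm_ring_1, 'a, 'q) linking_form \<Rightarrow> ('r, 'b, 'q) linking_form \<Rightarrow> bool" where
  "isometric m m' \<longleftrightarrow>
     (\<exists>f \<in> mod_hom (ring_of_type_algebra :: 'r ring) m m'.
        bij_betw f (carrier m) (carrier m') \<and>
        (\<forall>x\<in>carrier m. \<forall>y\<in>carrier m. bil m' (f x) (f y) = bil m x y) \<and>
        (\<forall>x\<in>carrier m. quad m' (f x) = quad m x))"


section \<open>Witt groups\<close>

text \<open>
  Over a countable ring, every length one module is countable, hence isomorphic to a module
  whose carrier is a set of natural numbers.  Witt classes are therefore formed inside the set
  of forms on such carriers, and a form \<open>m\<close> on any countable carrier (such as an orthogonal sum or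
  a base change) has the class \<open>witt_class A S m\<close>.  The parameter \<open>S\<close> is the set of forms admitted:
  all quadratic linking forms, or those of exponent \<open>2 ^ n\<close>.
\<close>

definition linking_forms ::
    "('r::comm_ring_1, 'q::comm_ring_1) inv_ring \<Rightarrow> ('r, nat, 'q) linking_form set" where
  "linking_forms A = {m. quadratic_linking_form A m}"

definition linking_forms_exp ::
    "('r::comm_ring_1, 'q::comm_ring_1) inv_ring \<Rightarrow> nat \<Rightarrow> ('r, nat, 'q) linking_form set" where
  "linking_forms_exp A n = {m. quadratic_linking_form A m \<and> two_power_torsion n m}"

definition witt_equiv ::
    "('r::comm_ring_1, 'q::comm_ring_1) inv_ring \<Rightarrow> ('r, nat, 'q) linking_form set \<Rightarrow>
     ('r, 'a, 'q) linking_form \<Rightarrow> ('r, 'b, 'q) linking_form \<Rightarrow> bool" where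
  "witt_equiv A S m m' \<longleftrightarrow>
     (\<exists>m\<^sub>0\<in>S. \<exists>m\<^sub>0'\<in>S. (\<exists>L. lagrangian A m\<^sub>0 L) \<and> (\<exists>L. lagrangian A m\<^sub>0' L) \<and>
        isometric (orth_sum A m m\<^sub>0) (orth_sum A m' m\<^sub>0'))"

definition witt_class ::
    "('r::comm_ring_1, 'q::comm_ring_1) inv_ring \<Rightarrow> ('r, nat, 'q) linking_form set \<Rightarrow>
     ('r, 'a, 'q) linking_form \<Rightarrow> ('r, nat, 'q) linking_form set" where
  "witt_class A S m = {m' \<in> S. witt_equiv A S m m'}"

definition zero_form ::
    "('r::comm_ring_1, 'q::comm_ring_1) inv_ring \<Rightarrow> ('r, nat, 'q) linking_form" where
  "zero_form A =
     \<lparr> carrier = {0},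
       monoid.mult = (\<lambda>_ _. undefined), one = undefined,
       zero = 0, add = (\<lambda>_ _. 0), module.smult = (\<lambda>_ _. 0),
       bil = (\<lambda>_ _. \<zero>\<^bsub>rat_mod_int A\<^esub>), quad = (\<lambda>_. \<zero>\<^bsub>rat_mod_ops A\<^esub>) \<rparr>"

definition witt_group ::
    "('r::comm_ring_1, 'q::comm_ring_1) inv_ring \<Rightarrow> ('r, nat, 'q) linking_form set \<Rightarrow>
     ('r, nat, 'q) linking_form set monoid" where
  "witt_group A S =
     \<lparr> carrier = witt_class A S ` S,
       monoid.mult = (\<lambda>C D. \<Union>m\<in>C. \<Union>m'\<in>D. witt_class A S (orth_sum A m m')),
       one = witt_class A S (zero_form A) \<rparr>"

definition L_exp ::
    "('r::comm_ring_1, 'q::comm_ring_1) inv_ring \<Rightarrow> nat \<Rightarrow> ('r, nat, 'q) linking_form set monoid" where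
  "L_exp A n = witt_group A (linking_forms_exp A n)"

definition L_all ::
    "('r::comm_ring_1, 'q::comm_ring_1) inv_ring \<Rightarrow> ('r, nat, 'q) linking_form set monoid" where
  "L_all A = witt_group A (linking_forms A)"


section \<open>Augmentation and reduced Witt groups\<close>

text \<open>
  Base change along \<open>\<epsilon>\<^sub>0 : \<int>[t] \<rightarrow> \<int>\<close>, \<open>f \<mapsto> f(0)\<close>.  As \<open>\<int> = \<int>[t]/(t)\<close>, the module \<open>\<int> \<otimes> M\<close> is
  \<open>M/tM\<close>, with \<open>\<int>\<close> acting through the constant polynomials; see \<open>eps0_form_universal\<close>.
\<close>

definition t_mult :: "(int poly, 'a, 'm) module_scheme \<Rightarrow> 'a set" where
  "t_mult M = (\<lambda>x. [:0, 1:] \<odot>\<^bsub>M\<^esub> x) ` carrier M"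

definition eps0_form :: "(int poly, 'a, rat poly) linking_form \<Rightarrow> (int, 'a set, rat) linking_form" where
  "eps0_form m =
     \<lparr> carrier = a_rcosets\<^bsub>m\<^esub> (t_mult m),
       monoid.mult = (\<lambda>_ _. undefined), one = undefined,
       zero = t_mult m, add = set_add m,
       module.smult = (\<lambda>k. induced m (t_mult m) (\<lambda>x. [:k:] \<odot>\<^bsub>m\<^esub> x)),
       bil = (\<lambda>C D. \<Union>x\<in>C. \<Union>y\<in>D. to_int_cosets Z_inv (\<lambda>f. poly f 0) (bil m x y)),
       quad = (\<lambda>C. \<Union>x\<in>C. to_ops_cosets Z_inv (\<lambda>f. poly f 0) (quad m x)) \<rparr>"

definition eps0_star ::
    "(int, nat, rat) linking_form set \<Rightarrow> (int poly, nat, rat poly) linking_form set \<Rightarrow>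
     (int, nat, rat) linking_form set" where
  "eps0_star S C = (\<Union>m\<in>C. witt_class Z_inv S (eps0_form m))"

definition L_exp_reduced :: "int \<Rightarrow> nat \<Rightarrow> (int poly, nat, rat poly) linking_form set monoid" where
  "L_exp_reduced s n =
     (L_exp (Zt_inv s) n)
       \<lparr> carrier := kernel (L_exp (Zt_inv s) n) (L_exp Z_inv n) (eps0_star (linking_forms_exp Z_inv n)) \<rparr>"

definition L_all_reduced :: "int \<Rightarrow> (int poly, nat, rat poly) linking_form set monoid" where
  "L_all_reduced s =
     (L_all (Zt_inv s))
       \<lparr> carrier := kernel (L_all (Zt_inv s)) (L_all Z_inv) (eps0_star (linking_forms Z_inv)) \<rparr>"


section \<open>Consistency of the definitions\<close>

lemma rat_denominator: "\<exists>n>0. \<exists>k. of_nat n * (a::rat) = of_int k"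
proof -
  obtain x y where a: "quotient_of a = (x, y)"
    by (cases "quotient_of a")
  then have y: "y > 0" and "a = of_int x / of_int y"
    using quotient_of_denom_pos quotient_of_div by blast+
  then have "of_nat (nat y) * a = of_int x"
    by (simp add: of_nat_nat)
  then show ?thesis
    using y by (intro exI[of _ "nat y"]) auto
qed

lemma torsion_free_inv_ring_Z: "torsion_free_inv_ring Z_inv"
proof -
  have inv: "\<exists>a::rat. of_nat n * a = 1" if "n > 0" for n
    using that by (intro exI[of _ "1 / of_nat n"]) auto
  have den: "\<exists>n>0. of_nat n * a \<in> range (of_int :: int \<Rightarrow> rat)" for a :: rat
    using rat_denominator[of a] by auto
  show ?thesis
    unfolding torsion_free_inv_ring_def Z_inv_def using inv den by (auto simp: inj_def)
qed

lemma torsion_free_inv_ring_Zt: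
  assumes "s = 1 \<or> s = -1"
  shows "torsion_free_inv_ring (Zt_inv s)"
proof -
  have inv: "\<exists>a::rat poly. of_nat n * a = 1" if "n > 0" for n
    using that by (intro exI[of _ "[:1 / of_nat n:]"]) (simp add: of_nat_poly)
  have den: "\<exists>n>0. of_nat n * a \<in> range (map_poly of_int :: int poly \<Rightarrow> rat poly)" for a :: "rat poly"
  proof (induction a rule: pCons_induct)
    case 0
    show ?case
      by (intro exI[of _ 1]) (auto intro: range_eqI[of _ _ 0])
  next
    case (pCons c p)
    obtain n p' where n: "n > 0" "of_nat n * p = map_poly of_int (p' :: int poly)"
      using pCons.IH by blast
    obtain k c' where k: "k > 0" "of_nat k * c = of_int c'"
      using rat_denominator by blast
    have "of_nat (n * k) * pCons c p
        = pCons (of_nat n * (of_nat k * c)) (of_nat k * (of_nat n * p))"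
      by (simp add: of_nat_poly algebra_simps)
    also have "\<dots> = map_poly of_int (pCons (int n * c') (of_nat k * p'))"
      unfolding n k by (intro poly_eqI)
        (auto simp: coeff_map_poly of_nat_poly coeff_pCons split: nat.split)
    finally show ?case
      using n k by (intro exI[of _ "n * k"]) auto
  qed
  have comp2: "p \<circ>\<^sub>p [:0, s:] \<circ>\<^sub>p [:0, s:] = p" for p :: "int poly"
    using assms by (auto simp: pcompose_assoc[symmetric] pcompose_pCons)
  have comp: "map_poly of_int p \<circ>\<^sub>p [:0, of_int s:] = (map_poly of_int (p \<circ>\<^sub>p [:0, s:]) :: rat poly)"
    for p :: "int poly" and s :: int
    by (intro poly_eqI) (simp add: coeff_map_poly coeff_pcompose_linear)
  have mult: "map_poly of_int (p * q) = map_poly of_int p * (map_poly of_int q :: rat poly)"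
    for p q :: "int poly"
    by (intro poly_eqI) (simp add: coeff_map_poly coeff_mult)
  have "inj (map_poly of_int :: int poly \<Rightarrow> rat poly)"
    by (auto simp: inj_def poly_eq_iff coeff_map_poly)
  moreover have "map_poly of_int (p + q) = map_poly of_int p + (map_poly of_int q :: rat poly)"
    for p q :: "int poly"
    by (intro poly_eqI) (simp add: coeff_map_poly)
  ultimately show ?thesis
    unfolding torsion_free_inv_ring_def Zt_inv_def using inv den comp2
    by (simp add: comp mult pcompose_1 pcompose_add pcompose_mult mult.commute)
qed

lemma coeff_invol_Zt: "poly.coeff (invol (Zt_inv s) p) i = s ^ i * poly.coeff p i"
  by (simp add: Zt_inv_def coeff_pcompose_linear)

lemma eps0_form_universal:
  fixes m :: "(int poly, 'a, rat poly) linking_form" and P :: "(int, 'b, 'm) module_scheme"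
  assumes m: "module ring_of_type_algebra m" and P: "module ring_of_type_algebra P"
    and g: "g \<in> carrier m \<rightarrow> carrier P"
    and g_add: "\<And>x y. x \<in> carrier m \<Longrightarrow> y \<in> carrier m \<Longrightarrow> g (x \<oplus>\<^bsub>m\<^esub> y) = g x \<oplus>\<^bsub>P\<^esub> g y"
    and g_smult: "\<And>p x. x \<in> carrier m \<Longrightarrow> g (p \<odot>\<^bsub>m\<^esub> x) = poly p 0 \<odot>\<^bsub>P\<^esub> g x"
  shows "\<exists>!h. h \<in> mod_hom (ring_of_type_algebra :: int ring) (eps0_form m) P \<and>
              (\<forall>x\<in>carrier m. h (t_mult m +>\<^bsub>m\<^esub> x) = g x)"
proof -
  interpret m: Module.module "ring_of_type_algebra :: int poly ring" m by (rule m)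
  interpret P: Module.module "ring_of_type_algebra :: int ring" P by (rule P)
  have R: "carrier ring_of_type_algebra = UNIV" "add ring_of_type_algebra = (+)"
    "monoid.mult ring_of_type_algebra = (*)" "zero ring_of_type_algebra = 0"
    by (auto simp: ring_of_type_algebra_def fun_eq_iff)
  have sm [simp]: "p \<odot>\<^bsub>m\<^esub> x \<in> carrier m" if "x \<in> carrier m" for p x
    using m.smult_closed[of p x] that by (simp add: R)
  have sub: "submodule (t_mult m) (ring_of_type_algebra :: int poly ring) m"
  proof (rule m.submoduleI)
    show "t_mult m \<subseteq> carrier m" by (auto simp: t_mult_def)
    have mem: "[:0, 1:] \<odot>\<^bsub>m\<^esub> x \<in> t_mult m" if "x \<in> carrier m" for x
      using that by (simp add: t_mult_def)
    show "\<zero>\<^bsub>m\<^esub> \<in> t_mult m"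
      using mem[of "\<zero>\<^bsub>m\<^esub>"] m.smult_r_null[of "[:0, 1:]"] by (simp add: R)
    show "\<ominus>\<^bsub>m\<^esub> a \<in> t_mult m" if a: "a \<in> t_mult m" for a
    proof -
      obtain x where x: "x \<in> carrier m" "a = [:0, 1:] \<odot>\<^bsub>m\<^esub> x"
        using a by (auto simp: t_mult_def)
      then show ?thesis
        using mem[of "\<ominus>\<^bsub>m\<^esub> x"] m.smult_r_minus[of "[:0, 1:]" x] by (simp add: R)
    qed
    show "a \<oplus>\<^bsub>m\<^esub> b \<in> t_mult m" if ab: "a \<in> t_mult m" "b \<in> t_mult m" for a b
    proof -
      obtain x y where "x \<in> carrier m" "a = [:0, 1:] \<odot>\<^bsub>m\<^esub> x"
          "y \<in> carrier m" "b = [:0, 1:] \<odot>\<^bsub>m\<^esub> y"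
        using ab by (auto simp: t_mult_def)
      then show ?thesis
        using mem[of "x \<oplus>\<^bsub>m\<^esub> y"] m.smult_r_distr[of "[:0, 1:]" x y] by (simp add: R)
    qed
    show "r \<odot>\<^bsub>m\<^esub> x \<in> t_mult m" if rx: "x \<in> t_mult m" for r x
    proof -
      obtain y where y: "y \<in> carrier m" "x = [:0, 1:] \<odot>\<^bsub>m\<^esub> y"
        using rx by (auto simp: t_mult_def)
      then have "r \<odot>\<^bsub>m\<^esub> x = [:0, 1:] \<odot>\<^bsub>m\<^esub> (r \<odot>\<^bsub>m\<^esub> y)"
        using m.smult_assoc1[of r "[:0, 1:]" y] m.smult_assoc1[of "[:0, 1:]" r y]
        by (simp add: R mult.commute)
      then show ?thesis using y by (auto simp: t_mult_def)
    qed
  qed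
  interpret T: abelian_subgroup "t_mult m" m
    using submodule.axioms(1)[OF sub] m.abelian_group_axioms
    by (intro abelian_subgroupI3 additive_subgroup.intro)
  have coset: "t_mult m +>\<^bsub>m\<^esub> x = (\<lambda>y. [:0, 1:] \<odot>\<^bsub>m\<^esub> y \<oplus>\<^bsub>m\<^esub> x) ` carrier m" for x
    by (auto simp: a_r_coset_def' t_mult_def)
  have g_coset: "g z = g x" if x: "x \<in> carrier m" and z: "z \<in> t_mult m +>\<^bsub>m\<^esub> x" for x z
  proof -
    obtain y where y: "y \<in> carrier m" "z = [:0, 1:] \<odot>\<^bsub>m\<^esub> y \<oplus>\<^bsub>m\<^esub> x"
      using z by (auto simp: coset)
    have "g y \<in> carrier P" "g x \<in> carrier P" using g y x by auto
    then show ?thesis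
      using y x P.smult_l_null[of "g y"] by (simp add: g_add g_smult R)
  qed
  have in_coset: "x \<in> t_mult m +>\<^bsub>m\<^esub> x" if "x \<in> carrier m" for x
    using that by (rule T.a_rcos_self)
  have carr: "carrier (eps0_form m) = (\<lambda>x. t_mult m +>\<^bsub>m\<^esub> x) ` carrier m"
    by (auto simp: eps0_form_def A_RCOSETS_def')
  have add: "(t_mult m +>\<^bsub>m\<^esub> x) \<oplus>\<^bsub>eps0_form m\<^esub> (t_mult m +>\<^bsub>m\<^esub> y) = t_mult m +>\<^bsub>m\<^esub> (x \<oplus>\<^bsub>m\<^esub> y)"
    if "x \<in> carrier m" "y \<in> carrier m" for x y
    using T.a_rcos_sum[OF that] by (simp add: eps0_form_def)
  have smult: "k \<odot>\<^bsub>eps0_form m\<^esub> (t_mult m +>\<^bsub>m\<^esub> x) = t_mult m +>\<^bsub>m\<^esub> ([:k:] \<odot>\<^bsub>m\<^esub> x)"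
    if x: "x \<in> carrier m" for k x
  proof -
    have "t_mult m +>\<^bsub>m\<^esub> ([:k:] \<odot>\<^bsub>m\<^esub> z) = t_mult m +>\<^bsub>m\<^esub> ([:k:] \<odot>\<^bsub>m\<^esub> x)"
      if z: "z \<in> t_mult m +>\<^bsub>m\<^esub> x" for z
    proof -
      obtain y where y: "y \<in> carrier m" "z = [:0, 1:] \<odot>\<^bsub>m\<^esub> y \<oplus>\<^bsub>m\<^esub> x"
        using z by (auto simp: coset)
      have "[:k:] \<odot>\<^bsub>m\<^esub> z = [:k:] \<odot>\<^bsub>m\<^esub> ([:0, 1:] \<odot>\<^bsub>m\<^esub> y) \<oplus>\<^bsub>m\<^esub> [:k:] \<odot>\<^bsub>m\<^esub> x"
        unfolding y(2) using m.smult_r_distr[of "[:k:]"] x y by (simp add: R)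
      also have "[:k:] \<odot>\<^bsub>m\<^esub> ([:0, 1:] \<odot>\<^bsub>m\<^esub> y) = [:0, 1:] \<odot>\<^bsub>m\<^esub> ([:k:] \<odot>\<^bsub>m\<^esub> y)"
        using m.smult_assoc1[of "[:k:]" "[:0, 1:]" y] m.smult_assoc1[of "[:0, 1:]" "[:k:]" y] y
        by (simp add: R mult.commute)
      finally have "[:k:] \<odot>\<^bsub>m\<^esub> z \<in> t_mult m +>\<^bsub>m\<^esub> ([:k:] \<odot>\<^bsub>m\<^esub> x)"
        unfolding coset using y by auto
      then show ?thesis
        using T.a_repr_independence' x by simp
    qed
    then have "induced m (t_mult m) (\<lambda>z. [:k:] \<odot>\<^bsub>m\<^esub> z) (t_mult m +>\<^bsub>m\<^esub> x)
        = t_mult m +>\<^bsub>m\<^esub> ([:k:] \<odot>\<^bsub>m\<^esub> x)"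
      unfolding induced_def using in_coset[OF x] by blast
    then show ?thesis by (simp add: eps0_form_def)
  qed
  define h where "h = (\<lambda>C\<in>carrier (eps0_form m). the_elem (g ` C))"
  have h: "h (t_mult m +>\<^bsub>m\<^esub> x) = g x" if x: "x \<in> carrier m" for x
  proof -
    have "g ` (t_mult m +>\<^bsub>m\<^esub> x) = {g x}"
      using g_coset[OF x] in_coset[OF x] by blast
    then show ?thesis using x by (simp add: h_def carr)
  qed
  show ?thesis
  proof (rule ex1I[of _ h])
    show "h \<in> mod_hom (ring_of_type_algebra :: int ring) (eps0_form m) P \<and>
        (\<forall>x\<in>carrier m. h (t_mult m +>\<^bsub>m\<^esub> x) = g x)"
      unfolding mod_hom_def
    proof (intro conjI CollectI ballI)
      show "h \<in> carrier (eps0_form m) \<rightarrow>\<^sub>E carrier P"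
      proof (rule PiE_I)
        show "h C \<in> carrier P" if "C \<in> carrier (eps0_form m)" for C
          using that g h by (auto simp: carr)
      qed (auto simp: h_def)
    qed (auto simp: carr add smult h g_add g_smult)
  next
    fix h'
    assume h': "h' \<in> mod_hom (ring_of_type_algebra :: int ring) (eps0_form m) P \<and>
        (\<forall>x\<in>carrier m. h' (t_mult m +>\<^bsub>m\<^esub> x) = g x)"
    then have "h' \<in> extensional (carrier (eps0_form m))"
      by (auto simp: mod_hom_def PiE_def)
    then show "h' = h"
      by (rule extensionalityI) (use h h' in \<open>auto simp: carr h_def\<close>)
  qed
qed

end

theory Submission
  imports Defs "HOL-Library.Function_Algebras" "HOL-Library.Product_Plus" "HOL-Library.Z2" "HOL-Library.Countable_Set"
begin

text \<open>
  Write \<open>R\<close> for \<open>\<int>\<close> or \<open>\<int>[t]\<close> and call a submodule of \<open>M\<close> saturated if the quotient has no torsion with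
  respect to elements of \<open>R\<close> outside \<open>2R\<close>.  As \<open>R/2R\<close> is Euclidean, a saturated submodule of
  \<open>R\<^sup>n\<close> containing \<open>2\<^sup>NR\<^sup>n\<close> is free of rank \<open>n\<close>.  Hence \<open>U\<^sup>\<bottom>\<^sup>\<bottom> = U\<close> for saturated \<open>U\<close>, every
  saturated isotropic \<open>K\<close> allows one to replace \<open>M\<close> by \<open>K\<^sup>\<bottom>/K\<close>, and a stably metabolic form is metabolic;
  the last fact makes \<open>\<L>(R, 2) \<rightarrow> \<L>(R, \<langle>2\<rangle>)\<close> injective.

  For surjectivity on the reduced groups, the saturations of \<open>2\<^sup>kM\<close> reduce \<open>M\<close> to exponent \<open>4\<close>, and
  the kernel of \<open>q\<close> on the saturation \<open>L\<close> of \<open>2M\<close> can then be removed, so that \<open>q\<close> becomes anisotropic on \<open>L\<close>.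
  On \<open>L\<close> the values of \<open>q\<close> lie in \<open>\<int>[t]/2\<int>[t]\<close>, where \<open>q\<close> is semilinear for the Frobenius map; write
  \<open>q = q\<^sub>0\<^sup>2 + t q\<^sub>1\<^sup>2\<close> with \<open>q\<^sub>i\<close> linear, \<open>q\<^sub>i = b(y\<^sub>i, -)\<close> and \<open>e\<^sub>i = 2y\<^sub>i\<close>.  Then \<open>q(e\<^sub>i) = q\<^sub>i(e\<^sub>i)\<close> and
  \<open>q\<^sub>1(e\<^sub>0) = q\<^sub>0(e\<^sub>1)\<close>, and comparing degrees gives \<open>q\<^sub>1 = 0\<close> and \<open>q(e\<^sub>0) = 0\<close> or \<open>1\<close>.  In the first case
  \<open>2M = 0\<close>.  In the second \<open>L\<close> is generated by \<open>e\<^sub>0 = 2y\<^sub>0\<close>; a Lagrangian of the augmentation cannot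
  contain the image of \<open>e\<^sub>0\<close>, so it contains some \<open>x\<close> with \<open>b(x, e\<^sub>0) = b(2x, y\<^sub>0) \<noteq> 0\<close>, but then
  \<open>2x\<close> is the image of \<open>e\<^sub>0\<close>.
\<close>

section \<open>Submodules of free modules over dyadic rings\<close>

text \<open>Over \<open>\<int>[t]\<close> duality fails for general submodules: for
  \<open>M = \<int>[t]/2\<close> and \<open>U = tM\<close> every homomorphism
  \<open>M/U \<rightarrow> \<rat>[t]/\<int>[t]\<close> is zero, because multiplication by
  \<open>t\<close> is injective on the target, so \<open>U\<^sup>\<bottom> = 0\<close> and
  \<open>U\<^sup>\<bottom>\<^sup>\<bottom> = M\<close>. For the same reason such a quotient has no
  resolution of length one. This is why sums, projections and multiples are replaced by their
  saturations before a double complement is taken. Forms are handled through hermitian lifts: a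
  \<open>pform\<close> carries an exactly sesquilinear form with values in \<open>\<rat>R\<close> on
  a set of vectors, and \<open>M\<close> is that set modulo its radical. Passing to
  \<open>K\<^sup>\<bottom>/K\<close> then changes only the carrier, and setting \<open>t = 0\<close>
  changes only scalars and values. The lift also absorbs \<open>q\<close>: its diagonal values are
  self-conjugate, and since conjugation is trivial modulo 2, a self-conjugate element has the form
  \<open>r + iv r\<close> exactly when it lies in \<open>2R\<close>. So \<open>q\<close> vanishes
  exactly where the diagonal of the lift is in \<open>2R\<close>. Below, a scalar is called odd if 2
  does not divide it.\<close>

locale two_euclidean =
  fixes ty :: "'r::comm_ring_1 itself"
  assumes two_prime: "(2::'r) dvd f * g \<Longrightarrow> 2 dvd f \<or> 2 dvd g"
    and two_cancel: "2 * (f::'r) = 2 * g \<Longrightarrow> f = g"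
    and two_nonunit: "\<not> (2::'r) dvd 1"
    and two_euclid: "\<exists>d::'r \<Rightarrow> nat. \<forall>f g. \<not> 2 dvd f \<longrightarrow> (\<exists>q. 2 dvd g - q * f \<or> d (g - q * f) < d f)"
begin

lemma two_power_cancel: "2 ^ k * (f::'r) = 2 ^ k * g \<Longrightarrow> f = g"
  by (induction k) (auto simp: mult.assoc dest: two_cancel)

text \<open>As 2 is prime and cancellable, its factors can be moved from the right side into
  \<open>g\<close> one at a time; \<open>f\<close> never absorbs any of them.\<close>

lemma two_power_dvd:
  fixes f g h :: 'r
  assumes f: "\<not> 2 dvd f" and eq: "f * g = 2 ^ k * h"
  shows "2 ^ k dvd g"
  using eq
proof (induction k arbitrary: g)
  case (Suc k)
  have "2 dvd f * g" using Suc.prems by simp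
  then obtain g' where g': "g = 2 * g'" using two_prime f by blast
  have "2 * (f * g') = 2 * (2 ^ k * h)" using Suc.prems by (simp add: g' ac_simps)
  then have "2 ^ k dvd g'" using Suc.IH two_cancel by blast
  then show ?case by (simp add: g' mult_dvd_mono)
qed simp

lemma not_two_dvd_mult: "\<not> 2 dvd f \<Longrightarrow> \<not> 2 dvd g \<Longrightarrow> \<not> (2::'r) dvd f * g"
  using two_prime by blast

end

section \<open>Linear maps on sequences of coefficients\<close>

definition fsc :: "'r::comm_ring_1 \<Rightarrow> (nat \<Rightarrow> 'r) \<Rightarrow> nat \<Rightarrow> 'r" where
  "fsc r c = (\<lambda>i. r * c i)"

lemma fsc_apply: "fsc r c i = r * c i"
  by (simp add: fsc_def)

lemma minus_fun_apply' [simp]: "((f :: 'a \<Rightarrow> 'b::ab_group_add) - g) x = f x - g x"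
  by (simp add: fun_diff_def)

lemma uminus_fun_apply' [simp]: "(- (f :: 'a \<Rightarrow> 'b::ab_group_add)) x = - f x"
  by (simp add: fun_Compl_def)

lemma sum_fun_apply: "(\<Sum>i\<in>S. (f i :: 'a \<Rightarrow> 'b::comm_monoid_add)) x = (\<Sum>i\<in>S. f i x)"
  by (induction S rule: infinite_finite_induct) auto

lemma module_fsc: "Modules.module (fsc :: 'r::comm_ring_1 \<Rightarrow> _)"
  by unfold_locales (auto simp: fun_eq_iff fsc_apply algebra_simps)

definition unit_vec :: "nat \<Rightarrow> nat \<Rightarrow> 'r::comm_ring_1" where
  "unit_vec i = (\<lambda>j. if j = i then 1 else 0)"

definition lin :: "((nat \<Rightarrow> 'r::comm_ring_1) \<Rightarrow> nat \<Rightarrow> 'r) \<Rightarrow> bool" where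
  "lin \<phi> \<longleftrightarrow> (\<forall>c d. \<phi> (c + d) = \<phi> c + \<phi> d) \<and> (\<forall>r c. \<phi> (fsc r c) = fsc r (\<phi> c))"

lemma lin_add: "lin \<phi> \<Longrightarrow> \<phi> (c + d) = \<phi> c + \<phi> d"
  and lin_fsc: "lin \<phi> \<Longrightarrow> \<phi> (fsc r c) = fsc r (\<phi> c)"
  by (simp_all add: lin_def)

lemma lin_0: "lin \<phi> \<Longrightarrow> \<phi> 0 = 0"
  using lin_add[of \<phi> 0 0] by simp

lemma lin_diff: "lin \<phi> \<Longrightarrow> \<phi> (c - d) = \<phi> c - \<phi> d"
  using lin_add[of \<phi> "c - d" d] by (simp add: algebra_simps)

lemma lin_sum: "lin \<phi> \<Longrightarrow> \<phi> (sum g S) = (\<Sum>x\<in>S. \<phi> (g x))"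
  by (induction S rule: infinite_finite_induct) (auto simp: lin_0 lin_add)

lemma lin_comp: "lin \<phi> \<Longrightarrow> lin \<psi> \<Longrightarrow> lin (\<phi> \<circ> \<psi>)"
  by (simp add: lin_def)

text \<open>
  The free module of rank \<open>n\<close> is treated as the quotient of all sequences by those that vanish on
  the first \<open>n\<close> entries, which avoids truncations.
\<close>

definition tail :: "nat \<Rightarrow> (nat \<Rightarrow> 'r::comm_ring_1) set" where
  "tail n = {c. \<forall>i<n. c i = 0}"

text \<open>The pair records a basis of the submodule \<open>range \<phi>\<close>. Here
  \<open>\<psi>\<close> is \<open>2 ^ N\<close> times the inverse of \<open>\<phi>\<close>, so that
  no rational coefficients occur; preserving \<open>tail n\<close> makes both maps descend to rank
  \<open>n\<close>.\<close>

definition quasi_iso :: "nat \<Rightarrow> nat \<Rightarrow> ((nat \<Rightarrow> 'r::comm_ring_1) \<Rightarrow> nat \<Rightarrow> 'r) \<Rightarrow> ((nat \<Rightarrow> 'r) \<Rightarrow> nat \<Rightarrow> 'r) \<Rightarrow> bool" where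
  "quasi_iso n N \<phi> \<psi> \<longleftrightarrow> lin \<phi> \<and> lin \<psi> \<and> (\<forall>c. \<phi> (\<psi> c) = fsc (2 ^ N) c) \<and> (\<forall>c. \<psi> (\<phi> c) = fsc (2 ^ N) c) \<and>
     \<phi> ` tail n \<subseteq> tail n \<and> \<psi> ` tail n \<subseteq> tail n"

lemma quasi_isoD:
  assumes "quasi_iso n N \<phi> \<psi>"
  shows "lin \<phi>" "lin \<psi>" "\<phi> (\<psi> c) = fsc (2 ^ N) c" "\<psi> (\<phi> c) = fsc (2 ^ N) c"
    "\<phi> ` tail n \<subseteq> tail n" "\<psi> ` tail n \<subseteq> tail n"
  using assms by (simp_all add: quasi_iso_def)

lemma quasi_iso_comp:
  assumes 1: "quasi_iso n M \<phi>1 \<psi>1" and 2: "quasi_iso n N \<phi>2 \<psi>2"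
  shows "quasi_iso n (M + N) (\<phi>1 \<circ> \<phi>2) (\<psi>2 \<circ> \<psi>1)"
proof -
  have ff: "fsc r (fsc r' c) = fsc (r * r') c" for r r' :: 'a and c
    by (simp add: fun_eq_iff fsc_apply mult.assoc)
  have "(\<phi>1 \<circ> \<phi>2) ` tail n \<subseteq> tail n" "(\<psi>2 \<circ> \<psi>1) ` tail n \<subseteq> tail n"
    using quasi_isoD(5,6)[OF 1] quasi_isoD(5,6)[OF 2] by (simp_all add: image_subset_iff)
  moreover have "(\<phi>1 \<circ> \<phi>2) ((\<psi>2 \<circ> \<psi>1) c) = fsc (2 ^ (M + N)) c"
      "(\<psi>2 \<circ> \<psi>1) ((\<phi>1 \<circ> \<phi>2) c) = fsc (2 ^ (M + N)) c" for c
    by (simp_all add: quasi_isoD(3,4)[OF 1] quasi_isoD(3,4)[OF 2] lin_fsc[OF quasi_isoD(1)[OF 1]]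
      lin_fsc[OF quasi_isoD(2)[OF 2]] ff power_add mult.commute)
  ultimately show ?thesis
    using lin_comp[OF quasi_isoD(1)[OF 1] quasi_isoD(1)[OF 2]]
      lin_comp[OF quasi_isoD(2)[OF 2] quasi_isoD(2)[OF 1]] by (simp add: quasi_iso_def)
qed

definition subm :: "('r::comm_ring_1 \<Rightarrow> 'v::ab_group_add \<Rightarrow> 'v) \<Rightarrow> 'v set \<Rightarrow> bool" where
  "subm sc S \<longleftrightarrow> 0 \<in> S \<and> (\<forall>x\<in>S. \<forall>y\<in>S. x + y \<in> S) \<and> (\<forall>c. \<forall>x\<in>S. sc c x \<in> S)"

definition saturated :: "('r::comm_ring_1 \<Rightarrow> 'v::ab_group_add \<Rightarrow> 'v) \<Rightarrow> 'v set \<Rightarrow> 'v set \<Rightarrow> bool" where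
  "saturated sc F U \<longleftrightarrow> (\<forall>f. \<forall>x\<in>F. \<not> 2 dvd f \<longrightarrow> sc f x \<in> U \<longrightarrow> x \<in> U)"

lemma saturatedD: "saturated sc F U \<Longrightarrow> sc f x \<in> U \<Longrightarrow> \<not> 2 dvd f \<Longrightarrow> x \<in> F \<Longrightarrow> x \<in> U"
  by (auto simp: saturated_def)

lemma subm_0: "subm sc S \<Longrightarrow> 0 \<in> S"
  and subm_add: "subm sc S \<Longrightarrow> x \<in> S \<Longrightarrow> y \<in> S \<Longrightarrow> x + y \<in> S"
  and subm_sc: "subm sc S \<Longrightarrow> x \<in> S \<Longrightarrow> sc c x \<in> S"
  by (simp_all add: subm_def)

lemma subm_minus: "Modules.module sc \<Longrightarrow> subm sc S \<Longrightarrow> x \<in> S \<Longrightarrow> - x \<in> S"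
  using subm_sc[of sc S x "-1"] Modules.module.scale_minus_left[of sc 1 x]
    Modules.module.scale_one[of sc x] by simp

lemma subm_diff: "Modules.module sc \<Longrightarrow> subm sc S \<Longrightarrow> x \<in> S \<Longrightarrow> y \<in> S \<Longrightarrow> x - y \<in> S"
  using subm_add[of sc S x "- y"] subm_minus[of sc S y] by simp

lemma subm_sum: "subm sc S \<Longrightarrow> (\<And>i. i \<in> J \<Longrightarrow> g i \<in> S) \<Longrightarrow> sum g J \<in> S"
  by (induction J rule: infinite_finite_induct) (auto simp: subm_0 subm_add)

lemma subm_diff_iff: "Modules.module sc \<Longrightarrow> subm sc S \<Longrightarrow> x - y \<in> S \<Longrightarrow> x \<in> S \<longleftrightarrow> y \<in> S"
  using subm_add[of sc S "x - y" y] subm_diff[of sc S x "x - y"] by auto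

lemma fun_split_tail: "c - (\<Sum>j<n. fsc (c j) (unit_vec j)) \<in> tail n"
proof -
  have "(\<Sum>j<n. fsc (c j) (unit_vec j)) i = c i" if "i < n" for i
    using that by (simp add: sum_fun_apply fsc_apply unit_vec_def if_distrib cong: if_cong)
  then show ?thesis by (simp add: tail_def)
qed

context two_euclidean
begin

text \<open>Modulo 2 this is linear algebra over the Euclidean ring \<open>R/2R\<close>: the image
  of \<open>K\<close> has a torsion free quotient, so it is spanned by part of a basis. That basis
  has to be lifted to one over \<open>R\<close>, so the elementary operations are carried out over
  \<open>R\<close> itself. \<open>K\<close> then consists of the vectors whose remaining coordinates
  are even.\<close>

lemma free_submodule_two:
  fixes K :: "(nat \<Rightarrow> 'r) set"
  assumes K: "subm fsc K" and tl: "tail n \<subseteq> K" and two: "\<And>c. fsc 2 c \<in> K"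
    and sat: "saturated fsc UNIV K"
  shows "\<exists>\<phi> \<psi>. quasi_iso n 1 \<phi> \<psi> \<and> range \<phi> = K"
proof -
  note md = module_fsc[where 'r = 'r]
  obtain d :: "'r \<Rightarrow> nat" where d: "\<And>f g. \<not> 2 dvd f \<Longrightarrow> \<exists>q. 2 dvd g - q * f \<or> d (g - q * f) < d f"
    using two_euclid by blast
  \<comment> \<open>\<open>e\<close> is a change of basis in rank \<open>n\<close>, seen on
    sequences, whose basis vectors indexed by \<open>T\<close> already lie in \<open>K\<close>;
    \<open>T\<close> will be taken as large as possible.\<close>
  define good where "good e e' T \<longleftrightarrow> lin e \<and> lin e' \<and> (\<forall>c. e (e' c) = c) \<and> (\<forall>c. e' (e c) = c) \<and>
    e ` tail n \<subseteq> tail n \<and> e' ` tail n \<subseteq> tail n \<and> T \<subseteq> {..<n} \<and> (\<forall>i\<in>T. e (unit_vec i) \<in> K)"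
    for e e' :: "(nat \<Rightarrow> 'r) \<Rightarrow> nat \<Rightarrow> 'r" and T
  have "good id id {}" by (simp add: good_def lin_def)
  then have ex: "\<exists>T e e'. good e e' T" by blast
  have bound: "\<forall>T. (\<exists>e e'. good e e' T) \<longrightarrow> card T \<le> n"
    by (metis good_def card_mono card_lessThan finite_lessThan)
  obtain T where T: "\<exists>e e'. good e e' T" and Tmax: "\<And>T'. \<exists>e e'. good e e' T' \<Longrightarrow> card T' \<le> card T"
    using ex_has_greatest_nat[of "\<lambda>T. \<exists>e e'. good e e' T" _ card "Suc n"] ex bound
    by (metis less_Suc_eq_le)
  have finT: "finite T" using T by (auto simp: good_def dest: finite_subset)
  have inK: "e x \<in> K" if g: "good e e' T" and x: "\<And>j. j < n \<Longrightarrow> j \<notin> T \<Longrightarrow> 2 dvd x j" for e e' x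
  proof -
    define y where "y j = (if j < n \<and> j \<notin> T then SOME z. x j = 2 * z else 0)" for j
    have y: "x j = 2 * y j" if "j < n" "j \<notin> T" for j
      using x[OF that] that someI_ex[of "\<lambda>z. x j = 2 * z"] by (auto simp: y_def dvd_def)
    define s where "s = (\<Sum>k\<in>T. fsc (x k) (unit_vec k))"
    have s: "s j = (if j \<in> T then x j else 0)" for j
      using finT by (simp add: s_def sum_fun_apply fsc_apply unit_vec_def if_distrib cong: if_cong)
    have le: "lin e" and sub: "T \<subseteq> {..<n}" using g by (auto simp: good_def)
    have "x - s - fsc 2 y \<in> tail n"
      using y sub by (auto simp: tail_def s y_def fsc_apply)
    then have "e (x - s - fsc 2 y) \<in> K" using g tl by (auto simp: good_def)
    moreover have "e s \<in> K"
      unfolding s_def lin_sum[OF le] using g by (auto intro!: subm_sum[OF K] simp: lin_fsc[OF le] good_def intro: subm_sc[OF K])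
    moreover have "e (fsc 2 y) \<in> K" using two by (simp add: lin_fsc[OF le])
    moreover have "e x = e (x - s - fsc 2 y) + e s + e (fsc 2 y)"
      by (simp add: lin_diff[OF le])
    ultimately show ?thesis using subm_add[OF K] by simp
  qed
  \<comment> \<open>A counterexample is chosen with \<open>d (c i)\<close> least among all good
    \<open>e\<close>, not only the given one, because the elementary operation below replaces
    \<open>e\<close>.\<close>
  have even: "2 dvd c i" if "good e e' T" "e c \<in> K" "i < n" "i \<notin> T" for e e' c i
  proof (rule ccontr)
    assume nd: "\<not> 2 dvd c i"
    define P where "P = (\<lambda>(e, e', c, i). good e e' T \<and> e c \<in> K \<and> i < n \<and> i \<notin> T \<and> \<not> 2 dvd c i)"
    have "P (e, e', c, i)" using that nd by (simp add: P_def)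
    then obtain z where Pz: "P z" and zmin: "\<And>w. P w \<Longrightarrow> (\<lambda>(e, e', c, i). d (c i)) z \<le> (\<lambda>(e, e', c, i). d (c i)) w"
      using ex_has_least_nat[of P _ "\<lambda>(e, e', c, i). d (c i)"] by metis
    obtain e e' c i where z: "z = (e, e', c, i)" by (metis prod_cases4)
    have g: "good e e' T" and c: "e c \<in> K" and i: "i < n" "i \<notin> T" and nd: "\<not> 2 dvd c i"
      using Pz by (auto simp: P_def z)
    have le: "lin e" and le': "lin e'" and ee': "\<And>c. e (e' c) = c" and e'e: "\<And>c. e' (e c) = c"
      using g by (auto simp: good_def)
    have "\<forall>j. \<exists>q. 2 dvd c j - q * c i \<or> d (c j - q * c i) < d (c i)"
      using d[OF nd] by blast
    then obtain q0 where q0: "\<And>j. 2 dvd c j - q0 j * c i \<or> d (c j - q0 j * c i) < d (c i)"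
      by metis
    define q where "q j = (if j < n \<and> j \<notin> T \<and> j \<noteq> i then q0 j else 0)" for j
    have qi: "q i = 0" by (simp add: q_def)
    have qtail: "fsc 0 q = 0" by (auto simp: fun_eq_iff fsc_apply)
    \<comment> \<open>An elementary operation: \<open>e2\<close> sends the \<open>i\<close>-th unit
      vector to \<open>e (unit_vec i + q)\<close> and agrees with \<open>e\<close> on the others. In
      the new coordinates the entries outside \<open>T\<close> are reduced modulo
      \<open>c i\<close>, while entry \<open>i\<close> stays fixed because
      \<open>q i = 0\<close>.\<close>
    define e2 where "e2 x = e (x + fsc (x i) q)" for x
    define e2' where "e2' x = e' x - fsc (e' x i) q" for x
    have le2: "lin e2"
    proof -
      have "c + d + fsc ((c + d) i) q = (c + fsc (c i) q) + (d + fsc (d i) q)"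
        "fsc r c + fsc (fsc r c i) q = fsc r (c + fsc (c i) q)" for c d r
        by (simp_all add: fun_eq_iff fsc_apply algebra_simps)
      then show ?thesis unfolding lin_def e2_def by (simp only: lin_add[OF le] lin_fsc[OF le] simp_thms)
    qed
    have le2': "lin e2'"
      unfolding lin_def e2'_def
      by (simp add: lin_add[OF le'] lin_fsc[OF le'] fun_eq_iff fsc_apply algebra_simps)
    have inv1: "e2 (e2' x) = x" for x
    proof -
      have "e2' x + fsc (e2' x i) q = e' x"
        by (auto simp: e2'_def fun_eq_iff fsc_apply qi)
      then show ?thesis by (simp add: e2_def ee')
    qed
    have inv2: "e2' (e2 x) = x" for x
      by (auto simp: e2'_def e2_def e'e fun_eq_iff fsc_apply qi)
    have uv: "e2 (unit_vec k) = e (unit_vec k)" if "k \<noteq> i" for k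
    proof -
      have "unit_vec k i = (0::'r)" using that by (simp add: unit_vec_def)
      then show ?thesis by (simp add: e2_def qtail)
    qed
    have t1: "e2 ` tail n \<subseteq> tail n"
    proof
      fix y assume "y \<in> e2 ` tail n"
      then obtain x where x: "x \<in> tail n" "y = e2 x" by auto
      then have "x i = 0" using i by (simp add: tail_def)
      then have "y = e x" using x by (simp add: e2_def qtail)
      then show "y \<in> tail n" using g x by (auto simp: good_def)
    qed
    have t2: "e2' ` tail n \<subseteq> tail n"
    proof
      fix y assume "y \<in> e2' ` tail n"
      then obtain x where x: "x \<in> tail n" "y = e2' x" by auto
      have e'x: "e' x \<in> tail n" using g x by (auto simp: good_def)
      then have "e' x i = 0" using i by (simp add: tail_def)
      then have "y = e' x" using x by (simp add: e2'_def qtail)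
      then show "y \<in> tail n" using e'x by simp
    qed
    have "e2 (unit_vec k) \<in> K" if "k \<in> T" for k
      using uv[of k] that i g by (metis good_def)
    then have g2: "good e2 e2' T"
      using g le2 le2' inv1 inv2 t1 t2 by (simp add: good_def)
    define c2 where "c2 = c - fsc (c i) q"
    have c2i: "c2 i = c i" by (simp add: c2_def qi fsc_apply)
    have "c2 + fsc (c2 i) q = c" unfolding c2i by (simp add: c2_def)
    then have e2c2: "e2 c2 \<in> K" using c by (simp add: e2_def)
    \<comment> \<open>An odd remainder would have a smaller \<open>d\<close>-value than
      \<open>c i\<close>, against minimality, so the division leaves only even entries.\<close>
    have ev: "2 dvd c2 j" if j: "j < n" "j \<notin> T" "j \<noteq> i" for j
    proof (rule ccontr)
      assume n: "\<not> 2 dvd c2 j"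
      have c2j: "c2 j = c j - q0 j * c i" using j by (simp add: c2_def q_def fsc_apply mult.commute)
      have "P (e2, e2', c2, j)" using g2 e2c2 j n by (simp add: P_def)
      then have "d (c i) \<le> d (c2 j)" using zmin by (fastforce simp: z)
      then show False using q0[of j] n unfolding c2j by simp
    qed
    \<comment> \<open>Without its \<open>i\<close>-th entry \<open>c2\<close> is even outside
      \<open>T\<close>, so it contributes an element of \<open>K\<close>. What remains is the odd
      multiple \<open>c i\<close> of a basis vector; saturation puts that vector into
      \<open>K\<close>, and \<open>T\<close> could have been larger.\<close>
    have "e2 (c2 - fsc (c i) (unit_vec i)) \<in> K"
      by (rule inK[OF g2]) (use ev c2i in \<open>auto simp: unit_vec_def fsc_apply\<close>)
    then have "e2 (c2 - (c2 - fsc (c i) (unit_vec i))) \<in> K"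
      unfolding lin_diff[OF le2, of c2] using e2c2 subm_diff[OF md K] by blast
    then have "fsc (c i) (e2 (unit_vec i)) \<in> K" by (simp add: lin_fsc[OF le2])
    then have "e2 (unit_vec i) \<in> K" using saturatedD[OF sat _ nd] by simp
    then have "good e2 e2' (insert i T)" using g2 i by (auto simp: good_def)
    then have "card (insert i T) \<le> card T" using Tmax by blast
    then show False using i finT by simp
  qed
  obtain e e' where g: "good e e' T" using T by blast
  have le: "lin e" and le': "lin e'" and ee': "\<And>c. e (e' c) = c" and e'e: "\<And>c. e' (e c) = c"
    using g by (auto simp: good_def)
  \<comment> \<open>Diagonal matrices with product 2. \<open>D\<close> has entry 1 on
    \<open>T\<close>, entry 2 on the other coordinates below \<open>n\<close>, and entry 1 beyond
    \<open>n\<close>, so that its range contains every tail.\<close>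
  define D where "D c = (\<lambda>j. if j < n \<and> j \<notin> T then 2 * c j else c j)" for c :: "nat \<Rightarrow> 'r"
  define D' where "D' c = (\<lambda>j. if j < n \<and> j \<notin> T then c j else 2 * c j)" for c :: "nat \<Rightarrow> 'r"
  have lD: "lin D" and lD': "lin D'"
    by (auto simp: lin_def D_def D'_def fun_eq_iff fsc_apply algebra_simps)
  have DD': "D (D' c) = fsc 2 c" "D' (D c) = fsc 2 c" for c
    by (auto simp: D_def D'_def fun_eq_iff fsc_apply)
  have Dt: "D ` tail n \<subseteq> tail n" "D' ` tail n \<subseteq> tail n"
    by (auto simp: tail_def D_def D'_def)
  have "range (e \<circ> D) = K"
  proof (intro equalityI subsetI)
    fix x assume "x \<in> range (e \<circ> D)"
    then show "x \<in> K" using inK[OF g] by (auto simp: D_def)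
  next
    fix x assume x: "x \<in> K"
    have "2 dvd e' x j" if "j < n" "j \<notin> T" for j
      using even[OF g, of "e' x" j] x that by (simp add: ee')
    then have "\<forall>j. \<exists>z. j < n \<and> j \<notin> T \<longrightarrow> e' x j = 2 * z" by (auto simp: dvd_def)
    then obtain z where z: "\<And>j. j < n \<Longrightarrow> j \<notin> T \<Longrightarrow> e' x j = 2 * z j" by metis
    have "e' x = D (\<lambda>j. if j < n \<and> j \<notin> T then z j else e' x j)"
      using z by (auto simp: D_def fun_eq_iff fsc_apply)
    then have "x = (e \<circ> D) (\<lambda>j. if j < n \<and> j \<notin> T then z j else e' x j)"
      using ee'[of x] by simp
    then show "x \<in> range (e \<circ> D)" by blast
  qed
  moreover have "(e \<circ> D) ` tail n \<subseteq> tail n" "(D' \<circ> e') ` tail n \<subseteq> tail n"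
    using g Dt unfolding good_def by (simp_all add: image_subset_iff)
  moreover have "(e \<circ> D) ((D' \<circ> e') c) = fsc 2 c" "(D' \<circ> e') ((e \<circ> D) c) = fsc 2 c" for c
    by (simp_all add: DD' e'e lin_fsc[OF le] ee')
  ultimately have "quasi_iso n 1 (e \<circ> D) (D' \<circ> e')" "range (e \<circ> D) = K"
    using lin_comp[OF le lD] lin_comp[OF lD' le'] by (simp_all add: quasi_iso_def)
  then show ?thesis by blast
qed

text \<open>Induction on \<open>N\<close> splits off one factor 2. The vectors carried into
  \<open>K\<close> by \<open>2 ^ N\<close> form a submodule \<open>K1\<close> containing twice
  everything, so it has a basis by \<open>free_submodule_two\<close>; in the coordinates of that
  basis \<open>K\<close> contains \<open>2 ^ N\<close> times everything.\<close>

lemma free_submodule: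
  fixes K :: "(nat \<Rightarrow> 'r) set"
  assumes K: "subm fsc K" and tl: "tail n \<subseteq> K" and pow: "\<And>c. fsc (2 ^ N) c \<in> K"
    and sat: "saturated fsc UNIV K"
  shows "\<exists>\<phi> \<psi>. quasi_iso n N \<phi> \<psi> \<and> range \<phi> = K"
  using K tl pow sat
proof (induction N arbitrary: K)
  case 0
  have "fsc 1 c = c" for c :: "nat \<Rightarrow> 'r" by (simp add: fun_eq_iff fsc_apply)
  then show ?case
    using 0 by (intro exI[of _ id]) (auto simp: quasi_iso_def lin_def)
next
  case (Suc N)
  define K1 where "K1 = {c. fsc (2 ^ N) c \<in> K}"
  have ff: "fsc r (fsc r' c) = fsc (r * r') c" for r r' and c :: "nat \<Rightarrow> 'r"
    by (simp add: fun_eq_iff fsc_apply mult.assoc)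
  have fa: "fsc r (c + c') = fsc r c + fsc r c'" for r and c c' :: "nat \<Rightarrow> 'r"
    by (simp add: fun_eq_iff fsc_apply algebra_simps)
  have f0: "fsc r 0 = (0 :: nat \<Rightarrow> 'r)" for r
    by (simp add: fun_eq_iff fsc_apply)
  have sub: "K \<subseteq> K1"
    unfolding K1_def using subm_sc[OF Suc.prems(1), of _ "2 ^ N"] by blast
  have "subm fsc K1"
    unfolding subm_def
  proof (intro conjI ballI allI)
    show "0 \<in> K1" using subm_0[OF Suc.prems(1)] by (simp only: K1_def mem_Collect_eq f0)
    show "x + y \<in> K1" if "x \<in> K1" "y \<in> K1" for x y
      using subm_add[OF Suc.prems(1)] that by (simp only: K1_def mem_Collect_eq fa)
    show "fsc r x \<in> K1" if "x \<in> K1" for r x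
    proof -
      have "fsc (2 ^ N) (fsc r x) = fsc r (fsc (2 ^ N) x)" by (simp only: ff mult.commute)
      then show ?thesis using subm_sc[OF Suc.prems(1)] that by (simp only: K1_def mem_Collect_eq)
    qed
  qed
  moreover have "tail n \<subseteq> K1" using sub Suc.prems by blast
  moreover have "fsc 2 c \<in> K1" for c using Suc.prems(3)[of c] by (simp only: K1_def mem_Collect_eq ff power_Suc2)
  moreover have "saturated fsc UNIV K1"
    unfolding saturated_def
  proof (intro allI ballI impI)
    fix f and x :: "nat \<Rightarrow> 'r" assume f: "\<not> 2 dvd f" and "fsc f x \<in> K1"
    then have "fsc f (fsc (2 ^ N) x) \<in> K" by (simp add: K1_def ff mult.commute)
    then show "x \<in> K1" using saturatedD[OF Suc.prems(4) _ f] by (simp add: K1_def)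
  qed
  ultimately obtain \<phi>1 \<psi>1 where q1: "quasi_iso n 1 \<phi>1 \<psi>1" and K1: "range \<phi>1 = K1"
    using free_submodule_two[of K1 n] by blast
  note 1 = quasi_isoD[OF q1] 
  define K2 where "K2 = {c. \<phi>1 c \<in> K}"
  have "subm fsc K2"
    using Suc.prems(1) by (simp add: subm_def K2_def lin_add[OF 1(1)] lin_fsc[OF 1(1)] lin_0[OF 1(1)])
  moreover have "tail n \<subseteq> K2" using 1(5) Suc.prems(2) by (auto simp: K2_def)
  moreover have "fsc (2 ^ N) c \<in> K2" for c
    using K1 by (auto simp: K2_def lin_fsc[OF 1(1)] K1_def)
  moreover have "saturated fsc UNIV K2"
    using Suc.prems(4) by (auto simp: saturated_def K2_def lin_fsc[OF 1(1)])
  ultimately obtain \<phi>2 \<psi>2 where q2: "quasi_iso n N \<phi>2 \<psi>2" and K2: "range \<phi>2 = K2"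
    using Suc.IH[of K2] by blast
  have "range (\<phi>1 \<circ> \<phi>2) = \<phi>1 ` K2" using K2 by (metis image_comp)
  also have "\<dots> = K" using sub K1 by (auto simp: K2_def)
  finally show ?case using quasi_iso_comp[OF q1 q2] by fastforce
qed

end

section \<open>Generators, resolutions and functionals modulo the ring\<close>

definition comb :: "('r::comm_ring_1 \<Rightarrow> 'v::ab_group_add \<Rightarrow> 'v) \<Rightarrow> (nat \<Rightarrow> 'v) \<Rightarrow> nat \<Rightarrow> (nat \<Rightarrow> 'r) \<Rightarrow> 'v" where
  "comb sc g n c = (\<Sum>i<n. sc (c i) (g i))"

lemma comb_add: "Modules.module sc \<Longrightarrow> comb sc g n (c + d) = comb sc g n c + comb sc g n d"
  by (simp add: comb_def Modules.module.scale_left_distrib sum.distrib)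

lemma comb_diff: "Modules.module sc \<Longrightarrow> comb sc g n (c - d) = comb sc g n c - comb sc g n d"
  using comb_add[of sc g n "c - d" d] by (simp add: algebra_simps)

lemma comb_fsc: "Modules.module sc \<Longrightarrow> comb sc g n (fsc r c) = sc r (comb sc g n c)"
  by (simp add: comb_def Modules.module.scale_sum_right Modules.module.scale_scale fsc_apply)

lemma comb_tail: "Modules.module sc \<Longrightarrow> c \<in> tail n \<Longrightarrow> comb sc g n c = 0"
  by (auto simp: comb_def tail_def Modules.module.scale_zero_left intro!: sum.neutral)

lemma comb_0: "Modules.module sc \<Longrightarrow> comb sc g n 0 = 0"
  by (simp add: comb_tail tail_def)

lemma comb_in:
  assumes F: "subm sc F" and g: "range g \<subseteq> F"
  shows "comb sc g n c \<in> F"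
  unfolding comb_def using g by (intro subm_sum[OF F] subm_sc[OF F]) auto

text \<open>Tails do not contribute, so the coefficient vector may be cut down to finitely many unit
  vectors; composing coefficients with \<open>\<phi>\<close> then amounts to a change of
  generators.\<close>

lemma comb_lin:
  assumes md: "Modules.module sc" and \<phi>: "lin \<phi>" and t: "\<phi> ` tail n \<subseteq> tail n"
  shows "comb sc g n (\<phi> d) = comb sc (\<lambda>j. comb sc g n (\<phi> (unit_vec j))) n d"
proof -
  define s where "s = (\<Sum>j<n. fsc (d j) (unit_vec j))"
  have "\<phi> (d - s) \<in> tail n" using fun_split_tail[of d n] t by (auto simp: s_def)
  then have "comb sc g n (\<phi> (d - s)) = 0" by (rule comb_tail[OF md])
  then have "comb sc g n (\<phi> d) = comb sc g n (\<phi> s)"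
    by (simp add: lin_diff[OF \<phi>] comb_diff[OF md])
  also have "\<phi> s = (\<Sum>j<n. fsc (d j) (\<phi> (unit_vec j)))"
    by (simp add: s_def lin_sum[OF \<phi>] lin_fsc[OF \<phi>])
  also have "comb sc g n \<dots> = (\<Sum>j<n. comb sc g n (fsc (d j) (\<phi> (unit_vec j))))"
    by (rule additive.sum[of "comb sc g n"]) (simp only: additive_def comb_add[OF md] simp_thms)
  finally show ?thesis by (simp add: comb_fsc[OF md] comb_def[of sc _ n d])
qed

context two_euclidean
begin

text \<open>The coefficient vectors that land in \<open>U\<close> form a saturated submodule
  containing \<open>2 ^ N\<close> times everything, so they have a basis of the same rank
  \<open>n\<close>. When \<open>g\<close> generates \<open>F\<close> modulo \<open>U\<close> this is
  a length one resolution of \<open>F/U\<close>.\<close>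

lemma resolution:
  fixes sc :: "'r \<Rightarrow> 'v::ab_group_add \<Rightarrow> 'v"
  assumes md: "Modules.module sc" and F: "subm sc F" and U: "subm sc U"
    and sat: "saturated sc F U" and g: "range g \<subseteq> F"
    and pow: "\<forall>v\<in>F. sc (2 ^ N) v \<in> U"
  shows "\<exists>\<phi> \<psi>. quasi_iso n N \<phi> \<psi> \<and> range \<phi> = {c. comb sc g n c \<in> U}"
proof -
  let ?K = "{c. comb sc g n c \<in> U}"
  have inF: "comb sc g n c \<in> F" for c using comb_in[OF F g] .
  have "subm fsc ?K"
    using U unfolding subm_def by (simp add: comb_0[OF md] comb_add[OF md] comb_fsc[OF md])
  moreover have "tail n \<subseteq> ?K" using comb_tail[OF md] subm_0[OF U] by auto
  moreover have "fsc (2 ^ N) c \<in> ?K" for c using pow[rule_format, OF inF] by (simp add: comb_fsc[OF md])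
  moreover have "saturated fsc UNIV ?K" using sat inF by (simp add: saturated_def comb_fsc[OF md])
  ultimately show ?thesis by (rule free_submodule)
qed

end

text \<open>\<open>invol_mod_two\<close> is what lets \<open>2R\<close> stand in for
  \<open>one_plus_star A\<close> on self-conjugate elements; countability serves to move every form
  to a carrier of natural numbers.\<close>

locale dyadic = two_euclidean "TYPE('r)" for A :: "('r::comm_ring_1, 'q::comm_ring_1) inv_ring" +
  assumes torsion_free: "torsion_free_inv_ring A"
    and qinvol_qinvol [simp]: "qinvol A (qinvol A a) = a"
    and invol_mod_two: "2 dvd r - invol A r"
    and countable_ring: "countable (UNIV :: 'r set)"
begin

abbreviation inc :: "'r \<Rightarrow> 'q" ("\<iota>") where "inc \<equiv> incl A"
abbreviation iv :: "'r \<Rightarrow> 'r" where "iv \<equiv> invol A"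
abbreviation cj :: "'q \<Rightarrow> 'q" where "cj \<equiv> qinvol A"
abbreviation II :: "'q set" where "II \<equiv> range (incl A)"

lemma incl_add: "\<iota> (r + r') = \<iota> r + \<iota> r'"
  and incl_mult: "\<iota> (r * r') = \<iota> r * \<iota> r'"
  and incl_1 [simp]: "\<iota> 1 = 1"
  and incl_inj: "inj \<iota>"
  and iv_add: "iv (r + r') = iv r + iv r'"
  and iv_mult: "iv (r * r') = iv r * iv r'"
  and iv_1 [simp]: "iv 1 = 1"
  and iv_iv [simp]: "iv (iv r) = r"
  and cj_add: "cj (a + a') = cj a + cj a'"
  and cj_mult: "cj (a * a') = cj a * cj a'"
  and cj_incl: "cj (\<iota> r) = \<iota> (iv r)"
proof -
  note tf = torsion_free[unfolded torsion_free_inv_ring_def]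
  have 1: "\<forall>r r'. \<iota> (r + r') = \<iota> r + \<iota> r'" using tf by (elim conjE)
  have 2: "\<forall>r r'. \<iota> (r * r') = \<iota> r * \<iota> r'" using tf by (elim conjE)
  have 3: "\<forall>r r'. iv (r + r') = iv r + iv r'" using tf by (elim conjE)
  have 4: "\<forall>r r'. iv (r * r') = iv r' * iv r" using tf by (elim conjE)
  have 5: "\<forall>r. iv (iv r) = r" using tf by (elim conjE)
  have 6: "\<forall>a a'. cj (a + a') = cj a + cj a'" using tf by (elim conjE)
  have 7: "\<forall>a a'. cj (a * a') = cj a' * cj a" using tf by (elim conjE)
  have 8: "\<forall>r. cj (\<iota> r) = \<iota> (iv r)" using tf by (elim conjE)
  show "\<iota> 1 = 1" using tf by (elim conjE)
  show "inj \<iota>" using tf by (elim conjE)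
  show "iv 1 = 1" using tf by (elim conjE)
  show "\<iota> (r + r') = \<iota> r + \<iota> r'" using 1 by blast
  show "\<iota> (r * r') = \<iota> r * \<iota> r'" using 2 by blast
  show "iv (r + r') = iv r + iv r'" using 3 by blast
  show "iv (r * r') = iv r * iv r'" using 4[rule_format, of r r'] by (metis mult.commute)
  show "iv (iv r) = r" using 5 by blast
  show "cj (a + a') = cj a + cj a'" using 6 by blast
  show "cj (a * a') = cj a * cj a'" using 7[rule_format, of a a'] by (metis mult.commute)
  show "cj (\<iota> r) = \<iota> (iv r)" using 8 by blast
qed

lemma additive_incl: "additive \<iota>" and additive_iv: "additive iv" and additive_cj: "additive cj"
  by (simp_all add: additive_def incl_add iv_add cj_add)

lemmas incl_0 [simp] = additive.zero[OF additive_incl]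
  and incl_minus = additive.minus[OF additive_incl]
  and incl_diff = additive.diff[OF additive_incl]
  and iv_0 [simp] = additive.zero[OF additive_iv]
  and cj_0 [simp] = additive.zero[OF additive_cj]
  and cj_minus = additive.minus[OF additive_cj]
  and cj_diff = additive.diff[OF additive_cj]
  and cj_sum = additive.sum[OF additive_cj]

lemma incl_2 [simp]: "\<iota> 2 = 2" and iv_2 [simp]: "iv 2 = 2"
  using incl_add[of 1 1] iv_add[of 1 1] by simp_all

lemma cj_1 [simp]: "cj 1 = 1"
  using cj_incl[of 1] by simp

lemma cj_2 [simp]: "cj 2 = 2"
  using cj_incl[of 2] by simp

lemma incl_power: "\<iota> (r ^ k) = \<iota> r ^ k" and iv_power: "iv (r ^ k) = iv r ^ k"
  by (induction k) (simp_all add: incl_mult iv_mult)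

lemma incl_2_power [simp]: "\<iota> (2 ^ k) = 2 ^ k" and iv_2_power [simp]: "iv (2 ^ k) = 2 ^ k"
  by (simp_all add: incl_power iv_power)

lemma incl_eq_iff: "\<iota> r = \<iota> r' \<longleftrightarrow> r = r'"
  using incl_inj by (auto simp: inj_def)

definition hf :: 'q where "hf = (SOME h. 2 * h = 1)"

lemma two_hf [simp]: "2 * hf = 1"
proof -
  have "\<forall>n>0. \<exists>a::'q. of_nat n * a = 1"
    using torsion_free[unfolded torsion_free_inv_ring_def] by (elim conjE)
  then have "\<exists>a::'q. of_nat 2 * a = 1" using zero_less_numeral by blast
  then show ?thesis unfolding hf_def of_nat_numeral by (rule someI_ex)
qed

lemma two_hf' [simp]: "2 * (hf * a) = a" "hf * (2 * a) = a"
  by (metis two_hf mult.assoc mult.left_commute mult_1)+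

lemma two_hf_power [simp]: "2 ^ k * hf ^ k = 1" "hf ^ k * 2 ^ k = 1"
  by (simp_all add: power_mult_distrib[symmetric] mult.commute[of hf])

lemma two_hf_power' [simp]: "2 ^ k * (hf ^ k * a) = a" "hf ^ k * (2 ^ k * a) = a"
  by (simp_all only: mult.assoc[symmetric] two_hf_power mult_1)

lemma q_two_cancel: "2 * (a::'q) = 2 * b \<Longrightarrow> a = b"
  by (metis two_hf'(2))

lemma cj_hf [simp]: "cj hf = hf"
  using cj_mult[of 2 hf] by (simp add: q_two_cancel)

lemma II_add: "a \<in> II \<Longrightarrow> b \<in> II \<Longrightarrow> a + b \<in> II"
  and II_minus: "a \<in> II \<Longrightarrow> - a \<in> II"
  and II_diff: "a \<in> II \<Longrightarrow> b \<in> II \<Longrightarrow> a - b \<in> II"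
  and II_mult: "a \<in> II \<Longrightarrow> \<iota> r * a \<in> II"
  and II_0 [simp]: "0 \<in> II"
  and II_cj: "a \<in> II \<Longrightarrow> cj a \<in> II"
  by (auto simp: incl_add[symmetric] incl_mult[symmetric] incl_minus[symmetric] incl_diff[symmetric] cj_incl
        intro: range_eqI[of _ _ 0])

lemma II_incl [simp]: "\<iota> r \<in> II" by simp

lemma II_2: "a \<in> II \<Longrightarrow> 2 * a \<in> II" and II_2_power: "a \<in> II \<Longrightarrow> 2 ^ k * a \<in> II"
  using II_mult[of a 2] II_mult[of a "2 ^ k"] by simp_all

lemma II_sum: "(\<And>i. i \<in> S \<Longrightarrow> f i \<in> II) \<Longrightarrow> sum f S \<in> II"
  by (induction S rule: infinite_finite_induct) (auto intro: II_add simp del: image_iff)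

lemma II_diff_iff: "a - b \<in> II \<Longrightarrow> a \<in> II \<longleftrightarrow> b \<in> II"
  using II_add[of "a - b" b] II_diff[of a "a - b"] by (auto simp del: image_iff)

lemma II_diff_sym: "a - b \<in> II \<Longrightarrow> b - a \<in> II"
  using II_minus[of "a - b"] by simp

lemma II_diff_trans: "a - b \<in> II \<Longrightarrow> b - c \<in> II \<Longrightarrow> a - c \<in> II"
  using II_add[of "a - b" "b - c"] by simp

lemma II_cj_iff: "cj a \<in> II \<longleftrightarrow> a \<in> II"
  using II_cj[of a] II_cj[of "cj a"] by auto

lemma iv_two_dvd_iff: "2 dvd iv f \<longleftrightarrow> 2 dvd f"
  using invol_mod_two[of f] by (metis dvd_diff_commute dvd_diff_left_iff diff_diff_eq2 dvd_add_right_iff add.commute diff_add_cancel)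

text \<open>Write \<open>2 ^ k * a\<close> as a ring element \<open>r\<close>. Then
  \<open>f * r\<close> is divisible by \<open>2 ^ k\<close> and, \<open>f\<close> being odd, so is
  \<open>r\<close>. Thus odd scalars act injectively on the 2-primary part of
  \<open>\<rat>R/R\<close>.\<close>

lemma II_sat:
  assumes f: "\<not> 2 dvd f" and a: "2 ^ k * a \<in> II" and fa: "\<iota> f * a \<in> II"
  shows "a \<in> II"
proof -
  obtain r r' where r: "2 ^ k * a = \<iota> r" and r': "\<iota> f * a = \<iota> r'"
    using a fa by auto
  have "\<iota> (f * r) = \<iota> (2 ^ k * r')"
    using r r' by (metis incl_2_power incl_mult mult.left_commute)
  then have "f * r = 2 ^ k * r'" by (simp only: incl_eq_iff)
  then obtain t where t: "r = 2 ^ k * t" using two_power_dvd[OF f] by (metis dvd_def)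
  have "hf ^ k * (2 ^ k * a) = hf ^ k * (2 ^ k * \<iota> t)"
    by (simp only: r t incl_mult incl_2_power)
  then have "a = \<iota> t" by (simp add: mult.assoc[symmetric])
  then show ?thesis by simp
qed

text \<open>A homomorphism into \<open>\<rat>R/R\<close> is represented by arbitrary lifts of its
  values to \<open>\<rat>R\<close>, so linearity holds only modulo \<open>II\<close>.\<close>

definition homI :: "('r \<Rightarrow> 'v::ab_group_add \<Rightarrow> 'v) \<Rightarrow> 'v set \<Rightarrow> ('v \<Rightarrow> 'q) \<Rightarrow> bool" where
  "homI sc F h \<longleftrightarrow> (\<forall>v\<in>F. \<forall>w\<in>F. h (v + w) - h v - h w \<in> II) \<and> (\<forall>r. \<forall>v\<in>F. h (sc r v) - \<iota> r * h v \<in> II)"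

lemma homI_add: "homI sc F h \<Longrightarrow> v \<in> F \<Longrightarrow> w \<in> F \<Longrightarrow> h (v + w) - h v - h w \<in> II"
  and homI_sc: "homI sc F h \<Longrightarrow> v \<in> F \<Longrightarrow> h (sc r v) - \<iota> r * h v \<in> II"
  by (simp_all add: homI_def)

lemma homI_0: "homI sc F h \<Longrightarrow> 0 \<in> F \<Longrightarrow> h 0 \<in> II"
  using homI_add[of sc F h 0 0] II_minus[of "- h 0"] by simp

lemma homI_diff:
  assumes h: "homI sc F h" and "Modules.module sc" "subm sc F" "v \<in> F" "w \<in> F"
  shows "h (v - w) - h v + h w \<in> II"
  using homI_add[OF h, of "v - w" w] subm_diff[of sc F v w] assms II_minus[of "h v - h (v - w) - h w"]
  by (simp add: algebra_simps)

lemma homI_sum: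
  assumes h: "homI sc F h" and F: "subm sc F" and u: "\<And>j. j \<in> S \<Longrightarrow> u j \<in> F"
  shows "h (\<Sum>j\<in>S. sc (r j) (u j)) - (\<Sum>j\<in>S. \<iota> (r j) * h (u j)) \<in> II"
  using u
proof (induction S rule: infinite_finite_induct)
  case (insert x S)
  let ?s = "\<Sum>j\<in>S. sc (r j) (u j)"
  have "?s \<in> F" "sc (r x) (u x) \<in> F" using insert.prems by (auto intro!: subm_sum[OF F] subm_sc[OF F])
  then have 1: "h (sc (r x) (u x) + ?s) - h (sc (r x) (u x)) - h ?s \<in> II" by (intro homI_add[OF h])
  have 2: "h (sc (r x) (u x)) - \<iota> (r x) * h (u x) \<in> II" using insert.prems by (intro homI_sc[OF h]) auto
  have 3: "h ?s - (\<Sum>j\<in>S. \<iota> (r j) * h (u j)) \<in> II" using insert by auto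
  have "h (sc (r x) (u x) + ?s) - (\<iota> (r x) * h (u x) + (\<Sum>j\<in>S. \<iota> (r j) * h (u j))) \<in> II"
    using II_add[OF II_add[OF 1 2] 3] by (simp add: algebra_simps)
  then show ?case using insert by simp
qed (use homI_0[OF h] F in \<open>auto simp: subm_0\<close>)

text \<open>\<open>H0\<close> is exactly linear on coefficients and integral on relations, so the
  choice of the coefficients \<open>cc v\<close> affects its value only modulo
  \<open>II\<close>.\<close>

lemma homI_descend:
  fixes sc :: "'r \<Rightarrow> 'v::ab_group_add \<Rightarrow> 'v"
  assumes md: "Modules.module sc" and F: "subm sc F" and K: "subm sc K"
    and cc: "\<And>v. v \<in> F \<Longrightarrow> v - comb sc g n (cc v) \<in> K"
    and add: "\<And>c d. H0 (c + d) = H0 c + H0 d" and fsc: "\<And>r c. H0 (fsc r c) = \<iota> r * H0 c"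
    and H0K: "\<And>c. comb sc g n c \<in> K \<Longrightarrow> H0 c \<in> II"
  shows "homI sc F (\<lambda>v. H0 (cc v))"
  unfolding homI_def
proof (intro conjI ballI allI)
  have diff: "H0 (c - d) = H0 c - H0 d" for c d
    using add[of "c - d" d] by simp
  fix v assume v: "v \<in> F"
  show "H0 (cc (v + w)) - H0 (cc v) - H0 (cc w) \<in> II" if w: "w \<in> F" for w
  proof -
    have "(v - comb sc g n (cc v)) + (w - comb sc g n (cc w)) - ((v + w) - comb sc g n (cc (v + w))) \<in> K"
      using v w by (intro subm_diff[OF md K] subm_add[OF K] cc) (auto intro: subm_add[OF F])
    then have "comb sc g n (cc (v + w) - (cc v + cc w)) \<in> K"
      by (simp only: comb_diff[OF md] comb_add[OF md] add_diff_add diff_diff_eq2) (simp add: algebra_simps)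
    from H0K[OF this] show ?thesis by (simp add: diff add diff_diff_eq)
  qed
  show "H0 (cc (sc r v)) - \<iota> r * H0 (cc v) \<in> II" for r
  proof -
    have "sc r (v - comb sc g n (cc v)) - (sc r v - comb sc g n (cc (sc r v))) \<in> K"
      using v by (intro subm_diff[OF md K] subm_sc[OF K] cc) (auto intro: subm_sc[OF F])
    then have "comb sc g n (cc (sc r v) - fsc r (cc v)) \<in> K"
      by (simp add: comb_diff[OF md] comb_fsc[OF md] Modules.module.scale_right_diff_distrib[OF md])
    from H0K[OF this] show ?thesis by (simp add: diff fsc)
  qed
qed

text \<open>The obstruction lies in an Ext group of \<open>F/U\<close>, which vanishes: the
  coefficient vectors landing in \<open>U\<close> have a basis, \<open>h\<close> can be lifted
  arbitrarily on it, and over \<open>\<rat>R\<close> the resulting linear form extends to all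
  coefficients because \<open>\<psi>\<close> inverts the basis up to \<open>2 ^ N\<close>.\<close>

lemma homI_extend:
  fixes sc :: "'r \<Rightarrow> 'v::ab_group_add \<Rightarrow> 'v"
  assumes md: "Modules.module sc" and F: "subm sc F" and U: "subm sc U" and UF: "U \<subseteq> F"
    and sat: "saturated sc F U" and K: "subm sc K" "K \<subseteq> U"
    and g: "range g \<subseteq> F" and gen: "\<forall>v\<in>F. \<exists>c. v - comb sc g n c \<in> K"
    and pow: "\<forall>v\<in>F. sc (2 ^ N) v \<in> U"
    and h: "homI sc U h" and hK: "\<forall>k\<in>K. h k \<in> II"
  shows "\<exists>H. homI sc F H \<and> (\<forall>u\<in>U. H u - h u \<in> II)"
proof -
  obtain \<phi> \<psi> where q: "quasi_iso n N \<phi> \<psi>" and rg: "range \<phi> = {c. comb sc g n c \<in> U}"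
    using resolution[OF md F U sat g pow] by blast
  note 1 = quasi_isoD[OF q]
  have inF: "comb sc g n c \<in> F" for c using comb_in[OF F g] .
  define u where "u = (\<lambda>j. comb sc g n (\<phi> (unit_vec j)))"
  have uU: "u j \<in> U" for j using rg by (auto simp: u_def)
  \<comment> \<open>On \<open>c = \<phi> d\<close> the factor \<open>hf ^ N\<close> cancels the
    \<open>2 ^ N\<close> of \<open>\<psi> (\<phi> d)\<close>, which leaves the combination of the
    values \<open>h (u j)\<close> with coefficients \<open>d\<close>.\<close>
  define H0 where "H0 c = hf ^ N * (\<Sum>j<n. \<iota> (\<psi> c j) * h (u j))" for c
  have H0_add: "H0 (c + d) = H0 c + H0 d" for c d
    by (simp add: H0_def lin_add[OF 1(2)] incl_add algebra_simps sum.distrib)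
  have H0_fsc: "H0 (fsc r c) = \<iota> r * H0 c" for r c
    by (simp add: H0_def lin_fsc[OF 1(2)] fsc_apply incl_mult sum_distrib_left mult_ac)
  have H0: "H0 c - h (comb sc g n c) \<in> II" if c: "comb sc g n c \<in> U" for c
  proof -
    have "c \<in> range \<phi>" unfolding rg using c by simp
    then obtain d where d: "c = \<phi> d" by (rule rangeE)
    have "H0 c = (hf ^ N * 2 ^ N) * (\<Sum>j<n. \<iota> (d j) * h (u j))"
      by (simp add: H0_def d 1(4) fsc_apply incl_mult sum_distrib_left mult_ac del: two_hf_power)
    then have "H0 c = (\<Sum>j<n. \<iota> (d j) * h (u j))" by simp
    moreover have "comb sc g n c = (\<Sum>j<n. sc (d j) (u j))"
      unfolding d u_def comb_lin[OF md 1(1) 1(5), of g d] comb_def[of sc _ n d] by (rule refl)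
    ultimately show ?thesis using II_diff_sym[OF homI_sum[OF h U, of "{..<n}" u d]] uU by simp
  qed
  obtain cc where cc: "\<And>v. v \<in> F \<Longrightarrow> v - comb sc g n (cc v) \<in> K" using gen by metis
  define H where "H v = H0 (cc v)" for v
  have H0K: "H0 c \<in> II" if "comb sc g n c \<in> K" for c
    using H0[of c] hK[rule_format, OF that] that K(2) II_diff_iff by blast
  have "homI sc F H"
    unfolding H_def by (rule homI_descend[OF md F K(1) cc H0_add H0_fsc H0K])
  moreover have "H v - h v \<in> II" if v: "v \<in> U" for v
  proof -
    let ?w = "comb sc g n (cc v)"
    have k: "v - ?w \<in> K" using cc v UF by blast
    then have w: "?w \<in> U" using subm_diff_iff[OF md U] K(2) v by blast
    have "h v - h ?w \<in> II"
      using homI_diff[OF h md U v w] hK[rule_format, OF k] II_diff[of "h (v - ?w)" "h (v - ?w) - h v + h ?w"] by simp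
    then show ?thesis using H0[OF w] II_diff_trans II_diff_sym unfolding H_def by blast
  qed
  ultimately show ?thesis by blast
qed

text \<open>The coordinates of \<open>\<psi> c\<close> divided by \<open>2 ^ N\<close> are
  functionals that are integral on \<open>U\<close>. If all of them are integral at
  \<open>c\<close>, then \<open>c\<close> agrees up to a tail with an element of
  \<open>range \<phi>\<close>; so at an element outside \<open>U\<close> one of them is not
  integral.\<close>

lemma homI_separate:
  fixes sc :: "'r \<Rightarrow> 'v::ab_group_add \<Rightarrow> 'v"
  assumes md: "Modules.module sc" and F: "subm sc F" and U: "subm sc U" and UF: "U \<subseteq> F"
    and sat: "saturated sc F U" 
    and g: "range g \<subseteq> F" and gen: "\<forall>v\<in>F. \<exists>c. v - comb sc g n c \<in> U"
    and pow: "\<forall>v\<in>F. sc (2 ^ N) v \<in> U"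
    and x: "x \<in> F" "x \<notin> U"
  shows "\<exists>H. homI sc F H \<and> (\<forall>u\<in>U. H u \<in> II) \<and> H x \<notin> II"
proof -
  obtain \<phi> \<psi> where q: "quasi_iso n N \<phi> \<psi>" and rg: "range \<phi> = {c. comb sc g n c \<in> U}"
    using resolution[OF md F U sat g pow] by blast
  note 1 = quasi_isoD[OF q]
  obtain cc where cc: "\<And>v. v \<in> F \<Longrightarrow> v - comb sc g n (cc v) \<in> U" using gen by metis
  define H0 where "H0 j c = hf ^ N * \<iota> (\<psi> c j)" for j c
  have H0_add: "H0 j (c + d) = H0 j c + H0 j d" for j c d
    by (simp add: H0_def lin_add[OF 1(2)] incl_add algebra_simps)
  have H0_fsc: "H0 j (fsc r c) = \<iota> r * H0 j c" for j r c
    by (simp add: H0_def lin_fsc[OF 1(2)] fsc_apply incl_mult mult_ac)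
  have H0U: "H0 j c \<in> II" if "comb sc g n c \<in> U" for j c
  proof -
    have "c \<in> range \<phi>" unfolding rg using that by simp
    then obtain d where "c = \<phi> d" by (rule rangeE)
    then have "H0 j c = \<iota> (d j)" by (simp only: H0_def 1(4) fsc_apply incl_mult incl_2_power two_hf_power')
    then show ?thesis by (simp only: II_incl)
  qed
  have "\<exists>j<n. H0 j (cc x) \<notin> II"
  proof (rule ccontr)
    assume "\<not> ?thesis"
    then have "\<forall>j. \<exists>d. j < n \<longrightarrow> H0 j (cc x) = \<iota> d" by auto
    then obtain d where d: "\<And>j. j < n \<Longrightarrow> H0 j (cc x) = \<iota> (d j)" by metis
    have "\<psi> (cc x) j = fsc (2 ^ N) d j" if "j < n" for j
    proof -
      have "2 ^ N * H0 j (cc x) = \<iota> (2 ^ N * d j)" using d[OF that] by (simp add: incl_mult)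
      then have "\<iota> (\<psi> (cc x) j) = \<iota> (2 ^ N * d j)" by (simp add: H0_def)
      then show ?thesis by (simp add: incl_eq_iff fsc_apply)
    qed
    then have "\<psi> (cc x) - fsc (2 ^ N) d \<in> tail n" by (simp add: tail_def)
    then have "\<phi> (\<psi> (cc x) - fsc (2 ^ N) d) \<in> tail n" using 1(5) by blast
    then have "fsc (2 ^ N) (cc x) - fsc (2 ^ N) (\<phi> d) \<in> tail n"
      by (simp only: lin_diff[OF 1(1)] 1(3) lin_fsc[OF 1(1)])
    then have "2 ^ N * cc x j = 2 ^ N * \<phi> d j" if "j < n" for j
      using that by (simp add: tail_def fsc_apply)
    then have "cc x j = \<phi> d j" if "j < n" for j using that two_power_cancel by blast
    then have "comb sc g n (cc x - \<phi> d) = 0" by (intro comb_tail[OF md]) (simp add: tail_def)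
    then have "comb sc g n (cc x) = comb sc g n (\<phi> d)" by (simp add: comb_diff[OF md])
    then have "comb sc g n (cc x) \<in> U" using rg by auto
    then show False using cc[OF x(1)] x(2) subm_diff_iff[OF md U] by blast
  qed
  then obtain j where j: "H0 j (cc x) \<notin> II" by blast
  define H where "H v = H0 j (cc v)" for v
  have "homI sc F H"
    unfolding H_def by (rule homI_descend[OF md F U cc H0_add H0_fsc H0U])
  moreover have "H v \<in> II" if v: "v \<in> U" for v
    using H0U subm_diff_iff[OF md U cc[of v]] v UF unfolding H_def by blast
  ultimately show ?thesis using j unfolding H_def by blast
qed

text \<open>The basis of the coefficient vectors landing in \<open>U\<close> maps to generators of
  \<open>U\<close>, as many as there were for \<open>F\<close>.\<close>

lemma submodule_generators:
  fixes sc :: "'r \<Rightarrow> 'v::ab_group_add \<Rightarrow> 'v"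
  assumes md: "Modules.module sc" and F: "subm sc F" and U: "subm sc U" and UF: "U \<subseteq> F"
    and sat: "saturated sc F U" and K: "K \<subseteq> U"
    and g: "range g \<subseteq> F" and gen: "\<forall>v\<in>F. \<exists>c. v - comb sc g n c \<in> K"
    and pow: "\<forall>v\<in>F. sc (2 ^ N) v \<in> U"
  shows "\<exists>g'. (\<forall>i. g' i \<in> U) \<and> (\<forall>v\<in>U. \<exists>c. v - comb sc g' n c \<in> K)"
proof -
  obtain \<phi> \<psi> where q: "quasi_iso n N \<phi> \<psi>" and rg: "range \<phi> = {c. comb sc g n c \<in> U}"
    using resolution[OF md F U sat g pow] by blast
  note 1 = quasi_isoD[OF q]
  show ?thesis
  proof (intro exI[of _ "\<lambda>j. comb sc g n (\<phi> (unit_vec j))"] conjI allI ballI)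
    fix v assume v: "v \<in> U"
    obtain c where c: "v - comb sc g n c \<in> K" using gen v UF by blast
    then have "comb sc g n c \<in> U" using subm_diff_iff[OF md U] K v by blast
    then have "c \<in> range \<phi>" unfolding rg by simp
    then obtain d where d: "c = \<phi> d" by (rule rangeE)
    show "\<exists>c. v - comb sc (\<lambda>j. comb sc g n (\<phi> (unit_vec j))) n c \<in> K"
      using c unfolding d comb_lin[OF md 1(1) 1(5), of g d] by (rule exI[of _ d])
  qed (use rg in auto)
qed

end

section \<open>Hermitian presentations of linking forms\<close>

record ('r, 'v, 'q) pform =
  scal :: "'r \<Rightarrow> 'v \<Rightarrow> 'v"
  car :: "'v set"
  bf :: "'v \<Rightarrow> 'v \<Rightarrow> 'q"

context dyadic
begin

text \<open>Diagonal values of a hermitian lift are self-conjugate, and for such values this set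
  decides membership of \<open>one_plus_star A\<close>; see \<open>JJ_iff\<close>.\<close>

definition twoI :: "'q set" where "twoI = range (\<lambda>r. 2 * \<iota> r)"

lemma twoI_iff: "a \<in> twoI \<longleftrightarrow> hf * a \<in> II"
proof
  assume "hf * a \<in> II"
  then obtain r where "hf * a = \<iota> r" by auto
  then have "a = 2 * \<iota> r" by (metis two_hf'(1))
  then show "a \<in> twoI" by (auto simp: twoI_def)
qed (auto simp: twoI_def)

lemma twoI_0 [simp]: "0 \<in> twoI"
  and twoI_add: "a \<in> twoI \<Longrightarrow> b \<in> twoI \<Longrightarrow> a + b \<in> twoI"
  and twoI_minus: "a \<in> twoI \<Longrightarrow> - a \<in> twoI"
  and twoI_diff: "a \<in> twoI \<Longrightarrow> b \<in> twoI \<Longrightarrow> a - b \<in> twoI"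
  and twoI_mult: "a \<in> twoI \<Longrightarrow> \<iota> r * a \<in> twoI"
  and twoI_II: "a \<in> twoI \<Longrightarrow> a \<in> II"
proof -
  show "0 \<in> twoI" by (simp only: twoI_iff mult_zero_right II_0)
  show "a \<in> twoI \<Longrightarrow> b \<in> twoI \<Longrightarrow> a + b \<in> twoI"
    unfolding twoI_iff distrib_left by (rule II_add)
  show "a \<in> twoI \<Longrightarrow> - a \<in> twoI" unfolding twoI_iff mult_minus_right by (rule II_minus)
  show "a \<in> twoI \<Longrightarrow> b \<in> twoI \<Longrightarrow> a - b \<in> twoI"
    unfolding twoI_iff right_diff_distrib by (rule II_diff)
  show "a \<in> twoI \<Longrightarrow> \<iota> r * a \<in> twoI" unfolding twoI_iff mult.left_commute[of hf] by (rule II_mult)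
  show "a \<in> twoI \<Longrightarrow> a \<in> II" using II_2[of "hf * a"] unfolding twoI_iff by (simp only: two_hf')
qed

text \<open>Conjugation is trivial modulo 2, so \<open>r + iv r\<close> is congruent to
  \<open>2 * r\<close>.\<close>

lemma twoI_cj: "a \<in> II \<Longrightarrow> a + cj a \<in> twoI"
proof -
  assume "a \<in> II"
  then obtain r where r: "a = \<iota> r" by auto
  obtain s where "r - iv r = 2 * s" using invol_mod_two[of r] by (auto simp: dvd_def)
  then have "r + iv r = 2 * (r - s)" by (simp add: algebra_simps)
  then have "a + cj a = 2 * \<iota> (r - s)"
    unfolding r cj_incl incl_add[symmetric] by (simp only: incl_mult incl_2)
  then show ?thesis by (auto simp: twoI_def)
qed

definition rad :: "('r, 'v, 'q) pform \<Rightarrow> 'v set" where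
  "rad E = {v \<in> car E. \<forall>w\<in>car E. bf E v w \<in> II}"

definition perp :: "('r, 'v, 'q) pform \<Rightarrow> 'v set \<Rightarrow> 'v set" where
  "perp E U = {v \<in> car E. \<forall>w\<in>U. bf E v w \<in> II}"

definition herm :: "('r, 'v::ab_group_add, 'q) pform \<Rightarrow> bool" where
  "herm E \<longleftrightarrow> Modules.module (scal E) \<and> subm (scal E) (car E) \<and>
     (\<forall>u v w. bf E (u + v) w = bf E u w + bf E v w) \<and>
     (\<forall>v w. cj (bf E v w) = bf E w v) \<and>
     (\<forall>r v w. bf E v (scal E r w) = \<iota> r * bf E v w)"

definition finite_type :: "('r, 'v::ab_group_add, 'q) pform \<Rightarrow> bool" where
  "finite_type E \<longleftrightarrow> (\<exists>n g. range g \<subseteq> car E \<and> (\<forall>v\<in>car E. \<exists>c. v - comb (scal E) g n c \<in> rad E))"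

definition tors :: "nat \<Rightarrow> ('r, 'v, 'q) pform \<Rightarrow> bool" where
  "tors N E \<longleftrightarrow> (\<forall>v\<in>car E. scal E (2 ^ N) v \<in> rad E)"

text \<open>Surjectivity of the adjoint; its injectivity is built in, as the presented module is the
  quotient by \<open>rad E\<close>.\<close>

definition nonsing :: "('r, 'v::ab_group_add, 'q) pform \<Rightarrow> bool" where
  "nonsing E \<longleftrightarrow> (\<forall>h. homI (scal E) (car E) h \<longrightarrow> (\<forall>k\<in>rad E. h k \<in> II) \<longrightarrow>
      (\<exists>x\<in>car E. \<forall>y\<in>car E. h y - bf E x y \<in> II))"

text \<open>
  The linking form \<open>(M, b, q)\<close> presented by \<open>E\<close> has \<open>M = car E / rad E\<close>, with \<open>b\<close> and \<open>q\<close> induced by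
  \<open>bf E v w\<close> and \<open>bf E v v\<close>; the lift \<open>bf E\<close> of \<open>b\<close> to \<open>\<rat>R\<close> is exactly sesquilinear and hermitian.
\<close>

definition form :: "('r, 'v::ab_group_add, 'q) pform \<Rightarrow> bool" where
  "form E \<longleftrightarrow> herm E \<and> finite_type E \<and> (\<exists>N. tors N E) \<and> (\<forall>v\<in>rad E. bf E v v \<in> twoI) \<and> nonsing E"

text \<open>The length one condition on the quotient is recovered from \<open>L = perp E L\<close>:
  complements are saturated, and \<open>mpres_length_one\<close> resolves the quotient by a
  saturated submodule.\<close>

definition lagr :: "('r, 'v::ab_group_add, 'q) pform \<Rightarrow> 'v set \<Rightarrow> bool" where
  "lagr E L \<longleftrightarrow> subm (scal E) L \<and> L \<subseteq> car E \<and> (\<forall>x\<in>L. bf E x x \<in> twoI) \<and> L = perp E L"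

definition metabolic :: "('r, 'v::ab_group_add, 'q) pform \<Rightarrow> bool" where
  "metabolic E \<longleftrightarrow> (\<exists>L. lagr E L)"

lemma form_herm: "form E \<Longrightarrow> herm E"
  by (simp add: form_def)

context
  fixes E :: "('r, 'v::ab_group_add, 'q) pform"
  assumes H: "herm E"
begin

lemma herm_module: "Modules.module (scal E)"
  and herm_subm: "subm (scal E) (car E)"
  and bf_add_left: "bf E (u + v) w = bf E u w + bf E v w"
  and bf_sc_right: "bf E v (scal E r w) = \<iota> r * bf E v w"
  using H unfolding herm_def by blast+

lemma bf_cj: "bf E v w = cj (bf E w v)"
proof -
  have "\<forall>v w. cj (bf E v w) = bf E w v" using H unfolding herm_def by (elim conjE)
  then show ?thesis by (metis (no_types))
qed

lemma bf_add_right: "bf E w (u + v) = bf E w u + bf E w v"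
  by (metis bf_cj bf_add_left cj_add)

lemma bf_sc_left: "bf E (scal E r v) w = \<iota> (iv r) * bf E v w"
  by (metis bf_cj bf_sc_right cj_mult cj_incl)

lemma bf_0_left [simp]: "bf E 0 w = 0"
  using bf_add_left[of 0 0 w] by simp

lemma bf_0_right [simp]: "bf E w 0 = 0"
  using bf_add_right[of w 0 0] by simp

lemma bf_diff_left: "bf E (u - v) w = bf E u w - bf E v w"
  using bf_add_left[of "u - v" v w] by simp

lemma bf_diff_right: "bf E w (u - v) = bf E w u - bf E w v"
  using bf_add_right[of w "u - v" v] by simp

lemma bf_II_sym: "bf E v w \<in> II \<longleftrightarrow> bf E w v \<in> II"
  using bf_cj[of v w] II_cj_iff by (metis)

lemma rad_perp: "rad E = perp E (car E)"
  by (auto simp: rad_def perp_def)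

lemma rad_subset_perp: "U \<subseteq> car E \<Longrightarrow> rad E \<subseteq> perp E U"
  by (auto simp: rad_def perp_def)

lemma perp_subset: "perp E U \<subseteq> car E" and rad_subset: "rad E \<subseteq> car E"
  by (auto simp: rad_def perp_def)

lemma perp_antimono: "U \<subseteq> V \<Longrightarrow> perp E V \<subseteq> perp E U"
  by (auto simp: perp_def)

lemma perpD: "v \<in> perp E U \<Longrightarrow> u \<in> U \<Longrightarrow> bf E v u \<in> II"
  and perpD': "v \<in> perp E U \<Longrightarrow> u \<in> U \<Longrightarrow> bf E u v \<in> II"
  and perp_car: "v \<in> perp E U \<Longrightarrow> v \<in> car E"
  using bf_II_sym[of u v] by (auto simp: perp_def simp del: image_iff)

lemma perpI: "v \<in> car E \<Longrightarrow> (\<And>u. u \<in> U \<Longrightarrow> bf E v u \<in> II) \<Longrightarrow> v \<in> perp E U"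
  by (simp add: perp_def)

lemma radD: "v \<in> rad E \<Longrightarrow> u \<in> car E \<Longrightarrow> bf E v u \<in> II"
  and radD': "v \<in> rad E \<Longrightarrow> u \<in> car E \<Longrightarrow> bf E u v \<in> II"
  using perpD perpD' unfolding rad_perp by blast+

lemma subm_perp: "subm (scal E) (perp E U)"
  unfolding subm_def
proof (intro conjI ballI allI)
  note F = herm_subm
  show "0 \<in> perp E U" using subm_0[OF F] by (intro perpI) simp_all
  show "x + y \<in> perp E U" if "x \<in> perp E U" "y \<in> perp E U" for x y
    using that by (intro perpI subm_add[OF F]) (auto simp: bf_add_left perp_car simp del: image_iff intro!: II_add perpD)
  show "scal E c x \<in> perp E U" if "x \<in> perp E U" for c x
    using that by (intro perpI subm_sc[OF F]) (auto simp: bf_sc_left perp_car simp del: image_iff intro!: II_mult perpD)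
qed

lemma subm_rad: "subm (scal E) (rad E)"
  unfolding rad_perp by (rule subm_perp)

lemma subset_perp_perp: "U \<subseteq> car E \<Longrightarrow> U \<subseteq> perp E (perp E U)"
  using perpD' by (auto intro!: perpI simp del: image_iff)

lemma tors_mono:
  assumes "tors N E" "N \<le> N'"
  shows "tors N' E"
proof -
  have "scal E (2 ^ N') v = scal E (2 ^ (N' - N)) (scal E (2 ^ N) v)" for v
    using assms(2) by (simp add: Modules.module.scale_scale[OF herm_module] power_add[symmetric])
  then show ?thesis using assms(1) subm_sc[OF subm_rad] by (simp add: tors_def)
qed

lemma q_add: "bf E (u + v) (u + v) = bf E u u + bf E v v + (bf E u v + cj (bf E u v))"
  using bf_cj[of v u] by (simp add: bf_add_left bf_add_right)

lemma q_sc: "bf E (scal E r v) (scal E r v) = \<iota> r * \<iota> (iv r) * bf E v v"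
  by (simp add: bf_sc_left bf_sc_right)

text \<open>The polarisation defect is \<open>a + cj a\<close> with \<open>a\<close> integral, so on
  orthogonal vectors \<open>q\<close> is additive modulo \<open>2R\<close>.\<close>

lemma q_add_twoI:
  assumes "bf E u v \<in> II"
  shows "bf E (u + v) (u + v) - (bf E u u + bf E v v) \<in> twoI"
  using twoI_cj[OF assms] by (simp add: q_add)

end

lemma formD:
  assumes "form E"
  shows "herm E" "finite_type E" "\<exists>N. tors N E" "v \<in> rad E \<Longrightarrow> bf E v v \<in> twoI" "nonsing E"
  using assms by (auto simp: form_def)

section \<open>Complements in forms of two-power exponent\<close>

lemma bf_power_II:
  assumes E: "herm E" and N: "tors N E" and v: "v \<in> car E" and w: "w \<in> car E"
  shows "2 ^ N * bf E v w \<in> II"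
proof -
  have "bf E v (scal E (2 ^ N) w) \<in> II"
    using radD'[OF E] N v w by (auto simp: tors_def simp del: image_iff)
  then show ?thesis by (simp add: bf_sc_right[OF E])
qed

lemma bf_sat:
  assumes E: "herm E" and N: "tors N E" and v: "v \<in> car E" and w: "w \<in> car E" and f: "\<not> 2 dvd f"
    and "bf E v (scal E f w) \<in> II"
  shows "bf E v w \<in> II"
  using II_sat[OF f bf_power_II[OF E N v w]] assms(6) by (simp add: bf_sc_right[OF E])

lemma bf_sat_left:
  assumes E: "herm E" and N: "tors N E" and v: "v \<in> car E" and w: "w \<in> car E" and f: "\<not> 2 dvd f"
    and "bf E (scal E f v) w \<in> II"
  shows "bf E v w \<in> II"
  using bf_sat[OF E N w v f] assms(6) bf_II_sym[OF E] by blast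

text \<open>Both arguments contribute, so the scalar that comes out is \<open>f * iv f\<close>,
  still odd because conjugation preserves divisibility by 2. The exponent \<open>Suc N\<close> pays
  for the extra factor \<open>hf\<close>.\<close>

lemma twoI_sat:
  assumes E: "herm E" and N: "tors N E" and v: "v \<in> car E" and f: "\<not> 2 dvd f"
    and "bf E (scal E f v) (scal E f v) \<in> twoI"
  shows "bf E v v \<in> twoI"
proof -
  have "\<iota> (f * iv f) * (hf * bf E v v) \<in> II"
    using assms(5) by (simp add: twoI_iff q_sc[OF E] incl_mult mult_ac)
  moreover have "2 ^ Suc N * (hf * bf E v v) \<in> II"
    using bf_power_II[OF E N v v] by (simp add: mult_ac)
  moreover have "\<not> 2 dvd f * iv f" using f two_prime iv_two_dvd_iff by blast
  ultimately show ?thesis using II_sat twoI_iff by blast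
qed

text \<open>Pairings take 2-primary values, on which odd scalars are injective.\<close>

lemma satd_perp:
  assumes E: "herm E" and N: "tors N E" and U: "U \<subseteq> car E"
  shows "saturated (scal E) (car E) (perp E U)"
  unfolding saturated_def
proof (intro allI ballI impI)
  fix f x assume x: "x \<in> car E" and f: "\<not> 2 dvd f" and *: "scal E f x \<in> perp E U"
  show "x \<in> perp E U"
    using bf_sat_left[OF E N x _ f] perpD[OF E *] U x by (intro perpI[OF E]) auto
qed

lemma finE:
  assumes "finite_type E"
  obtains n g where "range g \<subseteq> car E" "\<forall>v\<in>car E. \<exists>c. v - comb (scal E) g n c \<in> rad E"
  using assms unfolding finite_type_def by blast

text \<open>First extend the functional from \<open>U\<close> to the whole carrier by
  \<open>homI_extend\<close>, then represent it by nonsingularity.\<close>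

lemma form_extend:
  assumes E: "form E" and U: "subm (scal E) U" "U \<subseteq> car E" "rad E \<subseteq> U" "saturated (scal E) (car E) U"
    and h: "homI (scal E) U h" "\<forall>k\<in>rad E. h k \<in> II"
  shows "\<exists>x\<in>car E. \<forall>u\<in>U. h u - bf E x u \<in> II"
proof -
  note Hm = form_herm[OF E]
  obtain N where N: "tors N E" using formD[OF E] by blast
  obtain n g where g: "range g \<subseteq> car E" "\<forall>v\<in>car E. \<exists>c. v - comb (scal E) g n c \<in> rad E"
    using formD(2)[OF E] by (rule finE)
  have pw: "\<forall>v\<in>car E. scal E (2 ^ N) v \<in> U" using N U by (auto simp: tors_def)
  obtain H where H: "homI (scal E) (car E) H" "\<forall>u\<in>U. H u - h u \<in> II"
    using homI_extend[OF herm_module[OF Hm] herm_subm[OF Hm] U(1,2,4) subm_rad[OF Hm] U(3) g pw h] by blast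
  have "\<forall>k\<in>rad E. H k \<in> II" using H(2) h(2) U(3) II_diff_iff by blast
  then obtain x where x: "x \<in> car E" "\<forall>y\<in>car E. H y - bf E x y \<in> II"
    using formD(5)[OF E] H(1) unfolding nonsing_def by blast
  have "h u - bf E x u \<in> II" if "u \<in> U" for u
    using H(2) x(2) that U(2) II_diff_trans[OF II_diff_sym, of "H u" "h u" "bf E x u"] by blast
  then show ?thesis using x(1) by blast
qed

text \<open>If \<open>x\<close> were outside \<open>U\<close>, some functional would vanish on
  \<open>U\<close> but not at \<open>x\<close>, by \<open>homI_separate\<close>. Nonsingularity
  writes it as pairing with a vector \<open>z\<close>, which then lies in the complement of
  \<open>U\<close> and so has to pair integrally with \<open>x\<close>.\<close>

lemma perp_perp:
  assumes E: "form E" and U: "subm (scal E) U" "U \<subseteq> car E" "rad E \<subseteq> U" "saturated (scal E) (car E) U"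
  shows "perp E (perp E U) = U"
proof (intro equalityI subset_perp_perp subsetI)
  note Hm = form_herm[OF E]
  fix x assume x: "x \<in> perp E (perp E U)"
  show "x \<in> U"
  proof (rule ccontr)
    assume xU: "x \<notin> U"
    obtain N where N: "tors N E" using formD[OF E] by blast
    obtain n g where g: "range g \<subseteq> car E" "\<forall>v\<in>car E. \<exists>c. v - comb (scal E) g n c \<in> rad E"
      using formD(2)[OF E] by (rule finE)
    have g2: "\<forall>v\<in>car E. \<exists>c. v - comb (scal E) g n c \<in> U" using g(2) U(3) by blast
    have pw: "\<forall>v\<in>car E. scal E (2 ^ N) v \<in> U" using N U by (auto simp: tors_def)
    obtain H where H: "homI (scal E) (car E) H" "\<forall>u\<in>U. H u \<in> II" "H x \<notin> II"
      using homI_separate[OF herm_module[OF Hm] herm_subm[OF Hm] U(1,2,4) g(1) g2 pw perp_car[OF Hm x] xU] by blast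
    have "\<forall>k\<in>rad E. H k \<in> II" using H U by blast
    then obtain z where z: "z \<in> car E" "\<forall>y\<in>car E. H y - bf E z y \<in> II"
      using formD(5)[OF E] H(1) unfolding nonsing_def by blast
    have "bf E z u \<in> II" if "u \<in> U" for u
      using z(2) H(2) II_diff_iff that U(2) by blast
    then have "z \<in> perp E U" using z(1) by (intro perpI[OF Hm])
    then have "bf E z x \<in> II" by (rule perpD'[OF Hm x])
    then show False using z(2) H(3) II_diff_iff perp_car[OF Hm x] by blast
  qed
qed (use assms form_herm in auto)

section \<open>Saturations\<close>

definition saturation :: "('r, 'v, 'q) pform \<Rightarrow> 'v set \<Rightarrow> 'v set" where
  "saturation E U = {x \<in> car E. \<exists>f. \<not> 2 dvd f \<and> scal E f x \<in> U}"

lemma satn_subset: "saturation E U \<subseteq> car E"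
  by (auto simp: saturation_def)

lemma saturationI: "x \<in> car E \<Longrightarrow> \<not> 2 dvd f \<Longrightarrow> scal E f x \<in> U \<Longrightarrow> x \<in> saturation E U"
  by (auto simp: saturation_def)

lemma saturationE:
  assumes "x \<in> saturation E U"
  obtains f where "\<not> 2 dvd f" "scal E f x \<in> U" "x \<in> car E"
  using assms by (auto simp: saturation_def)

context
  fixes E :: "('r, 'v::ab_group_add, 'q) pform"
  assumes H: "herm E"
begin

lemma subset_satn: "U \<subseteq> car E \<Longrightarrow> U \<subseteq> saturation E U"
proof
  fix x assume "U \<subseteq> car E" "x \<in> U"
  then show "x \<in> saturation E U"
    using two_nonunit Modules.module.scale_one[OF herm_module[OF H]] by (intro saturationI[of _ _ 1]) auto
qed

lemma satd_satn: "saturated (scal E) (car E) (saturation E U)"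
  unfolding saturated_def
proof (intro allI ballI impI)
  fix f x assume x: "x \<in> car E" "\<not> 2 dvd f" "scal E f x \<in> saturation E U"
  obtain g where g: "\<not> 2 dvd g" "scal E g (scal E f x) \<in> U" using x(3) by (rule saturationE)
  then show "x \<in> saturation E U"
    using x not_two_dvd_mult[of g f] by (intro saturationI[of _ _ "g * f"]) (auto simp: Modules.module.scale_scale[OF herm_module[OF H]])
qed

lemma subm_satn:
  assumes U: "subm (scal E) U" 
  shows "subm (scal E) (saturation E U)"
  unfolding subm_def
proof (intro conjI ballI allI)
  note md = herm_module[OF H] and F = herm_subm[OF H]
  note sm = Modules.module.scale_scale[OF md]
  show "0 \<in> saturation E U"
    using subm_0[OF F] subm_0[OF U] two_nonunit by (intro saturationI[of _ _ 1]) (simp_all add: Modules.module.scale_one[OF md])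
  show "x + y \<in> saturation E U" if x: "x \<in> saturation E U" and y: "y \<in> saturation E U" for x y
  proof -
    obtain f where f: "\<not> 2 dvd f" "scal E f x \<in> U" "x \<in> car E" using x by (rule saturationE)
    obtain g where g: "\<not> 2 dvd g" "scal E g y \<in> U" "y \<in> car E" using y by (rule saturationE)
    have "scal E (f * g) (x + y) = scal E g (scal E f x) + scal E f (scal E g y)"
      by (simp add: Modules.module.scale_right_distrib[OF md] sm mult.commute)
    then have "scal E (f * g) (x + y) \<in> U"
      using subm_add[OF U subm_sc[OF U f(2)] subm_sc[OF U g(2)]] by simp
    then show ?thesis using f g not_two_dvd_mult subm_add[OF F] by (intro saturationI[of _ _ "f * g"]) auto
  qed
  show "scal E r x \<in> saturation E U" if x: "x \<in> saturation E U" for r x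
  proof -
    obtain f where f: "\<not> 2 dvd f" "scal E f x \<in> U" "x \<in> car E" using x by (rule saturationE)
    have "scal E f (scal E r x) = scal E r (scal E f x)" by (simp add: sm mult.commute)
    then show ?thesis using f subm_sc[OF F] subm_sc[OF U f(2)] by (intro saturationI[of _ _ f]) auto
  qed
qed

text \<open>Saturating is invisible to the complement, since an odd scalar can be cancelled in the
  2-primary values.\<close>

lemma perp_satn:
  assumes "tors N E" and U: "U \<subseteq> car E"
  shows "perp E (saturation E U) = perp E U"
proof (intro equalityI subsetI)
  fix x assume "x \<in> perp E (saturation E U)"
  then show "x \<in> perp E U" using perp_antimono[OF H subset_satn[OF U]] by blast
next
  fix x assume x: "x \<in> perp E U"
  show "x \<in> perp E (saturation E U)"
  proof (rule perpI[OF H perp_car[OF H x]])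
    fix u assume "u \<in> saturation E U"
    then obtain f where "\<not> 2 dvd f" "scal E f u \<in> U" "u \<in> car E" by (rule saturationE)
    then show "bf E x u \<in> II" using bf_sat[OF H assms(1) perp_car[OF H x]] perpD[OF H x] by blast
  qed
qed

end

end

section \<open>Orthogonal sums, Witt equivalence and cancellation\<close>

definition psum :: "('r, 'v::ab_group_add, 'q::comm_ring_1) pform \<Rightarrow> ('r, 'w::ab_group_add, 'q) pform \<Rightarrow> ('r, 'v \<times> 'w, 'q) pform" where
  "psum E G = \<lparr> scal = (\<lambda>r (x, y). (scal E r x, scal G r y)), car = car E \<times> car G,
                bf = (\<lambda>(x, y) (x', y'). bf E x x' + bf G y y') \<rparr>"

definition pneg :: "('r, 'v, 'q::comm_ring_1) pform \<Rightarrow> ('r, 'v, 'q) pform" where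
  "pneg E = E \<lparr> bf := (\<lambda>x y. - bf E x y) \<rparr>"

lemma psum_simps [simp]:
  "scal (psum E G) r (x, y) = (scal E r x, scal G r y)"
  "car (psum E G) = car E \<times> car G"
  "bf (psum E G) (x, y) (x', y') = bf E x x' + bf G y y'"
  by (simp_all add: psum_def)

lemma pneg_simps [simp]:
  "scal (pneg E) = scal E" "car (pneg E) = car E" "bf (pneg E) x y = - bf E x y"
  by (simp_all add: pneg_def)

lemma pair_0: "(0, 0) = (0 :: 'a::zero \<times> 'b::zero)"
  by (simp add: zero_prod_def)

lemma comb_append:
  "comb sc (\<lambda>i. if i < n then g i else g' (i - n)) (n + m) (\<lambda>i. if i < n then c i else c' (i - n))
     = comb sc g n c + comb sc g' m c'"
proof (induction m)
  case 0
  show ?case by (simp add: comb_def)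
next
  case (Suc m)
  then show ?case by (simp add: comb_def add.assoc)
qed

context dyadic
begin

text \<open>Metabolicity of the difference is a condition without auxiliary forms and without a
  bound on the exponent; \<open>witt_equiv_iff\<close> identifies it with stable isometry.\<close>

definition weq :: "('r, 'v::ab_group_add, 'q) pform \<Rightarrow> ('r, 'w::ab_group_add, 'q) pform \<Rightarrow> bool" where
  "weq E G \<longleftrightarrow> metabolic (psum E (pneg G))"

lemma herm_psum:
  assumes E: "herm E" and G: "herm G"
  shows "herm (psum E G)"
proof -
  note mE = herm_module[OF E] and mG = herm_module[OF G]
  have "Modules.module (scal (psum E G))"
    by unfold_locales
      (auto simp: Modules.module.scale_right_distrib[OF mE] Modules.module.scale_right_distrib[OF mG]
        Modules.module.scale_left_distrib[OF mE] Modules.module.scale_left_distrib[OF mG]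
        Modules.module.scale_scale[OF mE] Modules.module.scale_scale[OF mG]
        Modules.module.scale_one[OF mE] Modules.module.scale_one[OF mG])
  moreover have "subm (scal (psum E G)) (car (psum E G))"
    using herm_subm[OF E] herm_subm[OF G] by (auto simp: subm_def pair_0[symmetric])
  moreover have "cj (bf (psum E G) w v) = bf (psum E G) v w" for v w
    using bf_cj[OF E, of "fst v" "fst w"] bf_cj[OF G, of "snd v" "snd w"]
    by (cases v, cases w) (simp only: psum_simps fst_conv snd_conv cj_add)
  ultimately show ?thesis
    unfolding herm_def
    by (auto simp: bf_add_left[OF E] bf_add_left[OF G] bf_sc_right[OF E] bf_sc_right[OF G] algebra_simps)
qed

lemma herm_pneg: "herm E \<Longrightarrow> herm (pneg E)"
  unfolding herm_def by (simp add: cj_minus)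

lemma rad_psum:
  assumes E: "herm E" and G: "herm G"
  shows "rad (psum E G) = rad E \<times> rad G"
proof -
  have "bf E x x' \<in> II" "bf G y y' \<in> II"
    if "\<And>x' y'. x' \<in> car E \<Longrightarrow> y' \<in> car G \<Longrightarrow> bf E x x' + bf G y y' \<in> II" "x' \<in> car E" "y' \<in> car G" for x x' y y'
    using that(1)[of x' 0] that(1)[of 0 y'] that(2,3) subm_0[OF herm_subm[OF E]] subm_0[OF herm_subm[OF G]]
    by (simp_all add: bf_0_right[OF E] bf_0_right[OF G])
  then show ?thesis
    using II_add subm_0[OF herm_subm[OF E]] subm_0[OF herm_subm[OF G]] unfolding rad_def by (auto simp del: image_iff) blast+
qed

lemma II_minus_iff: "- a \<in> II \<longleftrightarrow> a \<in> II"
  using II_minus[of a] II_minus[of "- a"] by auto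

lemma rad_pneg: "rad (pneg E) = rad E"
  by (simp only: rad_def pneg_simps II_minus_iff)

lemma tors_psum: "herm E \<Longrightarrow> herm G \<Longrightarrow> tors N E \<Longrightarrow> tors N G \<Longrightarrow> tors N (psum E G)"
  by (auto simp: tors_def rad_psum)

lemma tors_pneg: "tors N (pneg E) \<longleftrightarrow> tors N E"
  by (simp add: tors_def rad_pneg)

lemma fin_psum:
  assumes E: "herm E" and G: "herm G" and finite_type: "finite_type E" "finite_type G"
  shows "finite_type (psum E G)"
proof -
  obtain n g where g: "range g \<subseteq> car E" "\<forall>v\<in>car E. \<exists>c. v - comb (scal E) g n c \<in> rad E"
    using finite_type(1) by (rule finE)
  obtain m g' where g': "range g' \<subseteq> car G" "\<forall>v\<in>car G. \<exists>c. v - comb (scal G) g' m c \<in> rad G"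
    using finite_type(2) by (rule finE)
  define gg where "gg = (\<lambda>i. if i < n then (g i, 0) else (0, g' (i - n)))"
  have c1: "comb (scal (psum E G)) (\<lambda>i. (g i, 0)) n c = (comb (scal E) g n c, 0)" for c
    by (induction n) (simp_all add: comb_def pair_0 Modules.module.scale_zero_right[OF herm_module[OF G]])
  have c2: "comb (scal (psum E G)) (\<lambda>i. (0, g' i)) n c = (0, comb (scal G) g' n c)" for n c
    by (induction n) (simp_all add: comb_def pair_0 Modules.module.scale_zero_right[OF herm_module[OF E]])
  have "range gg \<subseteq> car (psum E G)"
    using g(1) g'(1) subm_0[OF herm_subm[OF E]] subm_0[OF herm_subm[OF G]] by (auto simp: gg_def)
  moreover have "\<exists>c. v - comb (scal (psum E G)) gg (n + m) c \<in> rad (psum E G)" if v: "v \<in> car (psum E G)" for v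
  proof -
    obtain x y where xy: "v = (x, y)" "x \<in> car E" "y \<in> car G" using v by auto
    obtain c where c: "x - comb (scal E) g n c \<in> rad E" using g xy by blast
    obtain c' where c': "y - comb (scal G) g' m c' \<in> rad G" using g' xy by blast
    have "comb (scal (psum E G)) gg (n + m) (\<lambda>i. if i < n then c i else c' (i - n))
        = (comb (scal E) g n c, comb (scal G) g' m c')"
      unfolding gg_def comb_append[of "scal (psum E G)" n "\<lambda>i. (g i, 0)" "\<lambda>i. (0, g' i)" m c c'] c1 c2
      by simp
    then have "v - comb (scal (psum E G)) gg (n + m) (\<lambda>i. if i < n then c i else c' (i - n)) \<in> rad (psum E G)"
      using c c' by (simp add: xy rad_psum[OF E G])
    then show ?thesis by (rule exI[of _ "\<lambda>i. if i < n then c i else c' (i - n)"])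
  qed
  ultimately show ?thesis unfolding finite_type_def by blast
qed

lemma fin_pneg: "finite_type E \<Longrightarrow> finite_type (pneg E)"
  by (simp add: finite_type_def rad_pneg)

lemma form_psum:
  assumes E: "form E" and G: "form G"
  shows "form (psum E G)"
proof -
  note HE = form_herm[OF E] and HG = form_herm[OF G]
  note zE = subm_0[OF herm_subm[OF HE]] and zG = subm_0[OF herm_subm[OF HG]]
  obtain N1 N2 where "tors N1 E" "tors N2 G" using formD(3) E G by meson
  then have "tors (max N1 N2) (psum E G)"
    by (intro tors_psum HE HG) (auto intro: tors_mono HE HG)
  moreover have "nonsing (psum E G)"
    unfolding nonsing_def
  proof (intro allI impI)
    fix h assume h: "homI (scal (psum E G)) (car (psum E G)) h" and hr: "\<forall>k\<in>rad (psum E G). h k \<in> II"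
    have "homI (scal E) (car E) (\<lambda>x. h (x, 0))"
      using zG homI_add[OF h, of "(x, 0)" "(y, 0)" for x y] homI_sc[OF h, of "(x, 0)" for x]
      by (auto simp: homI_def Modules.module.scale_zero_right[OF herm_module[OF HG]] simp del: image_iff)
    moreover have "\<forall>k\<in>rad E. h (k, 0) \<in> II" using hr subm_0[OF subm_rad[OF HG]] by (auto simp: rad_psum HE HG simp del: image_iff)
    ultimately obtain x where x: "x \<in> car E" "\<forall>y\<in>car E. h (y, 0) - bf E x y \<in> II"
      using formD(5)[OF E] unfolding nonsing_def by blast
    have "homI (scal G) (car G) (\<lambda>x. h (0, x))"
      using zE homI_add[OF h, of "(0, x)" "(0, y)" for x y] homI_sc[OF h, of "(0, x)" for x]
      by (auto simp: homI_def Modules.module.scale_zero_right[OF herm_module[OF HE]] simp del: image_iff)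
    moreover have "\<forall>k\<in>rad G. h (0, k) \<in> II" using hr subm_0[OF subm_rad[OF HE]] by (auto simp: rad_psum HE HG simp del: image_iff)
    ultimately obtain y where y: "y \<in> car G" "\<forall>w\<in>car G. h (0, w) - bf G y w \<in> II"
      using formD(5)[OF G] unfolding nonsing_def by blast
    show "\<exists>x\<in>car (psum E G). \<forall>y\<in>car (psum E G). h y - bf (psum E G) x y \<in> II"
    proof (intro bexI[of _ "(x, y)"] ballI)
      fix v assume "v \<in> car (psum E G)"
      then obtain v1 v2 where v: "v = (v1, v2)" "v1 \<in> car E" "v2 \<in> car G" by auto
      have "h ((v1, 0) + (0, v2)) - h (v1, 0) - h (0, v2) \<in> II"
        by (rule homI_add[OF h]) (use v zE zG in auto)
      then have *: "h (v1, v2) - h (v1, 0) - h (0, v2) \<in> II" by simp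
      have "(h (v1, v2) - h (v1, 0) - h (0, v2)) + (h (v1, 0) - bf E x v1) + (h (0, v2) - bf G y v2) \<in> II"
        by (intro II_add * x(2)[rule_format] y(2)[rule_format] v)
      then show "h v - bf (psum E G) (x, y) v \<in> II" by (simp add: v algebra_simps)
    qed (use x y in simp)
  qed
  ultimately show ?thesis
    unfolding form_def using herm_psum[OF HE HG] fin_psum[OF HE HG] formD(2,4)[OF E] formD(2,4)[OF G]
    by (auto simp: rad_psum HE HG intro: twoI_add)
qed

lemma homI_minus: "homI sc F h \<Longrightarrow> homI sc F (\<lambda>x. - h x)"
  unfolding homI_def
proof (intro conjI ballI allI)
  assume h: "(\<forall>v\<in>F. \<forall>w\<in>F. h (v + w) - h v - h w \<in> II) \<and> (\<forall>r. \<forall>v\<in>F. h (sc r v) - \<iota> r * h v \<in> II)"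
  show "- h (v + w) - - h v - - h w \<in> II" if "v \<in> F" "w \<in> F" for v w
    using II_minus[OF bspec[OF bspec[OF conjunct1[OF h] that(1)] that(2)]] by (simp add: algebra_simps)
  show "- h (sc r v) - \<iota> r * - h v \<in> II" if "v \<in> F" for r v
    using II_minus[OF bspec[OF spec[OF conjunct2[OF h]] that], of r] by (simp add: algebra_simps)
qed

lemma form_pneg:
  assumes E: "form E"
  shows "form (pneg E)"
proof -
  have "nonsing (pneg E)"
    unfolding nonsing_def
  proof (intro allI impI)
    fix h assume "homI (scal (pneg E)) (car (pneg E)) h" "\<forall>k\<in>rad (pneg E). h k \<in> II"
    then have "homI (scal E) (car E) (\<lambda>x. - h x)" "\<forall>k\<in>rad E. - h k \<in> II"
      using homI_minus II_minus by (auto simp: rad_pneg simp del: image_iff)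
    then obtain x where x: "x \<in> car E" "\<forall>y\<in>car E. - h y - bf E x y \<in> II"
      using formD(5)[OF E] unfolding nonsing_def by blast
    have "h y - bf (pneg E) x y \<in> II" if "y \<in> car E" for y
      using II_minus[OF x(2)[rule_format, OF that]] by (simp add: add.commute)
    then show "\<exists>x\<in>car (pneg E). \<forall>y\<in>car (pneg E). h y - bf (pneg E) x y \<in> II"
      using x(1) by (auto simp del: image_iff)
  qed
  then show ?thesis
    using formD(3)[OF E] formD(4)[OF E] unfolding form_def
    by (auto simp: rad_pneg tors_pneg herm_pneg[OF form_herm[OF E]] fin_pneg[OF formD(2)[OF E]] intro: twoI_minus)
qed

lemma metabolic_pneg:
  assumes "metabolic E"
  shows "metabolic (pneg E)"
proof -
  obtain L where L: "lagr E L" using assms by (auto simp: metabolic_def)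
  have "perp (pneg E) L = perp E L" by (simp only: perp_def pneg_simps II_minus_iff)
  then have "lagr (pneg E) L" using L by (auto simp: lagr_def intro: twoI_minus)
  then show ?thesis by (auto simp: metabolic_def)
qed

lemma metabolic_psum:
  assumes E: "herm E" and G: "herm G" and "metabolic E" "metabolic G"
  shows "metabolic (psum E G)"
proof -
  obtain L M where L: "lagr E L" and M: "lagr G M" using assms by (auto simp: metabolic_def)
  have LL: "L = perp E L" "M = perp G M" "subm (scal E) L" "subm (scal G) M" "L \<subseteq> car E" "M \<subseteq> car G"
    using L M by (auto simp: lagr_def)
  have "perp (psum E G) (L \<times> M) = L \<times> M"
  proof (intro equalityI subsetI)
    fix v assume v: "v \<in> perp (psum E G) (L \<times> M)"
    obtain x y where xy: "v = (x, y)" by (cases v)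
    have c: "x \<in> car E" "y \<in> car G" using perp_car[OF herm_psum[OF E G] v] xy by auto
    have *: "bf E x l + bf G y m \<in> II" if "l \<in> L" "m \<in> M" for l m
      using perpD[OF herm_psum[OF E G] v, of "(l, m)"] that xy by simp
    have "x \<in> perp E L"
      using *[OF _ subm_0[OF LL(4)]] by (intro perpI[OF E c(1)]) (simp add: bf_0_right[OF G])
    moreover have "y \<in> perp G M"
      using *[OF subm_0[OF LL(3)]] by (intro perpI[OF G c(2)]) (simp add: bf_0_right[OF E])
    ultimately show "v \<in> L \<times> M" using LL(1,2) xy by blast
  next
    fix v assume "v \<in> L \<times> M"
    then obtain x y where xy: "v = (x, y)" "x \<in> L" "y \<in> M" by auto
    have "x \<in> perp E L" "y \<in> perp G M" using xy LL(1,2) by auto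
    show "v \<in> perp (psum E G) (L \<times> M)"
    proof (rule perpI[OF herm_psum[OF E G]])
      fix u assume "u \<in> L \<times> M"
      then obtain l m where lm: "u = (l, m)" "l \<in> L" "m \<in> M" by auto
      show "bf (psum E G) v u \<in> II"
        unfolding xy lm psum_simps
        by (intro II_add perpD[OF E \<open>x \<in> perp E L\<close> lm(2)] perpD[OF G \<open>y \<in> perp G M\<close> lm(3)])
    qed (use LL xy in auto)
  qed
  then have "lagr (psum E G) (L \<times> M)"
    using L M unfolding lagr_def by (auto simp: subm_def pair_0[symmetric] intro: twoI_add)
  then show ?thesis by (auto simp: metabolic_def)
qed

text \<open>A correspondence between \<open>E\<close> and \<open>G\<close> serves as Lagrangian of
  the difference. For \<open>(x, y)\<close> orthogonal to it, \<open>onto\<close> supplies some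
  \<open>(x0, y)\<close> in it; then \<open>(x - x0, 0)\<close> is orthogonal to all first
  components and \<open>rad\<close> applies.\<close>

lemma weq_graph:
  assumes E: "herm E" and G: "herm G"
    and sub: "subm (scal (psum E G)) \<Gamma>" "\<Gamma> \<subseteq> car E \<times> car G"
    and q: "\<And>x y. (x, y) \<in> \<Gamma> \<Longrightarrow> bf E x x - bf G y y \<in> twoI"
    and b: "\<And>x y x' y'. (x, y) \<in> \<Gamma> \<Longrightarrow> (x', y') \<in> \<Gamma> \<Longrightarrow> bf E x x' - bf G y y' \<in> II"
    and onto: "\<And>y. y \<in> car G \<Longrightarrow> \<exists>x. (x, y) \<in> \<Gamma>"
    and rad: "\<And>z. z \<in> car E \<Longrightarrow> (\<And>x y. (x, y) \<in> \<Gamma> \<Longrightarrow> bf E z x \<in> II) \<Longrightarrow> (z, 0) \<in> \<Gamma>"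
  shows "weq E G"
proof -
  note Hm = herm_psum[OF E herm_pneg[OF G]]
  have "perp (psum E (pneg G)) \<Gamma> = \<Gamma>"
  proof (intro equalityI subsetI)
    fix v assume "v \<in> \<Gamma>"
    then show "v \<in> perp (psum E (pneg G)) \<Gamma>"
      using b sub(2) by (intro perpI[OF Hm]) (auto simp del: image_iff)
  next
    fix v assume v: "v \<in> perp (psum E (pneg G)) \<Gamma>"
    obtain x y where xy: "v = (x, y)" by (cases v)
    have c: "x \<in> car E" "y \<in> car G" using perp_car[OF Hm v] xy by auto
    obtain x0 where x0: "(x0, y) \<in> \<Gamma>" using onto c by blast
    have "(x - x0, 0) \<in> \<Gamma>"
    proof (rule rad)
      show "x - x0 \<in> car E" using x0 c sub(2) by (auto intro: subm_diff[OF herm_module[OF E] herm_subm[OF E]])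
      fix x' y' assume *: "(x', y') \<in> \<Gamma>"
      have "bf E x x' - bf G y y' \<in> II" using perpD[OF Hm v *] by (simp add: xy)
      from II_diff[OF this b[OF x0 *]] show "bf E (x - x0) x' \<in> II"
        by (simp add: bf_diff_left[OF E])
    qed
    then have "(x - x0, 0) + (x0, y) \<in> \<Gamma>" using x0 by (rule subm_add[OF sub(1)])
    then show "v \<in> \<Gamma>" by (simp add: xy)
  qed
  moreover have "subm (scal (psum E (pneg G))) \<Gamma>" using sub(1) by (simp add: psum_def)
  ultimately have "lagr (psum E (pneg G)) \<Gamma>"
    using sub(2) q unfolding lagr_def by auto
  then show ?thesis by (auto simp: weq_def metabolic_def)
qed

text \<open>The correspondence is the graph of \<open>g\<close>, thickened by the radical of
  \<open>E\<close> in the first component. As \<open>g\<close> is onto and preserves the form, it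
  identifies the quotients by the radicals even when it is not injective.\<close>

lemma weq_iso:
  assumes E: "herm E" and G: "herm G" and radE: "\<And>k. k \<in> rad E \<Longrightarrow> bf E k k \<in> twoI"
    and g: "\<And>y y'. g (y + y') = g y + g y'" "\<And>r y. g (scal G r y) = scal E r (g y)"
      "g ` car G = car E" "\<And>y y'. bf E (g y) (g y') = bf G y y'"
  shows "weq E G"
proof -
  note sR = subm_rad[OF E] and md = herm_module[OF E]
  have g0: "g 0 = 0" using g(1)[of 0 0] by simp
  define \<Gamma> where "\<Gamma> = {(x, y). x \<in> car E \<and> y \<in> car G \<and> x - g y \<in> rad E}"
  show ?thesis
  proof (rule weq_graph[OF E G])
    show "subm (scal (psum E G)) \<Gamma>"
      unfolding subm_def
    proof (intro conjI ballI allI)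
      show "0 \<in> \<Gamma>" using subm_0[OF herm_subm[OF E]] subm_0[OF herm_subm[OF G]] subm_0[OF sR]
        by (simp add: \<Gamma>_def pair_0[symmetric] g0)
      show "u + v \<in> \<Gamma>" if "u \<in> \<Gamma>" "v \<in> \<Gamma>" for u v
      proof -
        obtain x y x' y' where uv: "u = (x, y)" "v = (x', y')" by (cases u, cases v)
        have "(x - g y) + (x' - g y') \<in> rad E" using that uv by (intro subm_add[OF sR]) (auto simp: \<Gamma>_def)
        then show ?thesis
          using that by (auto simp: uv \<Gamma>_def g algebra_simps intro: subm_add[OF herm_subm[OF E]] subm_add[OF herm_subm[OF G]])
      qed
      show "scal (psum E G) r u \<in> \<Gamma>" if "u \<in> \<Gamma>" for r u
      proof -
        obtain x y where uv: "u = (x, y)" by (cases u)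
        have "scal E r (x - g y) \<in> rad E" using that uv by (intro subm_sc[OF sR]) (auto simp: \<Gamma>_def)
        then show ?thesis
          using that by (auto simp: uv \<Gamma>_def g Modules.module.scale_right_diff_distrib[OF md]
              intro: subm_sc[OF herm_subm[OF E]] subm_sc[OF herm_subm[OF G]])
      qed
    qed
    show "\<Gamma> \<subseteq> car E \<times> car G" by (auto simp: \<Gamma>_def)
    show "bf E x x - bf G y y \<in> twoI" if "(x, y) \<in> \<Gamma>" for x y
    proof -
      have k: "x - g y \<in> rad E" "g y \<in> car E" using that g(3) by (auto simp: \<Gamma>_def)
      have "bf E ((x - g y) + g y) ((x - g y) + g y) - (bf E (x - g y) (x - g y) + bf E (g y) (g y)) \<in> twoI"
        by (rule q_add_twoI[OF E radD[OF E k]])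
      then have "bf E x x - (bf E (x - g y) (x - g y) + bf G y y) \<in> twoI" by (simp add: g(4))
      from twoI_add[OF this radE[OF k(1)]] show ?thesis by simp
    qed
    show "bf E x x' - bf G y y' \<in> II" if xy: "(x, y) \<in> \<Gamma>" and xy': "(x', y') \<in> \<Gamma>" for x y x' y'
    proof -
      have k: "x - g y \<in> rad E" "x' \<in> car E" "g y \<in> car E" "x' - g y' \<in> rad E"
        using xy xy' g(3) by (auto simp: \<Gamma>_def)
      have "bf E (x - g y) x' + bf E (g y) (x' - g y') \<in> II"
        by (rule II_add[OF radD[OF E k(1,2)] radD'[OF E k(4,3)]])
      then show ?thesis by (simp add: bf_diff_left[OF E] bf_diff_right[OF E] g(4))
    qed
    show "\<exists>x. (x, y) \<in> \<Gamma>" if "y \<in> car G" for y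
      using that g(3) subm_0[OF sR] by (intro exI[of _ "g y"]) (auto simp: \<Gamma>_def)
    show "(z, 0) \<in> \<Gamma>" if z: "z \<in> car E" "\<And>x y. (x, y) \<in> \<Gamma> \<Longrightarrow> bf E z x \<in> II" for z
    proof -
      have "bf E z x \<in> II" if "x \<in> car E" for x
      proof -
        obtain y where "y \<in> car G" "x = g y" using \<open>x \<in> car E\<close> g(3) by blast
        then have "(x, y) \<in> \<Gamma>" using \<open>x \<in> car E\<close> subm_0[OF sR] by (auto simp: \<Gamma>_def)
        then show ?thesis by (rule z(2))
      qed
      then have "z \<in> rad E" using z(1) by (simp add: rad_def)
      then show ?thesis using z(1) subm_0[OF herm_subm[OF G]] by (simp add: \<Gamma>_def g0)
    qed
  qed
qed

text \<open>Intersect a Lagrangian \<open>P\<close> of the sum with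
  \<open>car E \<times> \<Lambda>\<close> and project to \<open>E\<close>. The projection
  \<open>U\<close> is isotropic and has the right complement only up to saturation, so the
  Lagrangian of \<open>E\<close> is \<open>saturation E U\<close>.\<close>

lemma metabolic_cancel:
  assumes E: "form E" and G: "form G" and "metabolic (psum E G)" "metabolic G"
  shows "metabolic E"
proof -
  note HE = form_herm[OF E] and HG = form_herm[OF G]
  let ?Z = "psum E G"
  note Z = form_psum[OF E G] and HZ = herm_psum[OF HE HG]
  note zE = subm_0[OF herm_subm[OF HE]] and zG = subm_0[OF herm_subm[OF HG]]
  obtain N where N: "tors N E" using formD(3)[OF E] by blast
  obtain NZ where NZ: "tors NZ ?Z" using formD(3)[OF Z] by blast
  obtain P \<Lambda> where P: "lagr ?Z P" and \<Lambda>: "lagr G \<Lambda>" using assms by (auto simp: metabolic_def)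
  have PP: "subm (scal ?Z) P" "P \<subseteq> car ?Z" "P = perp ?Z P" and qP: "\<And>v. v \<in> P \<Longrightarrow> bf ?Z v v \<in> twoI"
    and LL: "subm (scal G) \<Lambda>" "\<Lambda> \<subseteq> car G" "\<Lambda> = perp G \<Lambda>" and qL: "\<And>v. v \<in> \<Lambda> \<Longrightarrow> bf G v v \<in> twoI"
    using P \<Lambda> by (auto simp: lagr_def)
  have bP: "bf ?Z v w \<in> II" if "v \<in> P" "w \<in> P" for v w using perpD[OF HZ] that PP(3) by blast
  have bL: "bf G v w \<in> II" if "v \<in> \<Lambda>" "w \<in> \<Lambda>" for v w using perpD[OF HG] that LL(3) by blast
  define U where "U = {x \<in> car E. \<exists>l\<in>\<Lambda>. (x, l) \<in> P}"
  have U: "subm (scal E) U"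
    unfolding subm_def
  proof (intro conjI ballI allI)
    have "(0, 0) \<in> P" using subm_0[OF PP(1)] by (simp add: pair_0)
    then show "0 \<in> U" using zE subm_0[OF LL(1)] by (auto simp: U_def)
    show "x + y \<in> U" if xy: "x \<in> U" "y \<in> U" for x y
    proof -
      obtain l l' where l: "l \<in> \<Lambda>" "(x, l) \<in> P" "l' \<in> \<Lambda>" "(y, l') \<in> P" using xy by (auto simp: U_def)
      have "(x + y, l + l') \<in> P" using subm_add[OF PP(1) l(2) l(4)] by simp
      then show ?thesis using subm_add[OF LL(1) l(1) l(3)] PP(2) by (auto simp: U_def)
    qed
    show "scal E r x \<in> U" if xy: "x \<in> U" for r x
    proof -
      obtain l where l: "l \<in> \<Lambda>" "(x, l) \<in> P" using xy by (auto simp: U_def)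
      have "(scal E r x, scal G r l) \<in> P" using subm_sc[OF PP(1) l(2), of r] by simp
      then show ?thesis using subm_sc[OF LL(1) l(1)] PP(2) by (auto simp: U_def)
    qed
  qed
  have UE: "U \<subseteq> car E" by (auto simp: U_def)
  have bU: "bf E x y \<in> II" if xy: "x \<in> U" "y \<in> U" for x y
  proof -
    obtain l l' where l: "l \<in> \<Lambda>" "(x, l) \<in> P" "l' \<in> \<Lambda>" "(y, l') \<in> P" using xy by (auto simp: U_def)
    from II_diff[OF bP[OF l(2,4)] bL[OF l(1,3)]] show ?thesis by simp
  qed
  have qU: "bf E x x \<in> twoI" if xy: "x \<in> U" for x
  proof -
    obtain l where l: "l \<in> \<Lambda>" "(x, l) \<in> P" using xy by (auto simp: U_def)
    from twoI_diff[OF qP[OF l(2)] qL[OF l(1)]] show ?thesis by simp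
  qed
  \<comment> \<open>The sum of \<open>P\<close> and \<open>{0} \<times> \<Lambda>\<close>. Its
    complement is contained in \<open>P \<inter> (car E \<times> \<Lambda>)\<close>, whose first
    components form \<open>U\<close>.\<close>
  define Q where "Q = {(x, y + l) |x y l. (x, y) \<in> P \<and> l \<in> \<Lambda>}"
  have Qsub: "subm (scal ?Z) Q"
    unfolding subm_def
  proof (intro conjI ballI allI)
    show "0 \<in> Q" using subm_0[OF LL(1)] subm_0[OF PP(1)] unfolding Q_def pair_0[symmetric] by force
    show "v + w \<in> Q" if vw: "v \<in> Q" "w \<in> Q" for v w
    proof -
      obtain x y l where v: "v = (x, y + l)" "(x, y) \<in> P" "l \<in> \<Lambda>" using vw(1) unfolding Q_def by blast
      obtain x' y' l' where w: "w = (x', y' + l')" "(x', y') \<in> P" "l' \<in> \<Lambda>" using vw(2) unfolding Q_def by blast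
      have "(x + x', y + y') \<in> P" using subm_add[OF PP(1) v(2) w(2)] by simp
      moreover have "l + l' \<in> \<Lambda>" using subm_add[OF LL(1) v(3) w(3)] .
      moreover have "v + w = (x + x', (y + y') + (l + l'))" by (simp add: v w)
      ultimately show ?thesis unfolding Q_def by blast
    qed
    show "scal ?Z r v \<in> Q" if vw: "v \<in> Q" for r v
    proof -
      obtain x y l where v: "v = (x, y + l)" "(x, y) \<in> P" "l \<in> \<Lambda>" using vw(1) unfolding Q_def by blast
      have "(scal E r x, scal G r y) \<in> P" using subm_sc[OF PP(1) v(2), of r] by simp
      moreover have "scal G r l \<in> \<Lambda>" using subm_sc[OF LL(1) v(3)] .
      moreover have "scal ?Z r v = (scal E r x, scal G r y + scal G r l)"
        by (simp add: v Modules.module.scale_right_distrib[OF herm_module[OF HG]])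
      ultimately show ?thesis unfolding Q_def by blast
    qed
  qed
  have QZ: "Q \<subseteq> car ?Z" using PP(2) LL(2) subm_add[OF herm_subm[OF HG]] by (auto simp: Q_def)
  have PQ: "P \<subseteq> Q"
  proof
    fix v assume "v \<in> P"
    then show "v \<in> Q" using subm_0[OF LL(1)] unfolding Q_def by (cases v) force
  qed
  have radQ: "rad ?Z \<subseteq> saturation ?Z Q"
    using rad_subset_perp[OF HZ PP(2)] PP(3) PQ subset_satn[OF HZ QZ] by blast
  have pQ: "perp ?Z Q \<subseteq> {(x, l). (x, l) \<in> P \<and> l \<in> \<Lambda>}"
  proof
    fix v assume v: "v \<in> perp ?Z Q"
    then have vP: "v \<in> P" using perp_antimono[OF HZ PQ] PP(3) by blast
    obtain x y where xy: "v = (x, y)" by (cases v)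
    have "y \<in> perp G \<Lambda>"
    proof (rule perpI[OF HG])
      show "y \<in> car G" using perp_car[OF HZ v] xy by simp
      fix l assume "l \<in> \<Lambda>"
      moreover have "(0, 0) \<in> P" using subm_0[OF PP(1)] by (simp add: pair_0)
      ultimately have "(0, 0 + l) \<in> Q" unfolding Q_def by blast
      then show "bf G y l \<in> II" using perpD[OF HZ v] xy by (fastforce simp: bf_0_right[OF HE])
    qed
    then show "v \<in> {(x, l). (x, l) \<in> P \<and> l \<in> \<Lambda>}" using LL(3) vP xy by auto
  qed
  \<comment> \<open>If \<open>x\<close> is orthogonal to \<open>U\<close>, then
    \<open>(x, 0)\<close> is orthogonal to the complement of \<open>Q\<close>, so by double duality
    an odd multiple of \<open>(x, 0)\<close> lies in \<open>Q\<close>. Its second component being 0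
    puts that multiple of \<open>x\<close> into \<open>U\<close>.\<close>
  have key: "x \<in> saturation E U" if x: "x \<in> perp E U" for x
  proof -
    have xE: "x \<in> car E" using perp_car[OF HE x] .
    have "(x, 0) \<in> perp ?Z (perp ?Z Q)"
    proof (rule perpI[OF HZ])
      show "(x, 0) \<in> car ?Z" using xE zG by simp
      fix v assume v: "v \<in> perp ?Z Q"
      then obtain x' l where v': "v = (x', l)" "(x', l) \<in> P" "l \<in> \<Lambda>" using pQ by blast
      then have "x' \<in> U" using PP(2) by (auto simp: U_def)
      then show "bf ?Z (x, 0) v \<in> II" using perpD[OF HE x] v' by (simp add: bf_0_left[OF HG])
    qed
    also have "perp ?Z (perp ?Z Q) = saturation ?Z Q"
      using perp_perp[OF Z subm_satn[OF HZ Qsub] satn_subset radQ satd_satn[OF HZ]] perp_satn[OF HZ NZ QZ] by simp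
    finally obtain f where f: "\<not> 2 dvd f" "scal ?Z f (x, 0) \<in> Q" by (rule saturationE)
    then have "(scal E f x, 0) \<in> Q" by (simp add: Modules.module.scale_zero_right[OF herm_module[OF HG]])
    then obtain y l where yl: "(scal E f x, y) \<in> P" "l \<in> \<Lambda>" "0 = y + l" unfolding Q_def by blast
    have "y = - l" using yl(3) by (simp add: eq_neg_iff_add_eq_0)
    then have "y \<in> \<Lambda>" using subm_minus[OF herm_module[OF HG] LL(1) yl(2)] by simp
    then have "scal E f x \<in> U" using yl(1) subm_sc[OF herm_subm[OF HE] xE] by (auto simp: U_def)
    then show ?thesis using xE f(1) by (intro saturationI)
  qed
  have "perp E (saturation E U) = saturation E U"
  proof (intro equalityI subsetI)
    fix x assume "x \<in> perp E (saturation E U)"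
    then show "x \<in> saturation E U" using key perp_satn[OF HE N UE] by blast
  next
    fix x assume x: "x \<in> saturation E U"
    obtain f where f: "\<not> 2 dvd f" "scal E f x \<in> U" "x \<in> car E" using x by (rule saturationE)
    have "x \<in> perp E U"
      using bf_sat_left[OF HE N f(3) _ f(1)] bU[OF f(2)] UE by (intro perpI[OF HE f(3)]) blast
    then show "x \<in> perp E (saturation E U)" using perp_satn[OF HE N UE] by blast
  qed
  moreover have "bf E x x \<in> twoI" if x: "x \<in> saturation E U" for x
  proof -
    obtain f where f: "\<not> 2 dvd f" "scal E f x \<in> U" "x \<in> car E" using x by (rule saturationE)
    show ?thesis using twoI_sat[OF HE N f(3,1)] qU[OF f(2)] by blast
  qed
  ultimately have "lagr E (saturation E U)"
    unfolding lagr_def using subm_satn[OF HE U] satn_subset[of E U] by auto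
  then show ?thesis by (auto simp: metabolic_def)
qed

lemma weq_refl: "form E \<Longrightarrow> weq E E"
  by (rule weq_iso[where g = "\<lambda>x. x"]) (auto simp: form_def)

lemma metabolic_weq: "form E \<Longrightarrow> form G \<Longrightarrow> weq E G \<Longrightarrow> metabolic G \<Longrightarrow> metabolic E"
  unfolding weq_def using metabolic_cancel[of E "pneg G"] form_pneg metabolic_pneg by blast

lemma metabolic_iso:
  assumes E: "form E" and G: "form G"
    and g: "\<And>y y'. g (y + y') = g y + g y'" "\<And>r y. g (scal G r y) = scal E r (g y)"
      "g ` car G = car E" "\<And>y y'. bf E (g y) (g y') = bf G y y'"
    and "metabolic G"
  shows "metabolic E"
  using metabolic_weq[OF E G weq_iso[OF form_herm[OF E] form_herm[OF G] formD(4)[OF E] g]] assms(7) by blast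

lemma weq_sym:
  assumes E: "form E" and G: "form G" and w: "weq E G"
  shows "weq G E"
  unfolding weq_def
proof (rule metabolic_iso[where G = "pneg (psum E (pneg G))" and g = "\<lambda>(x, y). (y, x)"])
  show "metabolic (pneg (psum E (pneg G)))" using w metabolic_pneg by (simp add: weq_def)
qed (use assms in \<open>auto intro!: form_psum form_pneg\<close>)

text \<open>The sum of the two differences rearranges to the difference of \<open>E\<close> and
  \<open>K\<close> plus that of \<open>G\<close> with itself; the latter is metabolic and
  cancels.\<close>

lemma weq_trans:
  assumes E: "form E" and G: "form G" and K: "form K" and w: "weq E G" "weq G K"
  shows "weq E K"
proof -
  have "metabolic (psum (psum E (pneg G)) (psum G (pneg K)))"
    using w[unfolded weq_def] by (intro metabolic_psum[OF herm_psum herm_psum] form_herm form_pneg E G K)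
  then have "metabolic (psum (psum E (pneg K)) (psum G (pneg G)))"
    by (intro metabolic_iso[where G = "psum (psum E (pneg G)) (psum G (pneg K))"
          and g = "\<lambda>((x, y), (y', z)). ((x, z), (y', y))"])
      (use assms in \<open>auto intro!: form_psum form_pneg simp: image_iff split_paired_Ex\<close>)
  then show ?thesis
    unfolding weq_def
    by (rule metabolic_cancel[OF form_psum[OF E form_pneg[OF K]] form_psum[OF G form_pneg[OF G]] _
          weq_refl[OF G, unfolded weq_def]])
qed

lemma weq_psum:
  assumes E: "form E" "form E'" and G: "form G" "form G'" and w: "weq E E'" "weq G G'"
  shows "weq (psum E G) (psum E' G')"
proof -
  have "metabolic (psum (psum E (pneg E')) (psum G (pneg G')))"
    using w[unfolded weq_def] by (intro metabolic_psum[OF herm_psum herm_psum] form_herm form_pneg E G)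
  then show ?thesis
    unfolding weq_def
    by (intro metabolic_iso[where G = "psum (psum E (pneg E')) (psum G (pneg G'))"
          and g = "\<lambda>((x, x'), (y, y')). ((x, y), (x', y'))"])
      (use assms in \<open>auto intro!: form_psum form_pneg simp: image_iff split_paired_Ex\<close>)
qed

lemma metabolic_imp_weq: "form E \<Longrightarrow> form G \<Longrightarrow> metabolic E \<Longrightarrow> metabolic G \<Longrightarrow> weq E G"
  unfolding weq_def by (intro metabolic_psum metabolic_pneg form_herm form_pneg)

text \<open>The form on \<open>K\<^sup>\<bottom>/K\<close> is \<open>E\<close> with a smaller
  carrier: on the complement of \<open>K\<close> the radical becomes \<open>K\<close>, by
  \<open>perp_perp\<close>. A functional there that kills \<open>K\<close> is represented by a
  vector of \<open>E\<close>, and killing \<open>K\<close> places this vector in the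
  complement.\<close>

lemma sublagrangian_reduction:
  assumes E: "form E" and K: "subm (scal E) K" "K \<subseteq> car E" "rad E \<subseteq> K" "saturated (scal E) (car E) K"
    and q: "\<forall>x\<in>K. bf E x x \<in> twoI" and b: "\<forall>x\<in>K. \<forall>y\<in>K. bf E x y \<in> II"
  shows "form (E\<lparr>car := perp E K\<rparr>)" "rad (E\<lparr>car := perp E K\<rparr>) = K" "weq E (E\<lparr>car := perp E K\<rparr>)"
proof -
  note HE = form_herm[OF E]
  let ?E = "E\<lparr>car := perp E K\<rparr>"
  obtain N where N: "tors N E" using formD(3)[OF E] by blast
  note KK = perp_perp[OF E K]
  have KP: "K \<subseteq> perp E K" using b K(2) by (auto intro!: perpI[OF HE] simp del: image_iff)
  have rd: "rad ?E = K"
  proof -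
    have "rad ?E = perp E K \<inter> perp E (perp E K)" by (auto simp: rad_def perp_def)
    then show ?thesis using KK KP by blast
  qed
  then show "rad ?E = K" .
  have HK: "herm ?E" using HE subm_perp[OF HE] by (simp add: herm_def)
  have sp: "saturated (scal E) (car E) (perp E K)" using satd_perp[OF HE N K(2)] .
  have pw: "\<forall>v\<in>car E. scal E (2 ^ N) v \<in> perp E K"
    using N rad_subset_perp[OF HE K(2)] by (auto simp: tors_def)
  obtain n g where g: "range g \<subseteq> car E" "\<forall>v\<in>car E. \<exists>c. v - comb (scal E) g n c \<in> rad E"
    using formD(2)[OF E] by (rule finE)
  obtain g' where g': "\<forall>i. g' i \<in> perp E K" "\<forall>v\<in>perp E K. \<exists>c. v - comb (scal E) g' n c \<in> rad E"
    using submodule_generators[OF herm_module[OF HE] herm_subm[OF HE] subm_perp[OF HE] perp_subset[OF HE] sp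
      rad_subset_perp[OF HE K(2)] g pw] by blast
  have "finite_type ?E"
    unfolding finite_type_def rd using g' K(3) by (intro exI[of _ n] exI[of _ g']) (simp, blast)
  moreover have "tors N ?E"
    using N K(3) perp_subset[OF HE, of K] unfolding tors_def rd by auto
  moreover have "nonsing ?E"
    unfolding nonsing_def rd
  proof (intro allI impI)
    fix h assume h: "homI (scal ?E) (car ?E) h" "\<forall>k\<in>K. h k \<in> II"
    have "\<forall>k\<in>rad E. h k \<in> II" using h(2) K(3) by blast
    then obtain x where x: "x \<in> car E" "\<forall>u\<in>perp E K. h u - bf E x u \<in> II"
      using form_extend[OF E subm_perp[OF HE] perp_subset[OF HE] rad_subset_perp[OF HE K(2)] sp, of h] h(1)
      by auto
    have "x \<in> perp E K"
      using x(2) KP h(2) II_diff_iff by (intro perpI[OF HE x(1)]) blast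
    then show "\<exists>x\<in>car ?E. \<forall>y\<in>car ?E. h y - bf ?E x y \<in> II" using x(2) by auto
  qed
  ultimately show "form ?E" unfolding form_def rd using HK q by auto
  \<comment> \<open>The correspondence pairing vectors of the complement with the same class modulo
    \<open>K\<close>.\<close>
  define \<Gamma> where "\<Gamma> = {(x, y). x \<in> perp E K \<and> y \<in> perp E K \<and> x - y \<in> K}"
  note sp = subm_perp[OF HE, of K] and md = herm_module[OF HE]
  show "weq E ?E"
  proof (rule weq_graph[OF HE HK])
    show "subm (scal (psum E ?E)) \<Gamma>"
      unfolding subm_def
    proof (intro conjI ballI allI)
      show "0 \<in> \<Gamma>" using subm_0[OF sp] subm_0[OF K(1)] by (simp add: \<Gamma>_def pair_0[symmetric])
      show "u + v \<in> \<Gamma>" if "u \<in> \<Gamma>" "v \<in> \<Gamma>" for u v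
      proof -
        obtain x y x' y' where uv: "u = (x, y)" "v = (x', y')" by (cases u, cases v)
        have "(x - y) + (x' - y') \<in> K" using that uv by (intro subm_add[OF K(1)]) (auto simp: \<Gamma>_def)
        then show ?thesis using that by (auto simp: uv \<Gamma>_def algebra_simps intro: subm_add[OF sp])
      qed
      show "scal (psum E ?E) r u \<in> \<Gamma>" if "u \<in> \<Gamma>" for r u
      proof -
        obtain x y where uv: "u = (x, y)" by (cases u)
        have "scal E r (x - y) \<in> K" using that uv by (intro subm_sc[OF K(1)]) (auto simp: \<Gamma>_def)
        then show ?thesis
          using that by (auto simp: uv \<Gamma>_def Modules.module.scale_right_diff_distrib[OF md] intro: subm_sc[OF sp])
      qed
    qed
    show "\<Gamma> \<subseteq> car E \<times> car ?E" using perp_subset[OF HE, of K] by (auto simp: \<Gamma>_def)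
    show "bf E x x - bf ?E y y \<in> twoI" if "(x, y) \<in> \<Gamma>" for x y
    proof -
      have k: "x - y \<in> K" "y \<in> perp E K" using that by (auto simp: \<Gamma>_def)
      have "bf E ((x - y) + y) ((x - y) + y) - (bf E (x - y) (x - y) + bf E y y) \<in> twoI"
        by (rule q_add_twoI[OF HE perpD'[OF HE k(2,1)]])
      from twoI_add[OF this q[rule_format, OF k(1)]] show ?thesis by simp
    qed
    show "bf E x x' - bf ?E y y' \<in> II" if xy: "(x, y) \<in> \<Gamma>" and xy': "(x', y') \<in> \<Gamma>" for x y x' y'
    proof -
      have k: "x - y \<in> K" "x' \<in> perp E K" "y \<in> perp E K" "x' - y' \<in> K"
        using xy xy' by (auto simp: \<Gamma>_def)
      have "bf E (x - y) x' + bf E y (x' - y') \<in> II"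
        by (rule II_add[OF perpD'[OF HE k(2,1)] perpD[OF HE k(3,4)]])
      then show ?thesis by (simp add: bf_diff_left[OF HE] bf_diff_right[OF HE])
    qed
    show "\<exists>x. (x, y) \<in> \<Gamma>" if "y \<in> car ?E" for y
      using that subm_0[OF K(1)] by (intro exI[of _ y]) (auto simp: \<Gamma>_def)
    show "(z, 0) \<in> \<Gamma>" if z: "z \<in> car E" "\<And>x y. (x, y) \<in> \<Gamma> \<Longrightarrow> bf E z x \<in> II" for z
    proof -
      have "bf E z x \<in> II" if "x \<in> perp E K" for x
        using that subm_0[OF K(1)] by (intro z(2)[of x x]) (auto simp: \<Gamma>_def)
      then have "z \<in> perp E (perp E K)" using z(1) by (intro perpI[OF HE])
      then have "z \<in> K" using KK by simp
      then show ?thesis using KP subm_0[OF sp] by (auto simp: \<Gamma>_def)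
    qed
  qed
qed

end

section \<open>Reduction of the exponent\<close>

context dyadic
begin

text \<open>The preimage of the submodule \<open>2^k M\<close> of the presented module, which
  explains the error term in \<open>rad E\<close>.\<close>

definition mult_mod :: "nat \<Rightarrow> ('r, 'v::ab_group_add, 'q) pform \<Rightarrow> 'v set" where
  "mult_mod k E = {v \<in> car E. \<exists>y\<in>car E. v - scal E (2 ^ k) y \<in> rad E}"

lemma subm_mult_mod:
  assumes E: "herm E"
  shows "subm (scal E) (mult_mod k E)"
  unfolding subm_def
proof (intro conjI ballI allI)
  note md = herm_module[OF E] and F = herm_subm[OF E] and R = subm_rad[OF E]
  show "0 \<in> mult_mod k E"
    using subm_0[OF F] subm_0[OF R] by (auto simp: mult_mod_def Modules.module.scale_zero_right[OF md] intro!: bexI[of _ 0])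
  show "v + w \<in> mult_mod k E" if vw: "v \<in> mult_mod k E" "w \<in> mult_mod k E" for v w
  proof -
    obtain y y' where y: "y \<in> car E" "v - scal E (2 ^ k) y \<in> rad E" "y' \<in> car E" "w - scal E (2 ^ k) y' \<in> rad E"
      using vw by (auto simp: mult_mod_def)
    have "(v + w) - scal E (2 ^ k) (y + y') \<in> rad E"
      using subm_add[OF R y(2,4)] by (simp add: Modules.module.scale_right_distrib[OF md] algebra_simps)
    then show ?thesis using vw y subm_add[OF F] by (auto simp: mult_mod_def)
  qed
  show "scal E r v \<in> mult_mod k E" if v: "v \<in> mult_mod k E" for r v
  proof -
    obtain y where y: "y \<in> car E" "v - scal E (2 ^ k) y \<in> rad E"
      using v by (auto simp: mult_mod_def)
    have "scal E r v - scal E (2 ^ k) (scal E r y) \<in> rad E"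
      using subm_sc[OF R y(2), of r]
      by (simp add: Modules.module.scale_right_diff_distrib[OF md] Modules.module.scale_scale[OF md] mult.commute)
    then show ?thesis using v y subm_sc[OF F] by (auto simp: mult_mod_def)
  qed
qed

lemma mult_mod_subset: "mult_mod k E \<subseteq> car E"
  by (auto simp: mult_mod_def)

lemma rad_subset_mult_mod:
  assumes E: "herm E"
  shows "rad E \<subseteq> mult_mod k E"
  using rad_subset[OF E] subm_0[OF herm_subm[OF E]]
  by (auto simp: mult_mod_def Modules.module.scale_zero_right[OF herm_module[OF E]] intro!: bexI[of _ 0])

lemma scal_mult_mod:
  assumes E: "herm E" and y: "y \<in> car E"
  shows "scal E (2 ^ k) y \<in> mult_mod k E"
  using y subm_sc[OF herm_subm[OF E]] subm_0[OF subm_rad[OF E]] by (auto simp: mult_mod_def intro!: bexI[of _ y])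

lemma mult_modE:
  assumes E: "herm E" and v: "v \<in> mult_mod k E"
  obtains y z where "y \<in> car E" "z \<in> rad E" "v = scal E (2 ^ k) y + z"
proof -
  obtain y where y: "y \<in> car E" "v - scal E (2 ^ k) y \<in> rad E" using v by (auto simp: mult_mod_def)
  show thesis by (rule that[OF y]) simp
qed

lemma satn_form:
  assumes E: "herm E"
  shows "subm (scal E) (saturation E (mult_mod k E))" "saturation E (mult_mod k E) \<subseteq> car E"
    "rad E \<subseteq> saturation E (mult_mod k E)" "saturated (scal E) (car E) (saturation E (mult_mod k E))"
proof -
  show "subm (scal E) (saturation E (mult_mod k E))" by (rule subm_satn[OF E subm_mult_mod[OF E]])
  show "saturation E (mult_mod k E) \<subseteq> car E" by (rule satn_subset)
  show "rad E \<subseteq> saturation E (mult_mod k E)"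
    by (rule subset_trans[OF rad_subset_mult_mod[OF E] subset_satn[OF E mult_mod_subset]])
  show "saturated (scal E) (car E) (saturation E (mult_mod k E))" by (rule satd_satn[OF E])
qed

text \<open>Values of \<open>b\<close> are killed by \<open>2 ^ Suc k\<close> and acquire the factor
  \<open>2 ^ (2 * k)\<close> on \<open>2^k M\<close>. As \<open>2k = (k + 1) + 1 + (k - 2)\<close>,
  they land in \<open>2R\<close> there; the extra factor 2, demanded by \<open>q\<close>, is the
  reason for \<open>k \<ge> 2\<close>.\<close>

lemma exponent_reduction:
  assumes E: "form E" and N: "tors (Suc k) E" and k: "k \<ge> 2"
  shows "\<exists>K. form (E\<lparr>car := K\<rparr>) \<and> tors k (E\<lparr>car := K\<rparr>) \<and> weq E (E\<lparr>car := K\<rparr>)"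
proof -
  note HE = form_herm[OF E]
  let ?U = "mult_mod k E"
  let ?K = "saturation E ?U"
  have pw: "2 ^ (2 * k) * a \<in> twoI" if "2 ^ Suc k * a \<in> II" for a
  proof -
    obtain j where j: "k = j + 2" using k by (metis le_add_diff_inverse2)
    have "(2 :: 'q) ^ (2 * k) = 2 * (2 ^ j * 2 ^ Suc k)"
      unfolding j by (simp add: mult_2 power_add[symmetric] power_Suc[symmetric] del: power_Suc)
    then have "hf * (2 ^ (2 * k) * a) = hf * (2 * (2 ^ j * (2 ^ Suc k * a)))"
      by (simp only: mult.assoc)
    also have "\<dots> \<in> II" using II_2_power[OF that] by (simp only: two_hf')
    finally show ?thesis by (simp only: twoI_iff)
  qed
  have bb: "bf E (scal E (2 ^ k) x) (scal E (2 ^ k) y) \<in> twoI" if "x \<in> car E" "y \<in> car E" for x y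
    using pw[OF bf_power_II[OF HE N that]]
    by (simp add: bf_sc_left[OF HE] bf_sc_right[OF HE] mult.assoc[symmetric] power_add[symmetric] mult_2)
  have qU: "bf E v v \<in> twoI" if v: "v \<in> ?U" for v
  proof -
    obtain y z where y: "y \<in> car E" "z \<in> rad E" "v = scal E (2 ^ k) y + z" using v by (rule mult_modE[OF HE])
    have "scal E (2 ^ k) y \<in> car E" using subm_sc[OF herm_subm[OF HE] y(1)] .
    then have "bf E v v - (bf E (scal E (2 ^ k) y) (scal E (2 ^ k) y) + bf E z z) \<in> twoI"
      unfolding y(3) using radD'[OF HE y(2)] by (intro q_add_twoI[OF HE])
    from twoI_add[OF this twoI_add[OF bb[OF y(1,1)] formD(4)[OF E y(2)]]] show ?thesis by simp
  qed
  have bU: "bf E v w \<in> II" if v: "v \<in> ?U" "w \<in> ?U" for v w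
  proof -
    obtain y z where y: "y \<in> car E" "z \<in> rad E" "v = scal E (2 ^ k) y + z" using v(1) by (rule mult_modE[OF HE])
    obtain y' z' where y': "y' \<in> car E" "z' \<in> rad E" "w = scal E (2 ^ k) y' + z'" using v(2) by (rule mult_modE[OF HE])
    have "scal E (2 ^ k) y \<in> car E" "w \<in> car E" using subm_sc[OF herm_subm[OF HE] y(1)] v(2) mult_mod_subset[of k E] by auto
    then have "bf E (scal E (2 ^ k) y) (scal E (2 ^ k) y') + bf E (scal E (2 ^ k) y) z' + bf E z w \<in> II"
      by (intro II_add twoI_II[OF bb] y y' radD[OF HE] radD'[OF HE])
    then show ?thesis by (simp add: y(3) y'(3) bf_add_left[OF HE] bf_add_right[OF HE] add_ac)
  qed
  have q: "bf E x x \<in> twoI" if "x \<in> ?K" for x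
    using that twoI_sat[OF HE N] qU by (elim saturationE) blast
  have UE: "?U \<subseteq> car E" by (rule mult_mod_subset)
  have bU2: "bf E x y \<in> II" if x: "x \<in> ?U" and y: "y \<in> ?K" for x y
  proof -
    obtain f where f: "\<not> 2 dvd f" "scal E f y \<in> ?U" "y \<in> car E" using y by (rule saturationE)
    show ?thesis using bf_sat[OF HE N _ f(3,1)] bU[OF x f(2)] x UE by blast
  qed
  have b: "bf E x y \<in> II" if x: "x \<in> ?K" and y: "y \<in> ?K" for x y
  proof -
    obtain f where f: "\<not> 2 dvd f" "scal E f x \<in> ?U" "x \<in> car E" using x by (rule saturationE)
    show ?thesis using bf_sat_left[OF HE N f(3) _ f(1)] bU2[OF f(2) y] y satn_subset[of E ?U] by blast
  qed
  have "\<forall>x\<in>?K. bf E x x \<in> twoI" "\<forall>x\<in>?K. \<forall>y\<in>?K. bf E x y \<in> II" using q b by blast+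
  note red = sublagrangian_reduction[OF E satn_form[OF HE] this]
  \<comment> \<open>The new radical is \<open>?K\<close>, and it contains \<open>2 ^ k\<close> times
    every vector of \<open>car E\<close>.\<close>
  have "tors k (E\<lparr>car := perp E ?K\<rparr>)"
    unfolding tors_def red(2)
    using scal_mult_mod[OF HE, of _ k] subset_satn[OF HE UE] perp_subset[OF HE, of ?K] by auto
  then show ?thesis using red by blast
qed

lemma exponent_four:
  assumes E: "form E"
  shows "\<exists>K. form (E\<lparr>car := K\<rparr>) \<and> tors 2 (E\<lparr>car := K\<rparr>) \<and> weq E (E\<lparr>car := K\<rparr>)"
proof -
  have "\<exists>K. form (E\<lparr>car := K\<rparr>) \<and> tors 2 (E\<lparr>car := K\<rparr>) \<and> weq E (E\<lparr>car := K\<rparr>)"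
    if "form E" "tors (k + 2) E" for k and E :: "('r, 'a, 'q) pform"
    using that
  proof (induction k arbitrary: E)
    case 0
    then show ?case using weq_refl[of E] by (intro exI[of _ "car E"]) (simp add: numeral_2_eq_2)
  next
    case (Suc k)
    then obtain K where K: "form (E\<lparr>car := K\<rparr>)" "tors (k + 2) (E\<lparr>car := K\<rparr>)" "weq E (E\<lparr>car := K\<rparr>)"
      using exponent_reduction[of E "k + 2"] by auto
    obtain K' where K': "form (E\<lparr>car := K'\<rparr>)" "tors 2 (E\<lparr>car := K'\<rparr>)" "weq (E\<lparr>car := K\<rparr>) (E\<lparr>car := K'\<rparr>)"
      using Suc.IH[OF K(1,2)] by auto
    show ?case using K' weq_trans[OF Suc.prems(1) K(1) K'(1) K(3) K'(3)] by blast
  qed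
  moreover obtain N where "tors N E" using formD(3)[OF E] by blast
  then have "tors (N + 2) E" by (rule tors_mono[OF form_herm[OF E]]) simp
  ultimately show ?thesis using E by blast
qed

text \<open>The test is confined to the saturation of \<open>2M\<close>: in exponent 4 the form
  \<open>b\<close> vanishes there, so that \<open>q\<close> is additive and its zeros form a
  submodule.\<close>

definition anisotropic :: "('r, 'v::ab_group_add, 'q) pform \<Rightarrow> bool" where
  "anisotropic E \<longleftrightarrow> (\<forall>v\<in>saturation E (mult_mod 1 E). bf E v v \<in> twoI \<longrightarrow> v \<in> rad E)"

text \<open>An odd \<open>f\<close> brings \<open>v\<close> into \<open>2M\<close>, so
  \<open>f\<close> times \<open>2v\<close> lies in \<open>4M = 0\<close>; the radical is
  saturated.\<close>

lemma two_satn_mult_mod: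
  assumes E: "herm E" and N: "tors 2 E" and v: "v \<in> saturation E (mult_mod 1 E)"
  shows "scal E 2 v \<in> rad E"
proof -
  note md = herm_module[OF E] and R = subm_rad[OF E]
  obtain f where f: "\<not> 2 dvd f" "scal E f v \<in> mult_mod 1 E" "v \<in> car E" using v by (rule saturationE)
  obtain y z where y: "y \<in> car E" "z \<in> rad E" "scal E f v = scal E (2 ^ 1) y + z"
    using f(2) by (rule mult_modE[OF E])
  have "scal E f (scal E 2 v) = scal E 2 (scal E f v)"
    by (simp add: Modules.module.scale_scale[OF md] mult.commute)
  also have "\<dots> = scal E (2 ^ 2) y + scal E 2 z"
    by (simp add: y(3) Modules.module.scale_right_distrib[OF md] Modules.module.scale_scale[OF md])
  also have "\<dots> \<in> rad E"
    by (rule subm_add[OF R N[unfolded tors_def, rule_format, OF y(1)] subm_sc[OF R y(2)]])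
  finally show ?thesis
    using saturatedD[OF satd_perp[OF E N subset_refl] _ f(1), unfolded rad_perp[OF E, symmetric]]
      subm_sc[OF herm_subm[OF E] f(3)] by blast
qed

text \<open>After an odd scalar \<open>w\<close> becomes \<open>2y\<close>, and the factor 2 moves
  across: \<open>b(v, 2y) = b(2v, y) = 0\<close>.\<close>

lemma bf_satn_mult_mod:
  assumes E: "herm E" and N: "tors 2 E" and v: "v \<in> saturation E (mult_mod 1 E)" and w: "w \<in> saturation E (mult_mod 1 E)"
  shows "bf E v w \<in> II"
proof -
  obtain f where f: "\<not> 2 dvd f" "scal E f w \<in> mult_mod 1 E" "w \<in> car E" using w by (rule saturationE)
  obtain y z where y: "y \<in> car E" "z \<in> rad E" "scal E f w = scal E (2 ^ 1) y + z"
    using f(2) by (rule mult_modE[OF E])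
  have vE: "v \<in> car E" using v by (simp add: saturation_def)
  have "bf E (scal E 2 v) y + bf E v z \<in> II"
    using radD[OF E two_satn_mult_mod[OF E N v] y(1)] radD'[OF E y(2) vE] by (rule II_add)
  then have "bf E v (scal E f w) \<in> II"
    by (simp add: y(3) bf_add_right[OF E] bf_sc_left[OF E] bf_sc_right[OF E])
  then show ?thesis by (rule bf_sat[OF E N vE f(3,1)])
qed

text \<open>The zeros \<open>K\<close> of \<open>q\<close> on the saturation \<open>L\<close> of
  \<open>2M\<close> form a submodule because \<open>b\<close> vanishes on \<open>L\<close>. One
  reduction suffices: the analogous saturation inside the complement of \<open>K\<close> is
  contained in \<open>L\<close>, so its zeros of \<open>q\<close> lie in \<open>K\<close>, the new
  radical.\<close>

lemma anisotropic_reduction: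
  assumes E: "form E" and N: "tors 2 E"
  shows "\<exists>K. form (E\<lparr>car := K\<rparr>) \<and> tors 2 (E\<lparr>car := K\<rparr>) \<and> anisotropic (E\<lparr>car := K\<rparr>) \<and> weq E (E\<lparr>car := K\<rparr>)"
proof -
  note HE = form_herm[OF E]
  define L where "L = saturation E (mult_mod 1 E)"
  define K where "K = {v \<in> L. bf E v v \<in> twoI}"
  note L = satn_form[OF HE, of 1, folded L_def]
  have bL: "bf E v w \<in> II" if "v \<in> L" "w \<in> L" for v w
    using bf_satn_mult_mod[OF HE N] that by (simp add: L_def)
  have K1: "subm (scal E) K"
    unfolding subm_def
  proof (intro conjI ballI allI)
    show "0 \<in> K" using subm_0[OF L(1)] by (simp add: K_def bf_0_left[OF HE])
    show "v + w \<in> K" if "v \<in> K" "w \<in> K" for v w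
    proof -
      have vw: "v \<in> L" "w \<in> L" "bf E v v \<in> twoI" "bf E w w \<in> twoI" using that by (auto simp: K_def)
      from twoI_add[OF q_add_twoI[OF HE bL[OF vw(1,2)]] twoI_add[OF vw(3,4)]]
      show ?thesis using subm_add[OF L(1) vw(1,2)] by (simp add: K_def)
    qed
    show "scal E r v \<in> K" if "v \<in> K" for r v
      using that subm_sc[OF L(1)] twoI_mult[of "bf E v v" "r * iv r"] by (auto simp: K_def q_sc[OF HE] incl_mult)
  qed
  have K2: "K \<subseteq> car E" using L(2) by (auto simp: K_def)
  have K3: "rad E \<subseteq> K" using L(3) formD(4)[OF E] by (auto simp: K_def)
  have K4: "saturated (scal E) (car E) K"
    unfolding saturated_def
  proof (intro allI ballI impI)
    fix f x assume x: "x \<in> car E" "\<not> 2 dvd f" "scal E f x \<in> K"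
    have "x \<in> L" using saturatedD[OF L(4) _ x(2,1)] x(3) by (simp add: K_def)
    moreover have "bf E x x \<in> twoI" using twoI_sat[OF HE N x(1,2)] x(3) by (simp add: K_def)
    ultimately show "x \<in> K" by (simp add: K_def)
  qed
  have q: "\<forall>x\<in>K. bf E x x \<in> twoI" by (simp add: K_def)
  have b: "\<forall>x\<in>K. \<forall>y\<in>K. bf E x y \<in> II" using bL by (simp add: K_def)
  note red = sublagrangian_reduction[OF E K1 K2 K3 K4 q b]
  let ?E = "E\<lparr>car := perp E K\<rparr>"
  have "tors 2 ?E" using N K3 perp_subset[OF HE, of K] by (auto simp: tors_def red(2))
  moreover have "anisotropic ?E"
    unfolding anisotropic_def red(2)
  proof (intro ballI impI)
    fix v assume v: "v \<in> saturation ?E (mult_mod 1 ?E)" and qv: "bf ?E v v \<in> twoI"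
    obtain f where f: "\<not> 2 dvd f" "scal ?E f v \<in> mult_mod 1 ?E" "v \<in> car ?E" using v by (rule saturationE)
    obtain y z where y: "y \<in> car ?E" "z \<in> rad ?E" "scal ?E f v = scal ?E (2 ^ 1) y + z"
      using f(2) by (rule mult_modE[OF form_herm[OF red(1)]])
    have "y \<in> car E" using y perp_subset[OF HE] by auto
    then have "scal E (2 ^ 1) y \<in> L"
      unfolding L_def using subset_satn[OF HE mult_mod_subset] scal_mult_mod[OF HE, of y 1] by blast
    moreover have "z \<in> L" using y(2) unfolding red(2) by (simp add: K_def)
    ultimately have "scal E f v \<in> L" using y(3) subm_add[OF L(1)] by simp
    then have "v \<in> L" using saturatedD[OF L(4) _ f(1)] f(3) perp_subset[OF HE] by auto
    then show "v \<in> K" using qv by (simp add: K_def)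
  qed
  ultimately show ?thesis using red by blast
qed

end

section \<open>The rings of integers and of integral polynomials\<close>

lemma two_euclidean_int: "two_euclidean TYPE(int)"
proof
  show "\<exists>d::int \<Rightarrow> nat. \<forall>f g. \<not> 2 dvd f \<longrightarrow> (\<exists>q. 2 dvd g - q * f \<or> d (g - q * f) < d f)"
  proof (intro exI[of _ "\<lambda>_. 0"] allI impI)
    fix f g :: int assume "\<not> 2 dvd f"
    \<comment> \<open>As \<open>\<int>/2\<close> is a field, no remainder is left: the quotient
      \<open>g\<close> gives \<open>g * (1 - f)\<close>, which is even.\<close>
    then show "\<exists>q. 2 dvd g - q * f \<or> (0::nat) < 0" by (intro exI[of _ g]) simp
  qed
qed auto

lemma dyadic_Z: "dyadic Z_inv"
proof -
  interpret two_euclidean "TYPE(int)" by (rule two_euclidean_int)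
  show ?thesis
    by unfold_locales (auto simp: torsion_free_inv_ring_Z, auto simp: Z_inv_def)
qed

definition red :: "int poly \<Rightarrow> bit poly" where "red = map_poly of_int"

text \<open>A section of \<open>red\<close> on sets only: it is neither additive nor multiplicative,
  and identities hold for it only after reduction.\<close>

definition lft :: "bit poly \<Rightarrow> int poly" where "lft = map_poly (\<lambda>b. if b = 0 then 0 else 1)"

lemma coeff_red: "poly.coeff (red p) i = of_int (poly.coeff p i)"
  by (simp add: red_def coeff_map_poly)

lemma red_add: "red (p + q) = red p + red q"
  and red_diff: "red (p - q) = red p - red q"
  and red_mult: "red (p * q) = red p * red q"
  and red_0 [simp]: "red 0 = 0"
  and red_1 [simp]: "red 1 = 1"
  by (auto intro!: poly_eqI simp: coeff_red coeff_mult)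

lemma red_lft [simp]: "red (lft p) = p"
  by (rule poly_eqI) (simp add: coeff_red lft_def coeff_map_poly)

lemma lft_0 [simp]: "lft 0 = 0"
  by (simp add: lft_def)

lemma of_int_bit_eq_0: "(of_int k :: bit) = 0 \<longleftrightarrow> even k"
proof (cases "even k")
  case True
  then obtain j where "k = 2 * j" by (auto elim: evenE)
  then show ?thesis by simp
next
  case False
  then obtain j where "k = 2 * j + 1" by (auto elim: oddE)
  then show ?thesis by simp
qed

lemma red_eq_0_iff: "red p = 0 \<longleftrightarrow> 2 dvd p"
proof -
  have "2 dvd p \<longleftrightarrow> (\<forall>i. 2 dvd poly.coeff p i)"
    using const_poly_dvd_iff[of 2 p] by (simp add: numeral_poly)
  then show ?thesis by (simp add: poly_eq_iff coeff_red of_int_bit_eq_0)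
qed

lemma red_eq_iff: "red p = red q \<longleftrightarrow> 2 dvd p - q"
  by (simp add: red_eq_0_iff[symmetric] red_diff del: minus_bit_def)

lemma two_euclidean_int_poly: "two_euclidean TYPE(int poly)"
proof
  fix f g :: "int poly"
  show "2 dvd f * g \<Longrightarrow> 2 dvd f \<or> 2 dvd g"
    by (simp add: red_eq_0_iff[symmetric] red_mult)
  show "2 * f = 2 * g \<Longrightarrow> f = g" by simp
  show "\<not> (2 :: int poly) dvd 1" by (simp add: red_eq_0_iff[symmetric])
  show "\<exists>d::int poly \<Rightarrow> nat. \<forall>f g. \<not> 2 dvd f \<longrightarrow> (\<exists>q. 2 dvd g - q * f \<or> d (g - q * f) < d f)"
  proof (intro exI[of _ "\<lambda>f. degree (red f)"] allI impI)
    fix f g :: "int poly" assume f: "\<not> 2 dvd f"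
    have "red (g - lft (red g div red f) * f) = red g mod red f"
      by (simp only: red_diff red_mult red_lft minus_div_mult_eq_mod)
    then show "\<exists>q. 2 dvd g - q * f \<or> degree (red (g - q * f)) < degree (red f)"
      using degree_mod_less[of "red f" "red g"] f
      by (intro exI[of _ "lft (red g div red f)"]) (simp add: red_eq_0_iff[symmetric])
  qed
qed

lemma countable_int_poly: "countable (UNIV :: int poly set)"
  by (rule countableI'[of "to_nat \<circ> coeffs"]) (auto simp: inj_on_def coeffs_eq_iff)

lemma dyadic_Zt:
  assumes s: "s = 1 \<or> s = -1"
  shows "dyadic (Zt_inv s)"
proof -
  interpret two_euclidean "TYPE(int poly)" by (rule two_euclidean_int_poly)
  show ?thesis
  proof unfold_locales
    show "torsion_free_inv_ring (Zt_inv s)" using s by (rule torsion_free_inv_ring_Zt)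
    have ss: "s ^ i * s ^ i = 1" for i using s by (auto simp: power_mult_distrib[symmetric])
    then have ss': "(of_int s :: rat) ^ i * of_int s ^ i = 1" for i
      by (metis of_int_1 of_int_mult of_int_power)
    show "qinvol (Zt_inv s) (qinvol (Zt_inv s) a) = a" for a
      by (rule poly_eqI) (simp add: Zt_inv_def coeff_pcompose_linear mult.assoc[symmetric] ss')
    show "2 dvd r - invol (Zt_inv s) r" for r
    proof -
      have "even (poly.coeff r i - s ^ i * poly.coeff r i)" for i
        using s by auto
      then show ?thesis
        by (simp add: red_eq_0_iff[symmetric] poly_eq_iff coeff_red coeff_invol_Zt of_int_bit_eq_0 del: of_int_diff)
    qed
    show "countable (UNIV :: int poly set)" by (rule countable_int_poly)
  qed
qed

interpretation Z: dyadic Z_inv by (rule dyadic_Z)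

locale zt =
  fixes s :: int
  assumes s: "s = 1 \<or> s = -1"

sublocale zt \<subseteq> dyadic "Zt_inv s"
  using s by (rule dyadic_Zt)

section \<open>Base change along the augmentation\<close>

text \<open>Base change to \<open>t = 0\<close> on the same vectors: only scalars and values are
  specialised. The division by \<open>tM\<close> shows up as growth of the radical; see
  \<open>rad_epsf\<close>.\<close>

definition epsf :: "(int poly, 'v, rat poly) pform \<Rightarrow> (int, 'v, rat) pform" where
  "epsf E = \<lparr> scal = (\<lambda>k. scal E [:k:]), car = car E, bf = (\<lambda>v w. poly (bf E v w) 0) \<rparr>"

lemma epsf_simps [simp]:
  "scal (epsf E) k v = scal E [:k:] v" "car (epsf E) = car E" "bf (epsf E) v w = poly (bf E v w) 0"
  by (simp_all add: epsf_def)

context zt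
begin

notation inc ("\<iota>")

abbreviation t :: "int poly" where "t \<equiv> [:0, 1:]"

lemma incl_Zt: "\<iota> = map_poly of_int"
  by (simp add: Zt_inv_def)

lemma poly_incl_0 [simp]: "poly (\<iota> p) 0 = of_int (poly p 0)"
  by (simp add: incl_Zt poly_0_coeff_0 coeff_map_poly)

lemma poly_cj_0 [simp]: "poly (cj a) 0 = poly a 0"
  by (simp add: Zt_inv_def poly_pcompose)

lemma poly_iv_0 [simp]: "poly (iv a) 0 = poly a 0"
  by (simp add: Zt_inv_def poly_pcompose)

lemma incl_t: "\<iota> t = [:0, 1:]"
  by (simp add: incl_Zt map_poly_pCons)

lemma Z_incl: "incl Z_inv = of_int"
  by (simp add: Z_inv_def)

lemma poly_0_II: "a \<in> II \<Longrightarrow> poly a 0 \<in> Z.II"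
  by (auto simp: Z_incl)

lemma poly_0_twoI: "a \<in> twoI \<Longrightarrow> poly a 0 \<in> Z.twoI"
  unfolding twoI_def Z.twoI_def by (auto simp: Z_incl)

text \<open>Exactness in the middle, with \<open>cancel_t\<close> as exactness on the left, of the
  sequence \<open>0 \<rightarrow> \<rat>[t]/\<int>[t] \<rightarrow> \<rat>[t]/\<int>[t]
  \<rightarrow> \<rat>/\<int>\<close> given by multiplication by \<open>t\<close> and evaluation at
  0.\<close>

lemma divide_by_t:
  assumes "poly a 0 \<in> Z.II"
  shows "\<exists>h. a - \<iota> t * h \<in> II"
proof (cases a)
  case (pCons c h)
  then obtain k where "c = of_int k" using assms by (auto simp: Z_incl)
  then have "a - \<iota> t * h = \<iota> [:k:]" using pCons by (simp add: incl_t incl_Zt map_poly_pCons)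
  then have "a - \<iota> t * h \<in> II" by (simp only: II_incl)
  then show ?thesis by blast
qed

lemma cancel_t:
  assumes "\<iota> t * h \<in> II"
  shows "h \<in> II"
proof -
  obtain p where "\<iota> t * h = \<iota> p" using assms by (rule rangeE)
  then have p: "pCons 0 h = map_poly of_int p" unfolding incl_t by (simp add: incl_Zt)
  have "h = map_poly of_int (poly_shift 1 p)"
  proof (rule poly_eqI)
    fix i
    have "poly.coeff (pCons 0 h) (Suc i) = of_int (poly.coeff p (Suc i))"
      unfolding p by (simp add: coeff_map_poly)
    then show "poly.coeff h i = poly.coeff (map_poly of_int (poly_shift 1 p)) i"
      by (simp add: coeff_map_poly coeff_poly_shift)
  qed
  then show ?thesis by (simp add: incl_Zt)
qed

lemma iv_t: "iv t = [:0, s:]"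
  by (simp add: Zt_inv_def pcompose_pCons)

lemma const_plus_t: "r = [:poly r 0:] + t * poly_shift 1 r"
  by (rule poly_eqI) (simp add: coeff_poly_shift poly_0_coeff_0 coeff_pCons split: nat.splits)

context
  fixes E :: "(int poly, 'v::ab_group_add, rat poly) pform"
  assumes E: "form E"
begin

lemma herm_epsf: "Z.herm (epsf E)"
proof -
  note H = form_herm[OF E]
  note md = herm_module[OF H]
  have "Modules.module (scal (epsf E))"
  proof unfold_locales
    show "scal (epsf E) a (x + y) = scal (epsf E) a x + scal (epsf E) a y" for a x y
      by (simp add: Modules.module.scale_right_distrib[OF md])
    show "scal (epsf E) (a + b) x = scal (epsf E) a x + scal (epsf E) b x" for a b x
      using Modules.module.scale_left_distrib[OF md, of "[:a:]" "[:b:]" x] by simp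
    show "scal (epsf E) a (scal (epsf E) b x) = scal (epsf E) (a * b) x" for a b x
      using Modules.module.scale_scale[OF md, of "[:a:]" "[:b:]" x] by (simp add: mult.commute)
    show "scal (epsf E) 1 x = x" for x
      using Modules.module.scale_one[OF md, of x] by (simp add: one_pCons)
  qed
  moreover have "subm (scal (epsf E)) (car (epsf E))" using herm_subm[OF H] by (simp add: subm_def)
  moreover have "qinvol Z_inv (bf (epsf E) v w) = bf (epsf E) w v" for v w
  proof -
    have "poly (bf E w v) 0 = poly (cj (bf E v w)) 0" using bf_cj[OF H, of w v] by simp
    then show ?thesis by (simp add: Z_inv_def)
  qed
  ultimately show ?thesis
    unfolding Z.herm_def by (simp add: bf_add_left[OF H] bf_sc_right[OF H] Z_incl)
qed

text \<open>If the values \<open>b(v, w)\<close> are integral at \<open>t = 0\<close>, then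
  \<open>b(v, -)\<close> can be divided by \<open>t\<close>. The quotient is again a homomorphism on
  \<open>U\<close>, since \<open>t\<close> is injective on \<open>\<rat>[t]/\<int>[t]\<close>, and
  it is represented by some \<open>z\<close>.\<close>

lemma divide_bf_by_t:
  assumes U: "subm (scal E) U" "U \<subseteq> car E" "rad E \<subseteq> U" "saturated (scal E) (car E) U"
    and v: "v \<in> car E" and vU: "\<And>w. w \<in> U \<Longrightarrow> poly (bf E v w) 0 \<in> Z.II"
  shows "\<exists>y\<in>car E. \<forall>w\<in>U. bf E (v - scal E t y) w \<in> II"
proof -
  note H = form_herm[OF E]
  note md = herm_module[OF H]
  have "\<forall>w. \<exists>h. w \<in> U \<longrightarrow> bf E v w - \<iota> t * h \<in> II" using divide_by_t vU by blast
  then obtain h where h: "\<And>w. w \<in> U \<Longrightarrow> bf E v w - \<iota> t * h w \<in> II" by metis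
  have "homI (scal E) U h"
    unfolding homI_def
  proof (intro conjI ballI allI)
    fix w w' assume w: "w \<in> U" "w' \<in> U"
    have "(bf E v w - \<iota> t * h w) + (bf E v w' - \<iota> t * h w') - (bf E v (w + w') - \<iota> t * h (w + w')) \<in> II"
      by (rule II_diff[OF II_add[OF h[OF w(1)] h[OF w(2)]] h[OF subm_add[OF U(1) w]]])
    then have "\<iota> t * (h (w + w') - h w - h w') \<in> II" by (simp add: bf_add_right[OF H] algebra_simps)
    then show "h (w + w') - h w - h w' \<in> II" by (rule cancel_t)
  next
    fix r w assume w: "w \<in> U"
    have "\<iota> r * (bf E v w - \<iota> t * h w) - (bf E v (scal E r w) - \<iota> t * h (scal E r w)) \<in> II"
      by (rule II_diff[OF II_mult[OF h[OF w]] h[OF subm_sc[OF U(1) w]]])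
    then have "\<iota> t * (h (scal E r w) - \<iota> r * h w) \<in> II" by (simp add: bf_sc_right[OF H] algebra_simps)
    then show "h (scal E r w) - \<iota> r * h w \<in> II" by (rule cancel_t)
  qed
  moreover have "\<forall>k\<in>rad E. h k \<in> II"
  proof
    fix k assume k: "k \<in> rad E"
    then have kU: "k \<in> U" using U(3) by blast
    have "bf E v k - (bf E v k - \<iota> t * h k) \<in> II" by (rule II_diff[OF radD'[OF H k v] h[OF kU]])
    then have "\<iota> t * h k \<in> II" by simp
    then show "h k \<in> II" by (rule cancel_t)
  qed
  ultimately obtain z where z: "z \<in> car E" "\<forall>y\<in>U. h y - bf E z y \<in> II"
    using form_extend[OF E U] by blast
  \<comment> \<open>The form is conjugate linear on the left and \<open>iv t\<close> is
    \<open>s\<close> times \<open>t\<close>; the vector to be multiplied by \<open>t\<close> is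
    therefore \<open>s z\<close> rather than \<open>z\<close>.\<close>
  have "bf E (v - scal E t (scal E [:s:] z)) w \<in> II" if w: "w \<in> U" for w
  proof -
    have "scal E t (scal E [:s:] z) = scal E (iv t) z" by (simp add: Modules.module.scale_scale[OF md] iv_t)
    moreover have "(bf E v w - \<iota> t * h w) + \<iota> t * (h w - bf E z w) \<in> II"
      using z(2) w by (intro II_add[OF h[OF w]] II_mult) blast
    ultimately show ?thesis by (simp add: bf_diff_left[OF H] bf_sc_left[OF H] algebra_simps)
  qed
  then show ?thesis using subm_sc[OF herm_subm[OF H] z(1)] by blast
qed

text \<open>\<open>divide_bf_by_t\<close> with the whole carrier as \<open>U\<close>. This
  identifies the module presented by \<open>epsf E\<close> with \<open>M/tM\<close>.\<close>

lemma rad_epsf: "Z.rad (epsf E) = {v \<in> car E. \<exists>y\<in>car E. v - scal E t y \<in> rad E}"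
proof (intro equalityI subsetI)
  note H = form_herm[OF E]
  note md = herm_module[OF H] and F = herm_subm[OF H]
  fix v assume v: "v \<in> Z.rad (epsf E)"
  have vE: "v \<in> car E" using v by (simp add: Z.rad_def)
  have "saturated (scal E) (car E) (car E)" by (simp add: saturated_def)
  then obtain y where y: "y \<in> car E" "\<forall>w\<in>car E. bf E (v - scal E t y) w \<in> II"
    using divide_bf_by_t[OF F subset_refl rad_subset[OF H] _ vE] v by (auto simp: Z.rad_def)
  have "v - scal E t y \<in> car E" by (intro subm_diff[OF md F] vE subm_sc[OF F] y(1))
  then have "v - scal E t y \<in> rad E" using y(2) by (simp add: rad_def)
  then show "v \<in> {v \<in> car E. \<exists>y\<in>car E. v - scal E t y \<in> rad E}" using vE y(1) by blast
next
  note H = form_herm[OF E]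
  fix v assume "v \<in> {v \<in> car E. \<exists>y\<in>car E. v - scal E t y \<in> rad E}"
  then obtain y where y: "v \<in> car E" "y \<in> car E" "v - scal E t y \<in> rad E" by blast
  have "poly (bf E v w) 0 \<in> Z.II" if w: "w \<in> car E" for w
  proof -
    have "poly (bf E v w) 0 = poly (bf E (v - scal E t y) w) 0"
      by (simp add: bf_diff_left[OF H] bf_sc_left[OF H])
    then show ?thesis using poly_0_II[OF radD[OF H y(3) w]] by simp
  qed
  then show "v \<in> Z.rad (epsf E)" using y(1) by (simp add: Z.rad_def)
qed

lemma rad_subset_epsf: "rad E \<subseteq> Z.rad (epsf E)"
proof
  note H = form_herm[OF E]
  fix v assume "v \<in> rad E"
  then show "v \<in> Z.rad (epsf E)"
    unfolding rad_epsf using rad_subset[OF H] subm_0[OF herm_subm[OF H]]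
    by (auto simp: Modules.module.scale_zero_right[OF herm_module[OF H]] intro!: bexI[of _ 0])
qed

lemma t_in_rad_epsf: "y \<in> car E \<Longrightarrow> scal E t y \<in> Z.rad (epsf E)"
  unfolding rad_epsf using subm_0[OF subm_rad[OF form_herm[OF E]]] subm_sc[OF herm_subm[OF form_herm[OF E]]]
  by (auto intro!: bexI[of _ y])

lemma scal_epsf_mod:
  assumes v: "v \<in> car E"
  shows "scal E r v - scal E [:poly r 0:] v \<in> Z.rad (epsf E)"
proof -
  note H = form_herm[OF E]
  note md = herm_module[OF H]
  have "scal E r v = scal E ([:poly r 0:] + t * poly_shift 1 r) v" using const_plus_t[of r] by simp
  also have "\<dots> = scal E [:poly r 0:] v + scal E t (scal E (poly_shift 1 r) v)"
    by (simp only: Modules.module.scale_left_distrib[OF md] Modules.module.scale_scale[OF md])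
  finally show ?thesis
    using t_in_rad_epsf[OF subm_sc[OF herm_subm[OF H] v]] by simp
qed

lemma tors_epsf: "tors N E \<Longrightarrow> Z.tors N (epsf E)"
proof -
  have "[:2 ^ N:] = (2 ^ N :: int poly)" by (simp add: poly_const_pow[symmetric] numeral_poly)
  then show "tors N E \<Longrightarrow> Z.tors N (epsf E)"
    using rad_subset_epsf by (auto simp: tors_def Z.tors_def)
qed

lemma fin_epsf: "Z.finite_type (epsf E)"
proof -
  note H = form_herm[OF E]
  note F = herm_subm[OF H] and RZ = Z.subm_rad[OF herm_epsf]
  obtain n g where g: "range g \<subseteq> car E" "\<forall>v\<in>car E. \<exists>c. v - comb (scal E) g n c \<in> rad E"
    using formD(2)[OF E] by (rule finE)
  have "\<exists>c. v - comb (scal (epsf E)) g n c \<in> Z.rad (epsf E)" if v: "v \<in> car E" for v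
  proof -
    obtain c where c: "v - comb (scal E) g n c \<in> rad E" using g v by blast
    have "comb (scal E) g n c - comb (scal (epsf E)) g n (\<lambda>i. poly (c i) 0) \<in> Z.rad (epsf E)"
      unfolding comb_def sum_subtractf[symmetric] epsf_simps
      using g(1) by (intro subm_sum[OF RZ] scal_epsf_mod) auto
    then have "(v - comb (scal E) g n c) + (comb (scal E) g n c - comb (scal (epsf E)) g n (\<lambda>i. poly (c i) 0)) \<in> Z.rad (epsf E)"
      using rad_subset_epsf c by (intro subm_add[OF RZ]) auto
    then have "v - comb (scal (epsf E)) g n (\<lambda>i. poly (c i) 0) \<in> Z.rad (epsf E)" by simp
    then show ?thesis by (rule exI[of _ "\<lambda>i. poly (c i) 0"])
  qed
  then show ?thesis unfolding Z.finite_type_def using g(1) by auto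
qed

text \<open>A functional on \<open>M/tM\<close> with values in \<open>\<rat>/\<int>\<close> has to
  be lifted to one on \<open>M\<close> with values in \<open>\<rat>[t]/\<int>[t]\<close>. Extended
  linearly to coefficients it takes integer values \<open>m j\<close> on the basis of relations;
  read as constant polynomials, these prescribe the lift, and nonsingularity of \<open>E\<close>
  represents it.\<close>

lemma nonsing_epsf: "Z.nonsing (epsf E)"
  unfolding Z.nonsing_def
proof (intro allI impI)
  note H = form_herm[OF E]
  note md = herm_module[OF H] and F = herm_subm[OF H] and R = subm_rad[OF H]
  fix h assume h: "Z.homI (scal (epsf E)) (car (epsf E)) h" and hr: "\<forall>k\<in>Z.rad (epsf E). h k \<in> Z.II"
  obtain N where N: "tors N E" using formD(3)[OF E] by blast
  obtain n g where g: "range g \<subseteq> car E" "\<forall>v\<in>car E. \<exists>c. v - comb (scal E) g n c \<in> rad E"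
    using formD(2)[OF E] by (rule finE)
  have pw: "\<forall>v\<in>car E. scal E (2 ^ N) v \<in> rad E" using N by (simp add: tors_def)
  have sat: "saturated (scal E) (car E) (rad E)"
    unfolding rad_perp[OF H] using satd_perp[OF H N] by blast
  obtain \<phi> \<psi> where q: "quasi_iso n N \<phi> \<psi>" and rg: "range \<phi> = {c. comb (scal E) g n c \<in> rad E}"
    using resolution[OF md F R sat g(1) pw] by blast
  note 1 = quasi_isoD[OF q]
  obtain cc where cc: "\<And>v. v \<in> car E \<Longrightarrow> v - comb (scal E) g n (cc v) \<in> rad E" using g(2) by metis
  \<comment> \<open>\<open>\<rat>\<close> becomes a \<open>\<int>[t]\<close>-module through
    \<open>t = 0\<close>, so that \<open>comb\<close> and \<open>comb_lin\<close> also apply to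
    values of \<open>h\<close>.\<close>
  define sQ where "sQ = (\<lambda>(r :: int poly) (a :: rat). of_int (poly r 0) * a)"
  have mQ: "Modules.module sQ" by unfold_locales (simp_all add: sQ_def algebra_simps)
  define hh where "hh c = comb sQ (\<lambda>i. h (g i)) n c" for c
  have hsc: "h (scal E r v) - of_int (poly r 0) * h v \<in> Z.II" if v: "v \<in> car E" for r v
  proof -
    have v': "scal E r v \<in> car E" "scal E [:poly r 0:] v \<in> car E" using subm_sc[OF F v] by auto
    have "h (scal E r v - scal E [:poly r 0:] v) - h (scal E r v) + h (scal E [:poly r 0:] v) \<in> Z.II"
      using Z.homI_diff[OF h Z.herm_module[OF herm_epsf] Z.herm_subm[OF herm_epsf]] v' by simp
    then have "h (scal E r v) - h (scal E [:poly r 0:] v) \<in> Z.II"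
      using hr scal_epsf_mod[OF v, of r] Z.II_diff[of "h (scal E r v - scal E [:poly r 0:] v)"
          "h (scal E r v - scal E [:poly r 0:] v) - h (scal E r v) + h (scal E [:poly r 0:] v)"] by simp
    moreover have "h (scal E [:poly r 0:] v) - of_int (poly r 0) * h v \<in> Z.II"
      using Z.homI_sc[OF h, of v "poly r 0"] v by (simp add: Z_incl)
    ultimately show ?thesis by (rule Z.II_diff_trans)
  qed
  have hadd: "h (v + w) - h v - h w \<in> Z.II" if "v \<in> car E" "w \<in> car E" for v w
    using Z.homI_add[OF h] that by simp
  have hh: "h (comb (scal E) g n c) - hh c \<in> Z.II" for c
    unfolding hh_def
  proof (induction n)
    case 0
    show ?case using Z.homI_0[OF h] subm_0[OF F] by (simp add: comb_def)
  next
    case (Suc n)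
    have gE: "g n \<in> car E" and cE: "comb (scal E) g n c \<in> car E" using g(1) comb_in[OF F g(1)] by auto
    have "(h (comb (scal E) g n c + scal E (c n) (g n)) - h (comb (scal E) g n c) - h (scal E (c n) (g n)))
       + (h (comb (scal E) g n c) - comb sQ (\<lambda>i. h (g i)) n c) + (h (scal E (c n) (g n)) - of_int (poly (c n) 0) * h (g n)) \<in> Z.II"
      using subm_sc[OF F gE] by (intro Z.II_add hadd Suc.IH hsc gE cE) auto
    then show ?case by (simp add: comb_def sQ_def algebra_simps)
  qed
  have "hh (\<phi> (unit_vec j)) \<in> Z.II" for j
  proof -
    have "comb (scal E) g n (\<phi> (unit_vec j)) \<in> rad E" using rg by auto
    then have "h (comb (scal E) g n (\<phi> (unit_vec j))) \<in> Z.II" using hr rad_subset_epsf by blast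
    then show ?thesis using Z.II_diff_iff[OF hh] by blast
  qed
  then have "\<forall>j. \<exists>m. hh (\<phi> (unit_vec j)) = of_int m" by (auto simp: Z_incl)
  then obtain m where m: "\<And>j. hh (\<phi> (unit_vec j)) = of_int (m j)" by metis
  \<comment> \<open>The linear form with constant value \<open>m j\<close> on the
    \<open>j\<close>-th basic relation. At \<open>t = 0\<close> it returns \<open>hh\<close>,
    because \<open>\<phi> (\<psi> c)\<close> is \<open>2 ^ N\<close> times \<open>c\<close>.\<close>
  define H0 where "H0 c = hf ^ N * (\<Sum>j<n. \<iota> (\<psi> c j) * \<iota> [:m j:])" for c
  have H0_add: "H0 (c + d) = H0 c + H0 d" for c d
    by (simp only: H0_def lin_add[OF 1(2)] plus_fun_apply incl_add distrib_right sum.distrib distrib_left)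
  have H0_fsc: "H0 (fsc r c) = \<iota> r * H0 c" for r c
    by (simp add: H0_def lin_fsc[OF 1(2)] fsc_apply incl_mult sum_distrib_left mult_ac)
  have H0K: "H0 c \<in> II" if "comb (scal E) g n c \<in> rad E" for c
  proof -
    have "c \<in> range \<phi>" unfolding rg using that by simp
    then obtain d where d: "c = \<phi> d" by (rule rangeE)
    have "H0 c = hf ^ N * (2 ^ N * (\<Sum>j<n. \<iota> (d j) * \<iota> [:m j:]))"
      unfolding d by (simp add: H0_def 1(4) fsc_apply incl_mult sum_distrib_left mult_ac del: two_hf_power two_hf_power')
    also have "\<dots> = (\<Sum>j<n. \<iota> (d j) * \<iota> [:m j:])" by (rule two_hf_power')
    also have "\<dots> \<in> II" by (intro II_sum II_mult II_incl)
    finally show ?thesis .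
  qed
  have ph: "2 ^ N * poly (hf ^ N) 0 = 1"
  proof -
    have "poly (2 ^ N * hf ^ N) 0 = 1" by (simp only: two_hf_power poly_1)
    then show ?thesis by (simp only: poly_mult poly_power poly_numeral)
  qed
  have p0: "poly (H0 c) 0 = hh c" for c
  proof -
    have "comb sQ (\<lambda>j. hh (\<phi> (unit_vec j))) n (\<psi> c) = hh (\<phi> (\<psi> c))"
      unfolding hh_def using comb_lin[OF mQ 1(1) 1(5), of "\<lambda>i. h (g i)" "\<psi> c"] by simp
    also have "\<dots> = 2 ^ N * hh c"
      unfolding 1(3) hh_def comb_fsc[OF mQ] by (simp add: sQ_def poly_power)
    finally have *: "(\<Sum>j<n. of_int (poly (\<psi> c j) 0) * of_int (m j)) = 2 ^ N * hh c"
      by (simp add: comb_def sQ_def m)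
    have "poly (H0 c) 0 = poly (hf ^ N) 0 * (\<Sum>j<n. of_int (poly (\<psi> c j) 0) * of_int (m j))"
      by (simp add: H0_def poly_sum)
    then show ?thesis unfolding * using ph by (simp add: mult.assoc[symmetric] mult.commute[of _ "2 ^ N"])
  qed
  have "homI (scal E) (car E) (\<lambda>v. H0 (cc v))"
    by (rule homI_descend[OF md F R cc H0_add H0_fsc H0K])
  moreover have "H0 (cc k) \<in> II" if "k \<in> rad E" for k
  proof -
    have "k \<in> car E" using that rad_subset[OF H] by blast
    then show ?thesis using cc subm_diff_iff[OF md R] that by (intro H0K) blast
  qed
  ultimately obtain x where x: "x \<in> car E" "\<forall>y\<in>car E. H0 (cc y) - bf E x y \<in> II"
    using formD(5)[OF E] unfolding nonsing_def by blast
  show "\<exists>x\<in>car (epsf E). \<forall>y\<in>car (epsf E). h y - bf (epsf E) x y \<in> Z.II"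
  proof (intro bexI[of _ x] ballI)
    fix y assume "y \<in> car (epsf E)"
    then have y: "y \<in> car E" by simp
    let ?c = "comb (scal E) g n (cc y)"
    have c: "?c \<in> car E" using comb_in[OF F g(1)] .
    have "h (y - ?c) - h y + h ?c \<in> Z.II"
      using Z.homI_diff[OF h Z.herm_module[OF herm_epsf] Z.herm_subm[OF herm_epsf]] y c by simp
    moreover have "h (y - ?c) \<in> Z.II" using hr rad_subset_epsf cc[OF y] by blast
    ultimately have "h (y - ?c) - (h (y - ?c) - h y + h ?c) \<in> Z.II" by (intro Z.II_diff)
    then have 1: "h y - h ?c \<in> Z.II" by simp
    have "poly (H0 (cc y) - bf E x y) 0 \<in> Z.II" using x(2) y by (intro poly_0_II) blast
    then have 2: "hh (cc y) - poly (bf E x y) 0 \<in> Z.II" by (simp add: p0)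
    show "h y - bf (epsf E) x y \<in> Z.II"
      using Z.II_diff_trans[OF Z.II_diff_trans[OF 1 hh] 2] by simp
  qed (use x in simp)
qed

text \<open>What remains is \<open>q\<close> on the enlarged radical: \<open>q(ty)\<close> carries a
  factor \<open>t\<close> and vanishes at 0.\<close>

lemma form_epsf: "Z.form (epsf E)"
proof -
  note H = form_herm[OF E]
  have "bf (epsf E) v v \<in> Z.twoI" if v: "v \<in> Z.rad (epsf E)" for v
  proof -
    obtain y where y: "v \<in> car E" "y \<in> car E" "v - scal E t y \<in> rad E" using v unfolding rad_epsf by blast
    let ?z = "v - scal E t y"
    have ty: "scal E t y \<in> car E" using subm_sc[OF herm_subm[OF H] y(2)] .
    have "bf E (?z + scal E t y) (?z + scal E t y) - (bf E ?z ?z + bf E (scal E t y) (scal E t y)) \<in> twoI"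
      by (rule q_add_twoI[OF H radD[OF H y(3) ty]])
    from twoI_add[OF this formD(4)[OF E y(3)]]
    have "bf E v v - bf E (scal E t y) (scal E t y) \<in> twoI" by simp
    from poly_0_twoI[OF this] show ?thesis by (simp add: bf_sc_right[OF H])
  qed
  then show ?thesis
    unfolding Z.form_def using herm_epsf fin_epsf nonsing_epsf formD(3)[OF E] tors_epsf by blast
qed

text \<open>The image of a Lagrangian \<open>L\<close> is \<open>L + tM\<close>. A vector orthogonal
  to it at \<open>t = 0\<close> can be altered by an element of \<open>tM\<close> so as to become
  orthogonal to \<open>L\<close> over \<open>\<int>[t]\<close>, by \<open>divide_bf_by_t\<close>,
  and then lies in \<open>L\<close>.\<close>

lemma metabolic_epsf:
  assumes "metabolic E"
  shows "Z.metabolic (epsf E)"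
proof -
  note H = form_herm[OF E] and HZ = herm_epsf
  note md = herm_module[OF H] and F = herm_subm[OF H] and RZ = Z.subm_rad[OF HZ]
  obtain N where N: "tors N E" using formD(3)[OF E] by blast
  obtain L where L: "lagr E L" using assms by (auto simp: metabolic_def)
  have LL: "subm (scal E) L" "L \<subseteq> car E" "L = perp E L" and qL: "\<And>x. x \<in> L \<Longrightarrow> bf E x x \<in> twoI"
    using L by (auto simp: lagr_def)
  have sat: "saturated (scal E) (car E) L" using satd_perp[OF H N LL(2)] LL(3) by simp
  have rL: "rad E \<subseteq> L" using rad_subset_perp[OF H LL(2)] LL(3) by simp
  define M where "M = {v. \<exists>l\<in>L. \<exists>y\<in>car E. v = l + scal E t y}"
  have ME: "M \<subseteq> car E"
    using LL(2) subm_sc[OF F] by (auto simp: M_def intro!: subm_add[OF F])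
  have M: "subm (scal (epsf E)) M"
    unfolding subm_def
  proof (intro conjI ballI allI)
    show "0 \<in> M" using subm_0[OF LL(1)] subm_0[OF F]
      by (auto simp: M_def Modules.module.scale_zero_right[OF md] intro!: bexI[of _ 0])
    show "v + w \<in> M" if vw: "v \<in> M" "w \<in> M" for v w
    proof -
      obtain l y l' y' where "l \<in> L" "y \<in> car E" "v = l + scal E t y" "l' \<in> L" "y' \<in> car E" "w = l' + scal E t y'"
        using vw by (auto simp: M_def)
      then show ?thesis
        unfolding M_def using subm_add[OF LL(1)] subm_add[OF F]
        by (intro CollectI bexI[of _ "l + l'"] bexI[of _ "y + y'"]) (auto simp: Modules.module.scale_right_distrib[OF md])
    qed
    show "scal (epsf E) r v \<in> M" if v: "v \<in> M" for r v
    proof -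
      obtain l y where "l \<in> L" "y \<in> car E" "v = l + scal E t y" using v by (auto simp: M_def)
      then show ?thesis
        unfolding M_def using subm_sc[OF LL(1)] subm_sc[OF F]
        by (intro CollectI bexI[of _ "scal E [:r:] l"] bexI[of _ "scal E [:r:] y"])
          (auto simp: Modules.module.scale_right_distrib[OF md] Modules.module.scale_scale[OF md] mult.commute)
    qed
  qed
  have LM: "L \<subseteq> M" using subm_0[OF F] by (force simp: M_def Modules.module.scale_zero_right[OF md])
  have tM: "scal E t y \<in> M" if "y \<in> car E" for y using that subm_0[OF LL(1)] by (force simp: M_def)
  have "M = Z.perp (epsf E) M"
  proof (intro equalityI subsetI)
    fix v assume v: "v \<in> M"
    then obtain l y where ly: "l \<in> L" "y \<in> car E" "v = l + scal E t y" by (auto simp: M_def)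
    show "v \<in> Z.perp (epsf E) M"
    proof (rule Z.perpI[OF HZ])
      show "v \<in> car (epsf E)" using v ME by auto
      fix w assume "w \<in> M"
      then obtain l' y' where ly': "l' \<in> L" "y' \<in> car E" "w = l' + scal E t y'" by (auto simp: M_def)
      have "l \<in> perp E L" using LL(3) ly by blast
      then have "poly (bf E l l') 0 \<in> Z.II" using perpD[OF H _ ly'(1)] by (intro poly_0_II)
      then show "bf (epsf E) v w \<in> Z.II"
        by (simp add: ly ly' bf_add_left[OF H] bf_add_right[OF H] bf_sc_left[OF H] bf_sc_right[OF H])
    qed
  next
    fix v assume v: "v \<in> Z.perp (epsf E) M"
    have vE: "v \<in> car E" using Z.perp_car[OF HZ v] by simp
    have "poly (bf E v w) 0 \<in> Z.II" if "w \<in> L" for w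
      using Z.perpD[OF HZ v, of w] LM that by auto
    then obtain y where y: "y \<in> car E" "\<forall>w\<in>L. bf E (v - scal E t y) w \<in> II"
      using divide_bf_by_t[OF LL(1,2) rL sat vE] by blast
    have "v - scal E t y \<in> car E" by (intro subm_diff[OF md F] vE subm_sc[OF F] y(1))
    then have "v - scal E t y \<in> perp E L" using y(2) by (intro perpI[OF H]) blast+
    then have "v - scal E t y \<in> L" using LL(3) by simp
    then show "v \<in> M" unfolding M_def using y(1) by (intro CollectI bexI[of _ "v - scal E t y"] bexI[of _ y]) auto
  qed
  moreover have "bf (epsf E) v v \<in> Z.twoI" if v: "v \<in> M" for v
  proof -
    obtain l y where ly: "l \<in> L" "y \<in> car E" "v = l + scal E t y" using v by (auto simp: M_def)
    show ?thesis
      using poly_0_twoI[OF qL[OF ly(1)]]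
      by (simp add: ly(3) bf_add_left[OF H] bf_add_right[OF H] bf_sc_left[OF H] bf_sc_right[OF H])
  qed
  ultimately have "Z.lagr (epsf E) M" using M ME unfolding Z.lagr_def by auto
  then show ?thesis by (auto simp: Z.metabolic_def)
qed

end

end

section \<open>Squares in characteristic two\<close>

lemma bit_poly_double [simp]: "(p :: bit poly) + p = 0"
proof (rule poly_eqI)
  have "(b :: bit) + b = 0" for b by (cases b) simp_all
  then show "poly.coeff (p + p) i = poly.coeff 0 i" for i by (simp only: coeff_add coeff_0)
qed

lemma bit_poly_two: "(2 :: bit poly) = 0"
  by (simp add: numeral_poly)

lemma bit_poly_minus [simp]: "- (p :: bit poly) = p"
  by (rule minus_unique) simp

lemma bit_poly_diff [simp]: "(p :: bit poly) - q = p + q"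
  by (metis bit_poly_minus diff_conv_add_uminus)

lemma bit_poly_add_eq_0: "(p :: bit poly) + q = 0 \<longleftrightarrow> p = q"
  by (metis bit_poly_diff eq_iff_diff_eq_0)

lemma bit_poly_sq_add: "((p :: bit poly) + q)\<^sup>2 = p\<^sup>2 + q\<^sup>2"
  by (simp add: power2_sum bit_poly_two)

text \<open>Polynomials over the field with two elements are free over the subring of squares, with
  basis 1 and \<open>t\<close>; \<open>u\<close> and \<open>v\<close> are the square roots of the
  two coordinates.\<close>

definition sqt :: "bit poly \<Rightarrow> bit poly \<Rightarrow> bit poly" where "sqt u v = u\<^sup>2 + [:0, 1:] * v\<^sup>2"

lemma sqt_add: "sqt (u + u') (v + v') = sqt u v + sqt u' v'"
  unfolding sqt_def bit_poly_sq_add by (simp only: distrib_left ac_simps)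

lemma sqt_mult: "sqt (r * u) (r * v) = r\<^sup>2 * sqt u v"
  by (simp only: sqt_def power_mult_distrib distrib_left ac_simps)

text \<open>The two summands have degrees of different parity, so their leading terms cannot
  cancel.\<close>

lemma degree_sqt: "v \<noteq> 0 \<Longrightarrow> degree (sqt u v) \<ge> 1 + 2 * degree v"
proof -
  assume v: "v \<noteq> 0"
  have d: "degree ([:0, 1:] * v\<^sup>2) = 1 + 2 * degree v"
    using v by (simp add: degree_mult_eq degree_power_eq)
  show ?thesis
  proof (cases "u = 0")
    case True
    then show ?thesis using d by (simp only: sqt_def power_zero_numeral add_0 order_refl)
  next
    case False
    then have du: "degree (u\<^sup>2) = 2 * degree u" by (simp add: degree_power_eq)
    have "2 * degree u < 1 + 2 * degree v \<or> 1 + 2 * degree v < 2 * degree u" by presburger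
    then show ?thesis
      unfolding sqt_def
      using degree_add_eq_right[of "u\<^sup>2" "[:0, 1:] * v\<^sup>2"] degree_add_eq_left[of "[:0, 1:] * v\<^sup>2" "u\<^sup>2"] d du by linarith
  qed
qed

lemma sqt_eq_0: "sqt u v = 0 \<longleftrightarrow> u = 0 \<and> v = 0"
proof
  assume *: "sqt u v = 0"
  then have "v = 0" using degree_sqt[of v u] by fastforce
  then show "u = 0 \<and> v = 0" using * by (simp add: sqt_def)
qed (simp add: sqt_def)

lemma sqt_inject: "sqt u v = sqt u' v' \<longleftrightarrow> u = u' \<and> v = v'"
  using sqt_eq_0[of "u + u'" "v + v'"] unfolding sqt_add bit_poly_add_eq_0 .

lemma sqt_surj: "\<exists>u v. p = sqt u v"
proof (induction p rule: pCons_induct)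
  case 0
  show ?case using sqt_eq_0[of 0 0] by metis
next
  case (pCons c p)
  then obtain u v where p: "p = sqt u v" by blast
  have cc: "c * c = c" by (cases c) simp_all
  have "pCons c p = [:c:] + [:0, 1:] * sqt u v" by (simp add: p)
  \<comment> \<open>Multiplication by \<open>t\<close> exchanges the two parts, as
    \<open>t(u^2 + t v^2) = (t v)^2 + t u^2\<close>, and a constant is its own square.\<close>
  also have "\<dots> = sqt ([:c:] + [:0, 1:] * v) u"
    unfolding sqt_def bit_poly_sq_add
    by (simp add: power2_eq_square cc algebra_simps)
  finally show ?case by blast
qed

definition sq0 :: "bit poly \<Rightarrow> bit poly" where "sq0 p = (THE u. \<exists>v. p = sqt u v)"
definition sq1 :: "bit poly \<Rightarrow> bit poly" where "sq1 p = (THE v. \<exists>u. p = sqt u v)"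

lemma sq0_sqt [simp]: "sq0 (sqt u v) = u" and sq1_sqt [simp]: "sq1 (sqt u v) = v"
  unfolding sq0_def sq1_def by (auto simp: sqt_inject)

lemma sqt_sq: "sqt (sq0 p) (sq1 p) = p"
  using sqt_surj[of p] by auto

text \<open>Uniqueness of the decomposition. The rules for \<open>r\<^sup>2 * p\<close> turn
  Frobenius semilinear maps into linear ones, which is how \<open>q\<close> yields
  functionals.\<close>

lemma sq0_add: "sq0 (p + p') = sq0 p + sq0 p'" and sq1_add: "sq1 (p + p') = sq1 p + sq1 p'"
  and sq0_mult: "sq0 (r\<^sup>2 * p) = r * sq0 p" and sq1_mult: "sq1 (r\<^sup>2 * p) = r * sq1 p"
proof -
  show "sq0 (p + p') = sq0 p + sq0 p'" "sq1 (p + p') = sq1 p + sq1 p'"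
    using sqt_add[of "sq0 p" "sq0 p'" "sq1 p" "sq1 p'"] unfolding sqt_sq by (metis sq0_sqt, metis sq1_sqt)
  show "sq0 (r\<^sup>2 * p) = r * sq0 p" "sq1 (r\<^sup>2 * p) = r * sq1 p"
    using sqt_mult[of r "sq0 p" "sq1 p"] unfolding sqt_sq by (metis sq0_sqt, metis sq1_sqt)
qed

lemma sq_0 [simp]: "sq0 0 = 0" "sq1 0 = 0"
  using sq0_add[of 0 0] sq1_add[of 0 0] by simp_all

text \<open>A nonzero \<open>d\<close> would give the left side degree at least
  \<open>1 + 2 * degree d\<close>, more than that of \<open>d\<close>.\<close>

lemma sqt_self_right:
  assumes "sqt c d = d"
  shows "c = 0" "d = 0"
proof -
  show "d = 0" using degree_sqt[of d c] assms by fastforce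
  then show "c = 0" using assms sqt_eq_0[of c d] by simp
qed

lemma sqt_self_left: "sqt a 0 = a \<Longrightarrow> a = 0 \<or> a = 1"
proof -
  assume "sqt a 0 = a"
  then show ?thesis by (simp add: sqt_def power2_eq_square)
qed

context zt
begin

section \<open>Anisotropic forms of exponent four\<close>

text \<open>Meaningful on \<open>II\<close>, where the preimage is unique; elsewhere the choice is
  arbitrary.\<close>

definition redI :: "rat poly \<Rightarrow> bit poly" where "redI a = red (SOME r. \<iota> r = a)"

lemma redI_incl [simp]: "redI (\<iota> r) = red r"
  by (simp add: redI_def incl_eq_iff)

lemma redI_add: "a \<in> II \<Longrightarrow> b \<in> II \<Longrightarrow> redI (a + b) = redI a + redI b"
  by (auto simp: incl_add[symmetric] red_add)

lemma redI_mult: "a \<in> II \<Longrightarrow> redI (\<iota> r * a) = red r * redI a"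
  by (auto simp: incl_mult[symmetric] red_mult)

lemma red_iv: "red (iv r) = red r"
  using invol_mod_two[of r] red_eq_iff[of r "iv r"] by simp

lemma redI_cj: "a \<in> II \<Longrightarrow> redI (cj a) = redI a"
  by (auto simp: cj_incl red_iv)

lemma redI_eq_0: "a \<in> II \<Longrightarrow> redI a = 0 \<longleftrightarrow> a \<in> twoI"
proof -
  assume "a \<in> II"
  then obtain r where a: "a = \<iota> r" by auto
  have "2 dvd r \<longleftrightarrow> \<iota> r \<in> twoI"
    unfolding twoI_def dvd_def by (auto simp: image_iff incl_eq_iff[symmetric] incl_mult)
  then show ?thesis by (simp add: a red_eq_0_iff)
qed

lemma redI_cong: "a \<in> II \<Longrightarrow> b \<in> II \<Longrightarrow> a - b \<in> twoI \<Longrightarrow> redI a = redI b"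
  using redI_eq_0[of "a - b"] redI_add[of "a - b" b] II_diff[of a b] by simp

text \<open>Half of the lift realises the isomorphism of \<open>R/2R\<close> with the 2-torsion of
  \<open>\<rat>R/R\<close>. It turns functionals with values modulo 2 into ones that nonsingularity
  can represent.\<close>

lemma half_lft_II:
  assumes "2 * a \<in> II"
  shows "hf * \<iota> (lft p) - a \<in> II \<longleftrightarrow> redI (2 * a) = p"
proof -
  have "hf * (\<iota> (lft p) - 2 * a) = hf * \<iota> (lft p) - a" by (simp add: right_diff_distrib)
  then have "hf * \<iota> (lft p) - a \<in> II \<longleftrightarrow> \<iota> (lft p) - 2 * a \<in> twoI" by (simp add: twoI_iff)
  also have "\<dots> \<longleftrightarrow> redI (\<iota> (lft p) - 2 * a) = 0"
    using redI_eq_0[OF II_diff[OF II_incl assms]] by simp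
  also have "redI (\<iota> (lft p) - 2 * a) = p + redI (2 * a)"
    using assms by (auto simp: incl_diff[symmetric] red_diff)
  finally show ?thesis by (auto simp: bit_poly_add_eq_0)
qed

text \<open>By anisotropy an element of \<open>L\<close> on which \<open>\<rho>\<close> vanishes is
  in the radical, so polynomial identities between values of \<open>\<rho>\<close> decide which
  elements are zero. The augmentation enters in the last case, \<open>\<rho> e0 = 1\<close>.\<close>

lemma anisotropic_exponent_two:
  fixes E :: "(int poly, 'v::ab_group_add, rat poly) pform"
  assumes E: "form E" and N: "tors 2 E" and an: "anisotropic E" and me: "Z.metabolic (epsf E)"
  shows "tors 1 E"
proof -
  note H = form_herm[OF E]
  note md = herm_module[OF H] and F = herm_subm[OF H] and R = subm_rad[OF H]
  define L where "L = saturation E (mult_mod 1 E)"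
  note L = satn_form[OF H, of 1, folded L_def]
  have bL: "bf E v w \<in> II" if "v \<in> L" "w \<in> L" for v w
    using bf_satn_mult_mod[OF H N] that by (simp add: L_def)
  have tL: "scal E 2 v \<in> rad E" if "v \<in> L" for v
    using two_satn_mult_mod[OF H N] that by (simp add: L_def)
  have LE: "v \<in> car E" if "v \<in> L" for v using that L(2) by blast
  have FL: "scal E 2 v \<in> L" if "v \<in> car E" for v
    using scal_mult_mod[OF H that, of 1] subset_satn[OF H mult_mod_subset] unfolding L_def by auto
  have anisotropic: "v \<in> rad E" if "v \<in> L" "redI (bf E v v) = 0" for v
    using an that redI_eq_0[OF bL[OF that(1,1)]] unfolding anisotropic_def L_def by blast
  define \<rho> where "\<rho> v = redI (bf E v v)" for v
  have \<rho>_add: "\<rho> (v + w) = \<rho> v + \<rho> w" if v: "v \<in> L" and w: "w \<in> L" for v w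
  proof -
    have "redI (bf E (v + w) (v + w)) = redI (bf E v v + bf E w w)"
      using v w by (intro redI_cong q_add_twoI[OF H] II_add bL subm_add[OF L(1)])
    then show ?thesis using bL v w by (simp add: \<rho>_def redI_add)
  qed
  have \<rho>_sc: "\<rho> (scal E r v) = (red r)\<^sup>2 * \<rho> v" if v: "v \<in> L" for r v
  proof -
    have "bf E (scal E r v) (scal E r v) = \<iota> (r * iv r) * bf E v v" by (simp add: q_sc[OF H] incl_mult)
    then show ?thesis
      using redI_mult[OF bL[OF v v]] by (simp add: \<rho>_def red_mult red_iv power2_eq_square del: range_ex1_eq)
  qed
  have \<rho>_rad: "\<rho> k = 0" if "k \<in> rad E" for k
    using formD(4)[OF E that] redI_eq_0[OF twoI_II] by (simp add: \<rho>_def)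
  have two_bf: "2 * bf E y l \<in> II" if "y \<in> car E" "l \<in> L" for y l
    using radD'[OF H tL[OF that(2)] that(1)] by (simp add: bf_sc_right[OF H])
  \<comment> \<open>For \<open>f\<close> equal to \<open>sq0\<close> or \<open>sq1\<close> the map
    \<open>f (\<rho> l)\<close> is linear in \<open>l\<close> over \<open>R/2R\<close>. Embedded as
    half-integral values it is pairing with some \<open>y\<close>; doubling recovers it modulo
    2.\<close>
  have functional: "\<exists>y\<in>car E. \<forall>l\<in>L. redI (2 * bf E y l) = f (\<rho> l)"
    if f: "\<And>p p'. f (p + p') = f p + f p'" "\<And>r p. f (r\<^sup>2 * p) = r * f p" for f
  proof -
    define h where "h l = hf * \<iota> (lft (f (\<rho> l)))" for l
    have f0: "f 0 = 0" using f(1)[of 0 0] by simp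
    have "homI (scal E) L h"
      unfolding homI_def
    proof (intro conjI ballI allI)
      fix v w assume v: "v \<in> L" and w: "w \<in> L"
      have "hf * \<iota> (lft (f (\<rho> (v + w)))) - (h v + h w) \<in> II"
        by (subst half_lft_II)
          (simp_all add: h_def distrib_left \<rho>_add[OF v w] f incl_add[symmetric] red_add)
      then show "h (v + w) - h v - h w \<in> II" by (simp add: h_def diff_diff_eq)
    next
      fix r v assume v: "v \<in> L"
      have *: "2 * (\<iota> r * h v) = \<iota> (r * lft (f (\<rho> v)))" by (simp add: h_def incl_mult mult.left_commute)
      have "hf * \<iota> (lft (f (\<rho> (scal E r v)))) - \<iota> r * h v \<in> II"
        by (subst half_lft_II) (simp_all only: * II_incl redI_incl red_mult red_lft \<rho>_sc[OF v] f)
      then show "h (scal E r v) - \<iota> r * h v \<in> II" by (simp add: h_def)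
    qed
    moreover have "\<forall>k\<in>rad E. h k \<in> II" by (simp add: h_def \<rho>_rad f0 del: range_ex1_eq)
    ultimately obtain y where y: "y \<in> car E" "\<forall>l\<in>L. h l - bf E y l \<in> II"
      using form_extend[OF E L] by blast
    have "redI (2 * bf E y l) = f (\<rho> l)" if "l \<in> L" for l
      using y(2) that half_lft_II[OF two_bf[OF y(1) that], of "f (\<rho> l)"] unfolding h_def by blast
    then show ?thesis using y(1) by blast
  qed
  obtain y0 where y0: "y0 \<in> car E" "\<And>l. l \<in> L \<Longrightarrow> redI (2 * bf E y0 l) = sq0 (\<rho> l)"
    using functional[of sq0, OF sq0_add sq0_mult] by blast
  obtain y1 where y1: "y1 \<in> car E" "\<And>l. l \<in> L \<Longrightarrow> redI (2 * bf E y1 l) = sq1 (\<rho> l)"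
    using functional[of sq1, OF sq1_add sq1_mult] by blast
  define e0 where "e0 = scal E 2 y0"
  define e1 where "e1 = scal E 2 y1"
  have e: "e0 \<in> L" "e1 \<in> L" using FL y0 y1 by (auto simp: e0_def e1_def)
  have four: "bf E (scal E 2 x) (scal E 2 y) = 2 * bf E x (scal E 2 y)" for x y
    by (simp add: bf_sc_left[OF H])
  \<comment> \<open>\<open>q(e0) = b(2 y0, 2 y0) = 2 b(y0, e0)\<close>, and by the choice of
    \<open>y0\<close> this reduces to \<open>sq0 (\<rho> e0)\<close>.\<close>
  have \<rho>0: "\<rho> e0 = sq0 (\<rho> e0)" using y0(2)[OF e(1)] unfolding \<rho>_def e0_def four by simp
  have \<rho>1: "\<rho> e1 = sq1 (\<rho> e1)" using y1(2)[OF e(2)] unfolding \<rho>_def e1_def four by simp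
  \<comment> \<open>Conjugation is trivial modulo 2, so \<open>b\<close> is symmetric there; this
    equates the two mixed values.\<close>
  have "redI (bf E e1 e0) = redI (bf E e0 e1)"
    using redI_cj[OF bL[OF e]] bf_cj[OF H, of e1 e0] by simp
  then have \<gamma>: "sq1 (\<rho> e0) = sq0 (\<rho> e1)"
    using y1(2)[OF e(1)] y0(2)[OF e(2)] unfolding e0_def e1_def four by simp
  have "sqt (sq0 (\<rho> e1)) (\<rho> e1) = \<rho> e1" using sqt_sq[of "\<rho> e1"] \<rho>1 by simp
  note c = sqt_self_right[OF this]
  have "sqt (\<rho> e0) 0 = \<rho> e0" using sqt_sq[of "\<rho> e0"] \<rho>0 \<gamma> c by simp
  then have a: "\<rho> e0 = 0 \<or> \<rho> e0 = 1" by (rule sqt_self_left)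
  \<comment> \<open>A vector killed by 2 pairs integrally with \<open>2M\<close>, hence with its
    saturation \<open>L\<close>, and so it represents the zero functional.\<close>
  have vanish: "redI (2 * bf E y l) = 0" if y: "y \<in> car E" "scal E 2 y \<in> rad E" and l: "l \<in> L" for y l
  proof -
    obtain f where f: "\<not> 2 dvd f" "scal E f l \<in> mult_mod 1 E" "l \<in> car E"
      using l unfolding L_def by (rule saturationE)
    obtain w z where wz: "w \<in> car E" "z \<in> rad E" "scal E f l = scal E (2 ^ 1) w + z"
      using f(2) by (rule mult_modE[OF H])
    have "bf E (scal E 2 y) w + bf E y z \<in> II"
      using radD[OF H y(2) wz(1)] radD'[OF H wz(2) y(1)] by (rule II_add)
    then have "bf E y (scal E f l) \<in> II"
      by (simp add: wz(3) bf_add_right[OF H] bf_sc_left[OF H] bf_sc_right[OF H])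
    then have "bf E y l \<in> II" by (rule bf_sat[OF H N y(1) f(3,1)])
    then have "2 * bf E y l \<in> twoI" by (simp add: twoI_iff)
    then show ?thesis using redI_eq_0[OF two_bf[OF y(1) l]] by simp
  qed
  have "e1 \<in> rad E" using anisotropic[OF e(2)] c(2) by (simp add: \<rho>_def)
  then have sq1: "sq1 (\<rho> l) = 0" if "l \<in> L" for l
    using vanish[OF y1(1) _ that] y1(2)[OF that] by (simp add: e1_def)
  show ?thesis
  proof (cases "\<rho> e0 = 0")
    case True
    then have "e0 \<in> rad E" using anisotropic[OF e(1)] by (simp add: \<rho>_def)
    then have "sq0 (\<rho> l) = 0" if "l \<in> L" for l
      using vanish[OF y0(1) _ that] y0(2)[OF that] by (simp add: e0_def)
    then have "\<rho> l = 0" if "l \<in> L" for l using sqt_sq[of "\<rho> l"] sq1[OF that] that sqt_eq_0[of 0 0] by simp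
    then have "L \<subseteq> rad E" using anisotropic by (auto simp: \<rho>_def)
    then show ?thesis using FL by (auto simp: tors_def)
  next
    case False
    then have one: "\<rho> e0 = 1" using a by simp
    note HZ = herm_epsf[OF E]
    \<comment> \<open>Since \<open>sq1\<close> vanishes, \<open>\<rho> l\<close> is the square of
      \<open>sq0 (\<rho> l)\<close>, and since \<open>\<rho> e0 = 1\<close> subtracting that
      multiple of \<open>e0\<close> kills \<open>\<rho>\<close>. Anisotropy leaves an element of the
      radical.\<close>
    have mod_e0: "l - scal E (lft (sq0 (\<rho> l))) e0 \<in> rad E" if l: "l \<in> L" for l
    proof -
      let ?r = "lft (sq0 (\<rho> l))"
      have "scal E (- ?r) e0 \<in> L" using subm_sc[OF L(1) e(1)] .
      then have m: "l + scal E (- ?r) e0 \<in> L" using subm_add[OF L(1) l] by blast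
      have "sq0 (\<rho> (l + scal E (- ?r) e0)) = 0"
        using \<rho>0 one by (simp add: \<rho>_add[OF l \<open>scal E (- ?r) e0 \<in> L\<close>] \<rho>_sc[OF e(1)] sq0_add red_diff[of 0 ?r, simplified]
          sq0_mult[of _ 1, simplified])
      then have "\<rho> (l + scal E (- ?r) e0) = 0"
        using sqt_sq[of "\<rho> (l + scal E (- ?r) e0)"] sq1[OF m] sqt_eq_0[of 0 0] by simp
      then have "l + scal E (- ?r) e0 \<in> rad E" using anisotropic[OF m] by (simp add: \<rho>_def)
      then show ?thesis by (simp add: Modules.module.scale_minus_left[OF md])
    qed
    obtain \<Lambda> where \<Lambda>: "Z.lagr (epsf E) \<Lambda>" using me by (auto simp: Z.metabolic_def)
    have LL: "subm (scal (epsf E)) \<Lambda>" "\<Lambda> \<subseteq> car E" "\<Lambda> = Z.perp (epsf E) \<Lambda>"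
      and qL: "\<And>x. x \<in> \<Lambda> \<Longrightarrow> bf (epsf E) x x \<in> Z.twoI"
      using \<Lambda> by (auto simp: Z.lagr_def)
    have rZ: "Z.rad (epsf E) \<subseteq> \<Lambda>" using Z.rad_subset_perp[OF HZ, of \<Lambda>] LL(2,3) by simp
    have e0E: "e0 \<in> car E" using LE e by blast
    \<comment> \<open>At \<open>t = 0\<close> the value \<open>q(e0)\<close> is odd, while
      \<open>q\<close> is even on a Lagrangian.\<close>
    have e0n: "e0 \<notin> \<Lambda>"
    proof
      assume "e0 \<in> \<Lambda>"
      then have *: "poly (bf E e0 e0) 0 \<in> Z.twoI" using qL by fastforce
      obtain r where r: "bf E e0 e0 = \<iota> r" using bL[OF e(1,1)] by auto
      then have "red r = 1" using one by (simp add: \<rho>_def)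
      then have "of_int (poly.coeff r 0) = (1 :: bit)" using coeff_red[of r 0] by simp
      then have "odd (poly.coeff r 0)" using of_int_bit_eq_0[of "poly.coeff r 0"] by auto
      moreover obtain k where "poly (bf E e0 e0) 0 = 2 * of_int k" using * by (auto simp: Z.twoI_def Z_incl)
      then have "(of_int (poly.coeff r 0) :: rat) = of_int (2 * k)" using poly_incl_0[of r] by (simp add: r) (simp add: poly_0_coeff_0)
      then have "poly.coeff r 0 = 2 * k" by (simp only: of_int_eq_iff)
      ultimately show False by simp
    qed
    then have "\<exists>l\<in>\<Lambda>. poly (bf E e0 l) 0 \<notin> Z.II"
      using LL(3) e0E Z.perpI[OF HZ, of e0 \<Lambda>] by auto
    then obtain l where l: "l \<in> \<Lambda>" "poly (bf E e0 l) 0 \<notin> Z.II" by blast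
    have lE: "l \<in> car E" using l LL(2) by blast
    \<comment> \<open>\<open>2l\<close> lies in \<open>L\<close>, hence is congruent to
      \<open>r e0\<close>; the parity of \<open>r(0)\<close> separates two contradictions.\<close>
    define r where "r = lft (sq0 (\<rho> (scal E 2 l)))"
    have k: "scal E 2 l - scal E r e0 \<in> rad E" unfolding r_def using mod_e0[OF FL[OF lE]] .
    have sub: "v - w \<in> \<Lambda>" if "v \<in> \<Lambda>" "w \<in> \<Lambda>" for v w
      using subm_diff[OF Z.herm_module[OF HZ] LL(1)] that by blast
    show ?thesis
    proof (cases "even (poly r 0)")
      case True
      \<comment> \<open>Up to conjugation \<open>b(e0, l)\<close> is \<open>b(2l, y0)\<close>, which
        is \<open>b(e0, y0)\<close> times a scalar with value \<open>2j\<close> at 0. Since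
        \<open>2 e0\<close> is in the radical, \<open>2 b(e0, y0)\<close> is integral, against the
        choice of \<open>l\<close>.\<close>
      then obtain j where j: "poly r 0 = 2 * j" by (auto elim: evenE)
      have "bf E e0 l = cj (bf E l e0)" by (rule bf_cj[OF H])
      moreover have "bf E l e0 = bf E (scal E 2 l - scal E r e0) y0 + \<iota> (iv r) * bf E e0 y0"
        by (simp add: e0_def bf_diff_left[OF H] bf_sc_left[OF H] bf_sc_right[OF H])
      ultimately have eq: "poly (bf E e0 l) 0
          = poly (bf E (scal E 2 l - scal E r e0) y0) 0 + of_int j * poly (2 * bf E e0 y0) 0"
        by (simp add: j)
      have "2 * bf E e0 y0 \<in> II"
        using radD[OF H tL[OF e(1)] y0(1)] by (simp add: bf_sc_left[OF H])
      then have "poly (2 * bf E e0 y0) 0 \<in> Z.II" by (rule poly_0_II)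
      then have "of_int j * poly (2 * bf E e0 y0) 0 \<in> Z.II" using Z.II_mult[of _ j] by (simp add: Z_incl)
      then have "poly (bf E e0 l) 0 \<in> Z.II"
        unfolding eq by (intro Z.II_add poly_0_II radD[OF H k y0(1)])
      then show ?thesis using l(2) by blast
    next
      case False
      \<comment> \<open>\<open>2l\<close> and the radical at \<open>t = 0\<close> lie in
        \<open>\<Lambda>\<close>, hence so does \<open>r(0) e0\<close>. As \<open>2 e0\<close> is in
        the radical, \<open>e0\<close> would lie in \<open>\<Lambda>\<close>.\<close>
      then obtain j where j: "poly r 0 = 2 * j + 1" by (auto elim: oddE)
      have "scal (epsf E) 2 l \<in> \<Lambda>" using subm_sc[OF LL(1) l(1)] .
      then have 1: "scal E 2 l \<in> \<Lambda>" by (simp add: numeral_poly)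
      have "scal E 2 l - scal E r e0 \<in> \<Lambda>" using k rad_subset_epsf[OF E] rZ by blast
      from sub[OF 1 this] have "scal E r e0 \<in> \<Lambda>" by simp
      moreover have "scal E r e0 - scal E [:poly r 0:] e0 \<in> \<Lambda>"
        using scal_epsf_mod[OF E e0E] rZ by blast
      ultimately have "scal E [:poly r 0:] e0 \<in> \<Lambda>" using sub by fastforce
      moreover have "scal E [:j:] (scal E 2 e0) \<in> \<Lambda>"
        using subm_sc[OF R tL[OF e(1)]] rad_subset_epsf[OF E] rZ by blast
      moreover have "scal E [:poly r 0:] e0 - scal E [:j:] (scal E 2 e0) = e0"
      proof -
        have "[:poly r 0:] - [:j:] * 2 = (1 :: int poly)" by (simp add: j numeral_poly one_pCons)
        then have "scal E ([:poly r 0:] - [:j:] * 2) e0 = e0" by (simp only: Modules.module.scale_one[OF md])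
        then show ?thesis
          by (simp only: Modules.module.scale_left_diff_distrib[OF md] Modules.module.scale_scale[OF md])
      qed
      ultimately show ?thesis using sub e0n by metis
    qed
  qed
qed

text \<open>The reductions to exponent 4 and to an anisotropic form replace \<open>E\<close>, so
  metabolicity of the augmentation must be carried over: the difference of old and new form is
  metabolic, hence so is its augmentation, from which \<open>epsf E\<close> cancels.\<close>

theorem exponent_two_representative:
  assumes E: "form E" and me: "Z.metabolic (epsf E)"
  shows "\<exists>K. form (E\<lparr>car := K\<rparr>) \<and> tors 1 (E\<lparr>car := K\<rparr>) \<and> weq E (E\<lparr>car := K\<rparr>)"
proof -
  obtain K where K: "form (E\<lparr>car := K\<rparr>)" "tors 2 (E\<lparr>car := K\<rparr>)" "weq E (E\<lparr>car := K\<rparr>)"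
    using exponent_four[OF E] by blast
  obtain K' where K': "form (E\<lparr>car := K'\<rparr>)" "tors 2 (E\<lparr>car := K'\<rparr>)" "anisotropic (E\<lparr>car := K'\<rparr>)"
      "weq (E\<lparr>car := K\<rparr>) (E\<lparr>car := K'\<rparr>)"
    using anisotropic_reduction[OF K(1,2)] by auto
  have w: "weq E (E\<lparr>car := K'\<rparr>)" using weq_trans[OF E K(1) K'(1) K(3) K'(4)] .
  let ?E = "E\<lparr>car := K'\<rparr>"
  have "metabolic (psum ?E (pneg E))" using weq_sym[OF E K'(1) w] by (simp add: weq_def)
  then have "Z.metabolic (epsf (psum ?E (pneg E)))"
    using metabolic_epsf[OF form_psum[OF K'(1) form_pneg[OF E]]] by blast
  moreover have "epsf (psum ?E (pneg E)) = psum (epsf ?E) (pneg (epsf E))"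
    by (auto simp: epsf_def psum_def pneg_def fun_eq_iff split: prod.splits)
  ultimately have "Z.metabolic (psum (epsf ?E) (pneg (epsf E)))" by simp
  then have "Z.metabolic (epsf ?E)"
    by (rule Z.metabolic_cancel[OF form_epsf[OF K'(1)] Z.form_pneg[OF form_epsf[OF E]]
          _ Z.metabolic_pneg[OF me]])
  then show ?thesis using anisotropic_exponent_two[OF K'(1,2,3)] K'(1) w by blast
qed

end

section \<open>Presentations of modules\<close>

abbreviation RR :: "'r::comm_ring_1 ring" where "RR \<equiv> ring_of_type_algebra"

lemma RR_simps [simp]:
  "carrier (RR :: 'r::comm_ring_1 ring) = UNIV" "add (RR :: 'r ring) = (+)" "monoid.mult (RR :: 'r ring) = (*)"
  "zero (RR :: 'r ring) = 0" "one (RR :: 'r ring) = 1"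
  by (auto simp: ring_of_type_algebra_def fun_eq_iff)

text \<open>Vectors live in an additive type while \<open>M\<close> may have any carrier;
  \<open>p\<close> translates computations in \<open>M\<close>, with values outside \<open>F\<close>
  left open.\<close>

definition mpres :: "('r::comm_ring_1 \<Rightarrow> 'v::ab_group_add \<Rightarrow> 'v) \<Rightarrow> 'v set \<Rightarrow> 'v set \<Rightarrow> ('v \<Rightarrow> 'a) \<Rightarrow>
    ('r, 'a, 'm) module_scheme \<Rightarrow> bool" where
  "mpres sc F K p M \<longleftrightarrow> p ` F = carrier M \<and>
     (\<forall>v\<in>F. \<forall>w\<in>F. p (v + w) = p v \<oplus>\<^bsub>M\<^esub> p w) \<and>
     (\<forall>r. \<forall>v\<in>F. p (sc r v) = r \<odot>\<^bsub>M\<^esub> p v) \<and>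
     (\<forall>v\<in>F. p v = \<zero>\<^bsub>M\<^esub> \<longleftrightarrow> v \<in> K)"

lemma comb_cong: "(\<And>i. i < n \<Longrightarrow> c i = d i) \<Longrightarrow> comb sc g n c = comb sc g n d"
  by (simp add: comb_def)

context
  fixes sc :: "'r::comm_ring_1 \<Rightarrow> 'v::ab_group_add \<Rightarrow> 'v" and F K p
    and M :: "('r, 'a, 'm) module_scheme"
  assumes md: "Modules.module sc" and F: "subm sc F" and K: "subm sc K" "K \<subseteq> F"
    and P: "mpres sc F K p M"
begin

lemma mpres_onto: "x \<in> carrier M \<Longrightarrow> \<exists>v\<in>F. x = p v"
  and mpres_add: "v \<in> F \<Longrightarrow> w \<in> F \<Longrightarrow> p (v + w) = p v \<oplus>\<^bsub>M\<^esub> p w"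
  and mpres_sc: "v \<in> F \<Longrightarrow> p (sc r v) = r \<odot>\<^bsub>M\<^esub> p v"
  and mpres_zero_iff: "v \<in> F \<Longrightarrow> p v = \<zero>\<^bsub>M\<^esub> \<longleftrightarrow> v \<in> K"
  and mpres_closed: "v \<in> F \<Longrightarrow> p v \<in> carrier M"
  using P unfolding mpres_def by blast+

lemma mpres_zero: "\<zero>\<^bsub>M\<^esub> = p 0"
  using mpres_zero_iff[of 0] subm_0[OF F] subm_0[OF K(1)] by simp

lemma mpres_abelian_group: "abelian_group M"
proof (rule abelian_groupI)
  fix x y assume "x \<in> carrier M" "y \<in> carrier M"
  then obtain v w where vw: "v \<in> F" "w \<in> F" "x = p v" "y = p w" using mpres_onto by blast
  show "x \<oplus>\<^bsub>M\<^esub> y \<in> carrier M"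
    using vw mpres_closed[OF subm_add[OF F vw(1,2)]] by (simp add: mpres_add)
  show "x \<oplus>\<^bsub>M\<^esub> y = y \<oplus>\<^bsub>M\<^esub> x"
    using vw mpres_add[of v w] mpres_add[of w v] by (simp add: add.commute)
  show "(x \<oplus>\<^bsub>M\<^esub> y) \<oplus>\<^bsub>M\<^esub> z = x \<oplus>\<^bsub>M\<^esub> (y \<oplus>\<^bsub>M\<^esub> z)" if z: "z \<in> carrier M" for z
  proof -
    obtain u where u: "u \<in> F" "z = p u" using mpres_onto[OF z] by blast
    have "p ((v + w) + u) = p (v + (w + u))" by (simp add: add.assoc)
    then show ?thesis
      using vw u subm_add[OF F] by (simp add: mpres_add)
  qed
next
  show "\<zero>\<^bsub>M\<^esub> \<in> carrier M" using mpres_closed[OF subm_0[OF F]] by (simp add: mpres_zero)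
  fix x assume "x \<in> carrier M"
  then obtain v where v: "v \<in> F" "x = p v" using mpres_onto by blast
  have zF: "0 \<in> F" using subm_0[OF F] .
  show "\<zero>\<^bsub>M\<^esub> \<oplus>\<^bsub>M\<^esub> x = x"
    using v mpres_add[OF zF v(1)] by (simp add: mpres_zero)
  have "- v \<in> F" using subm_minus[OF md F v(1)] .
  then show "\<exists>y\<in>carrier M. y \<oplus>\<^bsub>M\<^esub> x = \<zero>\<^bsub>M\<^esub>"
    using mpres_closed[of "- v"] mpres_add[of "- v" v] v by (auto simp: mpres_zero)
qed

lemma mpres_module: "module RR M"
proof (rule moduleI)
  fix x and a b :: 'r assume "x \<in> carrier M"
  then obtain v where v: "v \<in> F" "x = p v" using mpres_onto by blast
  note s = subm_sc[OF F v(1)]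
  show "a \<odot>\<^bsub>M\<^esub> x \<in> carrier M" using mpres_closed[OF s[of a]] v by (simp add: mpres_sc)
  show "(a \<oplus>\<^bsub>RR\<^esub> b) \<odot>\<^bsub>M\<^esub> x = a \<odot>\<^bsub>M\<^esub> x \<oplus>\<^bsub>M\<^esub> b \<odot>\<^bsub>M\<^esub> x"
    using mpres_sc[OF v(1), of "a + b"] mpres_add[OF s[of a] s[of b]]
    by (simp add: v Modules.module.scale_left_distrib[OF md] mpres_sc[OF v(1)])
  show "(a \<otimes>\<^bsub>RR\<^esub> b) \<odot>\<^bsub>M\<^esub> x = a \<odot>\<^bsub>M\<^esub> (b \<odot>\<^bsub>M\<^esub> x)"
    using mpres_sc[OF v(1), of "a * b"] mpres_sc[OF s[of b], of a]
    by (simp add: v Modules.module.scale_scale[OF md] mpres_sc[OF v(1)])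
  show "\<one>\<^bsub>RR\<^esub> \<odot>\<^bsub>M\<^esub> x = x"
    using mpres_sc[OF v(1), of 1] by (simp add: v Modules.module.scale_one[OF md])
  show "a \<odot>\<^bsub>M\<^esub> (x \<oplus>\<^bsub>M\<^esub> y) = a \<odot>\<^bsub>M\<^esub> x \<oplus>\<^bsub>M\<^esub> a \<odot>\<^bsub>M\<^esub> y" if y: "y \<in> carrier M" for y
  proof -
    obtain w where w: "w \<in> F" "y = p w" using mpres_onto[OF y] by blast
    have "p (sc a (v + w)) = p (sc a v + sc a w)" by (simp add: Modules.module.scale_right_distrib[OF md])
    then show ?thesis
      using v w subm_add[OF F v(1) w(1)] s[of a] subm_sc[OF F w(1), of a] by (simp add: mpres_sc mpres_add)
  qed
qed (use mpres_abelian_group in auto)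

lemma mpres_eq_iff:
  assumes v: "v \<in> F" and w: "w \<in> F"
  shows "p v = p w \<longleftrightarrow> v - w \<in> K"
proof -
  interpret abelian_group M by (rule mpres_abelian_group)
  have d: "v - w \<in> F" using subm_diff[OF md F v w] .
  have "p v = p (v - w) \<oplus>\<^bsub>M\<^esub> p w" using mpres_add[OF d w] by simp
  then have "p v = p w \<longleftrightarrow> p (v - w) = \<zero>\<^bsub>M\<^esub>"
    using mpres_closed d w by (metis l_zero add.r_cancel zero_closed)
  then show ?thesis using mpres_zero_iff[OF d] by simp
qed

lemma mpres_minus: "v \<in> F \<Longrightarrow> p (- v) = \<ominus>\<^bsub>M\<^esub> p v"
proof -
  interpret abelian_group M by (rule mpres_abelian_group)
  assume v: "v \<in> F"
  have n: "- v \<in> F" using subm_minus[OF md F v] .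
  have "p (- v) \<oplus>\<^bsub>M\<^esub> p v = \<zero>\<^bsub>M\<^esub>" using mpres_add[OF n v] by (simp add: mpres_zero)
  then show ?thesis using mpres_closed n v by (simp add: minus_equality)
qed

lemma mpres_add_pow: "v \<in> F \<Longrightarrow> p (sc (of_nat k) v) = add_pow M k (p v)"
proof (induction k)
  case 0
  then show ?case by (simp add: mpres_zero add_pow_def nat_pow_def Modules.module.scale_zero_left[OF md])
next
  case (Suc k)
  interpret abelian_group M by (rule mpres_abelian_group)
  have "sc (of_nat (Suc k)) v = sc (of_nat k) v + v"
    by (simp add: Modules.module.scale_left_distrib[OF md] Modules.module.scale_one[OF md] add.commute)
  then show ?case using Suc subm_sc[OF F Suc.prems] by (simp add: mpres_add)
qed

lemma mpres_two_power_torsion: "two_power_torsion n M \<longleftrightarrow> (\<forall>v\<in>F. sc (2 ^ n) v \<in> K)"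
proof -
  have "add_pow M ((2 :: nat) ^ n) (p v) = \<zero>\<^bsub>M\<^esub> \<longleftrightarrow> sc (2 ^ n) v \<in> K" if v: "v \<in> F" for v
    using mpres_add_pow[OF v, of "2 ^ n"] mpres_zero_iff[OF subm_sc[OF F v], of "2 ^ n"] by simp
  moreover have "carrier M = p ` F" using P by (simp add: mpres_def)
  ultimately show ?thesis by (simp add: two_power_torsion_def)
qed

context
  fixes U assumes U: "subm sc U" "U \<subseteq> F" "K \<subseteq> U"
begin

lemma mpres_image_iff:
  assumes v: "v \<in> F"
  shows "p v \<in> p ` U \<longleftrightarrow> v \<in> U"
proof
  assume "p v \<in> p ` U"
  then obtain u where u: "u \<in> U" "p v = p u" by blast
  then have "v - u \<in> K" using mpres_eq_iff[OF v] U(2) by blast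
  then show "v \<in> U" using subm_diff_iff[OF md U(1), of v u] U(3) u by blast
qed simp

lemma mpres_coset:
  assumes v: "v \<in> F"
  shows "p ` U +>\<^bsub>M\<^esub> p v = p ` {w \<in> F. w - v \<in> U}"
proof -
  have "p ` U +>\<^bsub>M\<^esub> p v = (\<lambda>u. p (u + v)) ` U"
    using U(2) v by (auto simp: a_r_coset_def' mpres_add subset_iff)
  also have "\<dots> = p ` (\<lambda>u. u + v) ` U" by (simp add: image_image)
  also have "(\<lambda>u. u + v) ` U = {w \<in> F. w - v \<in> U}"
  proof (intro equalityI subsetI)
    fix w assume "w \<in> {w \<in> F. w - v \<in> U}"
    then have "w = (w - v) + v" "w - v \<in> U" by auto
    then show "w \<in> (\<lambda>u. u + v) ` U" by (rule image_eqI)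
  qed (use U(2) v subm_add[OF F] in auto)
  finally show ?thesis .
qed

lemma mpres_coset_eq_iff:
  assumes v: "v \<in> F" and w: "w \<in> F"
  shows "p ` U +>\<^bsub>M\<^esub> p v = p ` U +>\<^bsub>M\<^esub> p w \<longleftrightarrow> v - w \<in> U"
proof
  assume eq: "p ` U +>\<^bsub>M\<^esub> p v = p ` U +>\<^bsub>M\<^esub> p w"
  have "v \<in> {v' \<in> F. v' - v \<in> U}" using v subm_0[OF U(1)] by simp
  then have "p v \<in> p ` U +>\<^bsub>M\<^esub> p v" unfolding mpres_coset[OF v] by blast
  then obtain w' where w': "w' \<in> F" "w' - w \<in> U" "p v = p w'" unfolding eq mpres_coset[OF w] by blast
  then have "v - w' \<in> U" using mpres_eq_iff[OF v w'(1)] U(3) by blast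
  from subm_add[OF U(1) this w'(2)] show "v - w \<in> U" by simp
next
  assume d: "v - w \<in> U"
  have "w' - v \<in> U \<longleftrightarrow> w' - w \<in> U" for w'
    using subm_diff_iff[OF md U(1), of "w' - w" "w' - v"] d by simp
  then show "p ` U +>\<^bsub>M\<^esub> p v = p ` U +>\<^bsub>M\<^esub> p w" by (simp add: mpres_coset v w)
qed

lemma mpres_coset_add:
  assumes v: "v \<in> F" and w: "w \<in> F"
  shows "set_add M (p ` U +>\<^bsub>M\<^esub> p v) (p ` U +>\<^bsub>M\<^esub> p w) = p ` U +>\<^bsub>M\<^esub> p (v + w)"
proof -
  have "set_add M (p ` U +>\<^bsub>M\<^esub> p v) (p ` U +>\<^bsub>M\<^esub> p w)
      = (\<Union>a\<in>{w \<in> F. w - v \<in> U}. \<Union>b\<in>{v \<in> F. v - w \<in> U}. {p (a + b)})"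
    unfolding set_add_def' mpres_coset[OF v] mpres_coset[OF w] by (auto simp: mpres_add)
  also have "\<dots> = p ` {x \<in> F. x - (v + w) \<in> U}"
  proof (intro equalityI subsetI)
    fix x assume "x \<in> (\<Union>a\<in>{w \<in> F. w - v \<in> U}. \<Union>b\<in>{v \<in> F. v - w \<in> U}. {p (a + b)})"
    then obtain a b where ab: "a \<in> F" "a - v \<in> U" "b \<in> F" "b - w \<in> U" "x = p (a + b)" by blast
    have "a + b - (v + w) \<in> U" using subm_add[OF U(1) ab(2,4)] by (simp add: algebra_simps)
    then show "x \<in> p ` {x \<in> F. x - (v + w) \<in> U}" using ab subm_add[OF F ab(1,3)] by blast
  next
    fix x assume "x \<in> p ` {x \<in> F. x - (v + w) \<in> U}"
    then obtain y where y: "y \<in> F" "y - (v + w) \<in> U" "x = p y" by blast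
    have "y - w \<in> F" using subm_diff[OF md F y(1) w] .
    moreover have "y - w - v \<in> U" "y - w + w = y" using y(2) by (simp_all add: algebra_simps)
    ultimately have "y - w \<in> {w \<in> F. w - v \<in> U}" "w \<in> {v \<in> F. v - w \<in> U}" "x \<in> {p (y - w + w)}"
      using y(3) w subm_0[OF U(1)] by simp_all
    then show "x \<in> (\<Union>a\<in>{w \<in> F. w - v \<in> U}. \<Union>b\<in>{v \<in> F. v - w \<in> U}. {p (a + b)})" by blast
  qed
  finally show ?thesis by (simp add: mpres_coset subm_add[OF F v w])
qed

lemma mpres_coset_induced:
  assumes v: "v \<in> F"
  shows "induced M (p ` U) (\<lambda>x. r \<odot>\<^bsub>M\<^esub> x) (p ` U +>\<^bsub>M\<^esub> p v) = p ` U +>\<^bsub>M\<^esub> p (sc r v)"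
proof -
  have "p ` U +>\<^bsub>M\<^esub> (r \<odot>\<^bsub>M\<^esub> p w) = p ` U +>\<^bsub>M\<^esub> p (sc r v)" if w: "w \<in> F" "w - v \<in> U" for w
  proof -
    have "sc r w - sc r v \<in> U"
      using subm_sc[OF U(1) w(2), of r] by (simp add: Modules.module.scale_right_diff_distrib[OF md])
    then show ?thesis
      using mpres_coset_eq_iff[OF subm_sc[OF F w(1)] subm_sc[OF F v]] by (simp add: mpres_sc[OF w(1)])
  qed
  moreover have "v \<in> {w \<in> F. w - v \<in> U}" using v subm_0[OF U(1)] by simp
  ultimately show ?thesis unfolding induced_def mpres_coset[OF v] by blast
qed

lemma mpres_rcosets: "a_rcosets\<^bsub>M\<^esub> (p ` U) = (\<lambda>v. p ` U +>\<^bsub>M\<^esub> p v) ` F"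
proof -
  have "carrier M = p ` F" using P by (simp add: mpres_def)
  then show ?thesis by (auto simp: A_RCOSETS_def')
qed

lemma mpres_submodule: "submodule (p ` U) RR M"
proof -
  interpret Module.module RR M by (rule mpres_module)
  have UF: "u \<in> F" if "u \<in> U" for u using that U(2) by blast
  show ?thesis
  proof (rule submoduleI)
    show "p ` U \<subseteq> carrier M" using mpres_closed UF by blast
    show "\<zero>\<^bsub>M\<^esub> \<in> p ` U" using subm_0[OF U(1)] by (simp add: mpres_zero)
    show "\<ominus>\<^bsub>M\<^esub> a \<in> p ` U" if a: "a \<in> p ` U" for a
    proof -
      obtain u where u: "u \<in> U" "a = p u" using a by blast
      then show ?thesis using subm_minus[OF md U(1) u(1)] mpres_minus[OF UF[OF u(1)]] by (metis imageI)
    qed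
    show "a \<oplus>\<^bsub>M\<^esub> b \<in> p ` U" if a: "a \<in> p ` U" and b: "b \<in> p ` U" for a b
    proof -
      obtain u u' where u: "u \<in> U" "a = p u" "u' \<in> U" "b = p u'" using a b by blast
      then show ?thesis using subm_add[OF U(1) u(1,3)] mpres_add[OF UF[OF u(1)] UF[OF u(3)]] by (metis imageI)
    qed
    show "r \<odot>\<^bsub>M\<^esub> a \<in> p ` U" if a: "a \<in> p ` U" for r a
    proof -
      obtain u where u: "u \<in> U" "a = p u" using a by blast
      then show ?thesis using subm_sc[OF U(1) u(1)] mpres_sc[OF UF[OF u(1)]] by (metis imageI)
    qed
  qed
qed

text \<open>A further quotient keeps the vectors and enlarges the submodule of relations.\<close>

lemma mpres_quot: "mpres sc F U (\<lambda>v. p ` U +>\<^bsub>M\<^esub> p v) (quot_module M (p ` U))"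
proof -
  have z: "p ` U = p ` U +>\<^bsub>M\<^esub> p 0"
    unfolding mpres_coset[OF subm_0[OF F]] using U(2) by (auto intro!: arg_cong[where f = "image p"])
  have "p ` U +>\<^bsub>M\<^esub> p v = p ` U \<longleftrightarrow> v \<in> U" if v: "v \<in> F" for v
    using mpres_coset_eq_iff[OF v subm_0[OF F]] z by simp
  then show ?thesis
    unfolding mpres_def
    by (auto simp: quot_module_def quot_add_def ring.defs module.defs mpres_rcosets mpres_coset_add mpres_coset_induced)
qed

end

end

section \<open>Length one from a saturated kernel\<close>

lemma free_module_simps:
  "carrier (free_module (RR :: 'r::comm_ring_1 ring) n) = {..<n} \<rightarrow>\<^sub>E UNIV"
  "c \<oplus>\<^bsub>free_module (RR :: 'r ring) n\<^esub> d = (\<lambda>i\<in>{..<n}. c i + d i)"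
  "r \<odot>\<^bsub>free_module (RR :: 'r ring) n\<^esub> c = (\<lambda>i\<in>{..<n}. r * c i)"
  by (simp_all add: free_module_def)

context two_euclidean
begin

text \<open>The basis of relations found by \<open>resolution\<close>, rewritten from sequences
  modulo tails to extensional functions on \<open>{..<n}\<close>; both free modules have rank
  \<open>n\<close>.\<close>

lemma mpres_length_one:
  fixes sc :: "'r \<Rightarrow> 'v::ab_group_add \<Rightarrow> 'v" and M :: "('r, 'a, 'm) module_scheme"
  assumes md: "Modules.module sc" and F: "subm sc F" and K: "subm sc K" "K \<subseteq> F"
    and P: "mpres sc F K p M" and sat: "saturated sc F K"
    and g: "range g \<subseteq> F" and gen: "\<forall>v\<in>F. \<exists>c. v - comb sc g n c \<in> K"
    and pow: "\<forall>v\<in>F. sc (2 ^ N) v \<in> K"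
  shows "length_one RR M"
proof -
  obtain \<phi> \<psi> where q: "quasi_iso n N \<phi> \<psi>" and rg: "range \<phi> = {c. comb sc g n c \<in> K}"
    using resolution[OF md F K(1) sat g pow] by blast
  note 1 = quasi_isoD[OF q]
  \<comment> \<open>Extensional functions are \<open>undefined\<close> beyond \<open>n\<close>;
    padding by 0 turns them into sequences in a linear way.\<close>
  define ext where "ext c = (\<lambda>i. if i < n then c i else 0)" for c :: "nat \<Rightarrow> 'r"
  let ?Fr = "free_module (RR :: 'r ring) n"
  note cF = free_module_simps(1)[where 'r = 'r] and aF = free_module_simps(2)[where 'r = 'r]
    and sF = free_module_simps(3)[where 'r = 'r]
  have ext_add: "ext (c \<oplus>\<^bsub>?Fr\<^esub> d) = ext c + ext d" for c d by (auto simp: ext_def aF fun_eq_iff)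
  have ext_sc: "ext (r \<odot>\<^bsub>?Fr\<^esub> c) = fsc r (ext c)" for r c by (auto simp: ext_def sF fun_eq_iff fsc_apply)
  have comb_ext: "comb sc g n (ext c) = comb sc g n c" for c by (rule comb_cong) (simp add: ext_def)
  have rF: "restrict c {..<n} \<in> carrier ?Fr" for c by (simp add: cF)
  have inF: "comb sc g n c \<in> F" for c using comb_in[OF F g] .
  define i where "i = (\<lambda>c\<in>carrier ?Fr. restrict (\<phi> (ext c)) {..<n})"
  define p' where "p' = (\<lambda>c\<in>carrier ?Fr. p (comb sc g n c))"
  have aC: "c \<oplus>\<^bsub>?Fr\<^esub> d \<in> carrier ?Fr" and sC: "r \<odot>\<^bsub>?Fr\<^esub> c \<in> carrier ?Fr" for r c d
    by (simp_all add: aF sF cF)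
  have "i \<in> mod_hom RR ?Fr ?Fr"
    unfolding mod_hom_def
  proof (intro CollectI conjI ballI)
    show "i \<in> carrier ?Fr \<rightarrow>\<^sub>E carrier ?Fr" using rF by (auto simp: i_def)
    show "i (c \<oplus>\<^bsub>?Fr\<^esub> d) = i c \<oplus>\<^bsub>?Fr\<^esub> i d" if "c \<in> carrier ?Fr" "d \<in> carrier ?Fr" for c d
      using that aC by (simp add: i_def ext_add lin_add[OF 1(1)]) (auto simp: aF fun_eq_iff)
    show "i (r \<odot>\<^bsub>?Fr\<^esub> c) = r \<odot>\<^bsub>?Fr\<^esub> i c" if "c \<in> carrier ?Fr" for r c
      using that sC by (simp add: i_def ext_sc lin_fsc[OF 1(1)]) (auto simp: sF fsc_apply fun_eq_iff)
  qed
  moreover have "p' \<in> mod_hom RR ?Fr M"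
    unfolding mod_hom_def
  proof (intro CollectI conjI ballI)
    show "p' \<in> carrier ?Fr \<rightarrow>\<^sub>E carrier M" using mpres_closed[OF md F K P inF] by (auto simp: p'_def)
    show "p' (c \<oplus>\<^bsub>?Fr\<^esub> d) = p' c \<oplus>\<^bsub>M\<^esub> p' d" if "c \<in> carrier ?Fr" "d \<in> carrier ?Fr" for c d
    proof -
      have "comb sc g n (c \<oplus>\<^bsub>?Fr\<^esub> d) = comb sc g n c + comb sc g n d"
        using comb_add[OF md, of g n "ext c" "ext d"] comb_ext[of "c \<oplus>\<^bsub>?Fr\<^esub> d"]
        unfolding ext_add comb_ext by simp
      then show ?thesis using that aC mpres_add[OF md F K P inF inF] by (simp add: p'_def)
    qed
    show "p' (r \<odot>\<^bsub>?Fr\<^esub> c) = r \<odot>\<^bsub>M\<^esub> p' c" if "c \<in> carrier ?Fr" for r c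
    proof -
      have "comb sc g n (r \<odot>\<^bsub>?Fr\<^esub> c) = sc r (comb sc g n c)"
        using comb_fsc[OF md, of g n r "ext c"] comb_ext[of "r \<odot>\<^bsub>?Fr\<^esub> c"]
        unfolding ext_sc comb_ext by simp
      then show ?thesis using that sC mpres_sc[OF md F K P inF] by (simp add: p'_def)
    qed
  qed
  moreover have "inj_on i (carrier ?Fr)"
  proof (rule inj_onI)
    fix c d assume cd: "c \<in> carrier ?Fr" "d \<in> carrier ?Fr" "i c = i d"
    have "\<phi> (ext c) j = \<phi> (ext d) j" if "j < n" for j
      using fun_cong[OF cd(3), of j] cd(1,2) that by (simp add: i_def)
    then have "\<phi> (ext c - ext d) \<in> tail n" by (simp add: lin_diff[OF 1(1)] tail_def)
    then have "\<psi> (\<phi> (ext c - ext d)) \<in> tail n" using 1(6) by blast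
    then have "2 ^ N * ext c j = 2 ^ N * ext d j" if "j < n" for j
      using that by (simp add: 1(4) tail_def fsc_apply right_diff_distrib)
    then have "c j = d j" if "j < n" for j using that two_power_cancel[of N] by (fastforce simp: ext_def)
    then show "c = d" using cd(1,2) by (intro PiE_ext[of c "{..<n}" "\<lambda>_. UNIV"]) (auto simp: cF)
  qed
  moreover have "i ` carrier ?Fr = a_kernel ?Fr M p'"
  proof -
    have ker: "a_kernel ?Fr M p' = {c \<in> carrier ?Fr. comb sc g n c \<in> K}"
      by (auto simp: a_kernel_def' p'_def mpres_zero_iff[OF md F K P inF])
    have "i c \<in> a_kernel ?Fr M p'" if c: "c \<in> carrier ?Fr" for c
    proof -
      have "comb sc g n (i c) = comb sc g n (\<phi> (ext c))" by (rule comb_cong) (simp add: i_def c)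
      also have "\<dots> \<in> K" using rg by auto
      finally show ?thesis using rF c unfolding ker by (simp add: i_def)
    qed
    moreover have "c \<in> i ` carrier ?Fr" if c: "c \<in> carrier ?Fr" "comb sc g n c \<in> K" for c
    proof -
      have "ext c \<in> range \<phi>" unfolding rg using c(2) by (simp add: comb_ext)
      then obtain d where d: "ext c = \<phi> d" by (rule rangeE)
      have "ext (restrict d {..<n}) - d \<in> tail n" by (simp add: tail_def ext_def)
      then have "\<phi> (ext (restrict d {..<n}) - d) \<in> tail n" using 1(5) by blast
      then have e: "\<phi> (ext (restrict d {..<n})) j = ext c j" if "j < n" for j
        using that by (simp add: lin_diff[OF 1(1)] tail_def d)
      have "c = restrict (\<phi> (ext (restrict d {..<n}))) {..<n}"
      proof (rule PiE_ext[of c "{..<n}" "\<lambda>_. UNIV"])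
        show "c \<in> {..<n} \<rightarrow>\<^sub>E UNIV" using c(1) by (simp add: cF)
        show "restrict (\<phi> (ext (restrict d {..<n}))) {..<n} \<in> {..<n} \<rightarrow>\<^sub>E UNIV" by simp
        show "c j = restrict (\<phi> (ext (restrict d {..<n}))) {..<n} j" if "j \<in> {..<n}" for j
          using that e[of j] by (simp add: ext_def)
      qed
      then have "c = i (restrict d {..<n})" unfolding i_def using rF by simp
      then show ?thesis using rF by blast
    qed
    ultimately show ?thesis using ker by blast
  qed
  moreover have "p' ` carrier ?Fr = carrier M"
  proof (intro equalityI subsetI)
    fix x assume "x \<in> p' ` carrier ?Fr"
    then show "x \<in> carrier M" using mpres_closed[OF md F K P inF] by (auto simp: p'_def)
  next
    fix x assume "x \<in> carrier M"
    then obtain v where v: "v \<in> F" "x = p v" using mpres_onto[OF md F K P] by blast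
    obtain c where c: "v - comb sc g n c \<in> K" using gen v by blast
    have "comb sc g n (restrict c {..<n}) = comb sc g n c" by (rule comb_cong) simp
    then have "x = p' (restrict c {..<n})"
      using mpres_eq_iff[OF md F K P v(1) inF] c rF by (simp add: p'_def v(2))
    then show "x \<in> p' ` carrier ?Fr" using rF by blast
  qed
  ultimately show ?thesis unfolding length_one_def by blast
qed

end

section \<open>Presentations of linking forms\<close>

definition add_coset :: "'q::ab_group_add set \<Rightarrow> 'q \<Rightarrow> 'q set" where
  "add_coset H a = (\<lambda>h. h + a) ` H"

definition add_subgrp :: "'q::ab_group_add set \<Rightarrow> bool" where
  "add_subgrp H \<longleftrightarrow> 0 \<in> H \<and> (\<forall>a\<in>H. \<forall>b\<in>H. a - b \<in> H)"

lemma add_subgrpD: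
  assumes "add_subgrp H"
  shows "0 \<in> H" "a \<in> H \<Longrightarrow> b \<in> H \<Longrightarrow> a - b \<in> H" "a \<in> H \<Longrightarrow> - a \<in> H"
    "a \<in> H \<Longrightarrow> b \<in> H \<Longrightarrow> a + b \<in> H"
proof -
  show 1: "0 \<in> H" and 2: "a \<in> H \<Longrightarrow> b \<in> H \<Longrightarrow> a - b \<in> H" for a b
    using assms by (auto simp: add_subgrp_def)
  show 3: "a \<in> H \<Longrightarrow> - a \<in> H" for a using 2[OF 1] by simp
  show "a \<in> H \<Longrightarrow> b \<in> H \<Longrightarrow> a + b \<in> H" using 2[OF _ 3] by simp
qed

lemma mem_add_coset: "x \<in> add_coset H a \<longleftrightarrow> x - a \<in> H"
  unfolding add_coset_def by (auto intro: image_eqI[of _ _ "x - a"])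

lemma add_coset_self: "add_subgrp H \<Longrightarrow> a \<in> add_coset H a"
  by (simp add: mem_add_coset add_subgrpD)

lemma add_coset_eq_iff:
  assumes "add_subgrp H"
  shows "add_coset H a = add_coset H b \<longleftrightarrow> a - b \<in> H"
proof
  assume "add_coset H a = add_coset H b"
  then show "a - b \<in> H" using add_coset_self[OF assms, of a] by (simp add: mem_add_coset)
next
  assume ab: "a - b \<in> H"
  show "add_coset H a = add_coset H b"
    unfolding set_eq_iff mem_add_coset
  proof
    fix x
    show "x - a \<in> H \<longleftrightarrow> x - b \<in> H"
      using add_subgrpD(4)[OF assms _ ab, of "x - a"] add_subgrpD(2)[OF assms _ ab, of "x - b"] by auto
  qed
qed

lemma add_coset_0: "add_coset H 0 = H"
  by (simp add: add_coset_def)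

lemma rat_module_simps [simp]:
  "carrier (rat_module A) = UNIV" "add (rat_module A) = (+)" "zero (rat_module A) = 0"
  "module.smult (rat_module A) = (\<lambda>r a. incl A r * a)"
  by (simp_all add: rat_module_def ring.defs module.defs)

lemma rat_coset: "H +>\<^bsub>rat_module A\<^esub> a = add_coset H a"
  by (auto simp: a_r_coset_def' add_coset_def)

lemma rat_set_add:
  assumes "add_subgrp H"
  shows "set_add (rat_module A) (add_coset H a) (add_coset H b) = add_coset H (a + b)"
  unfolding set_add_def'
proof (intro equalityI subsetI)
  fix x assume "x \<in> (\<Union>h\<in>add_coset H a. \<Union>k\<in>add_coset H b. {h \<oplus>\<^bsub>rat_module A\<^esub> k})"
  then obtain h k where "h - a \<in> H" "k - b \<in> H" "x = h + k" by (auto simp: mem_add_coset)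
  then show "x \<in> add_coset H (a + b)"
    using add_subgrpD(4)[OF assms, of "h - a" "k - b"] by (simp add: mem_add_coset algebra_simps)
next
  fix x assume "x \<in> add_coset H (a + b)"
  then have "x - b \<in> add_coset H a" "b \<in> add_coset H b" "x = (x - b) + b"
    using add_subgrpD(1)[OF assms] by (simp_all add: mem_add_coset algebra_simps)
  then show "x \<in> (\<Union>h\<in>add_coset H a. \<Union>k\<in>add_coset H b. {h \<oplus>\<^bsub>rat_module A\<^esub> k})" by force
qed

text \<open>\<open>f\<close> is constant modulo \<open>H\<close> on the coset, so the union in
  \<open>induced\<close> collapses to a single coset.\<close>

lemma induced_add_coset:
  assumes "add_subgrp H'" and "\<And>h. h \<in> H' \<Longrightarrow> f (h + a) - f a \<in> H" and "add_subgrp H"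
  shows "induced (rat_module A) H f (add_coset H' a) = add_coset H (f a)"
proof -
  have "add_coset H (f x) = add_coset H (f a)" if "x \<in> add_coset H' a" for x
    using assms(2)[of "x - a"] that by (simp add: add_coset_eq_iff[OF assms(3)] mem_add_coset)
  then show ?thesis unfolding induced_def rat_coset using add_coset_self[OF assms(1), of a] by blast
qed

section \<open>Cosets of values and presentations of forms\<close>

context dyadic
begin

definition JJ :: "'q set" where "JJ = one_plus_star A"

text \<open>If \<open>a = 2r\<close> is self-conjugate, cancelling 2 gives \<open>iv r = r\<close>,
  so \<open>a = r + iv r\<close>. Conversely \<open>r + iv r\<close> is even because conjugation is
  trivial modulo 2.\<close>

lemma JJ_iff: "a \<in> JJ \<longleftrightarrow> a \<in> twoI \<and> cj a = a"
proof
  assume "a \<in> JJ"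
  then obtain r where a: "a = \<iota> (r + iv r)" by (auto simp: JJ_def one_plus_star_def)
  have "\<iota> r + cj (\<iota> r) \<in> twoI" by (rule twoI_cj) (rule II_incl)
  then show "a \<in> twoI \<and> cj a = a" by (simp add: a incl_add cj_incl cj_add iv_add add.commute)
next
  assume a: "a \<in> twoI \<and> cj a = a"
  then obtain r where r: "a = 2 * \<iota> r" by (auto simp: twoI_def)
  have "cj a = 2 * \<iota> (iv r)" by (simp add: r cj_mult cj_incl)
  then have "2 * \<iota> (iv r) = 2 * \<iota> r" using a r by simp
  then have "iv r = r" using q_two_cancel incl_eq_iff by blast
  then have "a = \<iota> (r + iv r)" by (simp only: r incl_add mult_2)
  then show "a \<in> JJ" by (auto simp: JJ_def one_plus_star_def)
qed

lemma add_subgrp_II: "add_subgrp II"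
  unfolding add_subgrp_def using II_0 II_diff by blast

lemma add_subgrp_JJ: "add_subgrp JJ"
  by (auto simp: add_subgrp_def JJ_iff cj_diff intro: twoI_diff)

lemma JJ_plus_cj: "a \<in> II \<Longrightarrow> a + cj a \<in> JJ"
  by (simp add: JJ_iff twoI_cj cj_add add.commute)

lemma JJ_mult: "a \<in> JJ \<Longrightarrow> \<iota> r * a * \<iota> (iv r) \<in> JJ"
  using twoI_mult[of a "r * iv r"] by (simp add: JJ_iff cj_mult cj_incl incl_mult mult_ac)

lemma JJ_II: "a \<in> JJ \<Longrightarrow> a \<in> II"
  by (simp add: JJ_iff twoI_II)

lemma induced_cj: "to_int_cosets A cj (add_coset II a) = add_coset II (cj a)"
  using II_cj by (intro induced_add_coset add_subgrp_II) (simp add: cj_add)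

lemma induced_id: "to_int_cosets A (\<lambda>a. a) (add_coset JJ a) = add_coset II a"
  using JJ_II by (intro induced_add_coset add_subgrp_II add_subgrp_JJ) simp

lemma induced_plus_cj: "to_ops_cosets A (\<lambda>a. a + cj a) (add_coset II a) = add_coset JJ (a + cj a)"
  unfolding JJ_def[symmetric]
proof (intro induced_add_coset add_subgrp_II add_subgrp_JJ)
  fix h assume "h \<in> II"
  from JJ_plus_cj[OF this] show "h + a + cj (h + a) - (a + cj a) \<in> JJ" by (simp add: cj_add algebra_simps)
qed

lemma induced_mult:
  "to_ops_cosets A (\<lambda>a. \<iota> r * a * \<iota> (iv r)) (add_coset JJ a) = add_coset JJ (\<iota> r * a * \<iota> (iv r))"
  unfolding JJ_def[symmetric]
proof (intro induced_add_coset add_subgrp_JJ)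
  fix h assume "h \<in> JJ"
  from JJ_mult[OF this] show "\<iota> r * (h + a) * \<iota> (iv r) - \<iota> r * a * \<iota> (iv r) \<in> JJ" by (simp add: algebra_simps)
qed

lemma int_carrier: "carrier (rat_mod_int A) = range (add_coset II)"
  by (auto simp: rat_mod_int_def quot_module_def quot_add_def ring.defs module.defs A_RCOSETS_def' rat_coset)

lemma int_add: "add_coset II a \<oplus>\<^bsub>rat_mod_int A\<^esub> add_coset II b = add_coset II (a + b)"
  by (simp add: rat_mod_int_def quot_module_def quot_add_def ring.defs module.defs rat_set_add[OF add_subgrp_II])

lemma int_zero: "\<zero>\<^bsub>rat_mod_int A\<^esub> = add_coset II 0"
  by (simp add: rat_mod_int_def quot_module_def quot_add_def ring.defs module.defs add_coset_0)

lemma int_smult: "r \<odot>\<^bsub>rat_mod_int A\<^esub> add_coset II a = add_coset II (\<iota> r * a)"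
proof -
  have "induced (rat_module A) II (\<lambda>x. \<iota> r * x) (add_coset II a) = add_coset II (\<iota> r * a)"
    using II_mult by (intro induced_add_coset add_subgrp_II) (simp add: algebra_simps)
  then show ?thesis by (simp add: rat_mod_int_def quot_module_def quot_add_def ring.defs module.defs)
qed

lemma ops_carrier: "carrier (rat_mod_ops A) = range (add_coset JJ)"
  by (auto simp: rat_mod_ops_def quot_add_def A_RCOSETS_def' rat_coset JJ_def)

lemma ops_add: "add_coset JJ a \<oplus>\<^bsub>rat_mod_ops A\<^esub> add_coset JJ b = add_coset JJ (a + b)"
  by (simp add: rat_mod_ops_def quot_add_def rat_set_add[OF add_subgrp_JJ, folded JJ_def])

lemma ops_zero: "\<zero>\<^bsub>rat_mod_ops A\<^esub> = add_coset JJ 0"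
  by (simp add: rat_mod_ops_def quot_add_def add_coset_0 JJ_def)

lemma ops_abelian_group: "abelian_group (rat_mod_ops A)"
proof (rule abelian_groupI)
  fix x assume "x \<in> carrier (rat_mod_ops A)"
  then obtain a where a: "x = add_coset JJ a" by (auto simp: ops_carrier)
  show "\<exists>y\<in>carrier (rat_mod_ops A). y \<oplus>\<^bsub>rat_mod_ops A\<^esub> x = \<zero>\<^bsub>rat_mod_ops A\<^esub>"
    by (intro bexI[of _ "add_coset JJ (- a)"]) (simp_all add: a ops_add ops_zero ops_carrier)
qed (auto simp: ops_carrier ops_add ops_zero add_ac)

lemma ops_minus: "add_coset JJ a \<ominus>\<^bsub>rat_mod_ops A\<^esub> add_coset JJ b = add_coset JJ (a - b)"
proof -
  interpret abelian_group "rat_mod_ops A" by (rule ops_abelian_group)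
  have "\<ominus>\<^bsub>rat_mod_ops A\<^esub> add_coset JJ b = add_coset JJ (- b)"
    by (rule minus_equality) (simp_all add: ops_add ops_zero ops_carrier)
  then show ?thesis by (simp add: a_minus_def ops_add)
qed

lemmas coI_eq = add_coset_eq_iff[OF add_subgrp_II]
  and coJ_eq = add_coset_eq_iff[OF add_subgrp_JJ]

definition presents :: "('r, 'v::ab_group_add, 'q) pform \<Rightarrow> ('v \<Rightarrow> 'a) \<Rightarrow> ('r, 'a, 'q) linking_form \<Rightarrow> bool" where
  "presents E p m \<longleftrightarrow> mpres (scal E) (car E) (rad E) p m \<and>
     (\<forall>v\<in>car E. \<forall>w\<in>car E. bil m (p v) (p w) = add_coset II (bf E v w)) \<and>
     (\<forall>v\<in>car E. quad m (p v) = add_coset JJ (bf E v v))"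

lemma presentsD:
  assumes "presents E p m"
  shows "mpres (scal E) (car E) (rad E) p m"
    "v \<in> car E \<Longrightarrow> w \<in> car E \<Longrightarrow> bil m (p v) (p w) = add_coset II (bf E v w)"
    "v \<in> car E \<Longrightarrow> quad m (p v) = add_coset JJ (bf E v v)"
  using assms by (simp_all add: presents_def)

lemma form_satd_rad: "form E \<Longrightarrow> saturated (scal E) (car E) (rad E)"
  using satd_perp[of E _ "car E"] formD(3)[of E] by (auto simp: rad_perp form_herm)

context
  fixes E :: "('r, 'v::ab_group_add, 'q) pform" and p and m :: "('r, 'a, 'q) linking_form"
  assumes E: "form E" and P: "presents E p m"
begin

private lemmas HE = form_herm[OF E]
private lemmas mdE = herm_module[OF HE]
private lemmas FE = herm_subm[OF HE]
private lemmas KE = subm_rad[OF HE]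
private lemmas KFE = rad_subset[OF HE]
private lemmas PM = presentsD(1)[OF P]
lemmas presents_closed = mpres_closed[OF mdE FE KE KFE PM]
lemmas presents_add = mpres_add[OF mdE FE KE KFE PM]
lemmas presents_scal = mpres_sc[OF mdE FE KE KFE PM]
lemmas presents_zero = mpres_zero[OF mdE FE KE KFE PM]
lemmas presents_zero_iff = mpres_zero_iff[OF mdE FE KE KFE PM]
lemmas presents_eq_iff = mpres_eq_iff[OF mdE FE KE KFE PM]
lemmas presents_bil = presentsD(2)[OF P]
lemmas presents_quad = presentsD(3)[OF P]

lemma presents_torsion: "two_power_torsion n m \<longleftrightarrow> tors n E"
  using mpres_two_power_torsion[OF mdE FE KE KFE PM] by (simp add: tors_def)

lemma presents_quadratic_linking_form: "quadratic_linking_form A m"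
proof -
  obtain N where N: "tors N E" using formD(3)[OF E] by blast
  obtain n g where g: "range g \<subseteq> car E" "\<forall>v\<in>car E. \<exists>c. v - comb (scal E) g n c \<in> rad E"
    using formD(2)[OF E] by (rule finE)
  have 1: "module RR m" by (rule mpres_module[OF mdE FE KE KFE PM])
  have 2: "length_one RR m"
    using N by (intro mpres_length_one[OF mdE FE KE KFE PM form_satd_rad[OF E] g]) (simp add: tors_def)
  have 3: "\<exists>n. two_power_torsion n m" using N presents_torsion by blast
  have car: "carrier m = p ` car E" using PM by (simp add: mpres_def)
  have b1: "bil m x y \<in> carrier (rat_mod_int A)" if "x \<in> carrier m" "y \<in> carrier m" for x y
    using that unfolding car int_carrier by (auto simp: presents_bil)
  have b2: "bil m (x \<oplus>\<^bsub>m\<^esub> x') y = bil m x y \<oplus>\<^bsub>rat_mod_int A\<^esub> bil m x' y"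
    if "x \<in> carrier m" "x' \<in> carrier m" "y \<in> carrier m" for x x' y
    using that unfolding car
    by (auto simp: presents_add[symmetric] presents_bil int_add subm_add[OF FE] bf_add_left[OF HE])
  have b3: "bil m x (y \<oplus>\<^bsub>m\<^esub> y') = bil m x y \<oplus>\<^bsub>rat_mod_int A\<^esub> bil m x y'"
    if "x \<in> carrier m" "y \<in> carrier m" "y' \<in> carrier m" for x y y'
    using that unfolding car
    by (auto simp: presents_add[symmetric] presents_bil int_add subm_add[OF FE] bf_add_right[OF HE])
  have b4: "bil m x y = to_int_cosets A cj (bil m y x)" if "x \<in> carrier m" "y \<in> carrier m" for x y
  proof -
    obtain v w where vw: "v \<in> car E" "w \<in> car E" "x = p v" "y = p w" using \<open>x \<in> carrier m\<close> \<open>y \<in> carrier m\<close> car by blast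
    show ?thesis using bf_cj[OF HE, of v w] by (simp add: vw presents_bil induced_cj)
  qed
  have b5: "bil m x (r \<odot>\<^bsub>m\<^esub> y) = r \<odot>\<^bsub>rat_mod_int A\<^esub> bil m x y" if "x \<in> carrier m" "y \<in> carrier m" for r x y
    using that unfolding car
    by (auto simp: presents_scal[symmetric] presents_bil int_smult subm_sc[OF FE] bf_sc_right[OF HE])
  have b6: "bij_betw (\<lambda>x. \<lambda>y\<in>carrier m. bil m x y) (carrier m) (mod_hom RR m (rat_mod_int A))"
    unfolding bij_betw_def
  proof
    show "inj_on (\<lambda>x. \<lambda>y\<in>carrier m. bil m x y) (carrier m)"
    proof (rule inj_onI)
      fix x y assume xy: "x \<in> carrier m" "y \<in> carrier m" "(\<lambda>z\<in>carrier m. bil m x z) = (\<lambda>z\<in>carrier m. bil m y z)"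
      obtain v w where vw: "v \<in> car E" "w \<in> car E" "x = p v" "y = p w" using xy car by blast
      have "bf E (v - w) u \<in> II" if u: "u \<in> car E" for u
        using fun_cong[OF xy(3), of "p u"] presents_closed[OF u] vw u by (simp add: presents_bil coI_eq bf_diff_left[OF HE])
      then have "v - w \<in> rad E" using subm_diff[OF mdE FE vw(1,2)] by (simp add: rad_def)
      then show "x = y" using presents_eq_iff vw by simp
    qed
    show "(\<lambda>x. \<lambda>y\<in>carrier m. bil m x y) ` carrier m = mod_hom RR m (rat_mod_int A)"
    proof (intro equalityI subsetI)
      interpret m: Module.module RR m by (rule 1)
      fix \<eta> assume "\<eta> \<in> (\<lambda>x. \<lambda>y\<in>carrier m. bil m x y) ` carrier m"
      then obtain x where x: "x \<in> carrier m" "\<eta> = (\<lambda>y\<in>carrier m. bil m x y)" by blast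
      have "r \<odot>\<^bsub>m\<^esub> y \<in> carrier m" if "y \<in> carrier m" for r y using m.smult_closed[of r y] that by simp
      then show "\<eta> \<in> mod_hom RR m (rat_mod_int A)"
        using x b1 b3 b5 by (auto simp: mod_hom_def)
    next
      fix \<eta> assume \<eta>: "\<eta> \<in> mod_hom RR m (rat_mod_int A)"
      \<comment> \<open>For surjectivity of the adjoint, the values of \<open>\<eta>\<close> on
        classes of vectors are lifted to \<open>\<rat>R\<close>; homomorphy of \<open>\<eta>\<close>
        then reads \<open>homI\<close>.\<close>
      have "\<forall>v. \<exists>a. v \<in> car E \<longrightarrow> \<eta> (p v) = add_coset II a"
        using \<eta> presents_closed by (fastforce simp: mod_hom_def int_carrier)
      then obtain h where h: "\<And>v. v \<in> car E \<Longrightarrow> \<eta> (p v) = add_coset II (h v)" by metis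
      have "homI (scal E) (car E) h"
        unfolding homI_def
      proof (intro conjI ballI allI)
        fix v w assume vw: "v \<in> car E" "w \<in> car E"
        have "\<eta> (p v \<oplus>\<^bsub>m\<^esub> p w) = \<eta> (p v) \<oplus>\<^bsub>rat_mod_int A\<^esub> \<eta> (p w)"
          using \<eta> presents_closed vw by (simp add: mod_hom_def)
        then have "add_coset II (h (v + w)) = add_coset II (h v + h w)"
          using vw subm_add[OF FE] by (simp add: presents_add[symmetric] h int_add)
        then show "h (v + w) - h v - h w \<in> II" by (simp add: coI_eq diff_diff_eq)
      next
        fix r v assume v: "v \<in> car E"
        have "\<eta> (r \<odot>\<^bsub>m\<^esub> p v) = r \<odot>\<^bsub>rat_mod_int A\<^esub> \<eta> (p v)"
          using \<eta> presents_closed v by (simp add: mod_hom_def)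
        then have "add_coset II (h (scal E r v)) = add_coset II (\<iota> r * h v)"
          using v subm_sc[OF FE] by (simp add: presents_scal[symmetric] h int_smult)
        then show "h (scal E r v) - \<iota> r * h v \<in> II" by (simp add: coI_eq)
      qed
      note hh = this
      have "h k \<in> II" if k: "k \<in> rad E" for k
      proof -
        have kE: "k \<in> car E" using k KFE by blast
        have zE: "0 \<in> car E" using subm_0[OF FE] .
        have "p k = p 0" using presents_zero_iff[OF kE] k presents_zero by simp
        then have "add_coset II (h k) = add_coset II (h 0)" using h[OF kE] h[OF zE] by simp
        then show ?thesis using homI_0[OF hh zE] II_diff_iff coI_eq by blast
      qed
      then obtain x where x: "x \<in> car E" "\<forall>y\<in>car E. h y - bf E x y \<in> II"
        using formD(5)[OF E] hh unfolding nonsing_def by blast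
      have "\<eta> y = (\<lambda>y\<in>carrier m. bil m (p x) y) y" if "y \<in> carrier m" for y
      proof -
        obtain v where v: "v \<in> car E" "y = p v" using \<open>y \<in> carrier m\<close> car by blast
        show ?thesis using presents_closed[OF v(1)] x v(1) unfolding v(2) by (simp add: h presents_bil coI_eq)
      qed
      then have "\<eta> = (\<lambda>y\<in>carrier m. bil m (p x) y)"
        using \<eta> by (intro extensionalityI[of _ "carrier m"]) (auto simp: mod_hom_def PiE_def)
      then show "\<eta> \<in> (\<lambda>x. \<lambda>y\<in>carrier m. bil m x y) ` carrier m" using presents_closed[OF x(1)] by blast
    qed
  qed
  have q1: "quad m x \<in> carrier (rat_mod_ops A)" if "x \<in> carrier m" for x
    using that unfolding car ops_carrier by (auto simp: presents_quad)
  have q2: "to_int_cosets A (\<lambda>a. a) (quad m x) = bil m x x" if "x \<in> carrier m" for x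
    using that unfolding car by (auto simp: presents_quad presents_bil induced_id)
  have q3: "quad m (x \<oplus>\<^bsub>m\<^esub> y) \<ominus>\<^bsub>rat_mod_ops A\<^esub> quad m x \<ominus>\<^bsub>rat_mod_ops A\<^esub> quad m y
          = to_ops_cosets A (\<lambda>a. a + cj a) (bil m x y)" if "x \<in> carrier m" "y \<in> carrier m" for x y
  proof -
    obtain v w where vw: "v \<in> car E" "w \<in> car E" "x = p v" "y = p w" using \<open>x \<in> carrier m\<close> \<open>y \<in> carrier m\<close> car by blast
    have "quad m (x \<oplus>\<^bsub>m\<^esub> y) \<ominus>\<^bsub>rat_mod_ops A\<^esub> quad m x \<ominus>\<^bsub>rat_mod_ops A\<^esub> quad m y
        = add_coset JJ (bf E v w + cj (bf E v w))"
      using vw(1,2) subm_add[OF FE vw(1,2)]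
      by (simp add: vw(3,4) presents_add[symmetric] presents_quad ops_minus q_add[OF HE])
    also have "\<dots> = to_ops_cosets A (\<lambda>a. a + cj a) (bil m x y)"
      using vw(1,2) by (simp add: vw(3,4) presents_bil induced_plus_cj)
    finally show ?thesis .
  qed
  have q4: "quad m (r \<odot>\<^bsub>m\<^esub> x) = to_ops_cosets A (\<lambda>a. \<iota> r * a * \<iota> (iv r)) (quad m x)" if "x \<in> carrier m" for r x
  proof -
    obtain v where v: "v \<in> car E" "x = p v" using \<open>x \<in> carrier m\<close> car by blast
    have "quad m (r \<odot>\<^bsub>m\<^esub> x) = add_coset JJ (\<iota> r * bf E v v * \<iota> (iv r))"
      using v(1) subm_sc[OF FE v(1)] by (simp add: v(2) presents_scal[symmetric] presents_quad q_sc[OF HE])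
        (simp only: ac_simps)
    then show ?thesis using v by (simp add: presents_quad induced_mult)
  qed
  show ?thesis
    unfolding quadratic_linking_form_def
    by (intro conjI ballI allI 1 2 3 b1 b2 b3 b4 b5 b6 q1 q2 q3 q4)
qed

text \<open>Preimages and images under \<open>p\<close> translate between the two notions. For the
  length one condition, a self-complementary \<open>U\<close> is saturated and contains the radical,
  so \<open>mpres_length_one\<close> applies to the quotient.\<close>

lemma presents_lagrangian: "(\<exists>L. lagrangian A m L) \<longleftrightarrow> metabolic E"
proof
  assume "\<exists>L. lagrangian A m L"
  then obtain L where L: "lagrangian A m L" by blast
  interpret m: Module.module RR m by (rule mpres_module[OF mdE FE KE KFE PM])
  interpret L: submodule L RR m using L by (simp add: lagrangian_def)
  have car: "carrier m = p ` car E" using PM by (simp add: mpres_def)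
  define U where "U = {v \<in> car E. p v \<in> L}"
  have LU: "L = p ` U" using L.subset car by (auto simp: U_def)
  have "subm (scal E) U"
    using subm_0[OF FE] subm_add[OF FE] subm_sc[OF FE] L.one_closed L.m_closed L.smult_closed
    by (auto simp: subm_def U_def presents_zero[symmetric] presents_add presents_scal)
  moreover have "U \<subseteq> car E" by (auto simp: U_def)
  moreover have "bf E x x \<in> twoI" if "x \<in> U" for x
  proof -
    have "quad m (p x) = \<zero>\<^bsub>rat_mod_ops A\<^esub>" using L that by (auto simp: lagrangian_def U_def)
    then have "add_coset JJ (bf E x x) = add_coset JJ 0" using that by (simp add: ops_zero presents_quad U_def)
    then show ?thesis by (simp add: coJ_eq JJ_iff)
  qed
  moreover have "U = perp E U"
  proof -
    have L3: "L = {x \<in> carrier m. \<forall>y\<in>L. bil m x y = \<zero>\<^bsub>rat_mod_int A\<^esub>}" using L by (simp add: lagrangian_def)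
    have L4: "x \<in> L \<longleftrightarrow> (\<forall>y\<in>L. bil m x y = \<zero>\<^bsub>rat_mod_int A\<^esub>)" if "x \<in> carrier m" for x
      using equalityD1[OF L3] equalityD2[OF L3] that by blast
    have "v \<in> U \<longleftrightarrow> v \<in> perp E U" if v: "v \<in> car E" for v
    proof -
      have "v \<in> U \<longleftrightarrow> (\<forall>y\<in>L. bil m (p v) y = \<zero>\<^bsub>rat_mod_int A\<^esub>)"
        using v L4[OF presents_closed[OF v]] by (simp add: U_def)
      also have "\<dots> \<longleftrightarrow> (\<forall>u\<in>U. bil m (p v) (p u) = \<zero>\<^bsub>rat_mod_int A\<^esub>)" by (simp add: LU)
      also have "\<dots> \<longleftrightarrow> (\<forall>u\<in>U. bf E v u \<in> II)"
        using v by (intro ball_cong refl) (simp add: U_def presents_bil int_zero coI_eq)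
      finally show ?thesis using v by (simp add: perp_def)
    qed
    then show ?thesis by (auto simp: U_def perp_def)
  qed
  ultimately show "metabolic E" unfolding metabolic_def lagr_def by blast
next
  assume "metabolic E"
  then obtain U where U: "lagr E U" by (auto simp: metabolic_def)
  have UU: "subm (scal E) U" "U \<subseteq> car E" "U = perp E U" and qU: "\<And>v. v \<in> U \<Longrightarrow> bf E v v \<in> twoI"
    using U by (auto simp: lagr_def)
  have rU: "rad E \<subseteq> U" using rad_subset_perp[OF HE UU(2)] UU(3) by simp
  obtain N where N: "tors N E" using formD(3)[OF E] by blast
  obtain n g where g: "range g \<subseteq> car E" "\<forall>v\<in>car E. \<exists>c. v - comb (scal E) g n c \<in> rad E"
    using formD(2)[OF E] by (rule finE)
  have sat: "saturated (scal E) (car E) U" using satd_perp[OF HE N UU(2)] UU(3) by simp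
  have car: "carrier m = p ` car E" using PM by (simp add: mpres_def)
  have gU: "\<forall>v\<in>car E. \<exists>c. v - comb (scal E) g n c \<in> U" using g(2) rU by blast
  have "\<forall>v\<in>car E. scal E (2 ^ N) v \<in> U" using N rU by (auto simp: tors_def)
  then have "length_one RR (quot_module m (p ` U))"
    by (rule mpres_length_one[OF mdE FE UU(1,2) mpres_quot[OF mdE FE KE KFE PM UU(1,2) rU] sat g(1) gU])
  moreover have "quad m x = \<zero>\<^bsub>rat_mod_ops A\<^esub>" if x: "x \<in> p ` U" for x
  proof -
    obtain u where u: "u \<in> U" "x = p u" using x by blast
    have uE: "u \<in> car E" using u UU(2) by blast
    have "bf E u u \<in> JJ" using qU[OF u(1)] bf_cj[OF HE, of u u] by (simp add: JJ_iff)
    then show ?thesis by (simp add: u(2) presents_quad[OF uE] ops_zero coJ_eq)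
  qed
  moreover have "p ` U = {x \<in> carrier m. \<forall>y\<in>p ` U. bil m x y = \<zero>\<^bsub>rat_mod_int A\<^esub>}"
  proof -
    have "p v \<in> p ` U \<longleftrightarrow> (\<forall>y\<in>p ` U. bil m (p v) y = \<zero>\<^bsub>rat_mod_int A\<^esub>)" if v: "v \<in> car E" for v
    proof -
      have "p v \<in> p ` U \<longleftrightarrow> v \<in> perp E U"
        using mpres_image_iff[OF mdE FE KE KFE PM UU(1,2) rU v] UU(3) by simp
      also have "\<dots> \<longleftrightarrow> (\<forall>u\<in>U. bf E v u \<in> II)" using v by (simp add: perp_def)
      also have "\<dots> \<longleftrightarrow> (\<forall>u\<in>U. bil m (p v) (p u) = \<zero>\<^bsub>rat_mod_int A\<^esub>)"
      proof (intro ball_cong refl)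
        fix u assume "u \<in> U"
        then have "u \<in> car E" using UU(2) by blast
        then show "bf E v u \<in> II \<longleftrightarrow> bil m (p v) (p u) = \<zero>\<^bsub>rat_mod_int A\<^esub>"
          using v by (simp add: presents_bil int_zero coI_eq)
      qed
      also have "\<dots> \<longleftrightarrow> (\<forall>y\<in>p ` U. bil m (p v) y = \<zero>\<^bsub>rat_mod_int A\<^esub>)" by simp
      finally show ?thesis .
    qed
    then show ?thesis using UU(2) by (auto simp: car)
  qed
  ultimately show "\<exists>L. lagrangian A m L"
    unfolding lagrangian_def using mpres_submodule[OF mdE FE KE KFE PM UU(1,2) rU] by blast
qed

lemma presents_isometry:
  assumes m': "module RR m'" and f: "f \<in> mod_hom RR m m'" "bij_betw f (carrier m) (carrier m')"
    "\<forall>x\<in>carrier m. \<forall>y\<in>carrier m. bil m' (f x) (f y) = bil m x y"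
    "\<forall>x\<in>carrier m. quad m' (f x) = quad m x"
  shows "presents E (\<lambda>v. f (p v)) m'"
proof -
  interpret m: Module.module RR m by (rule mpres_module[OF mdE FE KE KFE PM])
  interpret m': Module.module RR m' by (rule m')
  have car: "carrier m = p ` car E" using PM by (simp add: mpres_def)
  have fadd: "f (x \<oplus>\<^bsub>m\<^esub> y) = f x \<oplus>\<^bsub>m'\<^esub> f y" if "x \<in> carrier m" "y \<in> carrier m" for x y
    using f(1) that by (simp add: mod_hom_def)
  have fsm: "f (r \<odot>\<^bsub>m\<^esub> x) = r \<odot>\<^bsub>m'\<^esub> f x" if "x \<in> carrier m" for r x
    using f(1) that by (simp add: mod_hom_def)
  have surj: "f ` carrier m = carrier m'" and inj: "inj_on f (carrier m)"
    using f(2) by (auto simp: bij_betw_def)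
  have fz: "f \<zero>\<^bsub>m\<^esub> = \<zero>\<^bsub>m'\<^esub>"
  proof -
    have "f \<zero>\<^bsub>m\<^esub> \<in> carrier m'" using surj m.zero_closed by blast
    then show ?thesis using fadd[of "\<zero>\<^bsub>m\<^esub>" "\<zero>\<^bsub>m\<^esub>"] by simp
  qed
  have "f (p v) = \<zero>\<^bsub>m'\<^esub> \<longleftrightarrow> v \<in> rad E" if "v \<in> car E" for v
    using inj_onD[OF inj _ presents_closed[OF that] m.zero_closed] presents_zero_iff[OF that] fz by auto
  then show ?thesis
    unfolding presents_def mpres_def
    using surj f(3,4) presents_closed by (auto simp: car image_image presents_add presents_scal fadd fsm presents_bil presents_quad)
qed

end

end

section \<open>Comparison and existence of presentations\<close>

context dyadic
begin

text \<open>The fibre product of the two presentations over \<open>m\<close> is a Lagrangian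
  correspondence.\<close>

lemma presents_unique:
  assumes E: "form E" and G: "form G" and p: "presents E p m" and p': "presents G p' m"
  shows "weq E G"
proof -
  note H = form_herm[OF E] and H' = form_herm[OF G]
  define \<Gamma> where "\<Gamma> = {(x, y). x \<in> car E \<and> y \<in> car G \<and> p x = p' y}"
  have onto: "carrier m = p ` car E" "carrier m = p' ` car G"
    using presentsD(1)[OF p] presentsD(1)[OF p'] by (auto simp: mpres_def)
  show ?thesis
  proof (rule weq_graph[OF H H'])
    show "subm (scal (psum E G)) \<Gamma>"
      using subm_0[OF herm_subm[OF H]] subm_0[OF herm_subm[OF H']] presents_zero[OF E p] presents_zero[OF G p']
        subm_add[OF herm_subm[OF H]] subm_add[OF herm_subm[OF H']]
        subm_sc[OF herm_subm[OF H]] subm_sc[OF herm_subm[OF H']]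
      by (auto simp: subm_def \<Gamma>_def pair_0[symmetric] presents_add[OF E p] presents_add[OF G p'] presents_scal[OF E p] presents_scal[OF G p'])
    show "\<Gamma> \<subseteq> car E \<times> car G" by (auto simp: \<Gamma>_def)
    show "bf E x x - bf G y y \<in> twoI" if "(x, y) \<in> \<Gamma>" for x y
    proof -
      have "add_coset JJ (bf E x x) = add_coset JJ (bf G y y)"
        using that presentsD(3)[OF p, of x] presentsD(3)[OF p', of y] by (auto simp: \<Gamma>_def)
      then show ?thesis by (simp add: coJ_eq JJ_iff)
    qed
    show "bf E x x' - bf G y y' \<in> II" if "(x, y) \<in> \<Gamma>" "(x', y') \<in> \<Gamma>" for x y x' y'
    proof -
      have "add_coset II (bf E x x') = add_coset II (bf G y y')"
        using that presentsD(2)[OF p, of x x'] presentsD(2)[OF p', of y y'] by (auto simp: \<Gamma>_def)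
      then show ?thesis by (simp only: coI_eq)
    qed
    show "\<exists>x. (x, y) \<in> \<Gamma>" if "y \<in> car G" for y
    proof -
      have "p' y \<in> p ` car E" using that onto by blast
      then show ?thesis using that by (auto simp: \<Gamma>_def)
    qed
    show "(z, 0) \<in> \<Gamma>" if z: "z \<in> car E" "\<And>x y. (x, y) \<in> \<Gamma> \<Longrightarrow> bf E z x \<in> II" for z
    proof -
      have "bf E z x \<in> II" if "x \<in> car E" for x
      proof -
        have "p x \<in> p' ` car G" using that onto by blast
        then obtain y where "y \<in> car G" "p x = p' y" by blast
        then show ?thesis using that by (intro z(2)[of x y]) (simp add: \<Gamma>_def)
      qed
      then have "z \<in> rad E" using z(1) by (simp add: rad_def)
      then have "p z = p' 0" using presents_zero_iff[OF E p z(1)] presents_zero[OF G p'] by simp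
      then show ?thesis using z(1) subm_0[OF herm_subm[OF H']] by (simp add: \<Gamma>_def)
    qed
  qed
qed

lemma presents_isometric:
  assumes E: "form E" and p: "presents E p m" and p': "presents E p' m'"
  shows "isometric m m'"
proof -
  define f where "f = (\<lambda>x\<in>carrier m. p' (SOME v. v \<in> car E \<and> p v = x))"
  have car: "carrier m = p ` car E" "carrier m' = p' ` car E"
    using presentsD(1)[OF p] presentsD(1)[OF p'] by (auto simp: mpres_def)
  note F = herm_subm[OF form_herm[OF E]]
  have f: "f (p v) = p' v" if v: "v \<in> car E" for v
  proof -
    define w where "w = (SOME w. w \<in> car E \<and> p w = p v)"
    have w: "w \<in> car E \<and> p w = p v" unfolding w_def by (rule someI[of _ v]) (simp add: v)
    then have "p' w = p' v" using presents_eq_iff[OF E p, of w v] presents_eq_iff[OF E p', of w v] v by simp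
    then show ?thesis using v by (simp add: f_def car w_def)
  qed
  have "f \<in> mod_hom RR m m'"
    unfolding mod_hom_def
  proof (intro CollectI conjI ballI)
    show "f \<in> carrier m \<rightarrow>\<^sub>E carrier m'"
    proof (rule PiE_I)
      show "f x \<in> carrier m'" if "x \<in> carrier m" for x using that f by (auto simp: car)
    qed (simp add: f_def)
    show "f (x \<oplus>\<^bsub>m\<^esub> y) = f x \<oplus>\<^bsub>m'\<^esub> f y" if "x \<in> carrier m" "y \<in> carrier m" for x y
      using that unfolding car
      by (auto simp: presents_add[OF E p, symmetric] f presents_add[OF E p'] subm_add[OF F])
    show "f (r \<odot>\<^bsub>m\<^esub> x) = r \<odot>\<^bsub>m'\<^esub> f x" if "x \<in> carrier m" for r x
      using that unfolding car
      by (auto simp: presents_scal[OF E p, symmetric] f presents_scal[OF E p'] subm_sc[OF F])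
  qed
  moreover have "bij_betw f (carrier m) (carrier m')"
    unfolding bij_betw_def
  proof
    show "inj_on f (carrier m)"
      by (rule inj_onI) (auto simp: car f presents_eq_iff[OF E p] presents_eq_iff[OF E p'])
    show "f ` carrier m = carrier m'"
      unfolding car image_image using f by (auto intro!: image_cong)
  qed
  moreover have "\<forall>x\<in>carrier m. \<forall>y\<in>carrier m. bil m' (f x) (f y) = bil m x y"
    unfolding car by (auto simp: f presentsD(2)[OF p] presentsD(2)[OF p'])
  moreover have "\<forall>x\<in>carrier m. quad m' (f x) = quad m x"
    unfolding car by (auto simp: f presentsD(3)[OF p] presentsD(3)[OF p'])
  ultimately show ?thesis unfolding isometric_def by blast
qed

lemma presents_iso:
  assumes E: "form E" and G: "form G" and p: "presents E p m"
    and g: "\<And>y y'. g (y + y') = g y + g y'" "\<And>r y. g (scal G r y) = scal E r (g y)"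
      "g ` car G = car E" "\<And>y y'. bf E (g y) (g y') = bf G y y'"
  shows "presents G (\<lambda>y. p (g y)) m"
proof -
  have gc: "g y \<in> car E" if "y \<in> car G" for y using g(3) that by blast
  have rad: "g y \<in> rad E \<longleftrightarrow> y \<in> rad G" if y: "y \<in> car G" for y
  proof -
    have "g y \<in> rad E \<longleftrightarrow> (\<forall>w\<in>g ` car G. bf E (g y) w \<in> II)" using gc[OF y] g(3) by (simp add: rad_def)
    also have "\<dots> \<longleftrightarrow> y \<in> rad G" using y by (simp add: rad_def g(4))
    finally show ?thesis .
  qed
  have "carrier m = p ` car E" using presentsD(1)[OF p] by (simp add: mpres_def)
  then have "(\<lambda>y. p (g y)) ` car G = carrier m" using g(3) by (metis image_image)
  then show ?thesis
    unfolding presents_def mpres_def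
    using gc by (simp add: g presents_add[OF E p] presents_scal[OF E p] presents_zero_iff[OF E p] rad presentsD(2,3)[OF p])
qed

lemma presents_orth_sum:
  assumes E: "form E" and G: "form G" and p: "presents E p m" and p': "presents G p' m'"
  shows "presents (psum E G) (\<lambda>(x, y). (p x, p' y)) (orth_sum A m m')"
proof -
  have car: "carrier m = p ` car E" "carrier m' = p' ` car G"
    using presentsD(1)[OF p] presentsD(1)[OF p'] by (auto simp: mpres_def)
  show ?thesis
    unfolding presents_def mpres_def rad_psum[OF form_herm[OF E] form_herm[OF G]]
    by (auto simp: orth_sum_def car presents_add[OF E p] presents_add[OF G p'] presents_scal[OF E p] presents_scal[OF G p']
        presents_zero_iff[OF E p] presents_zero_iff[OF G p'] presentsD(2,3)[OF p] presentsD(2,3)[OF p'] int_add ops_add)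
qed

text \<open>\<open>b\<close> and \<open>q\<close> are lifted together to one hermitian matrix on
  free generators. Off the diagonal lifts of \<open>b\<close> are used on one side and their
  conjugates on the other; the diagonal holds lifts of \<open>q\<close>. The form then induces
  \<open>q\<close> everywhere, since the discrepancy is additive and zero on generators.\<close>

lemma exists_presentation:
  fixes m :: "('r, 'a, 'q) linking_form"
  assumes m: "quadratic_linking_form A m"
  shows "\<exists>(E :: ('r, nat \<Rightarrow> 'r, 'q) pform) p. form E \<and> presents E p m"
proof -
  note qlf = m[unfolded quadratic_linking_form_def]
  have mod: "module RR m" and len: "length_one RR m" and tor: "\<exists>n. two_power_torsion n m" using qlf by blast+
  have b_car: "\<forall>x\<in>carrier m. \<forall>y\<in>carrier m. bil m x y \<in> carrier (rat_mod_int A)" using qlf by (elim conjE)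
  have b_left: "\<forall>x\<in>carrier m. \<forall>x'\<in>carrier m. \<forall>y\<in>carrier m.
        bil m (x \<oplus>\<^bsub>m\<^esub> x') y = bil m x y \<oplus>\<^bsub>rat_mod_int A\<^esub> bil m x' y" using qlf by (elim conjE)
  have b_right: "\<forall>x\<in>carrier m. \<forall>y\<in>carrier m. \<forall>y'\<in>carrier m.
        bil m x (y \<oplus>\<^bsub>m\<^esub> y') = bil m x y \<oplus>\<^bsub>rat_mod_int A\<^esub> bil m x y'" using qlf by (elim conjE)
  have b_sym: "\<forall>x\<in>carrier m. \<forall>y\<in>carrier m. bil m x y = to_int_cosets A cj (bil m y x)" using qlf by (elim conjE)
  have b_sc: "\<forall>r. \<forall>x\<in>carrier m. \<forall>y\<in>carrier m. bil m x (r \<odot>\<^bsub>m\<^esub> y) = r \<odot>\<^bsub>rat_mod_int A\<^esub> bil m x y" using qlf by (elim conjE)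
  have b_bij: "bij_betw (\<lambda>x. \<lambda>y\<in>carrier m. bil m x y) (carrier m) (mod_hom RR m (rat_mod_int A))" using qlf by (elim conjE)
  have q_car: "\<forall>x\<in>carrier m. quad m x \<in> carrier (rat_mod_ops A)" using qlf by (elim conjE)
  have q_b: "\<forall>x\<in>carrier m. to_int_cosets A (\<lambda>a. a) (quad m x) = bil m x x" using qlf by (elim conjE)
  have qm_add: "\<forall>x\<in>carrier m. \<forall>y\<in>carrier m.
        quad m (x \<oplus>\<^bsub>m\<^esub> y) \<ominus>\<^bsub>rat_mod_ops A\<^esub> quad m x \<ominus>\<^bsub>rat_mod_ops A\<^esub> quad m y
          = to_ops_cosets A (\<lambda>a. a + cj a) (bil m x y)" using qlf by (elim conjE)
  have qm_sc: "\<forall>r. \<forall>x\<in>carrier m. quad m (r \<odot>\<^bsub>m\<^esub> x)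
          = to_ops_cosets A (\<lambda>a. \<iota> r * a * \<iota> (iv r)) (quad m x)" using qlf by (elim conjE)
  interpret m: Module.module RR m by (rule mod)
  have sm_cl: "r \<odot>\<^bsub>m\<^esub> x \<in> carrier m" if "x \<in> carrier m" for r x using m.smult_closed[of r x] that by simp

  have "\<forall>x y. \<exists>a. x \<in> carrier m \<longrightarrow> y \<in> carrier m \<longrightarrow> bil m x y = add_coset II a"
    using b_car by (fastforce simp: int_carrier)
  then obtain \<beta> where \<beta>: "\<And>x y. x \<in> carrier m \<Longrightarrow> y \<in> carrier m \<Longrightarrow> bil m x y = add_coset II (\<beta> x y)" by metis
  have "\<forall>x. \<exists>a. x \<in> carrier m \<longrightarrow> quad m x = add_coset JJ a"
    using q_car by (fastforce simp: ops_carrier)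
  then obtain \<kappa> where \<kappa>: "\<And>x. x \<in> carrier m \<Longrightarrow> quad m x = add_coset JJ (\<kappa> x)" by metis
  have \<beta>_right: "\<beta> x (y \<oplus>\<^bsub>m\<^esub> y') - \<beta> x y - \<beta> x y' \<in> II" if "x \<in> carrier m" "y \<in> carrier m" "y' \<in> carrier m" for x y y'
    using b_right that by (simp add: \<beta> int_add coI_eq diff_diff_eq)
  have \<beta>_sc: "\<beta> x (r \<odot>\<^bsub>m\<^esub> y) - \<iota> r * \<beta> x y \<in> II" if "x \<in> carrier m" "y \<in> carrier m" for r x y
    using b_sc that sm_cl by (simp add: \<beta> int_smult coI_eq)
  have \<beta>_sym: "\<beta> x y - cj (\<beta> y x) \<in> II" if "x \<in> carrier m" "y \<in> carrier m" for x y
    using b_sym that by (simp add: \<beta> induced_cj coI_eq)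
  have \<kappa>_\<beta>: "\<kappa> x - \<beta> x x \<in> II" if "x \<in> carrier m" for x
    using q_b that by (simp add: \<beta> \<kappa> induced_id coI_eq)
  have \<kappa>_add: "\<kappa> (x \<oplus>\<^bsub>m\<^esub> y) - \<kappa> x - \<kappa> y - (\<beta> x y + cj (\<beta> x y)) \<in> JJ" if "x \<in> carrier m" "y \<in> carrier m" for x y
    using qm_add that by (simp add: \<beta> \<kappa> induced_plus_cj ops_minus coJ_eq)
  have \<kappa>_sc: "\<kappa> (r \<odot>\<^bsub>m\<^esub> x) - \<iota> r * \<kappa> x * \<iota> (iv r) \<in> JJ" if "x \<in> carrier m" for r x
    using qm_sc that sm_cl by (simp add: \<kappa> induced_mult coJ_eq)
  \<comment> \<open>Compare \<open>q(2x) = 4 q(x)\<close> with the polarisation of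
    \<open>x + x\<close>: the difference of \<open>\<kappa> x\<close> and its conjugate lies in
    \<open>JJ\<close>. So it is both fixed and negated by conjugation, hence zero.\<close>
  have \<kappa>_cj: "cj (\<kappa> x) = \<kappa> x" if x: "x \<in> carrier m" for x
  proof -
    have "2 \<odot>\<^bsub>m\<^esub> x = x \<oplus>\<^bsub>m\<^esub> x" using m.smult_l_distr[of 1 1 x] m.smult_one[OF x] x by simp
    then have "\<kappa> (x \<oplus>\<^bsub>m\<^esub> x) - 2 * \<kappa> x * 2 \<in> JJ" using \<kappa>_sc[OF x, of 2] by simp
    moreover have "(\<kappa> x - \<beta> x x) + cj (\<kappa> x - \<beta> x x) \<in> JJ" by (rule JJ_plus_cj[OF \<kappa>_\<beta>[OF x]])
    ultimately have "(\<kappa> (x \<oplus>\<^bsub>m\<^esub> x) - \<kappa> x - \<kappa> x - (\<beta> x x + cj (\<beta> x x))) - (\<kappa> (x \<oplus>\<^bsub>m\<^esub> x) - 2 * \<kappa> x * 2)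
        - ((\<kappa> x - \<beta> x x) + cj (\<kappa> x - \<beta> x x)) \<in> JJ"
      using \<kappa>_add[OF x x] add_subgrpD(2)[OF add_subgrp_JJ] by blast
    then have d: "\<kappa> x - cj (\<kappa> x) \<in> JJ" by (simp add: cj_diff algebra_simps)
    then have "cj (\<kappa> x - cj (\<kappa> x)) = \<kappa> x - cj (\<kappa> x)" by (simp add: JJ_iff)
    then have "2 * \<kappa> x = 2 * cj (\<kappa> x)" by (simp add: cj_diff algebra_simps)
    then show ?thesis using q_two_cancel by metis
  qed

  obtain n p0 where p0: "p0 \<in> mod_hom RR (free_module (RR :: 'r ring) n) m"
      "p0 ` carrier (free_module (RR :: 'r ring) n) = carrier m"
    using len unfolding length_one_def by blast
  let ?Fr = "free_module (RR :: 'r ring) n"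
  note cF = free_module_simps(1)[where 'r = 'r] and aF = free_module_simps(2)[where 'r = 'r]
    and sF = free_module_simps(3)[where 'r = 'r]
  define P where "P c = p0 (restrict c {..<n})" for c
  have rF: "restrict c {..<n} \<in> carrier ?Fr" for c by (simp add: cF)
  have Pc: "P c \<in> carrier m" for c using p0(2) rF by (auto simp: P_def)
  have P_add: "P (c + d) = P c \<oplus>\<^bsub>m\<^esub> P d" for c d
  proof -
    have "restrict (c + d) {..<n} = restrict c {..<n} \<oplus>\<^bsub>?Fr\<^esub> restrict d {..<n}"
      by (simp add: aF fun_eq_iff restrict_def)
    then show ?thesis using p0(1) rF by (simp add: P_def mod_hom_def)
  qed
  have P_sc: "P (fsc r c) = r \<odot>\<^bsub>m\<^esub> P c" for r c
  proof -
    have "restrict (fsc r c) {..<n} = r \<odot>\<^bsub>?Fr\<^esub> restrict c {..<n}"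
      by (simp add: sF fun_eq_iff restrict_def fsc_apply)
    then show ?thesis using p0(1) rF by (simp add: P_def mod_hom_def)
  qed
  have P_onto: "\<exists>c. x = P c" if x: "x \<in> carrier m" for x
  proof -
    obtain c where c: "c \<in> carrier ?Fr" "x = p0 c" using x p0(2) by blast
    then have "restrict c {..<n} = c" using c(1) by (simp add: cF PiE_restrict)
    then show ?thesis using c by (metis P_def)
  qed
  have P_0: "P 0 = \<zero>\<^bsub>m\<^esub>" using P_add[of 0 0] Pc[of 0] by simp
  have P_tail: "P c = \<zero>\<^bsub>m\<^esub>" if "c \<in> tail n" for c
  proof -
    have "restrict c {..<n} = restrict 0 {..<n}" using that by (auto simp: tail_def fun_eq_iff restrict_def)
    then show ?thesis using P_0 by (simp add: P_def)
  qed
  define u where "u = (unit_vec :: nat \<Rightarrow> nat \<Rightarrow> 'r)"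
  have split: "c - (\<Sum>j<n. fsc (c j) (u j)) \<in> tail n" for c unfolding u_def by (rule fun_split_tail)
  note mdf = module_fsc[where 'r = 'r]
  have sU: "subm fsc (UNIV :: (nat \<Rightarrow> 'r) set)" by (simp add: subm_def)
  have P_split: "P c = P (\<Sum>j<n. fsc (c j) (u j))" for c
  proof -
    let ?s = "\<Sum>j<n. fsc (c j) (u j)"
    have "P c = P ((c - ?s) + ?s)" by simp
    also have "\<dots> = P ?s" unfolding P_add P_tail[OF split] by (simp add: Pc)
    finally show ?thesis .
  qed
  have \<beta>hom: "homI fsc UNIV (\<lambda>c. \<beta> x (P c))" if "x \<in> carrier m" for x
    using that by (simp add: homI_def P_add P_sc \<beta>_right \<beta>_sc Pc)
  have \<beta>1: "\<beta> x (P w) - (\<Sum>j<n. \<iota> (w j) * \<beta> x (P (u j))) \<in> II" if "x \<in> carrier m" for x w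
    using homI_sum[OF \<beta>hom[OF that] sU, of "{..<n}" u w] by (simp add: P_split[of w])
  \<comment> \<open>Conjugating the upper triangle and using the self-conjugate
    \<open>\<kappa>\<close> on the diagonal makes \<open>B\<close> exactly hermitian, not just
    modulo \<open>II\<close>.\<close>
  define B where "B i j = (if i = j then \<kappa> (P (u i)) else if i < j then \<beta> (P (u i)) (P (u j)) else cj (\<beta> (P (u j)) (P (u i))))" for i j
  have B_cj: "cj (B i j) = B j i" for i j by (auto simp: B_def \<kappa>_cj Pc)
  have B_\<beta>: "\<beta> (P (u i)) (P (u j)) - B i j \<in> II" for i j
    using II_diff_sym[OF \<kappa>_\<beta>[OF Pc]] \<beta>_sym[OF Pc Pc] by (auto simp: B_def simp del: image_iff)
  define b where "b v w = (\<Sum>i<n. \<Sum>j<n. \<iota> (iv (v i)) * (\<iota> (w j) * B i j))" for v w :: "nat \<Rightarrow> 'r"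
  have b_sum: "b v w = (\<Sum>i<n. \<iota> (iv (v i)) * (\<Sum>j<n. \<iota> (w j) * B i j))" for v w
    by (simp add: b_def sum_distrib_left)
  have b\<beta>: "\<beta> (P v) (P w) - b v w \<in> II" for v w
  proof -
    have 1: "\<beta> (P (u i)) (P w) - (\<Sum>j<n. \<iota> (w j) * B i j) \<in> II" for i
    proof -
      have "(\<Sum>j<n. \<iota> (w j) * (\<beta> (P (u i)) (P (u j)) - B i j)) \<in> II" by (intro II_sum II_mult B_\<beta>)
      then have "(\<Sum>j<n. \<iota> (w j) * \<beta> (P (u i)) (P (u j))) - (\<Sum>j<n. \<iota> (w j) * B i j) \<in> II"
        by (simp add: right_diff_distrib sum_subtractf)
      with \<beta>1[OF Pc] show ?thesis by (rule II_diff_trans)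
    qed
    have 2: "\<beta> (P v) (P w) - (\<Sum>i<n. \<iota> (iv (v i)) * \<beta> (P (u i)) (P w)) \<in> II"
    proof -
      have "cj (\<beta> (P w) (P v) - (\<Sum>j<n. \<iota> (v j) * \<beta> (P w) (P (u j)))) \<in> II" by (intro II_cj \<beta>1 Pc)
      then have a: "cj (\<beta> (P w) (P v)) - (\<Sum>j<n. \<iota> (iv (v j)) * cj (\<beta> (P w) (P (u j)))) \<in> II"
        by (simp add: cj_diff cj_sum cj_mult cj_incl)
      have "(\<Sum>i<n. \<iota> (iv (v i)) * (\<beta> (P (u i)) (P w) - cj (\<beta> (P w) (P (u i))))) \<in> II"
        by (intro II_sum II_mult \<beta>_sym Pc)
      then have "(\<Sum>i<n. \<iota> (iv (v i)) * \<beta> (P (u i)) (P w)) - (\<Sum>j<n. \<iota> (iv (v j)) * cj (\<beta> (P w) (P (u j)))) \<in> II"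
        by (simp add: right_diff_distrib sum_subtractf)
      from II_diff_trans[OF II_diff_trans[OF \<beta>_sym[OF Pc Pc] a] II_diff_sym[OF this]] show ?thesis .
    qed
    have "(\<Sum>i<n. \<iota> (iv (v i)) * (\<beta> (P (u i)) (P w) - (\<Sum>j<n. \<iota> (w j) * B i j))) \<in> II"
      by (intro II_sum II_mult 1)
    then have "(\<Sum>i<n. \<iota> (iv (v i)) * \<beta> (P (u i)) (P w)) - b v w \<in> II"
      by (simp add: right_diff_distrib sum_subtractf b_sum)
    with 2 show ?thesis by (rule II_diff_trans)
  qed
  define E where "E = \<lparr> scal = fsc, car = UNIV, bf = b \<rparr>"
  have HE: "herm E"
    unfolding herm_def
  proof (intro conjI allI)
    show "Modules.module (scal E)" using mdf by (simp add: E_def)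
    show "subm (scal E) (car E)" using sU by (simp add: E_def)
    show "bf E (v + v') w = bf E v w + bf E v' w" for v v' w
      by (simp add: E_def b_sum iv_add incl_add distrib_right sum.distrib)
    show "cj (bf E v w) = bf E w v" for v w
    proof -
      have "cj (bf E v w) = (\<Sum>i<n. \<Sum>j<n. \<iota> (v i) * (\<iota> (iv (w j)) * B j i))"
        by (simp add: E_def b_def cj_sum cj_mult cj_incl B_cj)
      also have "\<dots> = (\<Sum>j<n. \<Sum>i<n. \<iota> (v i) * (\<iota> (iv (w j)) * B j i))" by (rule sum.swap)
      also have "\<dots> = bf E w v" by (simp add: E_def b_def mult.left_commute)
      finally show ?thesis .
    qed
    show "bf E v (scal E r w) = \<iota> r * bf E v w" for r v w
      by (simp add: E_def b_def fsc_apply incl_mult sum_distrib_left mult_ac)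
  qed
  have b_add: "b (v + w) (v + w) = b v v + b w w + (b v w + cj (b v w))" for v w
    using q_add[OF HE, of v w] by (simp add: E_def)
  have b_sc: "b (fsc r v) (fsc r v) = \<iota> r * b v v * \<iota> (iv r)" for r v
    using q_sc[OF HE, of r v] by (simp add: E_def mult_ac)
  \<comment> \<open>The discrepancy between \<open>q\<close> and the diagonal of the form. Both
    terms have the same polarisation modulo \<open>JJ\<close>, so \<open>D\<close> is additive
    there; on generators it vanishes by the diagonal of \<open>B\<close>.\<close>
  define D where "D v = \<kappa> (P v) - b v v" for v
  have D_add: "D (v + w) - D v - D w \<in> JJ" for v w
  proof -
    have "(\<beta> (P v) (P w) - b v w) + cj (\<beta> (P v) (P w) - b v w) \<in> JJ" by (rule JJ_plus_cj[OF b\<beta>])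
    from add_subgrpD(4)[OF add_subgrp_JJ \<kappa>_add[OF Pc[of v] Pc[of w]] this] show ?thesis
      by (simp add: D_def P_add b_add cj_diff algebra_simps)
  qed
  have D_sc: "D (fsc r v) - \<iota> r * D v * \<iota> (iv r) \<in> JJ" for r v
    using \<kappa>_sc[OF Pc, of r v] by (simp add: D_def P_sc b_sc algebra_simps)
  have D_sum: "D (v + w) \<in> JJ" if "D v \<in> JJ" "D w \<in> JJ" for v w
    using add_subgrpD(4)[OF add_subgrp_JJ add_subgrpD(4)[OF add_subgrp_JJ D_add[of v w] that(1)] that(2)] by simp
  have D_unit: "D (u i) = 0" if i: "i < n" for i
  proof -
    have "b (u i) (u i) = (\<Sum>k<n. if k = i then \<Sum>j<n. \<iota> (u i j) * B i j else 0)"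
      unfolding b_sum by (intro sum.cong refl) (auto simp: u_def unit_vec_def)
    also have "\<dots> = (\<Sum>j<n. \<iota> (u i j) * B i j)" using i by (simp add: sum.delta)
    also have "\<dots> = (\<Sum>j<n. if j = i then B i i else 0)"
      by (intro sum.cong refl) (auto simp: u_def unit_vec_def)
    also have "\<dots> = B i i" using i by (simp add: sum.delta)
    finally show ?thesis by (simp add: D_def B_def)
  qed
  have D_fsc_unit: "D (fsc r (u i)) \<in> JJ" if "i < n" for r i
    using D_sc[of r "u i"] D_unit[OF that] by simp
  have \<kappa>0: "\<kappa> \<zero>\<^bsub>m\<^esub> \<in> JJ"
    using \<kappa>_sc[of "\<zero>\<^bsub>m\<^esub>" 0] m.smult_r_null[of 0] by simp
  have D_tail: "D c \<in> JJ" if c: "c \<in> tail n" for c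
  proof -
    have "b c c = 0" using c by (simp add: b_def tail_def)
    then show ?thesis using \<kappa>0 by (simp add: D_def P_tail[OF c])
  qed
  have D: "D v \<in> JJ" for v
  proof -
    have "D (\<Sum>j<k. fsc (v j) (u j)) \<in> JJ" if "k \<le> n" for k
      using that
    proof (induction k)
      case 0
      have "D 0 \<in> JJ" by (rule D_tail) (simp add: tail_def)
      then show ?case by (simp only: lessThan_0 sum.empty)
    next
      case (Suc k)
      then have "D ((\<Sum>j<k. fsc (v j) (u j)) + fsc (v k) (u k)) \<in> JJ" by (intro D_sum D_fsc_unit) auto
      then show ?case by (simp only: sum.lessThan_Suc)
    qed
    from D_sum[OF D_tail[OF split[of v]] this[OF order_refl]] show ?thesis by (simp only: diff_add_cancel)
  qed
  have bilP: "bil m (P v) (P w) = add_coset II (b v w)" for v w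
    using b\<beta> by (simp add: \<beta>[OF Pc Pc] coI_eq)
  have quadP: "quad m (P v) = add_coset JJ (b v v)" for v
    using D[of v] by (simp add: \<kappa>[OF Pc] coJ_eq D_def)
  have rad: "P v = \<zero>\<^bsub>m\<^esub> \<longleftrightarrow> v \<in> rad E" for v
  proof
    assume v: "P v = \<zero>\<^bsub>m\<^esub>"
    have "b v w \<in> II" for w
    proof -
      have "add_coset II (b v w) = add_coset II (b 0 w)" using bilP[of v w] bilP[of 0 w] v P_0 by simp
      moreover have "b 0 w = 0" using bf_0_left[OF HE, of w] by (simp add: E_def)
      ultimately show ?thesis by (simp add: coI_eq)
    qed
    then show "v \<in> rad E" by (simp add: rad_def E_def)
  next
    \<comment> \<open>Injectivity of the adjoint of \<open>m\<close> forces the class of a radical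
      vector to be zero.\<close>
    assume v: "v \<in> rad E"
    have "bil m (P v) y = bil m \<zero>\<^bsub>m\<^esub> y" if y: "y \<in> carrier m" for y
    proof -
      obtain w where w: "y = P w" using P_onto[OF y] by blast
      have "b v w \<in> II" using v by (simp add: rad_def E_def)
      moreover have "b 0 w = 0" using bf_0_left[OF HE, of w] by (simp add: E_def)
      ultimately have "add_coset II (b v w) = add_coset II (b 0 w)" by (simp add: coI_eq)
      then show ?thesis using bilP[of v w] bilP[of 0 w] w P_0 by simp
    qed
    then have "(\<lambda>y\<in>carrier m. bil m (P v) y) = (\<lambda>y\<in>carrier m. bil m \<zero>\<^bsub>m\<^esub> y)" by (auto simp: restrict_def fun_eq_iff)
    then show "P v = \<zero>\<^bsub>m\<^esub>"
      using b_bij inj_onD[of "\<lambda>x. \<lambda>y\<in>carrier m. bil m x y" "carrier m" "P v" "\<zero>\<^bsub>m\<^esub>"] Pc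
      by (simp add: bij_betw_def)
  qed
  have pres: "presents E P m"
    unfolding presents_def mpres_def
    using P_onto Pc by (auto simp: E_def P_add P_sc rad[unfolded E_def] bilP quadP)
  have "finite_type E"
    unfolding finite_type_def
  proof (intro exI[of _ n] exI[of _ u] conjI ballI)
    fix v assume "v \<in> car E"
    have "v - comb (scal E) u n v \<in> rad E"
      using rad P_tail[OF split[of v]] by (simp add: comb_def E_def)
    then show "\<exists>c. v - comb (scal E) u n c \<in> rad E" by (rule exI[of _ v])
  qed (simp add: E_def)
  moreover have "\<exists>N. tors N E"
  proof -
    obtain N where N: "two_power_torsion N m" using tor by blast
    have "tors N E"
      using N mpres_two_power_torsion[OF herm_module[OF HE] herm_subm[OF HE] subm_rad[OF HE] rad_subset[OF HE]
          presentsD(1)[OF pres], of N] by (simp add: tors_def)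
    then show ?thesis by blast
  qed
  moreover have "bf E v v \<in> twoI" if v: "v \<in> rad E" for v
  proof -
    have "add_coset JJ (b v v) = add_coset JJ (\<kappa> \<zero>\<^bsub>m\<^esub>)" using quadP[of v] rad[of v] v \<kappa>[of "\<zero>\<^bsub>m\<^esub>"] by simp
    then have "b v v \<in> JJ" using \<kappa>0 add_subgrpD(4)[OF add_subgrp_JJ, of "b v v - \<kappa> \<zero>\<^bsub>m\<^esub>" "\<kappa> \<zero>\<^bsub>m\<^esub>"] by (simp add: coJ_eq)
    then show ?thesis by (simp add: JJ_iff E_def)
  qed
  moreover have "nonsing E"
    unfolding nonsing_def
  proof (intro allI impI)
    fix h assume h: "homI (scal E) (car E) h" and hr: "\<forall>k\<in>rad E. h k \<in> II"
    \<comment> \<open>\<open>h\<close> is given on vectors; being integral on the radical it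
      descends to \<open>m\<close>, whose adjoint is onto.\<close>
    define \<eta> where "\<eta> = (\<lambda>x\<in>carrier m. add_coset II (h (SOME v. P v = x)))"
    have \<eta>: "\<eta> (P v) = add_coset II (h v)" for v
    proof -
      define w where "w = (SOME w. P w = P v)"
      have "P w = P v" unfolding w_def by (rule someI[of _ v]) simp
      then have "w - v \<in> rad E"
        using mpres_eq_iff[OF herm_module[OF HE] herm_subm[OF HE] subm_rad[OF HE] rad_subset[OF HE]
          presentsD(1)[OF pres], of w v] by (simp add: E_def)
      then have "h (w - v) \<in> II" using hr by blast
      moreover have "h (w - v) - h w + h v \<in> II"
        by (rule homI_diff[OF h herm_module[OF HE] herm_subm[OF HE]]) (simp_all add: E_def)
      ultimately have "h (w - v) - (h (w - v) - h w + h v) \<in> II" by (rule II_diff)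
      then have "h w - h v \<in> II" by simp
      then show ?thesis using Pc by (simp add: \<eta>_def w_def[symmetric] coI_eq)
    qed
    have "\<eta> \<in> mod_hom RR m (rat_mod_int A)"
      unfolding mod_hom_def
    proof (intro CollectI conjI ballI)
      show "\<eta> \<in> carrier m \<rightarrow>\<^sub>E carrier (rat_mod_int A)" by (auto simp: \<eta>_def int_carrier)
      show "\<eta> (x \<oplus>\<^bsub>m\<^esub> y) = \<eta> x \<oplus>\<^bsub>rat_mod_int A\<^esub> \<eta> y" if x: "x \<in> carrier m" and y: "y \<in> carrier m" for x y
      proof -
        obtain v w where vw: "x = P v" "y = P w" using P_onto[OF x] P_onto[OF y] by blast
        have "h (v + w) - h v - h w \<in> II" using homI_add[OF h, of v w] by (simp add: E_def)
        then show ?thesis by (simp add: vw P_add[symmetric] \<eta> int_add coI_eq diff_diff_eq)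
      qed
      show "\<eta> (r \<odot>\<^bsub>m\<^esub> x) = r \<odot>\<^bsub>rat_mod_int A\<^esub> \<eta> x" if x: "x \<in> carrier m" for r x
      proof -
        obtain v where v: "x = P v" using P_onto[OF x] by blast
        have "h (fsc r v) - \<iota> r * h v \<in> II" using homI_sc[OF h, of v r] by (simp add: E_def)
        then show ?thesis by (simp add: v P_sc[symmetric] \<eta> int_smult coI_eq)
      qed
    qed
    then obtain x where x: "x \<in> carrier m" "\<eta> = (\<lambda>y\<in>carrier m. bil m x y)"
      using b_bij unfolding bij_betw_def by blast
    obtain v where v: "x = P v" using P_onto[OF x(1)] by blast
    have "b v w - h w \<in> II" for w
      using \<eta>[of w] fun_cong[OF x(2), of "P w"] Pc[of w] by (simp add: v bilP coI_eq)
    then have "h w - b v w \<in> II" for w by (rule II_diff_sym)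
    then show "\<exists>x\<in>car E. \<forall>y\<in>car E. h y - bf E x y \<in> II" by (intro bexI[of _ v]) (simp_all add: E_def)
  qed
  ultimately have "form E" using HE by (simp add: form_def)
  then show ?thesis using pres by blast
qed

end

section \<open>Countable carriers\<close>

context dyadic
begin

text \<open>Each class contains a combination of finitely many fixed generators, so finite lists of
  coefficients enumerate the classes.\<close>

lemma countable_quotient:
  assumes E: "form E"
  shows "countable ((\<lambda>v. {w \<in> car E. w - v \<in> rad E}) ` car E)"
proof -
  note H = form_herm[OF E]
  note md = herm_module[OF H] and R = subm_rad[OF H]
  obtain n g where g: "range g \<subseteq> car E" "\<forall>v\<in>car E. \<exists>c. v - comb (scal E) g n c \<in> rad E"
    using formD(2)[OF E] by (rule finE)
  define K where "K v = {w \<in> car E. w - v \<in> rad E}" for v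
  have "K v \<in> (\<lambda>xs. K (comb (scal E) g n (\<lambda>i. xs ! i))) ` lists UNIV" if v: "v \<in> car E" for v
  proof -
    obtain c where c: "v - comb (scal E) g n c \<in> rad E" using g v by blast
    have "comb (scal E) g n (\<lambda>i. map c [0..<n] ! i) = comb (scal E) g n c" by (rule comb_cong) simp
    moreover have "K v = K (comb (scal E) g n c)"
    proof -
      have "w - v \<in> rad E \<longleftrightarrow> w - comb (scal E) g n c \<in> rad E" for w
        using subm_diff_iff[OF md R, of "w - comb (scal E) g n c" "w - v"] c by simp
      then show ?thesis by (simp add: K_def)
    qed
    ultimately show ?thesis by (intro image_eqI[of _ _ "map c [0..<n]"]) simp_all
  qed
  then have "K ` car E \<subseteq> (\<lambda>xs. K (comb (scal E) g n (\<lambda>i. xs ! i))) ` lists UNIV" by blast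
  moreover have "countable ((\<lambda>xs. K (comb (scal E) g n (\<lambda>i. xs ! i))) ` lists UNIV)"
    using countable_ring by (intro countable_image countable_lists)
  ultimately have "countable (K ` car E)" by (rule countable_subset)
  then show ?thesis by (simp add: K_def)
qed

text \<open>Classes modulo the radical are numbered and the structure is transported through chosen
  representatives, whose choice matters only modulo \<open>II\<close> and \<open>JJ\<close>.\<close>

lemma presents_nat_form:
  assumes E: "form E"
  shows "\<exists>(m :: ('r, nat, 'q) linking_form) p. presents E p m"
proof -
  note H = form_herm[OF E]
  note md = herm_module[OF H] and F = herm_subm[OF H] and R = subm_rad[OF H]
  define K where "K v = {w \<in> car E. w - v \<in> rad E}" for v
  have cK: "countable (K ` car E)" using countable_quotient[OF E] by (simp add: K_def)
  define p where "p v = to_nat_on (K ` car E) (K v)" for v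
  have p_eq: "p v = p w \<longleftrightarrow> v - w \<in> rad E" if v: "v \<in> car E" and w: "w \<in> car E" for v w
  proof -
    have "p v = p w \<longleftrightarrow> K v = K w"
      using inj_on_to_nat_on[OF cK] v w by (auto simp: p_def inj_on_eq_iff)
    also have "\<dots> \<longleftrightarrow> v - w \<in> rad E"
    proof
      assume eq: "K v = K w"
      have "v \<in> K v" using v subm_0[OF R] by (simp add: K_def)
      then show "v - w \<in> rad E" unfolding eq by (simp add: K_def)
    next
      assume d: "v - w \<in> rad E"
      have "u - v \<in> rad E \<longleftrightarrow> u - w \<in> rad E" for u
        using subm_diff_iff[OF md R, of "u - w" "u - v"] d by simp
      then show "K v = K w" by (simp add: K_def)
    qed
    finally show ?thesis .
  qed
  define r where "r x = (SOME v. v \<in> car E \<and> p v = x)" for x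
  have r: "r (p v) \<in> car E" "p (r (p v)) = p v" if "v \<in> car E" for v
  proof -
    have "r (p v) \<in> car E \<and> p (r (p v)) = p v" unfolding r_def by (rule someI[of _ v]) (simp add: that)
    then show "r (p v) \<in> car E" "p (r (p v)) = p v" by auto
  qed
  have rd: "r (p v) - v \<in> rad E" if "v \<in> car E" for v using r[OF that] p_eq that by blast
  define m :: "('r, nat, 'q) linking_form" where
    "m = \<lparr> carrier = p ` car E, monoid.mult = (\<lambda>_ _. undefined), one = undefined, zero = p 0,
        add = (\<lambda>x y. p (r x + r y)), module.smult = (\<lambda>c x. p (scal E c (r x))),
        bil = (\<lambda>x y. add_coset II (bf E (r x) (r y))), quad = (\<lambda>x. add_coset JJ (bf E (r x) (r x))) \<rparr>"
  have 1: "p (r (p v) + r (p w)) = p (v + w)" if v: "v \<in> car E" and w: "w \<in> car E" for v w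
  proof -
    have "(r (p v) - v) + (r (p w) - w) \<in> rad E" by (rule subm_add[OF R rd[OF v] rd[OF w]])
    then show ?thesis using p_eq r v w subm_add[OF F] by (simp add: algebra_simps)
  qed
  have 2: "p (scal E c (r (p v))) = p (scal E c v)" if v: "v \<in> car E" for c v
  proof -
    have "scal E c (r (p v) - v) \<in> rad E" by (rule subm_sc[OF R rd[OF v]])
    then show ?thesis using p_eq r v subm_sc[OF F] by (simp add: Modules.module.scale_right_diff_distrib[OF md])
  qed
  have 3: "bf E (r (p v)) (r (p w)) - bf E v w \<in> II" if v: "v \<in> car E" and w: "w \<in> car E" for v w
  proof -
    have "bf E (r (p v) - v) (r (p w)) + bf E v (r (p w) - w) \<in> II"
      by (rule II_add[OF radD[OF H rd[OF v] r(1)[OF w]] radD'[OF H rd[OF w] v]])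
    then show ?thesis by (simp add: bf_diff_left[OF H] bf_diff_right[OF H])
  qed
  have 4: "bf E (r (p v)) (r (p v)) - bf E v v \<in> JJ" if v: "v \<in> car E" for v
  proof -
    have "bf E ((r (p v) - v) + v) ((r (p v) - v) + v) - (bf E (r (p v) - v) (r (p v) - v) + bf E v v) \<in> twoI"
      by (rule q_add_twoI[OF H radD[OF H rd[OF v] v]])
    from twoI_add[OF this formD(4)[OF E rd[OF v]]]
    have "bf E (r (p v)) (r (p v)) - bf E v v \<in> twoI" by simp
    then show ?thesis using bf_cj[OF H, of v v] bf_cj[OF H, of "r (p v)" "r (p v)"] by (simp add: JJ_iff cj_diff)
  qed
  have "presents E p m"
    unfolding presents_def mpres_def
    using p_eq subm_0[OF F] by (auto simp: m_def 1 2 3 4 coI_eq coJ_eq simp del: range_ex1_eq)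
  then show ?thesis by blast
qed

end

section \<open>Augmentation of presentations\<close>

lemma Z_JJ_iff: "a \<in> Z.JJ \<longleftrightarrow> a \<in> Z.twoI"
proof -
  have "qinvol Z_inv a = a" by (simp add: Z_inv_def)
  then show ?thesis by (simp add: Z.JJ_iff)
qed

context zt
begin

text \<open>By \<open>rad_epsf\<close> the radical of the augmented form is the preimage of
  \<open>tM\<close>, so its classes are exactly the cosets of \<open>t_mult m\<close>.\<close>

lemma presents_eps0_form:
  assumes E: "form E" and P: "presents E p m"
  shows "Z.presents (epsf E) (\<lambda>v. t_mult m +>\<^bsub>m\<^esub> p v) (eps0_form m)"
proof -
  note H = form_herm[OF E]
  note md = herm_module[OF H] and F = herm_subm[OF H] and R = subm_rad[OF H]
  note HZ = herm_epsf[OF E] and FZ = form_epsf[OF E]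
  let ?U = "Z.rad (epsf E)"
  have car: "carrier m = p ` car E" using presentsD(1)[OF P] by (simp add: mpres_def)
  have UE: "?U \<subseteq> car E" using Z.rad_subset[OF HZ] by simp
  \<comment> \<open>To enlarge the relations of \<open>m\<close> the radical at \<open>t = 0\<close>
    must be stable under all of \<open>\<int>[t]\<close>, not only under constants.\<close>
  have U: "subm (scal E) ?U"
    unfolding subm_def
  proof (intro conjI ballI allI)
    show "0 \<in> ?U" by (rule subm_0[OF Z.subm_rad[OF HZ]])
    show "x + y \<in> ?U" if "x \<in> ?U" "y \<in> ?U" for x y by (rule subm_add[OF Z.subm_rad[OF HZ] that])
    show "scal E c x \<in> ?U" if x: "x \<in> ?U" for c x
    proof -
      obtain y where y: "x \<in> car E" "y \<in> car E" "x - scal E t y \<in> rad E" using x unfolding rad_epsf[OF E] by blast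
      have "scal E c x - scal E t (scal E c y) = scal E c (x - scal E t y)"
        by (simp add: Modules.module.scale_right_diff_distrib[OF md] Modules.module.scale_scale[OF md] mult.commute)
      then have "scal E c x - scal E t (scal E c y) \<in> rad E" using subm_sc[OF R y(3)] by simp
      then show ?thesis unfolding rad_epsf[OF E] using subm_sc[OF F y(1)] subm_sc[OF F y(2)] by blast
    qed
  qed
  have T: "t_mult m = p ` ?U"
  proof (intro equalityI subsetI)
    fix x assume "x \<in> t_mult m"
    then obtain y where "y \<in> car E" "x = t \<odot>\<^bsub>m\<^esub> p y" by (auto simp: t_mult_def car)
    then show "x \<in> p ` ?U" using t_in_rad_epsf[OF E] presents_scal[OF E P] by (metis imageI)
  next
    fix x assume "x \<in> p ` ?U"
    then obtain v where v: "v \<in> ?U" "x = p v" by blast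
    obtain y where y: "v \<in> car E" "y \<in> car E" "v - scal E t y \<in> rad E" using v(1) unfolding rad_epsf[OF E] by blast
    have "x = p (scal E t y)" using presents_eq_iff[OF E P y(1) subm_sc[OF F y(2)]] y(3) v(2) by simp
    then have "x = t \<odot>\<^bsub>m\<^esub> p y" using presents_scal[OF E P y(2)] by simp
    then show "x \<in> t_mult m" using y(2) by (auto simp: t_mult_def car)
  qed
  note ctx = md F R rad_subset[OF H] presentsD(1)[OF P] U UE rad_subset_epsf[OF E]
  let ?p = "\<lambda>v. p ` ?U +>\<^bsub>m\<^esub> p v"
  have Q: "mpres (scal E) (car E) ?U ?p (quot_module m (p ` ?U))" by (rule mpres_quot[OF ctx])
  have coset: "?p v = p ` {w \<in> car E. w - v \<in> ?U}" if "v \<in> car E" for v by (rule mpres_coset[OF ctx that])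
  have near: "bf (epsf E) w w' - bf (epsf E) v v' \<in> Z.II"
    if "v \<in> car E" "v' \<in> car E" "w \<in> car E" "w' \<in> car E" "w - v \<in> ?U" "w' - v' \<in> ?U" for v v' w w'
  proof -
    have "bf (epsf E) (w - v) w' + bf (epsf E) v (w' - v') \<in> Z.II"
      using that by (intro Z.II_add Z.radD[OF HZ] Z.radD'[OF HZ]) simp_all
    then show ?thesis by (simp add: Z.bf_diff_left[OF HZ] Z.bf_diff_right[OF HZ] del: epsf_simps)
  qed
  have nearq: "bf (epsf E) w w - bf (epsf E) v v \<in> Z.JJ"
    if "v \<in> car E" "w \<in> car E" "w - v \<in> ?U" for v w
  proof -
    have "bf (epsf E) ((w - v) + v) ((w - v) + v) - (bf (epsf E) (w - v) (w - v) + bf (epsf E) v v) \<in> Z.twoI"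
      using that by (intro Z.q_add_twoI[OF HZ] Z.radD[OF HZ]) simp_all
    from Z.twoI_add[OF this Z.formD(4)[OF FZ that(3)]]
    have "bf (epsf E) w w - bf (epsf E) v v \<in> Z.twoI" by (simp del: epsf_simps)
    then show ?thesis by (simp add: Z_JJ_iff)
  qed
  have indI: "to_int_cosets Z_inv (\<lambda>f. poly f 0) (add_coset II a) = add_coset Z.II (poly a 0)" for a
    by (rule induced_add_coset[OF add_subgrp_II _ Z.add_subgrp_II]) (simp add: poly_0_II del: image_iff)
  have indJ: "to_ops_cosets Z_inv (\<lambda>f. poly f 0) (add_coset JJ a) = add_coset Z.JJ (poly a 0)" for a
    unfolding Z.JJ_def[symmetric]
    by (rule induced_add_coset[OF add_subgrp_JJ _ Z.add_subgrp_JJ]) (simp add: Z_JJ_iff JJ_iff poly_0_twoI)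
  have bil: "bil (eps0_form m) (?p v) (?p v') = add_coset Z.II (bf (epsf E) v v')" if v: "v \<in> car E" "v' \<in> car E" for v v'
  proof -
    have "to_int_cosets Z_inv (\<lambda>f. poly f 0) (bil m x y) = add_coset Z.II (bf (epsf E) v v')" if xy: "x \<in> ?p v" "y \<in> ?p v'" for x y
    proof -
      obtain w w' where w: "w \<in> car E" "w - v \<in> ?U" "x = p w" "w' \<in> car E" "w' - v' \<in> ?U" "y = p w'"
        using xy unfolding coset[OF v(1)] coset[OF v(2)] by blast
      show ?thesis
        using near[OF v w(1,4,2,5)] by (simp add: w(3,6) presentsD(2)[OF P w(1,4)] indI Z.coI_eq)
    qed
    moreover have "p v \<in> ?p v" "p v' \<in> ?p v'"
      using v subm_0[OF U] unfolding coset[OF v(1)] coset[OF v(2)] by auto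
    ultimately show ?thesis unfolding eps0_form_def by simp blast
  qed
  have quad: "quad (eps0_form m) (?p v) = add_coset Z.JJ (bf (epsf E) v v)" if v: "v \<in> car E" for v
  proof -
    have "to_ops_cosets Z_inv (\<lambda>f. poly f 0) (quad m x) = add_coset Z.JJ (bf (epsf E) v v)" if x: "x \<in> ?p v" for x
    proof -
      obtain w where w: "w \<in> car E" "w - v \<in> ?U" "x = p w" using x unfolding coset[OF v] by blast
      show ?thesis using nearq[OF v w(1,2)] by (simp add: w(3) presentsD(3)[OF P w(1)] indJ Z.coJ_eq)
    qed
    moreover have "p v \<in> ?p v" using v subm_0[OF U] unfolding coset[OF v] by auto
    ultimately show ?thesis unfolding eps0_form_def by simp blast
  qed
  have "mpres (scal (epsf E)) (car (epsf E)) ?U ?p (eps0_form m)"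
    using Q unfolding mpres_def
    by (simp add: eps0_form_def quot_module_def quot_add_def ring.defs module.defs T)
  then show ?thesis
    unfolding Z.presents_def T using bil quad by simp
qed

end

section \<open>Witt groups\<close>

context dyadic
begin

text \<open>\<open>None\<close> admits every exponent and \<open>Some n\<close> only
  \<open>2 ^ n\<close>, so that both kinds of Witt group are treated at once.\<close>

definition admissible :: "nat option \<Rightarrow> ('r, 'v::ab_group_add, 'q) pform \<Rightarrow> bool" where
  "admissible T E \<longleftrightarrow> form E \<and> (\<forall>n. T = Some n \<longrightarrow> tors n E)"

definition forms_of_exp :: "nat option \<Rightarrow> ('r, nat, 'q) linking_form set" where
  "forms_of_exp T = {m. quadratic_linking_form A m \<and> (\<forall>n. T = Some n \<longrightarrow> two_power_torsion n m)}"

lemma forms_of_exp_simps: "forms_of_exp None = linking_forms A" "forms_of_exp (Some n) = linking_forms_exp A n"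
  by (auto simp: forms_of_exp_def linking_forms_def linking_forms_exp_def)

text \<open>The presentation \<open>G\<close> is confined to sequences to fix its type;
  \<open>exists_presentation\<close> shows that this reaches every form.\<close>

definition wclass :: "nat option \<Rightarrow> ('r, 'v::ab_group_add, 'q) pform \<Rightarrow> ('r, nat, 'q) linking_form set" where
  "wclass T E = {m \<in> forms_of_exp T. \<exists>(G :: ('r, nat \<Rightarrow> 'r, 'q) pform) p. form G \<and> presents G p m \<and> weq E G}"

lemma admissible_form: "admissible T E \<Longrightarrow> form E"
  by (simp add: admissible_def)

lemma admissible_psum: "admissible T E \<Longrightarrow> admissible T G \<Longrightarrow> admissible T (psum E G)"
  by (auto simp: admissible_def form_psum intro: tors_psum form_herm)

lemma admissible_pneg: "admissible T E \<Longrightarrow> admissible T (pneg E)"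
  by (simp add: admissible_def form_pneg tors_pneg)

lemma forms_of_exp_iff:
  assumes "form E" "presents E p m"
  shows "m \<in> forms_of_exp T \<longleftrightarrow> admissible T E"
  using presents_quadratic_linking_form[OF assms] presents_torsion[OF assms] assms(1)
  by (simp add: forms_of_exp_def admissible_def)

lemma forms_of_exp_presentation:
  assumes "m \<in> forms_of_exp T"
  obtains E :: "('r, nat \<Rightarrow> 'r, 'q) pform" and p where "admissible T E" "presents E p m"
  using exists_presentation[of m] assms forms_of_exp_iff by (auto simp: forms_of_exp_def) (metis forms_of_exp_iff assms)

lemma admissible_representative:
  assumes "admissible T E"
  obtains m p where "m \<in> forms_of_exp T" "presents E p m"
  using presents_nat_form[OF admissible_form[OF assms]] forms_of_exp_iff[OF admissible_form[OF assms]] assms by blast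

lemma witt_equiv_iff:
  assumes E: "admissible T E" and G: "admissible T G" and p: "presents E p m" and p': "presents G p' m'"
  shows "witt_equiv A (forms_of_exp T) m m' \<longleftrightarrow> weq E G"
proof
  note fE = admissible_form[OF E] and fG = admissible_form[OF G]
  assume "witt_equiv A (forms_of_exp T) m m'"
  then obtain m0 m0' where m0: "m0 \<in> forms_of_exp T" "\<exists>L. lagrangian A m0 L" and m0': "m0' \<in> forms_of_exp T" "\<exists>L. lagrangian A m0' L"
    and iso: "isometric (orth_sum A m m0) (orth_sum A m' m0')"
    unfolding witt_equiv_def by blast
  obtain E0 :: "('r, nat \<Rightarrow> 'r, 'q) pform" and q where E0: "admissible T E0" "presents E0 q m0" using m0(1) by (rule forms_of_exp_presentation)
  obtain G0 :: "('r, nat \<Rightarrow> 'r, 'q) pform" and q' where G0: "admissible T G0" "presents G0 q' m0'" using m0'(1) by (rule forms_of_exp_presentation)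
  note fE0 = admissible_form[OF E0(1)] and fG0 = admissible_form[OF G0(1)]
  have met: "metabolic E0" "metabolic G0"
    using presents_lagrangian[OF fE0 E0(2)] presents_lagrangian[OF fG0 G0(2)] m0(2) m0'(2) by blast+
  note s1 = presents_orth_sum[OF fE fE0 p E0(2)] and s2 = presents_orth_sum[OF fG fG0 p' G0(2)]
  note f1 = form_psum[OF fE fE0] and f2 = form_psum[OF fG fG0]
  have "module RR (orth_sum A m' m0')"
    using presents_quadratic_linking_form[OF f2 s2] by (simp add: quadratic_linking_form_def)
  then obtain f where "presents (psum E E0) (\<lambda>v. f ((\<lambda>(x, y). (p x, q y)) v)) (orth_sum A m' m0')"
    using iso presents_isometry[OF f1 s1] unfolding isometric_def by blast
  from presents_unique[OF f1 f2 this s2] have w: "weq (psum E E0) (psum G G0)" .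
  have "metabolic (psum (psum E (pneg G)) (psum E0 (pneg G0)))"
    by (rule metabolic_iso[where G = "psum (psum E E0) (pneg (psum G G0))"
          and g = "\<lambda>((x, x0), (y, y0)). ((x, y), (x0, y0))"])
      (use w fE fG fE0 fG0 in \<open>auto intro!: form_psum form_pneg simp: image_iff split_paired_Ex weq_def\<close>)
  moreover have "metabolic (psum E0 (pneg G0))"
    using metabolic_imp_weq[OF fE0 fG0 met] by (simp add: weq_def)
  ultimately show "weq E G"
    unfolding weq_def
    by (rule metabolic_cancel[OF form_psum[OF fE form_pneg[OF fG]] form_psum[OF fE0 form_pneg[OF fG0]]])
next
  note fE = admissible_form[OF E] and fG = admissible_form[OF G]
  assume w: "weq E G"
  have a1: "admissible T (psum (pneg G) G)" and a2: "admissible T (psum E (pneg G))"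
    by (intro admissible_psum admissible_pneg E G)+
  note f1 = admissible_form[OF a1] and f2 = admissible_form[OF a2]
  obtain m0 q where m0: "m0 \<in> forms_of_exp T" "presents (psum (pneg G) G) q m0" using a1 by (rule admissible_representative)
  obtain m0' q' where m0': "m0' \<in> forms_of_exp T" "presents (psum E (pneg G)) q' m0'" using a2 by (rule admissible_representative)
  have "metabolic (psum (pneg G) G)"
    by (rule metabolic_iso[where G = "psum G (pneg G)" and g = "\<lambda>(x, y). (y, x)"])
      (use weq_refl[OF fG] fG in \<open>auto intro!: form_psum form_pneg simp: weq_def\<close>)
  then have L0: "\<exists>L. lagrangian A m0 L" using presents_lagrangian[OF f1 m0(2)] by blast
  have L0': "\<exists>L. lagrangian A m0' L" using presents_lagrangian[OF f2 m0'(2)] w by (simp add: weq_def)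
  note s1 = presents_orth_sum[OF fE f1 p m0(2)] and s2 = presents_orth_sum[OF fG f2 p' m0'(2)]
  have "presents (psum G (psum E (pneg G)))
      (\<lambda>v. (\<lambda>(x, y). (p x, q y)) ((\<lambda>(y, (x, y')). (x, (y', y))) v)) (orth_sum A m m0)"
    by (rule presents_iso[OF form_psum[OF fE f1] form_psum[OF fG f2] s1])
      (auto simp: image_iff split_paired_Ex)
  from presents_isometric[OF form_psum[OF fG f2] this s2]
  show "witt_equiv A (forms_of_exp T) m m'"
    unfolding witt_equiv_def using m0(1) m0'(1) L0 L0' by blast
qed

lemma witt_class_eq_wclass:
  assumes E: "admissible T E" and p: "presents E p m"
  shows "witt_class A (forms_of_exp T) m = wclass T E"
proof (intro equalityI subsetI)
  fix m' assume m': "m' \<in> witt_class A (forms_of_exp T) m"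
  then have "m' \<in> forms_of_exp T" by (simp add: witt_class_def)
  then obtain G :: "('r, nat \<Rightarrow> 'r, 'q) pform" and p' where G: "admissible T G" "presents G p' m'" by (rule forms_of_exp_presentation)
  have "weq E G" using m' witt_equiv_iff[OF E G(1) p G(2)] by (simp add: witt_class_def)
  then show "m' \<in> wclass T E" using G admissible_form[OF G(1)] \<open>m' \<in> forms_of_exp T\<close> unfolding wclass_def by blast
next
  fix m' assume "m' \<in> wclass T E"
  then obtain G :: "('r, nat \<Rightarrow> 'r, 'q) pform" and p' where G: "m' \<in> forms_of_exp T" "form G" "presents G p' m'" "weq E G"
    by (auto simp: wclass_def)
  have "admissible T G" using forms_of_exp_iff[OF G(2,3)] G(1) by blast
  then show "m' \<in> witt_class A (forms_of_exp T) m"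
    using witt_equiv_iff[OF E _ p G(3)] G by (simp add: witt_class_def)
qed

lemma mem_wclassE:
  assumes "m \<in> wclass T E"
  obtains G :: "('r, nat \<Rightarrow> 'r, 'q) pform" and p where "admissible T G" "presents G p m" "weq E G"
  using assms forms_of_exp_iff unfolding wclass_def by blast

lemma mem_wclass:
  assumes E: "admissible T E" and p: "presents E p m" and m: "m \<in> forms_of_exp T"
  shows "m \<in> wclass T E"
proof -
  obtain G :: "('r, nat \<Rightarrow> 'r, 'q) pform" and p' where G: "admissible T G" "presents G p' m" using m by (rule forms_of_exp_presentation)
  then show ?thesis
    using presents_unique[OF admissible_form[OF E] admissible_form[OF G(1)] p G(2)] m admissible_form[OF G(1)]
    unfolding wclass_def by blast
qed

lemma wclass_nonempty: "admissible T E \<Longrightarrow> \<exists>m. m \<in> wclass T E"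
  using admissible_representative[of T E] mem_wclass[of T E] by metis

lemma wclass_eq_iff:
  assumes E: "admissible T E" and G: "admissible T G"
  shows "wclass T E = wclass T G \<longleftrightarrow> weq E G"
proof
  note fE = admissible_form[OF E] and fG = admissible_form[OF G]
  assume eq: "wclass T E = wclass T G"
  obtain m p where m: "m \<in> forms_of_exp T" "presents E p m" using E by (rule admissible_representative)
  then have "m \<in> wclass T G" using mem_wclass[OF E m(2,1)] eq by simp
  then obtain G1 :: "('r, nat \<Rightarrow> 'r, 'q) pform" and p1 where G1: "admissible T G1" "presents G1 p1 m" "weq G G1"
    by (rule mem_wclassE)
  note f1 = admissible_form[OF G1(1)]
  show "weq E G"
    by (rule weq_trans[OF fE f1 fG presents_unique[OF fE f1 m(2) G1(2)] weq_sym[OF fG f1 G1(3)]])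
next
  note fE = admissible_form[OF E] and fG = admissible_form[OF G]
  assume w: "weq E G"
  have "weq E G1 \<longleftrightarrow> weq G G1" if "form G1" for G1 :: "('r, nat \<Rightarrow> 'r, 'q) pform"
    using weq_trans[OF fE fG that w] weq_trans[OF fG fE that weq_sym[OF fE fG w]] by blast
  then show "wclass T E = wclass T G" unfolding wclass_def by blast
qed

abbreviation witt :: "nat option \<Rightarrow> ('r, nat, 'q) linking_form set monoid" where
  "witt T \<equiv> witt_group A (forms_of_exp T)"

lemma wclass_carrier:
  assumes "admissible T E"
  shows "wclass T E \<in> carrier (witt T)"
proof -
  obtain m p where m: "m \<in> forms_of_exp T" "presents E p m" using assms by (rule admissible_representative)
  then show ?thesis using witt_class_eq_wclass[OF assms m(2)] by (auto simp: witt_group_def)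
qed

lemma carrier_wclass:
  assumes "C \<in> carrier (witt T)"
  obtains E :: "('r, nat \<Rightarrow> 'r, 'q) pform" where "admissible T E" "C = wclass T E"
proof -
  obtain m where m: "m \<in> forms_of_exp T" "C = witt_class A (forms_of_exp T) m" using assms by (auto simp: witt_group_def)
  obtain E :: "('r, nat \<Rightarrow> 'r, 'q) pform" and p where E: "admissible T E" "presents E p m" using m(1) by (rule forms_of_exp_presentation)
  show thesis using that[OF E(1)] witt_class_eq_wclass[OF E] m(2) by simp
qed

text \<open>The product is a union over representatives; by \<open>weq_psum\<close> each pair
  contributes the same class.\<close>

lemma wclass_mult:
  assumes E: "admissible T E" and G: "admissible T G"
  shows "wclass T E \<otimes>\<^bsub>witt T\<^esub> wclass T G = wclass T (psum E G)"
proof -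
  note fE = admissible_form[OF E] and fG = admissible_form[OF G]
  have "witt_class A (forms_of_exp T) (orth_sum A m m') = wclass T (psum E G)"
    if m: "m \<in> wclass T E" and m': "m' \<in> wclass T G" for m m'
  proof -
    obtain E1 :: "('r, nat \<Rightarrow> 'r, 'q) pform" and p where E1: "admissible T E1" "presents E1 p m" "weq E E1"
      using m by (rule mem_wclassE)
    obtain G1 :: "('r, nat \<Rightarrow> 'r, 'q) pform" and p' where G1: "admissible T G1" "presents G1 p' m'" "weq G G1"
      using m' by (rule mem_wclassE)
    note f1 = admissible_form[OF E1(1)] and g1 = admissible_form[OF G1(1)]
    have "witt_class A (forms_of_exp T) (orth_sum A m m') = wclass T (psum E1 G1)"
      by (rule witt_class_eq_wclass[OF admissible_psum[OF E1(1) G1(1)] presents_orth_sum[OF f1 g1 E1(2) G1(2)]])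
    also have "\<dots> = wclass T (psum E G)"
      using wclass_eq_iff[OF admissible_psum[OF E G] admissible_psum[OF E1(1) G1(1)]] weq_psum[OF fE f1 fG g1 E1(3) G1(3)] by simp
    finally show ?thesis .
  qed
  then show ?thesis
    using wclass_nonempty[OF E] wclass_nonempty[OF G] unfolding witt_group_def by simp blast
qed

definition trivial_pform :: "('r, nat \<Rightarrow> 'r, 'q) pform" where
  "trivial_pform = \<lparr> scal = fsc, car = {0}, bf = (\<lambda>_ _. 0) \<rparr>"

lemma herm_trivial: "herm trivial_pform"
  using module_fsc[where 'r = 'r]
  by (simp add: herm_def trivial_pform_def subm_def Modules.module.scale_zero_right[OF module_fsc])

lemma rad_trivial: "rad trivial_pform = {0}"
  by (simp add: rad_def trivial_pform_def)

lemma form_trivial: "form trivial_pform"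
proof -
  have "finite_type trivial_pform"
    unfolding finite_type_def rad_trivial
    by (intro exI[of _ 0] exI[of _ "\<lambda>_. 0"]) (auto simp: trivial_pform_def comb_def)
  moreover have "tors 0 trivial_pform"
    unfolding tors_def rad_trivial by (simp add: trivial_pform_def Modules.module.scale_zero_right[OF module_fsc])
  moreover have "nonsing trivial_pform"
    unfolding nonsing_def rad_trivial by (auto simp: trivial_pform_def)
  ultimately show ?thesis
    unfolding form_def rad_trivial using herm_trivial by (auto simp: trivial_pform_def)
qed

lemma admissible_trivial: "admissible T trivial_pform"
  unfolding admissible_def tors_def rad_trivial using form_trivial
  by (simp add: trivial_pform_def Modules.module.scale_zero_right[OF module_fsc])

lemma metabolic_trivial: "metabolic trivial_pform"
  unfolding metabolic_def lagr_def
  by (intro exI[of _ "{0}"])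
    (auto simp: trivial_pform_def perp_def subm_def Modules.module.scale_zero_right[OF module_fsc])

lemma presents_zero_form: "presents trivial_pform (\<lambda>_. 0) (zero_form A)"
  unfolding presents_def mpres_def rad_trivial
  by (simp add: trivial_pform_def zero_form_def int_zero ops_zero)

lemma one_wclass: "\<one>\<^bsub>witt T\<^esub> = wclass T trivial_pform"
  using witt_class_eq_wclass[OF admissible_trivial presents_zero_form] by (simp add: witt_group_def)

lemma wclass_eq_one_iff:
  assumes E: "admissible T E"
  shows "wclass T E = \<one>\<^bsub>witt T\<^esub> \<longleftrightarrow> metabolic E"
proof -
  note fE = admissible_form[OF E]
  have "wclass T E = \<one>\<^bsub>witt T\<^esub> \<longleftrightarrow> weq E trivial_pform"
    using wclass_eq_iff[OF E admissible_trivial] by (simp add: one_wclass)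
  also have "\<dots> \<longleftrightarrow> metabolic E"
    using metabolic_weq[OF fE form_trivial _ metabolic_trivial] metabolic_imp_weq[OF fE form_trivial _ metabolic_trivial]
    by blast
  finally show ?thesis .
qed

lemma comm_group_WG: "comm_group (witt T)"
proof (rule comm_groupI)
  fix x y assume "x \<in> carrier (witt T)" "y \<in> carrier (witt T)"
  then obtain E G :: "('r, nat \<Rightarrow> 'r, 'q) pform" where E: "admissible T E" "x = wclass T E" and G: "admissible T G" "y = wclass T G"
    using carrier_wclass by metis
  note fE = admissible_form[OF E(1)] and fG = admissible_form[OF G(1)]
  show "x \<otimes>\<^bsub>witt T\<^esub> y \<in> carrier (witt T)"
    using wclass_mult[OF E(1) G(1)] wclass_carrier[OF admissible_psum[OF E(1) G(1)]] by (simp add: E(2) G(2))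
  have "weq (psum E G) (psum G E)"
    by (rule weq_iso[where g = "\<lambda>(x, y). (y, x)"])
      (use fE fG form_psum[OF fE fG] in \<open>auto intro: herm_psum form_herm formD(4)\<close>)
  then show "x \<otimes>\<^bsub>witt T\<^esub> y = y \<otimes>\<^bsub>witt T\<^esub> x"
    using wclass_mult[OF E(1) G(1)] wclass_mult[OF G(1) E(1)]
      wclass_eq_iff[OF admissible_psum[OF E(1) G(1)] admissible_psum[OF G(1) E(1)]] by (simp add: E(2) G(2))
  show "x \<otimes>\<^bsub>witt T\<^esub> y \<otimes>\<^bsub>witt T\<^esub> z = x \<otimes>\<^bsub>witt T\<^esub> (y \<otimes>\<^bsub>witt T\<^esub> z)" if z: "z \<in> carrier (witt T)" for z
  proof -
    obtain K :: "('r, nat \<Rightarrow> 'r, 'q) pform" where K: "admissible T K" "z = wclass T K" using z by (rule carrier_wclass)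
    note fK = admissible_form[OF K(1)]
    note a1 = admissible_psum[OF admissible_psum[OF E(1) G(1)] K(1)] and a2 = admissible_psum[OF E(1) admissible_psum[OF G(1) K(1)]]
    have "weq (psum (psum E G) K) (psum E (psum G K))"
      by (rule weq_iso[where g = "\<lambda>(x, (y, z)). ((x, y), z)"])
        (use form_herm[OF admissible_form[OF a1]] form_herm[OF admissible_form[OF a2]] formD(4)[OF admissible_form[OF a1]]
          in \<open>auto simp: image_iff split_paired_Ex\<close>)
    then show ?thesis
      using wclass_mult[OF admissible_psum[OF E(1) G(1)] K(1)] wclass_mult[OF E(1) admissible_psum[OF G(1) K(1)]]
        wclass_mult[OF E(1) G(1)] wclass_mult[OF G(1) K(1)] wclass_eq_iff[OF a1 a2] by (simp add: E(2) G(2) K(2))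
  qed
next
  show "\<one>\<^bsub>witt T\<^esub> \<in> carrier (witt T)" using wclass_carrier[OF admissible_trivial] by (simp add: one_wclass)
next
  fix x assume "x \<in> carrier (witt T)"
  then obtain E :: "('r, nat \<Rightarrow> 'r, 'q) pform" where E: "admissible T E" "x = wclass T E" by (rule carrier_wclass)
  note fE = admissible_form[OF E(1)]
  have "weq (psum trivial_pform E) E"
    by (rule weq_iso[where g = "\<lambda>y. (0, y)"])
      (use form_herm[OF fE] form_herm[OF form_psum[OF form_trivial fE]] formD(4)[OF form_psum[OF form_trivial fE]]
        in \<open>auto simp: trivial_pform_def Modules.module.scale_zero_right[OF module_fsc]\<close>)
  then show "\<one>\<^bsub>witt T\<^esub> \<otimes>\<^bsub>witt T\<^esub> x = x"
    using wclass_mult[OF admissible_trivial E(1)] wclass_eq_iff[OF admissible_psum[OF admissible_trivial E(1)] E(1)]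
    by (simp add: one_wclass E(2))
  have "metabolic (psum (pneg E) E)"
    by (rule metabolic_iso[where G = "psum E (pneg E)" and g = "\<lambda>(x, y). (y, x)"])
      (use weq_refl[OF fE] fE in \<open>auto intro!: form_psum form_pneg simp: weq_def\<close>)
  then have "wclass T (pneg E) \<otimes>\<^bsub>witt T\<^esub> x = \<one>\<^bsub>witt T\<^esub>"
    using wclass_mult[OF admissible_pneg[OF E(1)] E(1)] wclass_eq_one_iff[OF admissible_psum[OF admissible_pneg[OF E(1)] E(1)]]
    by (simp add: E(2))
  then show "\<exists>y\<in>carrier (witt T). y \<otimes>\<^bsub>witt T\<^esub> x = \<one>\<^bsub>witt T\<^esub>"
    using wclass_carrier[OF admissible_pneg[OF E(1)]] by blast
qed

end

section \<open>The reduced groups and the map between them\<close>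

context zt
begin

lemma epsf_psum: "epsf (psum E G) = psum (epsf E) (epsf G)"
  by (auto simp: epsf_def psum_def fun_eq_iff)

lemma epsf_pneg: "epsf (pneg E) = pneg (epsf E)"
  by (simp add: epsf_def pneg_def)

text \<open>Augmentation commutes with differences, so this is \<open>metabolic_epsf\<close> for the
  difference.\<close>

lemma weq_epsf:
  assumes "form E" "form G" "weq E G"
  shows "Z.weq (epsf E) (epsf G)"
  using metabolic_epsf[OF form_psum[OF assms(1) form_pneg[OF assms(2)]]] assms(3)
  by (simp add: weq_def Z.weq_def epsf_psum epsf_pneg)

lemma admissible_epsf: "admissible T E \<Longrightarrow> Z.admissible T (epsf E)"
  by (simp add: admissible_def Z.admissible_def form_epsf tors_epsf)

lemma eps0_star_wclass:
  assumes E: "admissible T E"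
  shows "eps0_star (Z.forms_of_exp T) (wclass T E) = Z.wclass T (epsf E)"
proof -
  have "witt_class Z_inv (Z.forms_of_exp T) (eps0_form m) = Z.wclass T (epsf E)" if m: "m \<in> wclass T E" for m
  proof -
    obtain G :: "(int poly, nat \<Rightarrow> int poly, rat poly) pform" and p where G: "admissible T G" "presents G p m" "weq E G"
      using m by (rule mem_wclassE)
    have "witt_class Z_inv (Z.forms_of_exp T) (eps0_form m) = Z.wclass T (epsf G)"
      by (rule Z.witt_class_eq_wclass[OF admissible_epsf[OF G(1)] presents_eps0_form[OF admissible_form[OF G(1)] G(2)]])
    then show ?thesis
      using Z.wclass_eq_iff[OF admissible_epsf[OF E] admissible_epsf[OF G(1)]] weq_epsf[OF admissible_form[OF E] admissible_form[OF G(1)] G(3)]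
      by simp
  qed
  then show ?thesis unfolding eps0_star_def using wclass_nonempty[OF E] by blast
qed

lemma eps0_group_hom: "group_hom (witt T) (Z.witt T) (eps0_star (Z.forms_of_exp T))"
proof -
  have "eps0_star (Z.forms_of_exp T) \<in> hom (witt T) (Z.witt T)"
  proof (rule homI)
    fix x assume "x \<in> carrier (witt T)"
    then obtain E :: "(int poly, nat \<Rightarrow> int poly, rat poly) pform" where E: "admissible T E" "x = wclass T E" by (rule carrier_wclass)
    show "eps0_star (Z.forms_of_exp T) x \<in> carrier (Z.witt T)"
      using Z.wclass_carrier[OF admissible_epsf[OF E(1)]] by (simp add: E(2) eps0_star_wclass[OF E(1)])
    fix y assume "y \<in> carrier (witt T)"
    then obtain G :: "(int poly, nat \<Rightarrow> int poly, rat poly) pform" where G: "admissible T G" "y = wclass T G" by (rule carrier_wclass)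
    show "eps0_star (Z.forms_of_exp T) (x \<otimes>\<^bsub>witt T\<^esub> y) = eps0_star (Z.forms_of_exp T) x \<otimes>\<^bsub>Z.witt T\<^esub> eps0_star (Z.forms_of_exp T) y"
      by (simp add: E(2) G(2) wclass_mult[OF E(1) G(1)] eps0_star_wclass[OF admissible_psum[OF E(1) G(1)]] epsf_psum
          eps0_star_wclass[OF E(1)] eps0_star_wclass[OF G(1)] Z.wclass_mult[OF admissible_epsf[OF E(1)] admissible_epsf[OF G(1)]])
  qed
  then show ?thesis
    using comm_group_WG Z.comm_group_WG
    by (simp add: group_hom_def group_hom_axioms_def comm_group.axioms(2))
qed

abbreviation ker :: "nat option \<Rightarrow> (int poly, nat, rat poly) linking_form set set" where
  "ker T \<equiv> kernel (witt T) (Z.witt T) (eps0_star (Z.forms_of_exp T))"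

lemma comm_group_ker: "comm_group ((witt T)\<lparr>carrier := ker T\<rparr>)"
proof -
  interpret comm_group "witt T" by (rule comm_group_WG)
  have sub: "subgroup (ker T) (witt T)" by (rule group_hom.subgroup_kernel[OF eps0_group_hom])
  show ?thesis
  proof (rule group.group_comm_groupI)
    show "group ((witt T)\<lparr>carrier := ker T\<rparr>)" using sub by (rule subgroup.subgroup_is_group) (rule is_group)
    show "x \<otimes>\<^bsub>(witt T)\<lparr>carrier := ker T\<rparr>\<^esub> y = y \<otimes>\<^bsub>(witt T)\<lparr>carrier := ker T\<rparr>\<^esub> x"
      if "x \<in> carrier ((witt T)\<lparr>carrier := ker T\<rparr>)" "y \<in> carrier ((witt T)\<lparr>carrier := ker T\<rparr>)" for x y
      using that subgroup.mem_carrier[OF sub] by (simp add: m_comm)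
  qed
qed

lemma ker_wclass:
  assumes E: "admissible T E"
  shows "wclass T E \<in> ker T \<longleftrightarrow> Z.metabolic (epsf E)"
  using wclass_carrier[OF E] Z.wclass_eq_one_iff[OF admissible_epsf[OF E]] by (simp add: kernel_def eps0_star_wclass[OF E])

lemma kerE:
  assumes "C \<in> ker T"
  obtains E :: "(int poly, nat \<Rightarrow> int poly, rat poly) pform"
  where "admissible T E" "C = wclass T E" "Z.metabolic (epsf E)"
proof -
  have "C \<in> carrier (witt T)" using assms by (simp add: kernel_def)
  then obtain E :: "(int poly, nat \<Rightarrow> int poly, rat poly) pform" where "admissible T E" "C = wclass T E" by (rule carrier_wclass)
  then show thesis using that ker_wclass assms by blast
qed

text \<open>The map induced by dropping the bound on the exponent. Members of one class have the
  same image, so the union is a single class; see \<open>forget_wclass\<close>.\<close>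

definition forget :: "(int poly, nat, rat poly) linking_form set \<Rightarrow> (int poly, nat, rat poly) linking_form set" where
  "forget C = (\<Union>m\<in>C. witt_class (Zt_inv s) (forms_of_exp None) m)"

lemma admissible_None: "admissible T E \<Longrightarrow> admissible None E"
  by (simp add: admissible_def)

lemma forget_wclass:
  assumes E: "admissible T E"
  shows "forget (wclass T E) = wclass None E"
proof -
  have "witt_class (Zt_inv s) (forms_of_exp None) m = wclass None E" if m: "m \<in> wclass T E" for m
  proof -
    obtain G :: "(int poly, nat \<Rightarrow> int poly, rat poly) pform" and p where G: "admissible T G" "presents G p m" "weq E G"
      using m by (rule mem_wclassE)
    show ?thesis
      using witt_class_eq_wclass[OF admissible_None[OF G(1)] G(2)] wclass_eq_iff[OF admissible_None[OF E] admissible_None[OF G(1)]] G(3) by simp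
  qed
  then show ?thesis unfolding forget_def using wclass_nonempty[OF E] by blast
qed

text \<open>Classes are equal exactly when \<open>weq\<close> holds, whatever the bound on the
  exponent, so injectivity rests on the cancellation that freed \<open>weq\<close> from auxiliary
  forms. For surjectivity, the representative of exponent 2 has metabolic augmentation because it is
  equivalent to the given form.\<close>

lemma forget_iso: "forget \<in> iso ((witt (Some 1))\<lparr>carrier := ker (Some 1)\<rparr>) ((witt None)\<lparr>carrier := ker None\<rparr>)"
proof -
  have maps: "forget x \<in> ker None" if "x \<in> ker (Some 1)" for x
  proof -
    obtain E :: "(int poly, nat \<Rightarrow> int poly, rat poly) pform"
      where E: "admissible (Some 1) E" "x = wclass (Some 1) E" "Z.metabolic (epsf E)" using \<open>x \<in> ker (Some 1)\<close> by (rule kerE)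
    show ?thesis using E(3) ker_wclass[OF admissible_None[OF E(1)]] by (simp only: E(2) forget_wclass[OF E(1)])
  qed
  have hom: "forget (x \<otimes>\<^bsub>witt (Some 1)\<^esub> y) = forget x \<otimes>\<^bsub>witt None\<^esub> forget y"
    if x: "x \<in> ker (Some 1)" and y: "y \<in> ker (Some 1)" for x y
  proof -
    obtain E :: "(int poly, nat \<Rightarrow> int poly, rat poly) pform"
      where E: "admissible (Some 1) E" "x = wclass (Some 1) E" using x by (rule kerE)
    obtain G :: "(int poly, nat \<Rightarrow> int poly, rat poly) pform"
      where G: "admissible (Some 1) G" "y = wclass (Some 1) G" using y by (rule kerE)
    show ?thesis
      by (simp only: E(2) G(2) wclass_mult[OF E(1) G(1)] wclass_mult[OF admissible_None[OF E(1)] admissible_None[OF G(1)]]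
          forget_wclass[OF E(1)] forget_wclass[OF G(1)] forget_wclass[OF admissible_psum[OF E(1) G(1)]])
  qed
  have inj: "inj_on forget (ker (Some 1))"
  proof (rule inj_onI)
    fix x y assume x: "x \<in> ker (Some 1)" and y: "y \<in> ker (Some 1)" and eq: "forget x = forget y"
    obtain E :: "(int poly, nat \<Rightarrow> int poly, rat poly) pform"
      where E: "admissible (Some 1) E" "x = wclass (Some 1) E" using x by (rule kerE)
    obtain G :: "(int poly, nat \<Rightarrow> int poly, rat poly) pform"
      where G: "admissible (Some 1) G" "y = wclass (Some 1) G" using y by (rule kerE)
    have "wclass None E = wclass None G" using eq by (simp only: E(2) G(2) forget_wclass[OF E(1)] forget_wclass[OF G(1)])
    then show "x = y"
      using wclass_eq_iff[OF admissible_None[OF E(1)] admissible_None[OF G(1)]] wclass_eq_iff[OF E(1) G(1)] by (simp only: E(2) G(2))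
  qed
  have surj: "x \<in> forget ` ker (Some 1)" if "x \<in> ker None" for x
  proof -
    obtain E :: "(int poly, nat \<Rightarrow> int poly, rat poly) pform"
      where E: "admissible None E" "x = wclass None E" "Z.metabolic (epsf E)" using \<open>x \<in> ker None\<close> by (rule kerE)
    note fE = admissible_form[OF E(1)]
    obtain K where K: "form (E\<lparr>car := K\<rparr>)" "tors 1 (E\<lparr>car := K\<rparr>)" "weq E (E\<lparr>car := K\<rparr>)"
      using exponent_two_representative[OF fE E(3)] by blast
    let ?E = "E\<lparr>car := K\<rparr>"
    have a: "admissible (Some 1) ?E" using K by (simp add: admissible_def)
    have "Z.metabolic (epsf ?E)"
      using Z.metabolic_weq[OF form_epsf[OF K(1)] form_epsf[OF fE] weq_epsf[OF K(1) fE weq_sym[OF fE K(1,3)]] E(3)] .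
    then have "wclass (Some 1) ?E \<in> ker (Some 1)" using ker_wclass[OF a] by blast
    moreover have "x = forget (wclass (Some 1) ?E)"
      using wclass_eq_iff[OF E(1) admissible_None[OF a]] K(3) by (simp only: E(2) forget_wclass[OF a])
    ultimately show ?thesis by blast
  qed
  show ?thesis
    unfolding iso_def hom_def bij_betw_def using maps hom inj surj by auto
qed

end

theorem theorem1p5:
  fixes s :: int
  assumes "s = 1 \<or> s = -1"
  shows "comm_group (L_exp_reduced s 1) \<and> comm_group (L_all_reduced s) \<and>
         L_exp_reduced s 1 \<cong> L_all_reduced s"
proof -
  interpret zt s by unfold_locales (rule assms)
  \<comment> \<open>The exponent 2 of the statement is \<open>2 ^ 1\<close>, hence
    \<open>Some 1\<close>.\<close>
  have e: "L_exp_reduced s 1 = (witt (Some 1))\<lparr>carrier := ker (Some 1)\<rparr>"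
    by (simp add: L_exp_reduced_def L_exp_def forms_of_exp_simps Z.forms_of_exp_simps)
  have a: "L_all_reduced s = (witt None)\<lparr>carrier := ker None\<rparr>"
    by (simp add: L_all_reduced_def L_all_def forms_of_exp_simps Z.forms_of_exp_simps)
  show ?thesis
    unfolding e a is_iso_def using comm_group_ker forget_iso by blast
qed

end
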